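(* Let $H$ be a semisimple Hopf algebra of dimension $40$ over $k$. Then $H$ is not simple, that is, $H$ contains a proper normal Hopf subalgebra.
   Context: $k$ is an algebraically closed field of characteristic zero. A Hopf subalgebra $A\subseteq H$ is normal if $h_1A\mathcal S(h_2)\subseteq A$ for all $h\in H$. Proper means different from $k1$ and from $H$. *)

theory Defs
  imports "HOL-Computational_Algebra.Polynomial" "HOL-Library.Poly_Mapping"
begin

section \<open>Tensor powers\<close>

text \<open>
  The finitely supported functions \<^typ>\<open>'x \<Rightarrow>\<^sub>0 'k\<close> form the free vector space on \<^typ>\<open>'x\<close>.
  For a vector space \<open>V\<close> over \<open>k\<close>, the spaces \<open>V \<otimes> V\<close> and \<open>V \<otimes> V \<otimes> V\<close> are the quotients
  of the free vector spaces on \<open>V \<times> V\<close> and \<open>V \<times> V \<times> V\<close> by the subspaces spanned by the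
  relations that make the generators multilinear.
\<close>

definition free_scale :: "'k::field \<Rightarrow> ('x \<Rightarrow>\<^sub>0 'k) \<Rightarrow> ('x \<Rightarrow>\<^sub>0 'k)" where
  "free_scale c = Poly_Mapping.map ((*) c)"

lemma lookup_free_scale [simp]:
  "Poly_Mapping.lookup (free_scale c x) i = c * Poly_Mapping.lookup x i"
  by (simp add: free_scale_def Poly_Mapping.map.rep_eq when_def)

lemma vector_space_free_scale:
  "vector_space (free_scale :: 'k::field \<Rightarrow> ('x \<Rightarrow>\<^sub>0 'k) \<Rightarrow> ('x \<Rightarrow>\<^sub>0 'k))"
  by unfold_locales (auto intro!: poly_mapping_eqI simp: lookup_add algebra_simps)

definition gen :: "'x \<Rightarrow> ('x \<Rightarrow>\<^sub>0 'k::field)" where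
  "gen x = Poly_Mapping.single x 1"

definition lin_ext ::
    "('k::field \<Rightarrow> 'v::ab_group_add \<Rightarrow> 'v) \<Rightarrow> ('x \<Rightarrow> 'v) \<Rightarrow> ('x \<Rightarrow>\<^sub>0 'k) \<Rightarrow> 'v" where
  "lin_ext s f x = (\<Sum>i\<in>Poly_Mapping.keys x. s (Poly_Mapping.lookup x i) (f i))"

definition tensor2_rel ::
    "('k::field \<Rightarrow> 'v::ab_group_add \<Rightarrow> 'v) \<Rightarrow> (('v \<times> 'v) \<Rightarrow>\<^sub>0 'k) set" where
  "tensor2_rel s = module.span free_scale
     ({gen (a + a', b) - (gen (a, b) + gen (a', b)) | a a' b. True} \<union>
      {gen (a, b + b') - (gen (a, b) + gen (a, b')) | a b b'. True} \<union>
      {gen (s c a, b) - free_scale c (gen (a, b)) | c a b. True} \<union>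
      {gen (a, s c b) - free_scale c (gen (a, b)) | c a b. True})"

definition tensor3_rel ::
    "('k::field \<Rightarrow> 'v::ab_group_add \<Rightarrow> 'v) \<Rightarrow> (('v \<times> 'v \<times> 'v) \<Rightarrow>\<^sub>0 'k) set" where
  "tensor3_rel s = module.span free_scale
     ({gen (a + a', b, d) - (gen (a, b, d) + gen (a', b, d)) | a a' b d. True} \<union>
      {gen (a, b + b', d) - (gen (a, b, d) + gen (a, b', d)) | a b b' d. True} \<union>
      {gen (a, b, d + d') - (gen (a, b, d) + gen (a, b, d')) | a b d d'. True} \<union>
      {gen (s c a, b, d) - free_scale c (gen (a, b, d)) | c a b d. True} \<union>
      {gen (a, s c b, d) - free_scale c (gen (a, b, d)) | c a b d. True} \<union>
      {gen (a, b, s c d) - free_scale c (gen (a, b, d)) | c a b d. True})"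

text \<open>
  Elements of \<open>V \<otimes> V\<close> are cosets, so \<open>x \<in> T\<close> says that the formal sum \<open>x\<close> of pairs
  represents the tensor \<open>T\<close>.
\<close>

definition tensor2_class ::
    "('k::field \<Rightarrow> 'v::ab_group_add \<Rightarrow> 'v) \<Rightarrow> (('v \<times> 'v) \<Rightarrow>\<^sub>0 'k) \<Rightarrow> (('v \<times> 'v) \<Rightarrow>\<^sub>0 'k) set" where
  "tensor2_class s x = {y. y - x \<in> tensor2_rel s}"

definition tensor2 ::
    "('k::field \<Rightarrow> 'v::ab_group_add \<Rightarrow> 'v) \<Rightarrow> (('v \<times> 'v) \<Rightarrow>\<^sub>0 'k) set set" where
  "tensor2 s = {tensor2_class s x | x. True}"

text \<open>On representatives: \<open>(a \<otimes> b)(c \<otimes> d) = ac \<otimes> bd\<close>.\<close>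

definition tensor2_mult ::
    "(('h::ring_1 \<times> 'h) \<Rightarrow>\<^sub>0 'k::field) \<Rightarrow> (('h \<times> 'h) \<Rightarrow>\<^sub>0 'k) \<Rightarrow> (('h \<times> 'h) \<Rightarrow>\<^sub>0 'k)" where
  "tensor2_mult x y =
     lin_ext free_scale (\<lambda>(a, b). lin_ext free_scale (\<lambda>(c, d). gen (a * c, b * d)) y) x"

text \<open>On representatives: \<open>(D \<otimes> id)(a \<otimes> b) = D a \<otimes> b\<close> and \<open>(id \<otimes> D)(a \<otimes> b) = a \<otimes> D b\<close>.\<close>

definition map_left ::
    "('v \<Rightarrow> (('v \<times> 'v) \<Rightarrow>\<^sub>0 'k::field)) \<Rightarrow> (('v \<times> 'v) \<Rightarrow>\<^sub>0 'k) \<Rightarrow> (('v \<times> 'v \<times> 'v) \<Rightarrow>\<^sub>0 'k)" where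
  "map_left D = lin_ext free_scale (\<lambda>(a, b). lin_ext free_scale (\<lambda>(c, d). gen (c, d, b)) (D a))"

definition map_right ::
    "('v \<Rightarrow> (('v \<times> 'v) \<Rightarrow>\<^sub>0 'k::field)) \<Rightarrow> (('v \<times> 'v) \<Rightarrow>\<^sub>0 'k) \<Rightarrow> (('v \<times> 'v \<times> 'v) \<Rightarrow>\<^sub>0 'k)" where
  "map_right D = lin_ext free_scale (\<lambda>(a, b). lin_ext free_scale (\<lambda>(c, d). gen (a, c, d)) (D b))"


section \<open>Algebras and coalgebras over a field\<close>

locale k_algebra = vector_space scale
  for scale :: "'k::field \<Rightarrow> 'h::ring_1 \<Rightarrow> 'h" (infixr \<open>*s\<close> 75) +
  assumes scale_mult_left: "(c *s a) * b = c *s (a * b)"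
    and scale_mult_right: "a * (c *s b) = c *s (a * b)"
begin

definition left_ideal :: "'h set \<Rightarrow> bool" where
  "left_ideal I \<longleftrightarrow> subspace I \<and> (\<forall>h. \<forall>x\<in>I. h * x \<in> I)"

text \<open>Complete reducibility of the left regular module.\<close>

definition semisimple_algebra :: bool where
  "semisimple_algebra \<longleftrightarrow>
     (\<forall>I. left_ideal I \<longrightarrow>
       (\<exists>J. left_ideal J \<and> I \<inter> J = {0} \<and> (\<forall>h. \<exists>x\<in>I. \<exists>y\<in>J. h = x + y)))"

end

text \<open>
  The comultiplication is a map into the set of cosets \<^term>\<open>tensor2 scale\<close>. A formal sum
  \<open>x \<in> comul h\<close> corresponds to a choice of \<open>h\<^sub>1 \<otimes> h\<^sub>2\<close> in Sweedler notation, and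
  \<open>lin_ext scale f x\<close> to the sum of the \<open>f (h\<^sub>1, h\<^sub>2)\<close>. As in Sweedler notation, the expression
  does not depend on \<open>x\<close> when \<open>f\<close> is bilinear. Likewise \<open>D\<close> below is a choice of
  representatives for all \<open>comul a\<close>.
\<close>

locale coalgebra = vector_space scale
  for scale :: "'k::field \<Rightarrow> 'h::ab_group_add \<Rightarrow> 'h" (infixr \<open>*s\<close> 75) +
  fixes comul :: "'h \<Rightarrow> (('h \<times> 'h) \<Rightarrow>\<^sub>0 'k) set"
    and counit :: "'h \<Rightarrow> 'k"
  assumes comul_tensor2: "comul h \<in> tensor2 scale"
    and comul_add: "x \<in> comul a \<Longrightarrow> y \<in> comul b \<Longrightarrow> x + y \<in> comul (a + b)"
    and comul_scale: "x \<in> comul a \<Longrightarrow> free_scale c x \<in> comul (c *s a)"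
    and coassoc: "x \<in> comul h \<Longrightarrow> (\<And>a. D a \<in> comul a) \<Longrightarrow>
      map_left D x - map_right D x \<in> tensor3_rel scale"
    and linear_counit: "Vector_Spaces.linear scale (*) counit"
    and counit_left: "x \<in> comul h \<Longrightarrow> lin_ext scale (\<lambda>(a, b). counit a *s b) x = h"
    and counit_right: "x \<in> comul h \<Longrightarrow> lin_ext scale (\<lambda>(a, b). counit b *s a) x = h"


section \<open>Hopf algebras\<close>

locale bialgebra = k_algebra scale + coalgebra scale comul counit
  for scale :: "'k::field \<Rightarrow> 'h::ring_1 \<Rightarrow> 'h" (infixr \<open>*s\<close> 75)
    and comul :: "'h \<Rightarrow> (('h \<times> 'h) \<Rightarrow>\<^sub>0 'k) set"
    and counit :: "'h \<Rightarrow> 'k" +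
  assumes comul_one: "gen (1, 1) \<in> comul 1"
    and comul_mult: "x \<in> comul a \<Longrightarrow> y \<in> comul b \<Longrightarrow> tensor2_mult x y \<in> comul (a * b)"
    and counit_one: "counit 1 = 1"
    and counit_mult: "counit (a * b) = counit a * counit b"

locale hopf_algebra = bialgebra scale comul counit
  for scale :: "'k::field \<Rightarrow> 'h::ring_1 \<Rightarrow> 'h" (infixr \<open>*s\<close> 75)
    and comul :: "'h \<Rightarrow> (('h \<times> 'h) \<Rightarrow>\<^sub>0 'k) set"
    and counit :: "'h \<Rightarrow> 'k" +
  fixes antipode :: "'h \<Rightarrow> 'h"
  assumes linear_antipode: "Vector_Spaces.linear scale scale antipode"
    and antipode_left: "x \<in> comul h \<Longrightarrow> lin_ext scale (\<lambda>(a, b). antipode a * b) x = counit h *s 1"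
    and antipode_right: "x \<in> comul h \<Longrightarrow> lin_ext scale (\<lambda>(a, b). a * antipode b) x = counit h *s 1"
begin

text \<open>
  The condition \<open>comul a \<inter> {x. keys x \<subseteq> A \<times> A} \<noteq> {}\<close> says that the coproduct of \<open>a\<close> lies in
  the image of \<open>A \<otimes> A\<close>.
\<close>

definition hopf_subalgebra :: "'h set \<Rightarrow> bool" where
  "hopf_subalgebra A \<longleftrightarrow>
     subspace A \<and> 1 \<in> A \<and> (\<forall>a\<in>A. \<forall>b\<in>A. a * b \<in> A) \<and>
     (\<forall>a\<in>A. comul a \<inter> {x. Poly_Mapping.keys x \<subseteq> A \<times> A} \<noteq> {}) \<and>
     (\<forall>a\<in>A. antipode a \<in> A)"

text \<open>\<open>h\<^sub>1 A S(h\<^sub>2) \<subseteq> A\<close>\<close>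

definition normal_hopf_subalgebra :: "'h set \<Rightarrow> bool" where
  "normal_hopf_subalgebra A \<longleftrightarrow>
     hopf_subalgebra A \<and>
     (\<forall>h. \<forall>x\<in>comul h. \<forall>a\<in>A. lin_ext scale (\<lambda>(y, z). y * a * antipode z) x \<in> A)"

definition proper :: "'h set \<Rightarrow> bool" where
  "proper A \<longleftrightarrow> A \<noteq> {c *s 1 | c. True} \<and> A \<noteq> UNIV"

end

end

theory Submission
  imports Defs "HOL-Analysis.Determinants" "HOL-Computational_Algebra.Computational_Algebra"
begin

text \<open>
  In coordinates, \<open>H\<close> and its dual are both spaces \<open>k\<^sup>n\<close> that carry a product. By Maschke's argument
  and the theorem of Larson and Radford (\<open>S\<^sup>2 = id\<close>) both are semisimple, with character rings that are
  based rings. Counting dimensions in these rings leaves four possibilities for the degrees of the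
  irreducible characters when \<open>n = 40\<close>: the group \<open>G(H\<^sup>*)\<close> of linear characters has order 4 or 8 and
  all degrees are 1, 2 or 4, or its order is 20 or 40. The same holds for \<open>H\<^sup>*\<close> and the group \<open>G(H)\<close>.

  The goal is a central involution \<open>g\<close> in \<open>G(H)\<close> or in \<open>G(H\<^sup>*)\<close>. In the first case the span of
  \<open>1\<close> and \<open>g\<close> is normal, in the second case \<open>{h. h\<^sub>1 g(h\<^sub>2) = h}\<close> is. Orders 20 and 40 yield a central
  involution directly. For a homomorphism \<open>\<mu>\<close> from the character ring to \<open>k\<close>, the quotient of 40 by the
  formal codegree \<open>\<Sum>\<^sub>\<chi> \<mu>(\<chi>) \<mu>(\<chi>\<^sup>*)\<close> is a natural number whose
  parity is governed by \<open>G(H)\<close>. If \<open>\<mu>\<close> is evaluation at a noncentral involution with a class of odd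
  size, the codegree must be 8. In the orders 4 and 8 this forces most characters to vanish on most of
  \<open>G(H)\<close>. If both orders are 8, averaging over \<open>G(H)\<close> shows that 8 divides the degree of every
  nonlinear character, which is absurd. Otherwise, on one side, exactly two irreducible characters of
  degree 4 exist, and an explicit homomorphism \<open>\<mu>\<close> has an impossible codegree.
\<close>

text \<open>Two obstacles shape the argument. The field carries no absolute value, so estimates on
  character values need substitutes. Nonvanishing of the trace of S^2 is obtained by carrying a
  polynomial relation over to a complex root of unity. Values at grouplike elements of order
  dividing 8 are measured by the rational part of f(g) f(1/g) in Z[sqrt 2]. The second obstacle is
  divisibility without a theory of algebraic integers or of freeness over Hopf subalgebras. Its
  source is one formula: for an idempotent f of the dual and the normalized integral L, the number n
  f(L) is the sum of deg(g) rank_g(f) over the irreducible characters g of the dual. It bounds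
  orders of groups and dimensions of quotients by divisors of 40. It also explains the parity rule:
  summands of even degree disappear modulo 2, and those of degree one come from grouplike elements.
  This is why the degrees 1, 2, 4 have to be established on both sides before any parity argument
  starts. The orders 1 and 2 are excluded because they would create quotients of dimension 6 or
  22.\<close>

section \<open>Linear and bilinear algebra in coordinates\<close>

definition lin :: "('k::field ^ 'i \<Rightarrow> 'k) \<Rightarrow> bool" where
  "lin f \<longleftrightarrow> (\<forall>x y. f (x + y) = f x + f y) \<and> (\<forall>c x. f (c *s x) = c * f x)"

definition linv :: "('k::field ^ 'i \<Rightarrow> 'k ^ 'i) \<Rightarrow> bool" where
  "linv T \<longleftrightarrow> (\<forall>x y. T (x + y) = T x + T y) \<and> (\<forall>c x. T (c *s x) = c *s T x)"

definition pr :: "'k::field ^ 'i::finite \<Rightarrow> 'k ^ 'i \<Rightarrow> 'k"  (infix "\<cdot>" 72) where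
  "pr f x = (\<Sum>i\<in>UNIV. f $ i * x $ i)"

definition bm :: "('i::finite \<Rightarrow> 'i \<Rightarrow> 'i \<Rightarrow> 'k::field) \<Rightarrow> 'k ^ 'i \<Rightarrow> 'k ^ 'i \<Rightarrow> 'k ^ 'i" where
  "bm M x y = (\<chi> l. \<Sum>i\<in>UNIV. \<Sum>j\<in>UNIV. x $ i * y $ j * M i j l)"

text \<open>The Sweedler sum of F(x_1, x_2) for the coproduct with structure constants
  \<open>D\<close>. Keeping \<open>F\<close> scalar valued turns identities in tensor powers into
  identities in the field.\<close>

definition cop :: "('i::finite \<Rightarrow> 'i \<Rightarrow> 'i \<Rightarrow> 'k::field) \<Rightarrow> ('k ^ 'i \<Rightarrow> 'k ^ 'i \<Rightarrow> 'k) \<Rightarrow> 'k ^ 'i \<Rightarrow> 'k" where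
  "cop D F x = (\<Sum>l\<in>UNIV. \<Sum>i\<in>UNIV. \<Sum>j\<in>UNIV. x $ l * D i j l * F (axis i 1) (axis j 1))"

definition ant :: "('i::finite \<Rightarrow> 'i \<Rightarrow> 'k::field) \<Rightarrow> 'k ^ 'i \<Rightarrow> 'k ^ 'i" where
  "ant S x = (\<chi> j. \<Sum>i\<in>UNIV. x $ i * S i j)"

definition trc :: "('k::field ^ 'i::finite \<Rightarrow> 'k ^ 'i) \<Rightarrow> 'k" where
  "trc T = (\<Sum>i\<in>UNIV. T (axis i 1) $ i)"

definition vof :: "('k::field ^ 'i::finite \<Rightarrow> 'k) \<Rightarrow> 'k ^ 'i" where
  "vof f = (\<chi> i. f (axis i 1))"

lemma delta_mult:
  "(if P then b else 0) * (a::'a::semiring_1) = (if P then b * a else 0)"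
  "a * (if P then b else 0) = (if P then a * b else 0)"
  by simp_all

lemma linD: "lin f \<Longrightarrow> f (x + y) = f x + f y" "lin f \<Longrightarrow> f (c *s x) = c * f x"
  by (auto simp: lin_def)

lemma linvD: "linv f \<Longrightarrow> f (x + y) = f x + f y" "linv f \<Longrightarrow> f (c *s x) = c *s f x"
  by (auto simp: linv_def)

lemma lin_0: "lin f \<Longrightarrow> f 0 = 0"
  using linD(2)[of f 0 0] by simp

lemma linv_0: "linv f \<Longrightarrow> f 0 = 0"
  using linvD(2)[of f 0 0] by simp

lemma lin_uminus: "lin f \<Longrightarrow> f (- x) = - f x"
  using linD(2)[of f "-1" x] by (simp add: vector_sneg_minus1[symmetric])

lemma lin_diff: "lin f \<Longrightarrow> f (x - y) = f x - f y"
  using linD(1)[of f x "-y"] lin_uminus[of f y] by simp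

lemma linv_uminus: "linv f \<Longrightarrow> f (- x) = - f x"
  using linvD(2)[of f "-1" x] by (simp add: vector_sneg_minus1[symmetric])

lemma linv_diff: "linv f \<Longrightarrow> f (x - y) = f x - f y"
  using linvD(1)[of f x "-y"] linv_uminus[of f y] by simp

lemma lin_sum: "lin f \<Longrightarrow> f (sum g A) = (\<Sum>a\<in>A. f (g a))"
  by (induction A rule: infinite_finite_induct) (auto simp: linD lin_0)

lemma linv_sum: "linv f \<Longrightarrow> f (sum g A) = (\<Sum>a\<in>A. f (g a))"
  by (induction A rule: infinite_finite_induct) (auto simp: linvD linv_0)

lemma lin_basis:
  fixes x :: "'k::field ^ 'i::finite"
  assumes "lin f" shows "f x = (\<Sum>i\<in>UNIV. x $ i * f (axis i 1))"
proof -
  have "f x = f (\<Sum>i\<in>UNIV. x $ i *s axis i 1)" by (simp add: basis_expansion)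
  also have "\<dots> = (\<Sum>i\<in>UNIV. x $ i * f (axis i 1))" using assms by (simp add: lin_sum linD)
  finally show ?thesis .
qed

lemma linv_basis:
  fixes x :: "'k::field ^ 'i::finite"
  assumes "linv f" shows "f x = (\<Sum>i\<in>UNIV. x $ i *s f (axis i 1))"
proof -
  have "f x = f (\<Sum>i\<in>UNIV. x $ i *s axis i 1)" by (simp add: basis_expansion)
  also have "\<dots> = (\<Sum>i\<in>UNIV. x $ i *s f (axis i 1))" using assms by (simp add: linv_sum linvD)
  finally show ?thesis .
qed

lemma pr_axis [simp]: "f \<cdot> axis i 1 = f $ i" "axis i 1 \<cdot> f = f $ i"
  by (simp_all add: pr_def axis_def delta_mult)

lemma pr_comm: "f \<cdot> x = x \<cdot> f" by (simp add: pr_def mult.commute)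

lemma vof_pr: "lin f \<Longrightarrow> vof f \<cdot> x = f x"
  by (subst (2) lin_basis) (auto simp: vof_def pr_def mult.commute)

lemma pr_add: "(f + g) \<cdot> x = f \<cdot> x + g \<cdot> x" "f \<cdot> (x + y) = f \<cdot> x + f \<cdot> y"
  by (simp_all add: pr_def sum.distrib algebra_simps)

lemma pr_scale: "(c *s f) \<cdot> x = c * (f \<cdot> x)" "f \<cdot> (c *s x) = c * (f \<cdot> x)"
  by (simp_all add: pr_def sum_distrib_left algebra_simps)

lemma lin_pr: "lin (\<lambda>x. f \<cdot> x)" "lin (\<lambda>f. f \<cdot> x)"
  by (auto simp: lin_def pr_add pr_scale)

lemmas pr_diff = lin_diff[OF lin_pr(1)] lin_diff[OF lin_pr(2)]
lemmas pr_sum = lin_sum[OF lin_pr(1)] lin_sum[OF lin_pr(2)]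
lemmas pr_0 [simp] = lin_0[OF lin_pr(1)] lin_0[OF lin_pr(2)]

lemma pr_eqI: "(\<And>f. f \<cdot> x = f \<cdot> y) \<Longrightarrow> x = y"
  by (metis pr_axis(2) vec_eq_iff)

lemma pr_eqI': "(\<And>x. f \<cdot> x = g \<cdot> x) \<Longrightarrow> f = g"
  by (metis pr_axis(1) vec_eq_iff)

lemma bm_add: "bm M (x + y) z = bm M x z + bm M y z" "bm M x (y + z) = bm M x y + bm M x z"
  by (simp_all add: bm_def vec_eq_iff sum.distrib algebra_simps)

lemma bm_scale: "bm M (c *s x) y = c *s bm M x y" "bm M x (c *s y) = c *s bm M x y"
  by (simp_all add: bm_def vec_eq_iff sum_distrib_left algebra_simps)

lemma linv_bm: "linv (\<lambda>x. bm M x y)" "linv (\<lambda>y. bm M x y)"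
  by (auto simp: linv_def bm_add bm_scale)

lemmas bm_diff = linv_diff[OF linv_bm(1)] linv_diff[OF linv_bm(2)]
lemmas bm_minus = linv_uminus[OF linv_bm(1)] linv_uminus[OF linv_bm(2)]
lemmas bm_sum = linv_sum[OF linv_bm(1)] linv_sum[OF linv_bm(2)]
lemmas bm_0 [simp] = linv_0[OF linv_bm(1)] linv_0[OF linv_bm(2)]

lemma bm_axis: "bm M (axis i 1) (axis j 1) $ l = M i j l"
  by (simp add: bm_def axis_def delta_mult)

lemma linv_ant: "linv (ant S)"
  by (auto simp: linv_def ant_def vec_eq_iff sum.distrib sum_distrib_left algebra_simps)

lemmas ant_add = linvD(1)[OF linv_ant] and ant_scale = linvD(2)[OF linv_ant]
lemmas ant_diff = linv_diff[OF linv_ant] and ant_sum = linv_sum[OF linv_ant]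
lemmas ant_0 [simp] = linv_0[OF linv_ant]

lemma pr_ant: "f \<cdot> ant S x = ant (\<lambda>i j. S j i) f \<cdot> x"
  unfolding pr_def ant_def by (simp add: sum_distrib_left sum_distrib_right, subst sum.swap, simp add: algebra_simps)

lemma lin_cop: "lin (cop D F)"
  by (auto simp: lin_def cop_def sum.distrib sum_distrib_left algebra_simps)

lemma cop_axis: "cop D F (axis l 1) = (\<Sum>i\<in>UNIV. \<Sum>j\<in>UNIV. D i j l * F (axis i 1) (axis j 1))"
proof -
  have "cop D F (axis l 1) = (\<Sum>l'\<in>UNIV. if l' = l then (\<Sum>i\<in>UNIV. \<Sum>j\<in>UNIV. D i j l * F (axis i 1) (axis j 1)) else 0)"
    unfolding cop_def by (intro sum.cong) (auto simp: axis_def)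
  thus ?thesis by simp
qed

lemma cop_cong: "(\<And>a b. F a b = G a b) \<Longrightarrow> cop D F x = cop D G x"
  by (simp add: cop_def)

lemma cop_cmult: "cop D (\<lambda>a b. c * F a b) x = c * cop D F x" "cop D (\<lambda>a b. F a b * c) x = cop D F x * c"
  by (simp_all add: cop_def sum_distrib_left sum_distrib_right algebra_simps)

lemma cop_plus: "cop D (\<lambda>a b. F a b + G a b) x = cop D F x + cop D G x"
  by (simp add: cop_def sum.distrib algebra_simps)

lemma cop_sum: "cop D (\<lambda>a b. \<Sum>s\<in>A. F s a b) x = (\<Sum>s\<in>A. cop D (F s) x)"
  by (induction A rule: infinite_finite_induct) (simp_all add: cop_plus, simp_all add: cop_def)

lemma lin_cop_param:
  assumes "\<And>a b. lin (\<lambda>z. F z a b)" shows "lin (\<lambda>z. cop D (F z) x)"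
proof -
  have "cop D (F (z + z')) x = cop D (F z) x + cop D (F z') x" for z z'
    by (subst cop_plus[symmetric], rule cop_cong) (rule linD(1)[OF assms])
  moreover have "cop D (F (c *s z)) x = c * cop D (F z) x" for c z
    by (subst cop_cmult(1)[symmetric], rule cop_cong) (rule linD(2)[OF assms])
  ultimately show ?thesis by (simp add: lin_def)
qed

text \<open>Convolution: read as structure constants of a product, \<open>D\<close> multiplies
  functionals. This is the bridge between Sweedler sums and products in the dual.\<close>

lemma pr_bm: "bm D f g \<cdot> x = cop D (\<lambda>a b. f \<cdot> a * g \<cdot> b) x"
  unfolding pr_def[of "bm D f g"] by (simp add: bm_def cop_def sum_distrib_left sum_distrib_right algebra_simps)

lemma cop_swap:
  "cop D (\<lambda>a b. cop E (\<lambda>c d. F a b c d) y) x = cop E (\<lambda>c d. cop D (\<lambda>a b. F a b c d) x) y"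
  (is "?L = ?R")
proof -
  have 1: "cop E (\<lambda>c d. cop D (\<lambda>a b. F a b c d) x) y = 
    (\<Sum>l\<in>UNIV. \<Sum>i\<in>UNIV. \<Sum>j\<in>UNIV. y $ l * E i j l * cop D (\<lambda>a b. F a b (axis i 1) (axis j 1)) x)" by (simp add: cop_def[of E])
  show ?thesis unfolding 1 cop_def[of E]
    by (simp add: cop_sum cop_cmult)
qed

definition bil :: "('k::field ^ 'i \<Rightarrow> 'k ^ 'i \<Rightarrow> 'k) \<Rightarrow> bool" where
  "bil F \<longleftrightarrow> (\<forall>a. lin (\<lambda>b. F a b)) \<and> (\<forall>b. lin (\<lambda>a. F a b))"

lemma bil_basis:
  fixes x y :: "'k::field ^ 'i::finite"
  assumes "bil F" shows "F x y = (\<Sum>i\<in>UNIV. \<Sum>j\<in>UNIV. x $ i * y $ j * F (axis i 1) (axis j 1))"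
proof -
  have a: "lin (\<lambda>a. F a y)" and b: "\<And>a. lin (F a)" using assms by (auto simp: bil_def)
  show ?thesis by (subst lin_basis[OF a], subst lin_basis[OF b]) (simp add: sum_distrib_left mult.assoc)
qed

lemma lin_const_mult: "lin f \<Longrightarrow> lin (\<lambda>x. c * f x)" "lin f \<Longrightarrow> lin (\<lambda>x. f x * c)"
  by (auto simp: lin_def algebra_simps)

lemma lin_add: "lin f \<Longrightarrow> lin g \<Longrightarrow> lin (\<lambda>x. f x + g x)"
  by (auto simp: lin_def algebra_simps)

lemma lin_comp: "lin f \<Longrightarrow> linv T \<Longrightarrow> lin (\<lambda>x. f (T x))"
  by (auto simp: lin_def linv_def)

lemma linv_comp: "linv f \<Longrightarrow> linv T \<Longrightarrow> linv (\<lambda>x. f (T x))"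
  by (auto simp: linv_def)

lemma linv_id: "linv (\<lambda>x. x)" by (simp add: linv_def)

lemma linv_scale: "lin f \<Longrightarrow> linv (\<lambda>x. f x *s v)" "linv T \<Longrightarrow> linv (\<lambda>x. c *s T x)"
  by (auto simp: lin_def linv_def vec.scale_left_distrib vec.scale_right_distrib algebra_simps)

lemma linv_add: "linv f \<Longrightarrow> linv g \<Longrightarrow> linv (\<lambda>x. f x + g x)"
  by (auto simp: linv_def vec.scale_right_distrib)

lemma lin_sumI: "(\<And>a. a \<in> A \<Longrightarrow> lin (f a)) \<Longrightarrow> lin (\<lambda>x. \<Sum>a\<in>A. f a x)"
proof (induction A rule: infinite_finite_induct)
  case (insert x F) thus ?case by (simp add: lin_add)
qed (auto simp: lin_def)

lemma lin_prE: "linv T \<Longrightarrow> lin (\<lambda>x. f \<cdot> T x)" by (rule lin_comp[OF lin_pr(1)])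
lemma lin_prE2: "linv T \<Longrightarrow> lin (\<lambda>x. T x \<cdot> f)" by (rule lin_comp[OF lin_pr(2)])
lemma lin_copE: "linv T \<Longrightarrow> lin (\<lambda>x. cop D F (T x))" by (rule lin_comp[OF lin_cop])
lemma linv_bmE: "linv T \<Longrightarrow> linv (\<lambda>x. bm M (T x) y)" "linv T \<Longrightarrow> linv (\<lambda>x. bm M y (T x))"
  by (auto intro: linv_comp[OF linv_bm(1)] linv_comp[OF linv_bm(2)])
lemma linv_antE: "linv T \<Longrightarrow> linv (\<lambda>x. ant S (T x))" by (rule linv_comp[OF linv_ant])

lemmas lin_intros = lin_prE lin_prE2 lin_const_mult lin_copE lin_cop_param lin_add linv_id linv_bmE linv_antE
  linv_scale linv_add

lemma bilI: "(\<And>a. lin (\<lambda>b. F a b)) \<Longrightarrow> (\<And>b. lin (\<lambda>a. F a b)) \<Longrightarrow> bil F"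
  by (auto simp: bil_def)

text \<open>\<open>T\<close> is the sum of the rank one maps that send x to c_s(T x) v_s, and such a
  map has trace c_s(T v_s). In this form the matrix units of an algebra can be inserted for the
  family.\<close>

lemma trc_family:
  fixes T :: "'k::field ^ 'i::finite \<Rightarrow> 'k ^ 'i"
  assumes x: "\<And>x. x = (\<Sum>s\<in>A. c s x *s v s)" and c: "\<And>s. s \<in> A \<Longrightarrow> lin (c s)" and T: "linv T"
  shows "trc T = (\<Sum>s\<in>A. c s (T (v s)))"
proof -
  have "trc T = (\<Sum>i\<in>UNIV. \<Sum>s\<in>A. c s (T (axis i 1)) * v s $ i)"
    unfolding trc_def
  proof (rule sum.cong[OF refl])
    fix i
    show "T (axis i 1) $ i = (\<Sum>s\<in>A. c s (T (axis i 1)) * v s $ i)"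
      using arg_cong[where f = "\<lambda>z. z $ i", OF x[of "T (axis i 1)"]]
      unfolding sum_component vector_smult_component .
  qed
  also have "\<dots> = (\<Sum>s\<in>A. \<Sum>i\<in>UNIV. v s $ i * c s (T (axis i 1)))" by (subst sum.swap) (simp add: mult.commute)
  also have "\<dots> = (\<Sum>s\<in>A. c s (T (v s)))"
  proof (rule sum.cong[OF refl])
    fix s assume "s \<in> A"
    hence "lin (\<lambda>x. c s (T x))" using lin_comp[OF c T] by simp
    from lin_basis[OF this, of "v s"] show "(\<Sum>i\<in>UNIV. v s $ i * c s (T (axis i 1))) = c s (T (v s))" by simp
  qed
  finally show ?thesis .
qed

lemma trc_comm:
  fixes T U :: "'k::field ^ 'i::finite \<Rightarrow> 'k ^ 'i"
  assumes "linv T" "linv U" shows "trc (\<lambda>x. T (U x)) = trc (\<lambda>x. U (T x))"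
proof -
  have a: "V x $ i = (\<Sum>j\<in>UNIV. x $ j * V (axis j 1) $ i)" if "linv V" for V :: "'k ^ 'i \<Rightarrow> 'k ^ 'i" and x i
    by (subst linv_basis[OF that]) simp
  show ?thesis unfolding trc_def
    by (subst a[OF assms(1)], subst a[OF assms(2)], subst sum.swap) (simp add: mult.commute)
qed

text \<open>Wedderburn's rank reduction: subtracting a suitable rank one matrix from a nonzero idempotent
  matrix gives an idempotent matrix with trace lowered by one and one more zero row.\<close>

lemma idempotent_trace_nat:
  fixes A :: "'a \<Rightarrow> 'a \<Rightarrow> 'k::field_char_0"
  assumes "finite X" and "\<And>a c. a \<in> X \<Longrightarrow> c \<in> X \<Longrightarrow> (\<Sum>b\<in>X. A a b * A b c) = A a c"
  shows "\<exists>m::nat. m \<le> card X \<and> (\<Sum>a\<in>X. A a a) = of_nat m \<and> (m = 0 \<longrightarrow> (\<forall>a\<in>X. \<forall>b\<in>X. A a b = 0))"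
proof -
  define nz where "nz A = {a\<in>X. \<exists>b\<in>X. A a b \<noteq> (0::'k)}" for A
  have fin: "finite (nz A)" for A using assms(1) by (simp add: nz_def)
  have "\<exists>m::nat. m \<le> card (nz A) \<and> (\<Sum>a\<in>X. A a a) = of_nat m \<and> (m = 0 \<longrightarrow> (\<forall>a\<in>X. \<forall>b\<in>X. A a b = 0))"
    if "\<And>a c. a \<in> X \<Longrightarrow> c \<in> X \<Longrightarrow> (\<Sum>b\<in>X. A a b * A b c) = A a c" for A
    using that
  proof (induction "card (nz A)" arbitrary: A rule: less_induct)
    case less
    note A = less.prems
    show ?case
    proof (cases "\<forall>a\<in>X. \<forall>b\<in>X. A a b = 0")
      case True thus ?thesis by (intro exI[of _ 0]) auto
    next
      case False
      then obtain p q where pq: "p \<in> X" "q \<in> X" "A p q \<noteq> 0" by blast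
      define s where "s = A p q"
      define B where "B a b = A a b - A a q * A p b / s" for a b
      have s: "s \<noteq> 0" using pq by (simp add: s_def)
      have B: "(\<Sum>b\<in>X. B a b * B b c) = B a c" if "a \<in> X" "c \<in> X" for a c
      proof -
        have "(\<Sum>b\<in>X. B a b * B b c) = (\<Sum>b\<in>X. A a b * A b c) - (\<Sum>b\<in>X. A a b * A b q) * A p c / s
           - A a q * (\<Sum>b\<in>X. A p b * A b c) / s + A a q * (\<Sum>b\<in>X. A p b * A b q) * A p c / (s * s)"
          by (simp add: B_def algebra_simps sum_subtractf sum.distrib sum_distrib_left sum_distrib_right sum_divide_distrib)
        also have "\<dots> = B a c" using A that pq s by (simp add: B_def s_def[symmetric] )
        finally show ?thesis .
      qed
      have tr: "(\<Sum>a\<in>X. B a a) = (\<Sum>a\<in>X. A a a) - 1"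
      proof -
        have "(\<Sum>a\<in>X. B a a) = (\<Sum>a\<in>X. A a a) - (\<Sum>a\<in>X. A p a * A a q) / s"
          by (simp add: B_def sum_subtractf sum_divide_distrib mult.commute)
        thus ?thesis using A[OF pq(1,2)] s by (simp add: s_def)
      qed
      have sub: "nz B \<subset> nz A"
      proof
        show "nz B \<subseteq> nz A" using pq by (auto simp: nz_def B_def) (metis divide_eq_0_iff mult_eq_0_iff)
        have "p \<in> nz A" using pq by (auto simp: nz_def)
        moreover have "p \<notin> nz B" using s by (auto simp: nz_def B_def s_def)
        ultimately show "nz B \<noteq> nz A" by blast
      qed
      have "card (nz B) < card (nz A)" by (rule psubset_card_mono[OF fin sub])
      from less.hyps[OF this B] obtain m :: nat where m: "m \<le> card (nz B)" "(\<Sum>a\<in>X. B a a) = of_nat m" by blast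
      show ?thesis
        using m tr \<open>card (nz B) < card (nz A)\<close> by (intro exI[of _ "Suc m"]) (auto simp: algebra_simps)
    qed
  qed
  from this[OF assms(2)] obtain m where m: "m \<le> card (nz A)" "(\<Sum>a\<in>X. A a a) = of_nat m" "m = 0 \<longrightarrow> (\<forall>a\<in>X. \<forall>b\<in>X. A a b = 0)" by blast
  have "card (nz A) \<le> card X" using assms(1) by (auto intro: card_mono simp: nz_def)
  thus ?thesis using m by (intro exI[of _ m]) auto
qed

section \<open>Matrix units of a semisimple algebra\<close>

lemma linv_eqI:
  fixes f g :: "'k::field ^ 'i::finite \<Rightarrow> 'k ^ 'i"
  assumes "linv f" "linv g" "\<And>i. f (axis i 1) = g (axis i 1)" shows "f x = g x"
  by (subst linv_basis[OF assms(1)], subst linv_basis[OF assms(2)]) (simp add: assms(3))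

lemma lin_eqI:
  fixes f g :: "'k::field ^ 'i::finite \<Rightarrow> 'k"
  assumes "lin f" "lin g" "\<And>i. f (axis i 1) = g (axis i 1)" shows "f x = g x"
  by (subst lin_basis[OF assms(1)], subst lin_basis[OF assms(2)]) (simp add: assms(3))

lemma bm_axis_right: "bm M y (axis k 1) $ l = (\<Sum>p\<in>UNIV. y $ p * M p k l)"
  by (simp add: bm_def axis_def delta_mult)

lemma bm_axis_left: "bm M (axis k 1) y $ l = (\<Sum>p\<in>UNIV. y $ p * M k p l)"
proof -
  have "bm M (axis k 1) y $ l = (\<Sum>i\<in>UNIV. if i = k then \<Sum>j\<in>UNIV. y $ j * M k j l else 0)"
    unfolding bm_def vec_lambda_beta by (rule sum.cong[OF refl]) (simp add: axis_def)
  thus ?thesis by simp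
qed

text \<open>Indexing by numbers instead of by a set matters: if two of the n + 1 vectors coincide,
  their difference is already a nontrivial relation.\<close>

lemma linear_relation:
  fixes f :: "nat \<Rightarrow> 'k::field ^ 'i::finite"
  shows "\<exists>a. (\<exists>i\<le>CARD('i). a i \<noteq> 0) \<and> (\<Sum>i\<le>CARD('i). a i *s f i) = 0"
proof (cases "inj_on f {..CARD('i)}")
  case True
  have "vec.dependent (f ` {..CARD('i)})"
  proof (rule ccontr)
    assume "vec.independent (f ` {..CARD('i)})"
    hence "card (f ` {..CARD('i)}) \<le> vec.dim (f ` {..CARD('i)})"
      by (simp add: vec.dim_eq_card_independent)
    also have "\<dots> \<le> CARD('i)" using vec.dim_subset_UNIV[of "f ` {..CARD('i)}"] by (simp add: vec.dimension_def card_cart_basis)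
    finally show False using True by (simp add: card_image)
  qed
  then obtain c where c: "\<exists>v\<in>f ` {..CARD('i)}. c v \<noteq> 0" "(\<Sum>v\<in>f ` {..CARD('i)}. c v *s v) = 0"
    by (subst (asm) vec.dependent_finite) auto
  show ?thesis
    using c True by (intro exI[of _ "\<lambda>i. c (f i)"]) (auto simp: sum.reindex)
next
  case False
  then obtain i j where ij: "i \<le> CARD('i)" "j \<le> CARD('i)" "i \<noteq> j" "f i = f j" by (auto simp: inj_on_def)
  have "(\<Sum>l\<le>CARD('i). (if l = i then 1 else if l = j then -1 else 0) *s f l)
     = (\<Sum>l\<le>CARD('i). (if l = i then f i else 0) + (if l = j then - f j else 0))"
    using ij by (intro sum.cong) auto
  also have "\<dots> = 0" using ij by (simp add: sum.distrib)
  finally show ?thesis using ij(1) by (intro exI[of _ "\<lambda>l. if l = i then 1 else if l = j then -1 else 0"]) auto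
qed

text \<open>Some nonzero polynomial in \<open>T\<close> of degree at most n kills \<open>v\<close>.
  When its linear factors are split off one at a time, the last nonzero vector is an eigenvector.
  All vectors that occur are polynomials in \<open>T\<close> applied to \<open>v\<close>, so they
  stay in \<open>V\<close>.\<close>

lemma eigenvector_exists:
  fixes T :: "'k::alg_closed_field ^ 'i::finite \<Rightarrow> 'k ^ 'i"
  assumes T: "linv T" and V: "vec.subspace V" "\<And>x. x \<in> V \<Longrightarrow> T x \<in> V" and v: "v \<in> V" "v \<noteq> 0"
  shows "\<exists>w\<in>V. w \<noteq> 0 \<and> (\<exists>c. T w = c *s w)"
proof -
  \<comment> \<open>This is q(T) v; the bound \<open>N\<close> on the degree fixes the range of
    summation.\<close>
  define ev where "ev N q = (\<Sum>i\<le>N. coeff q i *s (T ^^ i) v)" for N q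
  have TV: "(T ^^ i) v \<in> V" for i by (induction i) (auto intro: V v)
  have evV: "ev N q \<in> V" for N q
    unfolding ev_def by (intro vec.subspace_sum V(1) vec.subspace_scale TV)
  have ev_mult: "ev (Suc N) ([:- c, 1:] * q) = T (ev N q) - c *s ev N q" if "degree q \<le> N" for N q c
  proof -
    have "ev (Suc N) ([:- c, 1:] * q) = ev (Suc N) (pCons 0 q) - c *s ev (Suc N) q"
      by (simp add: ev_def sum_subtractf algebra_simps vec.scale_left_diff_distrib vec.scale_sum_right)
    also have "ev (Suc N) q = ev N q" using that by (simp add: ev_def coeff_eq_0)
    also have "ev (Suc N) (pCons 0 q) = T (ev N q)"
      unfolding ev_def by (subst sum.atMost_Suc_shift) (simp add: linv_sum[OF T] linvD[OF T])
    finally show ?thesis .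
  qed
  have main: "\<exists>w\<in>V. w \<noteq> 0 \<and> (\<exists>c. T w = c *s w)" if "q \<noteq> 0" "degree q \<le> N" "ev N q = 0" for N q
    using that
  proof (induction N arbitrary: q)
    case 0
    thus ?case using v by (auto simp: ev_def elim: degree_eq_zeroE)
  next
    case (Suc N)
    show ?case
    proof (cases "degree q = 0")
      case True
      then obtain a where "q = [:a:]" by (auto elim: degree_eq_zeroE)
      moreover have "ev (Suc N) [:a:] = a *s v" 
        by (simp add: ev_def sum.atMost_Suc_shift del: sum.atMost_Suc)
      ultimately show ?thesis using Suc.prems v by simp
    next
      case False
      then obtain c where "poly q c = 0" using alg_closed_imp_poly_has_root by blast
      then obtain q' where q': "q = [:- c, 1:] * q'" by (auto simp: poly_eq_0_iff_dvd)
      hence nz: "q' \<noteq> 0" using Suc.prems by auto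
      hence "degree q = Suc (degree q')" unfolding q' by (subst degree_mult_eq) auto
      hence d: "degree q' \<le> N" using Suc.prems by simp
      have e: "T (ev N q') = c *s ev N q'" using ev_mult[OF d, of c] q' Suc.prems by simp
      show ?thesis
        using Suc.IH[OF nz d] e evV[of N q'] by (cases "ev N q' = 0") auto
    qed
  qed
  obtain a where a: "\<exists>i\<le>CARD('i). a i \<noteq> 0" "(\<Sum>i\<le>CARD('i). a i *s (T ^^ i) v) = 0"
    using linear_relation[of "\<lambda>i. (T ^^ i) v"] by blast
  define q where "q = (\<Sum>i\<le>CARD('i). monom (a i) i)"
  have cq: "coeff q i = (if i \<le> CARD('i) then a i else 0)" for i
    by (simp add: q_def coeff_sum if_distrib cong: if_cong) 
  have "q \<noteq> 0" using a(1) cq by (metis coeff_0)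
  moreover have "degree q \<le> CARD('i)" by (rule degree_le) (simp add: cq)
  moreover have "ev (CARD('i)) q = 0" using a(2) by (simp add: ev_def cq)
  ultimately show ?thesis by (rule main)
qed

locale fin_alg =
  fixes M :: "'i::finite \<Rightarrow> 'i \<Rightarrow> 'i \<Rightarrow> 'k::{alg_closed_field,field_char_0}" and u :: "'k ^ 'i"
  assumes M_assoc: "(\<Sum>p\<in>UNIV. M i j p * M p k l) = (\<Sum>p\<in>UNIV. M j k p * M i p l)"
    and M_unitl: "(\<Sum>i\<in>UNIV. u $ i * M i j l) = (if j = l then 1 else 0)"
    and M_unitr: "(\<Sum>j\<in>UNIV. u $ j * M i j l) = (if i = l then 1 else 0)"
begin

abbreviation mul (infixl "\<odot>" 75) where "x \<odot> y \<equiv> bm M x y"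

lemma mul_assoc: "x \<odot> y \<odot> z = x \<odot> (y \<odot> z)"
proof -
  have "axis i 1 \<odot> axis j 1 \<odot> axis k 1 = axis i 1 \<odot> (axis j 1 \<odot> axis k 1)" for i j k
    unfolding vec_eq_iff bm_axis_right[where y = "axis i 1 \<odot> axis j 1"]
      bm_axis_left[where y = "axis j 1 \<odot> axis k 1"] bm_axis by (simp add: M_assoc)
  hence "axis i 1 \<odot> axis j 1 \<odot> z = axis i 1 \<odot> (axis j 1 \<odot> z)" for i j
    by (rule linv_eqI[of "\<lambda>z. axis i 1 \<odot> axis j 1 \<odot> z" "\<lambda>z. axis i 1 \<odot> (axis j 1 \<odot> z)", rotated 2]) (intro lin_intros)+
  hence "axis i 1 \<odot> y \<odot> z = axis i 1 \<odot> (y \<odot> z)" for i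
    by (rule linv_eqI[of "\<lambda>y. axis i 1 \<odot> y \<odot> z" "\<lambda>y. axis i 1 \<odot> (y \<odot> z)", rotated 2]) (intro lin_intros)+
  thus ?thesis
    by (rule linv_eqI[of "\<lambda>x. x \<odot> y \<odot> z" "\<lambda>x. x \<odot> (y \<odot> z)", rotated 2]) (intro lin_intros)+
qed

lemma mul_1 [simp]: "u \<odot> x = x" "x \<odot> u = x"
proof -
  have "u \<odot> axis i 1 = axis i 1" for i
    unfolding vec_eq_iff bm_axis_right M_unitl by (auto simp: axis_def)
  thus "u \<odot> x = x" by (rule linv_eqI[of "\<lambda>x. u \<odot> x" "\<lambda>x. x", rotated 2]) (intro lin_intros)+
  have "axis i 1 \<odot> u = axis i 1" for i
    unfolding vec_eq_iff bm_axis_left M_unitr by (auto simp: axis_def)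
  thus "x \<odot> u = x" by (rule linv_eqI[of "\<lambda>x. x \<odot> u" "\<lambda>x. x", rotated 2]) (intro lin_intros)+
qed

lemmas mul_simps = bm_add bm_diff bm_scale bm_minus mul_assoc

definition left_id :: "('k ^ 'i) set \<Rightarrow> bool" where
  "left_id I \<longleftrightarrow> vec.subspace I \<and> (\<forall>h. \<forall>x\<in>I. h \<odot> x \<in> I)"

text \<open>Besides idempotence this says that the left ideal generated by \<open>p\<close> is
  minimal: each of its nonzero elements generates \<open>p\<close> again.\<close>

definition prim :: "'k ^ 'i \<Rightarrow> bool" where
  "prim p \<longleftrightarrow> p \<odot> p = p \<and> p \<noteq> 0 \<and> (\<forall>x. x \<odot> p \<noteq> 0 \<longrightarrow> (\<exists>y. y \<odot> (x \<odot> p) = p))"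

lemma left_id_fix: "left_id {x. x \<odot> e = x}"
  by (auto simp: left_id_def vec.subspace_def mul_simps)

lemma left_id_range: "left_id (range (\<lambda>x. x \<odot> e))"
  unfolding left_id_def
proof (intro conjI)
  show "vec.subspace (range (\<lambda>x. x \<odot> e))"
    unfolding vec.subspace_def
  proof (intro conjI ballI allI)
    show "0 \<in> range (\<lambda>x. x \<odot> e)" by (rule image_eqI[of _ _ 0]) auto
  next
    fix x y assume "x \<in> range (\<lambda>x. x \<odot> e)" "y \<in> range (\<lambda>x. x \<odot> e)"
    thus "x + y \<in> range (\<lambda>x. x \<odot> e)" by (auto simp: bm_add(1)[symmetric])
  next
    fix x c assume "x \<in> range (\<lambda>x. x \<odot> e)"
    thus "c *s x \<in> range (\<lambda>x. x \<odot> e)" by (auto simp: bm_scale(1)[symmetric])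
  qed
  show "\<forall>h. \<forall>x\<in>range (\<lambda>x. x \<odot> e). h \<odot> x \<in> range (\<lambda>x. x \<odot> e)"
    by (auto simp: mul_assoc[symmetric])
qed

text \<open>Wedderburn's theorem as data: \<open>r\<close> sends a primitive idempotent to the
  representative of its simple block, \<open>E p q\<close> are the matrix units inside a block, and
  \<open>co p q\<close> reads off their coefficients. Pairs from different blocks are left
  unconstrained.\<close>

definition wed where
  "wed P r E co \<longleftrightarrow> finite P \<and> (\<forall>p\<in>P. r p \<in> P \<and> r (r p) = r p) \<and>
     (\<forall>p\<in>P. \<forall>q\<in>P. \<forall>s\<in>P. \<forall>t\<in>P. r p = r q \<longrightarrow> r s = r t \<longrightarrow>
        E p q \<odot> E s t = (if q = s then E p t else 0) \<and>
        co p q (E s t) = (if p = s \<and> q = t then 1 else 0)) \<and>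
     (\<forall>x. x = (\<Sum>(p,q)\<in>{(p,q). p \<in> P \<and> q \<in> P \<and> r p = r q}. co p q x *s E p q)) \<and>
     (\<forall>p\<in>P. \<forall>q\<in>P. r p = r q \<longrightarrow> lin (co p q)) \<and> (\<Sum>p\<in>P. E p p) = u"

end

text \<open>Semisimplicity in its idempotent form: every left ideal contains a right unit for
  itself. Maschke's averaging produces this element directly, without a complement.\<close>

locale ss_alg = fin_alg M u
  for M :: "'i::finite \<Rightarrow> 'i \<Rightarrow> 'i \<Rightarrow> 'k::{alg_closed_field,field_char_0}" and u :: "'k ^ 'i" +
  assumes ss: "left_id I \<Longrightarrow> \<exists>e\<in>I. \<forall>x\<in>I. x \<odot> e = x"
begin

text \<open>A left ideal of least dimension inside \<open>I\<close> has a right unit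
  \<open>f\<close> by \<open>ss\<close>. By minimality, every nonzero x f generates the whole ideal
  and so recovers \<open>f\<close>.\<close>

lemma prim_exists:
  assumes I: "left_id I" "x \<in> I" "x \<noteq> 0" shows "\<exists>f\<in>I. prim f"
proof -
  define Q where "Q L \<longleftrightarrow> left_id L \<and> L \<subseteq> I \<and> (\<exists>x\<in>L. x \<noteq> 0)" for L
  have "Q I" using I by (auto simp: Q_def)
  then obtain L where L: "Q L" "\<And>L'. Q L' \<Longrightarrow> vec.dim L \<le> vec.dim L'"
    using ex_has_least_nat[of Q I vec.dim] by auto
  obtain f where f: "f \<in> L" "\<And>x. x \<in> L \<Longrightarrow> x \<odot> f = x" using ss[of L] L(1) by (auto simp: Q_def)
  have "f \<noteq> 0" using f L(1) by (auto simp: Q_def)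
  moreover have "\<exists>y. y \<odot> (x \<odot> f) = f" if x: "x \<odot> f \<noteq> 0" for x
  proof -
    let ?L = "range (\<lambda>y. y \<odot> (x \<odot> f))"
    have sub: "?L \<subseteq> L" using L(1) f(1) by (auto simp: Q_def left_id_def)
    have "x \<odot> f \<in> ?L" by (rule image_eqI[of _ _ u]) auto
    hence "Q ?L" using L(1) sub x left_id_range[of "x \<odot> f"] unfolding Q_def by blast
    hence "vec.dim L \<le> vec.dim ?L" by (rule L(2))
    hence "?L = L" using L(1) left_id_range[of "x \<odot> f"] sub
      by (intro vec.subspace_dim_equal) (auto simp: Q_def left_id_def)
    hence "f \<in> ?L" using f(1) by simp
    then obtain y where "f = y \<odot> (x \<odot> f)" by (rule rangeE)
    thus ?thesis by (intro exI[of _ y]) simp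
  qed
  ultimately have "prim f" using f by (auto simp: prim_def)
  thus ?thesis using f(1) L(1) by (auto simp: Q_def)
qed

text \<open>Induction on the dimension of the left ideal of \<open>e\<close>: a primitive idempotent
  of the corner is split off, and its difference from \<open>e\<close> generates a smaller
  ideal.\<close>

lemma prim_dec:
  assumes "e \<odot> e = e"
  shows "\<exists>P. finite P \<and> (\<forall>p\<in>P. prim p) \<and> (\<forall>p\<in>P. \<forall>q\<in>P. p \<noteq> q \<longrightarrow> p \<odot> q = 0) \<and> \<Sum>P = e"
  using assms
proof (induction "vec.dim {x. x \<odot> e = x}" arbitrary: e rule: less_induct)
  case less
  note e = less.prems
  show ?case
  proof (cases "e = 0")
    case True thus ?thesis by (intro exI[of _ "{}"]) auto
  next
    case False
    then obtain f where fe: "f \<odot> e = f" and f: "prim f"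
      using prim_exists[OF left_id_fix[of e], of e] e by auto
    \<comment> \<open>\<open>f\<close> satisfies f e = f but possibly not e f = f. Multiplication by
      \<open>e\<close> on the left moves it into the corner of \<open>e\<close>, which makes e - f'
      an idempotent orthogonal to f'.\<close>
    define f' where "f' = e \<odot> f"
    have ff: "f \<odot> f = f" using f by (simp add: prim_def)
    have f'e: "f' \<odot> e = f'" and ef': "e \<odot> f' = f'" using fe e by (simp_all add: f'_def mul_assoc, simp add: mul_assoc[symmetric])
    have f'f': "f' \<odot> f' = f'" 
    proof -
      have "f' \<odot> f' = e \<odot> ((f \<odot> e) \<odot> f)" by (simp add: f'_def mul_assoc)
      thus ?thesis by (simp add: fe ff f'_def)
    qed
    have "f \<odot> f' = f" using fe ff by (simp add: f'_def mul_assoc[symmetric])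
    hence f'0: "f' \<noteq> 0" using f by (auto simp: prim_def)
    have pf': "prim f'" unfolding prim_def
    proof (intro conjI allI impI f'f' f'0)
      fix x assume "x \<odot> f' \<noteq> 0"
      hence "(x \<odot> e) \<odot> f \<noteq> 0" by (simp add: f'_def mul_assoc)
      then obtain y where "y \<odot> (x \<odot> e \<odot> f) = f" using f by (auto simp: prim_def)
      hence "(e \<odot> y) \<odot> (x \<odot> f') = f'" by (simp add: f'_def mul_assoc)
      thus "\<exists>y. y \<odot> (x \<odot> f') = f'" by blast
    qed
    define e' where "e' = e - f'"
    have e'e': "e' \<odot> e' = e'" using e f'f' f'e ef' by (simp add: e'_def mul_simps)
    have f'e': "f' \<odot> e' = 0" "e' \<odot> f' = 0" using f'f' f'e ef' by (simp_all add: e'_def mul_simps)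
    have sub: "x \<odot> e = x" if "x \<odot> e' = x" for x
    proof -
      have "x \<odot> e = x \<odot> (e' \<odot> e)" using that by (simp add: mul_assoc[symmetric])
      also have "e' \<odot> e = e'" using e f'e by (simp add: e'_def mul_simps)
      finally show ?thesis using that by simp
    qed
    have s: "vec.span {x. x \<odot> d = x} = {x. x \<odot> d = x}" for d
      using left_id_fix[of d] by (intro vec.span_eq_iff[THEN iffD2]) (simp add: left_id_def)
    have "vec.dim {x. x \<odot> e' = x} < vec.dim {x. x \<odot> e = x}"
    proof (rule vec.dim_psubset, unfold s, rule psubsetI)
      show "{x. x \<odot> e' = x} \<subseteq> {x. x \<odot> e = x}" using sub by auto
      show "{x. x \<odot> e' = x} \<noteq> {x. x \<odot> e = x}" 
      proof -
        have "f' \<in> {x. x \<odot> e = x}" "f' \<notin> {x. x \<odot> e' = x}" using f'e f'e' f'0 by auto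
        thus ?thesis by blast
      qed
    qed
    from less.hyps[OF this e'e'] obtain P where
      P: "finite P" "\<forall>p\<in>P. prim p" "\<forall>p\<in>P. \<forall>q\<in>P. p \<noteq> q \<longrightarrow> p \<odot> q = 0" "\<Sum>P = e'" by blast
    have "p \<odot> f' = 0 \<and> f' \<odot> p = 0" if p: "p \<in> P" for p
    proof -
      have "p \<odot> e' = (\<Sum>q\<in>P. if q = p then p else 0)"
        unfolding P(4)[symmetric] bm_sum using P p by (intro sum.cong) (auto simp: prim_def)
      hence 1: "p \<odot> e' = p" using P(1) p by simp
      have "e' \<odot> p = (\<Sum>q\<in>P. if q = p then p else 0)"
        unfolding P(4)[symmetric] bm_sum using P p by (intro sum.cong) (auto simp: prim_def)
      hence 2: "e' \<odot> p = p" using P(1) p by simp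
      have "p \<odot> f' = p \<odot> (e' \<odot> f')" "f' \<odot> p = (f' \<odot> e') \<odot> p" 
        using 1 2 by (simp_all add: mul_assoc, simp add: mul_assoc[symmetric])
      thus ?thesis by (simp add: f'e')
    qed
    moreover have "f' \<notin> P" using calculation f'f' f'0 by fastforce
    ultimately show ?thesis using P pf' 
      by (intro exI[of _ "insert f' P"]) (auto simp: e'_def)
  qed
qed

text \<open>Schur's lemma over an algebraically closed field: right multiplication by p x p on the
  corner of \<open>p\<close> has an eigenvector, and primitivity turns this eigenvector back into
  \<open>p\<close>.\<close>

lemma prim_corner:
  assumes p: "prim p" shows "\<exists>c. p \<odot> x \<odot> p = c *s p"
proof -
  have pp: "p \<odot> p = p" using p by (simp add: prim_def)
  define y where "y = p \<odot> x \<odot> p"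
  define V where "V = {z. p \<odot> z = z \<and> z \<odot> p = z}"
  have "\<exists>w\<in>V. w \<noteq> 0 \<and> (\<exists>c. w \<odot> y = c *s w)"
  proof (rule eigenvector_exists)
    show "linv (\<lambda>z. z \<odot> y)" by (intro lin_intros)
    show "vec.subspace V" by (auto simp: V_def vec.subspace_def mul_simps)
    show "z \<odot> y \<in> V" if "z \<in> V" for z
    proof -
      have "p \<odot> (z \<odot> y) = (p \<odot> z) \<odot> y" by (simp add: mul_assoc)
      moreover have "(z \<odot> y) \<odot> p = z \<odot> y" by (simp add: y_def mul_assoc pp)
      ultimately show ?thesis using that by (simp add: V_def)
    qed
    show "p \<in> V" "p \<noteq> 0" using p by (auto simp: V_def prim_def)
  qed
  then obtain w c where w: "w \<odot> p = w" "w \<noteq> 0" "w \<odot> y = c *s w" by (auto simp: V_def)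
  then obtain z where "z \<odot> w = p" using p unfolding prim_def by metis
  hence "p \<odot> y = c *s p" using w(3) mul_assoc[of z w y] by (simp add: bm_scale)
  moreover have "p \<odot> y = y" by (simp add: y_def pp mul_assoc[symmetric])
  ultimately have "y = c *s p" by simp
  thus ?thesis unfolding y_def by blast
qed

text \<open>Primitivity of \<open>q\<close> gives a left inverse b. The product a b lies in the
  corner of \<open>p\<close>, so it is a multiple c p; it is idempotent and nonzero, which leaves c
  = 1.\<close>

lemma prim_inverse:
  assumes p: "prim p" and q: "prim q" and a: "p \<odot> x \<odot> q \<noteq> 0"
  shows "\<exists>b. b \<odot> (p \<odot> x \<odot> q) = q \<and> (p \<odot> x \<odot> q) \<odot> b = p \<and> q \<odot> b = b \<and> b \<odot> p = b"
proof -
  have pp: "p \<odot> p = p" and qq: "q \<odot> q = q" and q0: "q \<noteq> 0" using p q by (auto simp: prim_def)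
  define a where "a = p \<odot> x \<odot> q"
  have a1: "p \<odot> a = a" "a \<odot> q = a" by (simp_all add: a_def mul_assoc qq) (simp add: mul_assoc[symmetric] pp)
  obtain y where y: "y \<odot> a = q" using q a by (auto simp: prim_def a_def)
  define b where "b = q \<odot> y \<odot> p"
  have b1: "q \<odot> b = b" "b \<odot> p = b" by (simp_all add: b_def mul_assoc pp) (simp add: mul_assoc[symmetric] qq)
  have ba: "b \<odot> a = q" using y a1 qq by (simp add: b_def mul_assoc)
  have "\<exists>c. p \<odot> (a \<odot> b) \<odot> p = c *s p" by (rule prim_corner[OF p])
  moreover have "p \<odot> (a \<odot> b) \<odot> p = a \<odot> b" using b1 by (simp add: mul_assoc) (simp add: a1 mul_assoc[symmetric])
  ultimately obtain c where c: "a \<odot> b = c *s p" by auto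
  have "a \<odot> b \<odot> (a \<odot> b) = a \<odot> (b \<odot> a) \<odot> b" by (simp add: mul_assoc)
  hence "(c * c) *s p = c *s p" using a1 by (simp add: ba c bm_scale pp)
  hence "c = 0 \<or> c = 1" using p by (auto simp: prim_def)
  moreover have "c \<noteq> 0"
  proof
    assume "c = 0"
    hence "b \<odot> (a \<odot> b) \<odot> a = 0" by (simp add: c)
    moreover have "b \<odot> (a \<odot> b) \<odot> a = (b \<odot> a) \<odot> (b \<odot> a)" by (simp add: mul_assoc)
    ultimately show False using q0 by (simp add: ba qq)
  qed
  ultimately have "a \<odot> b = p" using c by simp
  thus ?thesis using ba b1 unfolding a_def by blast
qed

text \<open>\<open>rel p q\<close> says that the left ideals of \<open>p\<close> and
  \<open>q\<close> are isomorphic modules. For each \<open>p\<close>, mutually inverse elements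
  \<open>A p\<close> and \<open>B p\<close> connect it with the representative of its class, and the
  products of \<open>A p\<close> with \<open>B q\<close> are the matrix units.\<close>

theorem wedderburn: "\<exists>P r E co. wed (P :: ('k ^ 'i) set) r E co"
proof -
  obtain P where P: "finite P" "\<And>p. p \<in> P \<Longrightarrow> prim p" "\<And>p q. p \<in> P \<Longrightarrow> q \<in> P \<Longrightarrow> p \<noteq> q \<Longrightarrow> p \<odot> q = 0" "\<Sum>P = u"
    using prim_dec[of u] by auto
  have pp: "p \<odot> p = p" and p0: "p \<noteq> 0" if "p \<in> P" for p using P(2)[OF that] by (auto simp: prim_def)
  define rel where "rel p q \<longleftrightarrow> (\<exists>x. p \<odot> x \<odot> q \<noteq> 0)" for p q
  have refl: "rel p p" if "p \<in> P" for p
    unfolding rel_def by (rule exI[of _ u]) (use that pp p0 in auto)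
  have inv: "\<exists>a b. b \<odot> a = q \<and> a \<odot> b = p \<and> p \<odot> a = a \<and> a \<odot> q = a \<and> q \<odot> b = b \<and> b \<odot> p = b" 
    if pq: "p \<in> P" "q \<in> P" "rel p q" for p q
  proof -
    obtain x where "p \<odot> x \<odot> q \<noteq> 0" using pq(3) unfolding rel_def by blast
    then obtain b where b: "b \<odot> (p \<odot> x \<odot> q) = q \<and> (p \<odot> x \<odot> q) \<odot> b = p \<and> q \<odot> b = b \<and> b \<odot> p = b"
      using prim_inverse P(2) pq by metis
    have "p \<odot> (p \<odot> x \<odot> q) = p \<odot> x \<odot> q" "p \<odot> x \<odot> q \<odot> q = p \<odot> x \<odot> q"
      using pp[OF pq(1)] pp[OF pq(2)] by (simp_all add: mul_assoc, simp add: mul_assoc[symmetric])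
    thus ?thesis using b by blast
  qed
  have sym: "rel q p" if pq: "p \<in> P" "q \<in> P" "rel p q" for p q
  proof -
    obtain a b where "b \<odot> a = q" "q \<odot> b = b" "b \<odot> p = b" using inv[OF pq] by blast
    hence "q \<odot> b \<odot> p \<noteq> 0" using p0[OF pq(2)] by auto
    thus ?thesis by (auto simp: rel_def)
  qed
  have trans: "rel p s" if pqs: "p \<in> P" "q \<in> P" "s \<in> P" "rel p q" "rel q s" for p q s
  proof -
    obtain a b where ab: "b \<odot> a = q" "p \<odot> a = a" "a \<odot> q = a" using inv[OF pqs(1,2,4)] by blast
    obtain x where x: "q \<odot> x \<odot> s \<noteq> 0" using pqs by (auto simp: rel_def)
    have "b \<odot> (p \<odot> (a \<odot> x) \<odot> s) = b \<odot> ((p \<odot> a) \<odot> x \<odot> s)" by (simp add: mul_assoc)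
    also have "\<dots> = q \<odot> x \<odot> s" by (simp add: ab mul_assoc[symmetric])
    finally have "p \<odot> (a \<odot> x) \<odot> s \<noteq> 0" using x by auto
    thus ?thesis unfolding rel_def by blast
  qed
  \<comment> \<open>The choice depends on \<open>p\<close> only through the predicate, so equivalent
    idempotents get the same representative.\<close>
  define r where "r p = (SOME q. q \<in> P \<and> rel p q)" for p
  have r: "r p \<in> P" "rel p (r p)" if "p \<in> P" for p
    using someI_ex[of "\<lambda>q. q \<in> P \<and> rel p q"] refl[OF that] that unfolding r_def by blast+
  have req: "r p = r q \<longleftrightarrow> rel p q" if pq: "p \<in> P" "q \<in> P" for p q
  proof
    assume "r p = r q"
    thus "rel p q" using r[OF pq(1)] r[OF pq(2)] sym trans pq by metis
  next
    assume "rel p q"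
    hence "(\<lambda>s. s \<in> P \<and> rel p s) = (\<lambda>s. s \<in> P \<and> rel q s)" using sym trans pq by blast
    thus "r p = r q" unfolding r_def by simp
  qed
  have "\<forall>p\<in>P. \<exists>ab. snd ab \<odot> fst ab = r p \<and> fst ab \<odot> snd ab = p \<and> p \<odot> fst ab = fst ab \<and> fst ab \<odot> r p = fst ab 
        \<and> r p \<odot> snd ab = snd ab \<and> snd ab \<odot> p = snd ab"
    using inv r by fastforce
  then obtain ab where ab: "\<And>p. p \<in> P \<Longrightarrow> snd (ab p) \<odot> fst (ab p) = r p \<and> fst (ab p) \<odot> snd (ab p) = p 
        \<and> p \<odot> fst (ab p) = fst (ab p) \<and> fst (ab p) \<odot> r p = fst (ab p)
        \<and> r p \<odot> snd (ab p) = snd (ab p) \<and> snd (ab p) \<odot> p = snd (ab p)" by metis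
  define A B where "A p = fst (ab p)" and "B p = snd (ab p)" for p
  have AB: "B p \<odot> A p = r p" "A p \<odot> B p = p" "p \<odot> A p = A p" "A p \<odot> r p = A p" "r p \<odot> B p = B p" "B p \<odot> p = B p"
    if "p \<in> P" for p using ab[OF that] by (auto simp: A_def B_def)
  define E where "E p q = A p \<odot> B q" for p q
  have BA: "B q \<odot> A s = (if q = s then r q else 0)" if "q \<in> P" "s \<in> P" for q s
  proof (cases "q = s")
    case False
    have "B q \<odot> A s = (B q \<odot> q) \<odot> (s \<odot> A s)" using AB that by simp
    also have "\<dots> = B q \<odot> (q \<odot> s) \<odot> A s" by (simp add: mul_assoc)
    also have "\<dots> = 0" using P(3)[OF that False] by simp
    finally show ?thesis using False by simp
  qed (use AB that in auto)
  have EE: "E p q \<odot> E s t = (if q = s then E p t else 0)"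
    if h: "p \<in> P" "q \<in> P" "s \<in> P" "t \<in> P" "r p = r q" "r s = r t" for p q s t
  proof -
    have "E p q \<odot> E s t = A p \<odot> (B q \<odot> A s) \<odot> B t" by (simp add: E_def mul_assoc)
    also have "\<dots> = (if q = s then E p t else 0)" using h AB[OF h(4)] by (simp add: BA[OF h(2,3)] E_def mul_assoc)
    finally show ?thesis .
  qed
  have Enz: "E p q \<noteq> 0" if h: "p \<in> P" "q \<in> P" "r p = r q" for p q
    using EE[OF h(1,2,2,1) h(3) h(3)[symmetric]] p0[OF h(1)] AB(2)[OF h(1)] by (auto simp: E_def)
  \<comment> \<open>The element p x q is transported to the corner of the representative, where
    Schur's lemma makes it a scalar.\<close>
  have cex: "\<exists>c. p \<odot> x \<odot> q = c *s E p q" if h: "p \<in> P" "q \<in> P" "r p = r q" for p q x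
  proof -
    have "p \<odot> x \<odot> q = A p \<odot> (B p \<odot> x \<odot> A q) \<odot> B q" using AB(2)[OF h(1)] AB(2)[OF h(2)]
      by (simp add: mul_assoc) (simp add: mul_assoc[symmetric])
    also have "\<dots> = A p \<odot> (r p \<odot> (B p \<odot> x \<odot> A q) \<odot> r p) \<odot> B q"
      using AB(4)[OF h(1)] AB(5)[OF h(2)] h by (simp add: mul_assoc) (simp add: mul_assoc[symmetric])
    finally have 1: "p \<odot> x \<odot> q = A p \<odot> (r p \<odot> (B p \<odot> x \<odot> A q) \<odot> r p) \<odot> B q" .
    obtain c where "r p \<odot> (B p \<odot> x \<odot> A q) \<odot> r p = c *s r p" using prim_corner P(2) r(1)[OF h(1)] by blast
    thus ?thesis using 1 AB(4)[OF h(1)] by (auto simp: bm_scale E_def)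
  qed
  define co where "co p q x = (THE c. p \<odot> x \<odot> q = c *s E p q)" for p q x
  have co: "p \<odot> x \<odot> q = co p q x *s E p q" if h: "p \<in> P" "q \<in> P" "r p = r q" for p q x
  proof -
    have "\<exists>!c. p \<odot> x \<odot> q = c *s E p q" using cex[OF h, of x] Enz[OF h] by auto
    from theI'[OF this] show ?thesis by (simp add: co_def)
  qed
  have coI: "co p q x = c" if h: "p \<in> P" "q \<in> P" "r p = r q" and "p \<odot> x \<odot> q = c *s E p q" for p q x c
    using co[OF h, of x] that(4) Enz[OF h] by simp
  have "lin (co p q)" if h: "p \<in> P" "q \<in> P" "r p = r q" for p q
    unfolding lin_def
    by (intro conjI allI; rule coI[OF h]) (simp_all add: bm_add bm_scale co[OF h] vec.scale_left_distrib)
  moreover have "x = (\<Sum>(p,q)\<in>{(p,q). p \<in> P \<and> q \<in> P \<and> r p = r q}. co p q x *s E p q)" for x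
  proof -
    have "x = u \<odot> x \<odot> u" by simp
    also have "\<dots> = (\<Sum>p\<in>P. \<Sum>q\<in>P. p \<odot> x \<odot> q)"
      unfolding P(4)[symmetric] by (subst sum.swap) (simp add: bm_sum)
    also have "\<dots> = (\<Sum>(p,q)\<in>P \<times> P. p \<odot> x \<odot> q)" by (simp add: sum.cartesian_product)
    also have "\<dots> = (\<Sum>(p,q)\<in>{(p,q). p \<in> P \<and> q \<in> P \<and> r p = r q}. p \<odot> x \<odot> q)"
      using P(1) by (intro sum.mono_neutral_right) (auto simp: req rel_def)
    also have "\<dots> = (\<Sum>(p,q)\<in>{(p,q). p \<in> P \<and> q \<in> P \<and> r p = r q}. co p q x *s E p q)"
      by (intro sum.cong) (auto simp: co)
    finally show ?thesis .
  qed
  moreover have "(\<Sum>p\<in>P. E p p) = u" using AB P(4) by (simp add: E_def)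
  moreover have "r (r p) = r p" if "p \<in> P" for p
    using req[OF r(1)[OF that] that] sym r that by blast
  moreover have "co p q (E s t) = (if p = s \<and> q = t then 1 else 0)"
    if h: "p \<in> P" "q \<in> P" "s \<in> P" "t \<in> P" "r p = r q" "r s = r t" for p q s t
  proof (rule coI[OF h(1,2,5)])
    have "p \<odot> E s t \<odot> q = E p p \<odot> E s t \<odot> E q q" using AB h by (simp add: E_def)
    thus "p \<odot> E s t \<odot> q = (if p = s \<and> q = t then 1 else 0) *s E p q"
      using EE h by simp
  qed
  ultimately have "wed P r E co" unfolding wed_def using P(1) r(1) EE by (simp add: split_beta)
  thus ?thesis by blast
qed

end

section \<open>Hopf algebras by structure constants\<close>

lemma bil1: "bil F \<Longrightarrow> linv T \<Longrightarrow> lin (\<lambda>x. F (T x) y)"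
  by (rule lin_comp) (auto simp: bil_def)

lemma bil2: "bil F \<Longrightarrow> linv T \<Longrightarrow> lin (\<lambda>x. F y (T x))"
  by (rule lin_comp[of "F y"]) (auto simp: bil_def)

lemma bil_prod: "lin f \<Longrightarrow> lin g \<Longrightarrow> bil (\<lambda>a b. f a * g b)"
  by (intro bilI lin_const_mult)

lemma ant_axis: "ant S (axis i 1) $ r = S i r"
  by (simp add: ant_def axis_def delta_mult)

text \<open>The basis vectors satisfy \<open>b\<^sub>i b\<^sub>j = \<Sum>\<^sub>l M i j l b\<^sub>l\<close> and \<open>\<Delta> b\<^sub>l = \<Sum>\<^sub>i\<^sub>j D i j l b\<^sub>i \<otimes> b\<^sub>j\<close>; the
  dual Hopf algebra has the roles of \<open>M\<close> and \<open>D\<close> exchanged. An element of the dual is also written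
  as a coordinate vector.\<close>

locale fin_hopf = fin_alg M u
  for M :: "'i::finite \<Rightarrow> 'i \<Rightarrow> 'i \<Rightarrow> 'k::{alg_closed_field,field_char_0}" and u :: "'k ^ 'i" +
  fixes D :: "'i \<Rightarrow> 'i \<Rightarrow> 'i \<Rightarrow> 'k" and e :: "'k ^ 'i" and S :: "'i \<Rightarrow> 'i \<Rightarrow> 'k"
  assumes C: "fin_alg D e"
    and bialg: "(\<Sum>l\<in>UNIV. M i j l * D p q l) =
      (\<Sum>a\<in>UNIV. \<Sum>b\<in>UNIV. \<Sum>c\<in>UNIV. \<Sum>d\<in>UNIV. D a b i * D c d j * (M a c p * M b d q))"
    and counit_mult: "(\<Sum>l\<in>UNIV. M i j l * e $ l) = e $ i * e $ j"
    and comult_unit: "(\<Sum>l\<in>UNIV. D p q l * u $ l) = u $ p * u $ q"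
    and counit_unit: "e \<cdot> u = 1"
    and antl: "(\<Sum>p\<in>UNIV. \<Sum>q\<in>UNIV. \<Sum>r\<in>UNIV. D p q i * S p r * M r q l) = e $ i * u $ l"
    and antr: "(\<Sum>p\<in>UNIV. \<Sum>q\<in>UNIV. \<Sum>r\<in>UNIV. D p q i * S q r * M p r l) = e $ i * u $ l"
begin

abbreviation cmul (infixl "\<star>" 75) where "f \<star> g \<equiv> bm D f g"
abbreviation sw where "sw \<equiv> cop D"
abbreviation S' where "S' \<equiv> (\<lambda>i j. S j i)"

lemmas cmul_assoc = fin_alg.mul_assoc[OF C] and cmul_1 [simp] = fin_alg.mul_1[OF C]

text \<open>The axioms are symmetric under the exchange of product and coproduct; only the order of
  the finite sums changes. Every result of this locale thereby holds for the dual as well.\<close>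

lemma dual: "fin_hopf D e M u S'"
proof (intro fin_hopf.intro C fin_hopf_axioms.intro fin_alg_axioms)
  fix i j p q
  have "(\<Sum>l\<in>UNIV. D i j l * M p q l) = (\<Sum>l\<in>UNIV. M p q l * D i j l)" by (simp add: mult.commute)
  also have "\<dots> = (\<Sum>a\<in>UNIV. \<Sum>c\<in>UNIV. \<Sum>b\<in>UNIV. \<Sum>d\<in>UNIV. D a c p * D b d q * (M a b i * M c d j))" by (rule bialg)
  also have "\<dots> = (\<Sum>a\<in>UNIV. \<Sum>b\<in>UNIV. \<Sum>c\<in>UNIV. \<Sum>d\<in>UNIV. M a b i * M c d j * (D a c p * D b d q))"
    by (rule sum.cong[OF refl], subst sum.swap) (simp add: mult.commute)
  finally show "(\<Sum>l\<in>UNIV. D i j l * M p q l) = (\<Sum>a\<in>UNIV. \<Sum>b\<in>UNIV. \<Sum>c\<in>UNIV. \<Sum>d\<in>UNIV. M a b i * M c d j * (D a c p * D b d q))" .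
next
  fix i l
  have "(\<Sum>p\<in>UNIV. \<Sum>q\<in>UNIV. \<Sum>r\<in>UNIV. M p q i * S r p * D r q l) = (\<Sum>r\<in>UNIV. \<Sum>q\<in>UNIV. \<Sum>p\<in>UNIV. D r q l * S r p * M p q i)"
    by (subst sum.swap, subst (2) sum.swap, subst sum.swap) (simp add: algebra_simps)
  thus "(\<Sum>p\<in>UNIV. \<Sum>q\<in>UNIV. \<Sum>r\<in>UNIV. M p q i * S r p * D r q l) = u $ i * e $ l" by (simp add: antl)
next
  fix i l
  have "(\<Sum>p\<in>UNIV. \<Sum>q\<in>UNIV. \<Sum>r\<in>UNIV. M p q i * S r q * D p r l) = (\<Sum>p\<in>UNIV. \<Sum>r\<in>UNIV. \<Sum>q\<in>UNIV. D p r l * S r q * M p q i)"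
    by (subst (2) sum.swap) (simp add: algebra_simps)
  thus "(\<Sum>p\<in>UNIV. \<Sum>q\<in>UNIV. \<Sum>r\<in>UNIV. M p q i * S r q * D p r l) = u $ i * e $ l" by (simp add: antr)
qed (use comult_unit counit_mult counit_unit in \<open>simp_all add: pr_comm\<close>)

lemma sw_mul:
  assumes F: "bil F" shows "sw F (x \<odot> y) = sw (\<lambda>a b. sw (\<lambda>c d. F (a \<odot> c) (b \<odot> d)) y) x"
proof -
  have 0: "sw F (axis i 1 \<odot> axis j 1) = sw (\<lambda>a b. sw (\<lambda>c d. F (a \<odot> c) (b \<odot> d)) (axis j 1)) (axis i 1)" for i j
  proof -
    let ?F = "\<lambda>p q. F (axis p 1) (axis q 1)"
    have "sw F (axis i 1 \<odot> axis j 1) = (\<Sum>l\<in>UNIV. \<Sum>p\<in>UNIV. \<Sum>q\<in>UNIV. M i j l * D p q l * ?F p q)"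
      by (simp add: cop_def bm_axis)
    also have "\<dots> = (\<Sum>p\<in>UNIV. \<Sum>q\<in>UNIV. (\<Sum>l\<in>UNIV. M i j l * D p q l) * ?F p q)"
      by (subst sum.swap, rule sum.cong[OF refl], subst sum.swap) (simp add: sum_distrib_right)
    also have "\<dots> = (\<Sum>(p,q)\<in>UNIV. \<Sum>(a,b,c,d)\<in>UNIV. D a b i * D c d j * (M a c p * M b d q * ?F p q))"
      by (simp add: bialg sum.cartesian_product' sum_distrib_right UNIV_Times_UNIV[symmetric] mult.assoc del: UNIV_Times_UNIV)
    also have "\<dots> = (\<Sum>(a,b,c,d)\<in>UNIV. \<Sum>(p,q)\<in>UNIV. D a b i * D c d j * (M a c p * M b d q * ?F p q))"
      by (simp add: split_beta) (rule sum.swap)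
    also have "\<dots> = (\<Sum>a\<in>UNIV. \<Sum>b\<in>UNIV. \<Sum>c\<in>UNIV. \<Sum>d\<in>UNIV. D a b i * D c d j * (\<Sum>p\<in>UNIV. \<Sum>q\<in>UNIV. M a c p * M b d q * ?F p q))"
      by (simp add: sum.cartesian_product' sum_distrib_left UNIV_Times_UNIV[symmetric] split_beta del: UNIV_Times_UNIV)
    also have "\<dots> = sw (\<lambda>a b. sw (\<lambda>c d. F (a \<odot> c) (b \<odot> d)) (axis j 1)) (axis i 1)"
      by (simp add: cop_axis bil_basis[OF F, of "axis _ 1 \<odot> axis _ 1"] bm_axis sum_distrib_left mult.assoc)
    finally show ?thesis .
  qed
  have "sw F (axis i 1 \<odot> y) = sw (\<lambda>a b. sw (\<lambda>c d. F (a \<odot> c) (b \<odot> d)) y) (axis i 1)" for i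
    using 0 by (rule lin_eqI[of "\<lambda>y. sw F (axis i 1 \<odot> y)" "\<lambda>y. sw (\<lambda>a b. sw (\<lambda>c d. F (a \<odot> c) (b \<odot> d)) y) (axis i 1)", rotated 2])
      (intro lin_intros)+
  thus ?thesis
    by (rule lin_eqI[of "\<lambda>x. sw F (x \<odot> y)" "\<lambda>x. sw (\<lambda>a b. sw (\<lambda>c d. F (a \<odot> c) (b \<odot> d)) y) x", rotated 2]) (intro lin_intros lin_cop)+
qed

lemma coassoc: "sw (\<lambda>a b. sw (\<lambda>c d. F c d b) a) x = sw (\<lambda>a b. sw (\<lambda>c d. F a c d) b) x"
proof (rule lin_eqI[OF lin_cop lin_cop])
  fix l
  let ?F = "\<lambda>p q r. F (axis p 1) (axis q 1) (axis r 1)"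
  have "sw (\<lambda>a b. sw (\<lambda>c d. F c d b) a) (axis l 1) = (\<Sum>i\<in>UNIV. \<Sum>r\<in>UNIV. \<Sum>(p,q)\<in>UNIV. D p q i * D i r l * ?F p q r)"
    by (simp add: cop_axis sum_distrib_left sum.cartesian_product' UNIV_Times_UNIV[symmetric] mult_ac split_beta del: UNIV_Times_UNIV)
  also have "\<dots> = (\<Sum>r\<in>UNIV. \<Sum>(p,q)\<in>UNIV. \<Sum>i\<in>UNIV. D p q i * D i r l * ?F p q r)"
    by (subst sum.swap, rule sum.cong[OF refl], subst sum.swap) (simp add: split_beta)
  also have "\<dots> = (\<Sum>r\<in>UNIV. \<Sum>(p,q)\<in>UNIV. (\<Sum>i\<in>UNIV. D q r i * D p i l) * ?F p q r)"
    by (simp add: fin_alg.M_assoc[OF C, symmetric] sum_distrib_right split_beta)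
  also have "\<dots> = (\<Sum>r\<in>UNIV. \<Sum>p\<in>UNIV. \<Sum>q\<in>UNIV. \<Sum>i\<in>UNIV. D q r i * D p i l * ?F p q r)"
    by (simp add: sum.cartesian_product' UNIV_Times_UNIV[symmetric] sum_distrib_right del: UNIV_Times_UNIV)
  also have "\<dots> = (\<Sum>p\<in>UNIV. \<Sum>r\<in>UNIV. \<Sum>i\<in>UNIV. \<Sum>q\<in>UNIV. D q r i * D p i l * ?F p q r)"
    by (subst sum.swap, rule sum.cong[OF refl], rule sum.cong[OF refl], rule sum.swap)
  also have "\<dots> = (\<Sum>p\<in>UNIV. \<Sum>i\<in>UNIV. \<Sum>r\<in>UNIV. \<Sum>q\<in>UNIV. D q r i * D p i l * ?F p q r)"
    by (rule sum.cong[OF refl], rule sum.swap)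
  also have "\<dots> = (\<Sum>p\<in>UNIV. \<Sum>i\<in>UNIV. \<Sum>q\<in>UNIV. \<Sum>r\<in>UNIV. D q r i * D p i l * ?F p q r)"
    by (rule sum.cong[OF refl], rule sum.cong[OF refl], rule sum.swap)
  also have "\<dots> = sw (\<lambda>a b. sw (\<lambda>c d. F a c d) b) (axis l 1)"
    by (simp add: cop_axis sum_distrib_left algebra_simps)
  finally show "sw (\<lambda>a b. sw (\<lambda>c d. F c d b) a) (axis l 1) = sw (\<lambda>a b. sw (\<lambda>c d. F a c d) b) (axis l 1)" .
qed

lemma sw_counit: "lin f \<Longrightarrow> sw (\<lambda>a b. e \<cdot> a * f b) x = f x" "lin f \<Longrightarrow> sw (\<lambda>a b. f a * e \<cdot> b) x = f x"
  using pr_bm[of D e "vof f" x] pr_bm[of D "vof f" e x] by (simp_all add: vof_pr)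

lemma sw_antl: assumes "lin f" shows "sw (\<lambda>a b. f (ant S a \<odot> b)) x = e \<cdot> x * f u"
proof -
  have "sw (\<lambda>a b. f (ant S a \<odot> b)) (axis l 1) = e \<cdot> axis l 1 * f u" for l
  proof -
    have 1: "f (ant S (axis i 1) \<odot> axis j 1) = (\<Sum>m\<in>UNIV. \<Sum>r\<in>UNIV. S i r * M r j m * f (axis m 1))" for i j
      by (subst lin_basis[OF assms]) (simp add: bm_axis_right ant_axis sum_distrib_right)
    have "sw (\<lambda>a b. f (ant S a \<odot> b)) (axis l 1) 
        = (\<Sum>m\<in>UNIV. (\<Sum>i\<in>UNIV. \<Sum>j\<in>UNIV. \<Sum>r\<in>UNIV. D i j l * S i r * M r j m) * f (axis m 1))"
      unfolding cop_axis 1 sum_distrib_left sum_distrib_right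
      by (subst (2) sum.swap, subst sum.swap) (simp add: mult.assoc)
    also have "\<dots> = e $ l * f u" unfolding antl by (simp add: lin_basis[OF assms, of u] sum_distrib_left mult.assoc)
    finally show ?thesis by simp
  qed
  thus ?thesis by (rule lin_eqI[of _ "\<lambda>x. e \<cdot> x * f u", rotated 2]) (intro lin_cop lin_intros)+
qed

lemma sw_antr: assumes "lin f" shows "sw (\<lambda>a b. f (a \<odot> ant S b)) x = e \<cdot> x * f u"
proof -
  have "sw (\<lambda>a b. f (a \<odot> ant S b)) (axis l 1) = e \<cdot> axis l 1 * f u" for l
  proof -
    have 1: "f (axis i 1 \<odot> ant S (axis j 1)) = (\<Sum>m\<in>UNIV. \<Sum>r\<in>UNIV. S j r * M i r m * f (axis m 1))" for i j
      by (subst lin_basis[OF assms]) (simp add: bm_axis_left ant_axis sum_distrib_right)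
    have "sw (\<lambda>a b. f (a \<odot> ant S b)) (axis l 1) 
        = (\<Sum>m\<in>UNIV. (\<Sum>i\<in>UNIV. \<Sum>j\<in>UNIV. \<Sum>r\<in>UNIV. D i j l * S j r * M i r m) * f (axis m 1))"
      unfolding cop_axis 1 sum_distrib_left sum_distrib_right
      by (subst (2) sum.swap, subst sum.swap) (simp add: mult.assoc)
    also have "\<dots> = e $ l * f u" unfolding antr by (simp add: lin_basis[OF assms, of u] sum_distrib_left mult.assoc)
    finally show ?thesis by simp
  qed
  thus ?thesis by (rule lin_eqI[of _ "\<lambda>x. e \<cdot> x * f u", rotated 2]) (intro lin_cop lin_intros)+
qed

lemma counit_mul [simp]: "e \<cdot> (x \<odot> y) = e \<cdot> x * e \<cdot> y"
proof -
  have 0: "e \<cdot> (axis i 1 \<odot> axis j 1) = e $ i * e $ j" for i j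
    by (simp add: pr_def bm_axis counit_mult[symmetric] mult.commute)
  have "bil (\<lambda>x y. e \<cdot> (x \<odot> y))" "bil (\<lambda>x y. e \<cdot> x * e \<cdot> y)" by (intro bilI lin_intros)+
  from bil_basis[OF this(1), of x y] bil_basis[OF this(2), of x y] show ?thesis by (simp add: 0)
qed

lemma sw_unit: assumes F: "bil F" shows "sw F u = F u u"
proof -
  have "sw F u = (\<Sum>p\<in>UNIV. \<Sum>q\<in>UNIV. (\<Sum>l\<in>UNIV. D p q l * u $ l) * F (axis p 1) (axis q 1))"
    unfolding cop_def sum_distrib_right by (subst sum.swap, subst (2) sum.swap) (simp add: mult.commute)
  thus ?thesis by (simp add: comult_unit bil_basis[OF F, of u u])
qed

lemma pr_u_cmul [simp]: "(f \<star> g) \<cdot> u = f \<cdot> u * g \<cdot> u"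
  unfolding pr_bm by (rule sw_unit) (intro bilI lin_intros)

text \<open>With three-fold coproducts of both arguments, S(p) S(a) b q S(c r) is contracted in two
  ways. Cancelling S(a) b and then S(p) q leaves S(x y); cancelling b q against S(c r) leaves S(y)
  S(x).\<close>

lemma ant_mul: "ant S (x \<odot> y) = ant S y \<odot> ant S x"
proof (rule pr_eqI)
  fix f
  let ?T = "\<lambda>a b c p q r. f \<cdot> (ant S p \<odot> ant S a \<odot> b \<odot> q \<odot> ant S (c \<odot> r))"
  have "sw (\<lambda>a w. sw (\<lambda>b c. sw (\<lambda>p z. sw (\<lambda>q r. ?T a b c p q r) z) y) w) x
     = sw (\<lambda>w c. sw (\<lambda>a b. sw (\<lambda>p z. sw (\<lambda>q r. ?T a b c p q r) z) y) w) x"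
    by (rule coassoc[symmetric])
  also have "\<dots> = sw (\<lambda>w c. e \<cdot> w * sw (\<lambda>p z. sw (\<lambda>q r. f \<cdot> (ant S p \<odot> q \<odot> ant S (c \<odot> r))) z) y) x"
  proof (rule cop_cong)
    fix w c
    show "sw (\<lambda>a b. sw (\<lambda>p z. sw (\<lambda>q r. ?T a b c p q r) z) y) w
       = e \<cdot> w * sw (\<lambda>p z. sw (\<lambda>q r. f \<cdot> (ant S p \<odot> q \<odot> ant S (c \<odot> r))) z) y"
    proof -
      have "lin (\<lambda>v. sw (\<lambda>p z. sw (\<lambda>q r. f \<cdot> (ant S p \<odot> v \<odot> q \<odot> ant S (c \<odot> r))) z) y)"
        by (intro lin_intros)
      from sw_antl[OF this, of w] show ?thesis by (simp add: mul_assoc)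
    qed
  qed
  also have "\<dots> = sw (\<lambda>p z. sw (\<lambda>q r. f \<cdot> (ant S p \<odot> q \<odot> ant S (x \<odot> r))) z) y"
    by (rule sw_counit) (intro lin_intros)
  also have "\<dots> = sw (\<lambda>z r. sw (\<lambda>p q. f \<cdot> (ant S p \<odot> q \<odot> ant S (x \<odot> r))) z) y"
    by (rule coassoc[symmetric])
  also have "\<dots> = sw (\<lambda>z r. e \<cdot> z * f \<cdot> ant S (x \<odot> r)) y"
    by (rule cop_cong, subst sw_antl) (intro lin_intros, simp)
  also have "\<dots> = f \<cdot> ant S (x \<odot> y)"
    by (rule sw_counit) (intro lin_intros)
  finally have 1: "sw (\<lambda>a w. sw (\<lambda>b c. sw (\<lambda>p z. sw (\<lambda>q r. ?T a b c p q r) z) y) w) x = f \<cdot> ant S (x \<odot> y)" .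
  have "sw (\<lambda>a w. sw (\<lambda>b c. sw (\<lambda>p z. sw (\<lambda>q r. ?T a b c p q r) z) y) w) x
     = sw (\<lambda>a w. sw (\<lambda>p z. sw (\<lambda>b c. sw (\<lambda>q r. ?T a b c p q r) z) w) y) x"
    by (rule cop_cong, rule cop_swap)
  also have "\<dots> = sw (\<lambda>a w. sw (\<lambda>p z. e \<cdot> w * e \<cdot> z * f \<cdot> (ant S p \<odot> ant S a)) y) x"
  proof (rule cop_cong, rule cop_cong)
    fix a w p z
    have "sw (\<lambda>b c. sw (\<lambda>q r. ?T a b c p q r) z) w = sw (\<lambda>s t. f \<cdot> (ant S p \<odot> ant S a \<odot> (s \<odot> ant S t))) (w \<odot> z)"
      by (subst sw_mul) (intro bilI lin_intros, simp add: mul_assoc)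
    also have "\<dots> = e \<cdot> (w \<odot> z) * f \<cdot> (ant S p \<odot> ant S a)"
      by (subst sw_antr[of "\<lambda>v. f \<cdot> (ant S p \<odot> ant S a \<odot> v)"]) (intro lin_intros, simp)
    finally show "sw (\<lambda>b c. sw (\<lambda>q r. ?T a b c p q r) z) w = e \<cdot> w * e \<cdot> z * f \<cdot> (ant S p \<odot> ant S a)" by simp
  qed
  also have "\<dots> = sw (\<lambda>a w. sw (\<lambda>p z. f \<cdot> (ant S p \<odot> ant S a) * e \<cdot> z) y * e \<cdot> w) x"
    by (rule cop_cong, subst cop_cmult(2)[symmetric]) (simp add: mult_ac)
  also have "\<dots> = sw (\<lambda>a w. f \<cdot> (ant S y \<odot> ant S a) * e \<cdot> w) x"
    by (rule cop_cong, subst sw_counit(2)[of "\<lambda>p. f \<cdot> (ant S p \<odot> ant S _)"]) (intro lin_intros, simp)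
  also have "\<dots> = f \<cdot> (ant S y \<odot> ant S x)"
    by (rule sw_counit) (intro lin_intros)
  finally show "f \<cdot> ant S (x \<odot> y) = f \<cdot> (ant S y \<odot> ant S x)" using 1 by simp
qed

lemma ant_u [simp]: "ant S u = u"
proof (rule pr_eqI)
  fix f
  have "sw (\<lambda>a b. f \<cdot> (ant S a \<odot> b)) u = f \<cdot> (ant S u \<odot> u)" by (rule sw_unit) (intro bilI lin_intros)
  thus "f \<cdot> ant S u = f \<cdot> u" using sw_antl[of "\<lambda>x. f \<cdot> x" u] by (simp add: lin_pr counit_unit)
qed

lemma counit_ant [simp]: "e \<cdot> ant S x = e \<cdot> x"
  using fin_hopf.ant_u[OF dual] by (simp add: pr_ant)

text \<open>The transposed antipode reverses products in the dual, so the antipode reverses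
  coproducts. To use this, the bilinear form is expanded into products of coordinate
  functionals.\<close>

lemma sw_ant: assumes F: "bil F" shows "sw F (ant S x) = sw (\<lambda>a b. F (ant S b) (ant S a)) x"
proof -
  have 1: "sw (\<lambda>a b. f \<cdot> a * g \<cdot> b) (ant S x) = sw (\<lambda>a b. f \<cdot> ant S b * g \<cdot> ant S a) x" for f g
  proof -
    have "sw (\<lambda>a b. f \<cdot> a * g \<cdot> b) (ant S x) = ant S' (f \<star> g) \<cdot> x" by (simp add: pr_bm[symmetric] pr_ant)
    also have "\<dots> = (ant S' g \<star> ant S' f) \<cdot> x" by (simp add: fin_hopf.ant_mul[OF dual])
    finally show ?thesis by (simp add: pr_bm pr_ant mult.commute)
  qed
  have 2: "F a b = (\<Sum>i\<in>UNIV. \<Sum>j\<in>UNIV. axis i 1 \<cdot> a * axis j 1 \<cdot> b * F (axis i 1) (axis j 1))" for a b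
    using bil_basis[OF F, of a b] by simp
  have "sw F (ant S x) = (\<Sum>i\<in>UNIV. \<Sum>j\<in>UNIV. sw (\<lambda>a b. axis i 1 \<cdot> a * axis j 1 \<cdot> b) (ant S x) * F (axis i 1) (axis j 1))"
    by (subst cop_cong[OF 2]) (simp add: cop_sum cop_cmult del: pr_axis)
  also have "\<dots> = sw (\<lambda>a b. \<Sum>i\<in>UNIV. \<Sum>j\<in>UNIV. axis i 1 \<cdot> ant S b * axis j 1 \<cdot> ant S a * F (axis i 1) (axis j 1)) x"
    unfolding 1 by (simp add: cop_sum cop_cmult del: pr_axis)
  also have "\<dots> = sw (\<lambda>a b. F (ant S b) (ant S a)) x" by (simp add: 2[symmetric] del: pr_axis)
  finally show ?thesis .
qed

lemma sw_ant2: assumes F: "bil F" shows "sw F (ant S (ant S x)) = sw (\<lambda>a b. F (ant S (ant S a)) (ant S (ant S b))) x"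
  by (subst sw_ant[OF F], subst sw_ant) (intro bilI lin_intros bil1[OF F] bil2[OF F], simp)

section \<open>Grouplike elements\<close>

text \<open>A grouplike element is described as a unital algebra homomorphism from the dual to the
  field.\<close>

definition grp :: "'k ^ 'i \<Rightarrow> bool" where
  "grp g \<longleftrightarrow> e \<cdot> g = 1 \<and> (\<forall>f h. (f \<star> h) \<cdot> g = f \<cdot> g * h \<cdot> g)"

lemma sw_grp: assumes g: "grp g" and F: "bil F" shows "sw F g = F g g"
proof -
  have 2: "F a b = (\<Sum>i\<in>UNIV. \<Sum>j\<in>UNIV. axis i 1 \<cdot> a * axis j 1 \<cdot> b * F (axis i 1) (axis j 1))" for a b
    using bil_basis[OF F, of a b] by simp
  have "sw F g = (\<Sum>i\<in>UNIV. \<Sum>j\<in>UNIV. sw (\<lambda>a b. axis i 1 \<cdot> a * axis j 1 \<cdot> b) g * F (axis i 1) (axis j 1))"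
    by (subst cop_cong[OF 2]) (simp add: cop_sum cop_cmult del: pr_axis)
  also have "\<dots> = F g g" unfolding pr_bm[symmetric] using g by (simp add: grp_def 2[of g g])
  finally show ?thesis .
qed

lemma grp_mul: assumes "grp g" "grp h" shows "grp (g \<odot> h)"
  unfolding grp_def pr_bm
proof (intro conjI allI)
  show "e \<cdot> (g \<odot> h) = 1" using assms by (simp add: grp_def)
  fix f f'
  show "sw (\<lambda>a b. f \<cdot> a * f' \<cdot> b) (g \<odot> h) = f \<cdot> (g \<odot> h) * f' \<cdot> (g \<odot> h)"
    by (subst sw_mul, intro bilI lin_intros, subst sw_grp[OF assms(1)], intro bilI lin_intros, subst sw_grp[OF assms(2)])
      (intro bilI lin_intros, simp)
qed

lemma grp_u: "grp u" by (simp add: grp_def counit_unit)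

lemma grp_ant: assumes "grp g" shows "grp (ant S g)"
  unfolding grp_def pr_bm
proof (intro conjI allI)
  show "e \<cdot> ant S g = 1" using assms by (simp add: grp_def)
  fix f f'
  show "sw (\<lambda>a b. f \<cdot> a * f' \<cdot> b) (ant S g) = f \<cdot> ant S g * f' \<cdot> ant S g"
    by (subst sw_ant, intro bilI lin_intros, subst sw_grp[OF assms]) (intro bilI lin_intros, simp)
qed

lemma grp_inv: assumes "grp g" shows "ant S g \<odot> g = u" "g \<odot> ant S g = u"
proof -
  have 1: "sw (\<lambda>a b. f \<cdot> (ant S a \<odot> b)) g = f \<cdot> (ant S g \<odot> g)" for f
    by (rule sw_grp[OF assms, of "\<lambda>a b. f \<cdot> (ant S a \<odot> b)"]) (intro bilI lin_intros)
  have 2: "sw (\<lambda>a b. f \<cdot> (a \<odot> ant S b)) g = f \<cdot> (g \<odot> ant S g)" for f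
    by (rule sw_grp[OF assms, of "\<lambda>a b. f \<cdot> (a \<odot> ant S b)"]) (intro bilI lin_intros)
  have "e \<cdot> g = 1" using assms by (simp add: grp_def)
  thus "ant S g \<odot> g = u" "g \<odot> ant S g = u"
    using sw_antl[OF lin_pr(1), of _ g] sw_antr[OF lin_pr(1), of _ g] unfolding 1 2
    by (auto intro!: pr_eqI)
qed

end

lemma axis_app: "axis i x $ j = (if j = i then x else 0)"
  by (simp add: axis_def)

section \<open>Integrals and the fourth power of the antipode\<close>

context fin_hopf
begin

text \<open>The trace formula for an integral. The twist by S^2 is what makes
  \<open>lam_integral\<close> hold before S^2 = id is known; afterwards \<open>lam\<close> is the
  regular character.\<close>

definition lam where "lam h = trc (\<lambda>x. ant S (ant S x) \<odot> h)"
definition lv where "lv = vof lam"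

lemma lin_lam: "lin lam"
  by (auto simp: lin_def lam_def trc_def bm_add bm_scale sum.distrib sum_distrib_left)

lemma lv: "lv \<cdot> x = lam x" by (simp add: lv_def vof_pr lin_lam)

text \<open>The coproduct of S^2(p) h carries S^2 on both legs. In the second leg S(q) meets S^2(t),
  their product is S(S(t) q), and the antipode axiom removes it.\<close>

lemma sw_twist:
  assumes F: "bil F"
  shows "sw (\<lambda>a b. F (ant S (ant S x) \<odot> a) b) h = sw (\<lambda>p q. sw (\<lambda>a b. F a (ant S q \<odot> b)) (ant S (ant S p) \<odot> h)) x"
proof -
  note b = bil1[OF F] bil2[OF F]
  have 1: "sw (\<lambda>a b. F a (ant S q \<odot> b)) (ant S (ant S p) \<odot> h) =
     sw (\<lambda>s t. sw (\<lambda>a b. F (ant S (ant S s) \<odot> a) (ant S q \<odot> (ant S (ant S t) \<odot> b))) h) p" for p q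
    by (subst sw_mul, intro bilI lin_intros b, subst sw_ant2) (intro bilI lin_intros b, simp)
  have "sw (\<lambda>p q. sw (\<lambda>a b. F a (ant S q \<odot> b)) (ant S (ant S p) \<odot> h)) x
     = sw (\<lambda>s w. sw (\<lambda>t q. sw (\<lambda>a b. F (ant S (ant S s) \<odot> a) (ant S q \<odot> (ant S (ant S t) \<odot> b))) h) w) x"
    unfolding 1 by (rule coassoc)
  also have "\<dots> = sw (\<lambda>s w. sw (\<lambda>a b. F (ant S (ant S s) \<odot> a) b) h * e \<cdot> w) x"
  proof (rule cop_cong)
    fix s w
    let ?f = "\<lambda>z. sw (\<lambda>a b. F (ant S (ant S s) \<odot> a) (ant S z \<odot> b)) h"
    have "sw (\<lambda>t q. ?f (ant S t \<odot> q)) w = e \<cdot> w * ?f u"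
      by (rule sw_antl) (intro lin_intros b)
    thus "sw (\<lambda>t q. sw (\<lambda>a b. F (ant S (ant S s) \<odot> a) (ant S q \<odot> (ant S (ant S t) \<odot> b))) h) w
       = sw (\<lambda>a b. F (ant S (ant S s) \<odot> a) b) h * e \<cdot> w"
      by (simp add: ant_mul mul_assoc mult.commute)
  qed
  also have "\<dots> = sw (\<lambda>a b. F (ant S (ant S x) \<odot> a) b) h"
    by (rule sw_counit(2)[of "\<lambda>s. sw (\<lambda>a b. F (ant S (ant S s) \<odot> a) b) h"]) (intro lin_intros b)
  finally show ?thesis ..
qed

text \<open>The sum over i replaces the coproduct of the basis vector by that of the first leg of Y
  p. By coassociativity S(d) then stands next to b, the antipode axiom cancels them, and the trace
  of Y remains.\<close>

lemma trc_collapse: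
  "(\<Sum>i\<in>UNIV. sw (\<lambda>p q. sw (\<lambda>a b. axis i 1 \<cdot> a * f \<cdot> (ant S q \<odot> b)) (Y p)) (axis i 1))
    = (\<Sum>p\<in>UNIV. Y (axis p 1) $ p) * f \<cdot> u"
proof -
  have "(\<Sum>i\<in>UNIV. sw (\<lambda>p q. sw (\<lambda>a b. axis i 1 \<cdot> a * f \<cdot> (ant S q \<odot> b)) (Y p)) (axis i 1))
     = (\<Sum>i\<in>UNIV. \<Sum>p\<in>UNIV. \<Sum>q\<in>UNIV. D p q i * sw (\<lambda>a b. a $ i * f \<cdot> (ant S (axis q 1) \<odot> b)) (Y (axis p 1)))"
    by (simp add: cop_axis)
  also have "\<dots> = (\<Sum>p\<in>UNIV. \<Sum>i\<in>UNIV. \<Sum>q\<in>UNIV. D p q i * sw (\<lambda>a b. a $ i * f \<cdot> (ant S (axis q 1) \<odot> b)) (Y (axis p 1)))"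
    by (rule sum.swap)
  also have "\<dots> = (\<Sum>p\<in>UNIV. \<Sum>i\<in>UNIV. sw (\<lambda>a b. \<Sum>q\<in>UNIV. a $ i * D p q i * f \<cdot> (ant S (axis q 1) \<odot> b)) (Y (axis p 1)))"
    by (simp add: cop_sum cop_cmult(1)[symmetric] mult_ac)
  also have "\<dots> = (\<Sum>p\<in>UNIV. sw (\<lambda>a b. \<Sum>i\<in>UNIV. \<Sum>q\<in>UNIV. a $ i * D p q i * f \<cdot> (ant S (axis q 1) \<odot> b)) (Y (axis p 1)))"
    by (simp only: cop_sum)
  also have "\<dots> = (\<Sum>p\<in>UNIV. sw (\<lambda>a b. sw (\<lambda>c d. axis p 1 \<cdot> c * f \<cdot> (ant S d \<odot> b)) a) (Y (axis p 1)))"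
  proof -
    have "(\<Sum>i\<in>UNIV. \<Sum>q\<in>UNIV. a $ i * D p q i * f \<cdot> (ant S (axis q 1) \<odot> b)) =
      sw (\<lambda>c d. axis p 1 \<cdot> c * f \<cdot> (ant S d \<odot> b)) a" for a b p
    proof -
      have "sw (\<lambda>c d. axis p 1 \<cdot> c * f \<cdot> (ant S d \<odot> b)) a =
        (\<Sum>i\<in>UNIV. \<Sum>p'\<in>UNIV. if p' = p then (\<Sum>q\<in>UNIV. a $ i * D p q i * f \<cdot> (ant S (axis q 1) \<odot> b)) else 0)"
        unfolding cop_def by (intro sum.cong refl) (simp add: axis_app)
      thus ?thesis by simp
    qed
    thus ?thesis by simp
  qed
  also have "\<dots> = (\<Sum>p\<in>UNIV. sw (\<lambda>c w. sw (\<lambda>d b. axis p 1 \<cdot> c * f \<cdot> (ant S d \<odot> b)) w) (Y (axis p 1)))"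
    by (simp only: coassoc)
  also have "\<dots> = (\<Sum>p\<in>UNIV. sw (\<lambda>c w. (axis p 1 \<cdot> c * f \<cdot> u) * e \<cdot> w) (Y (axis p 1)))"
    unfolding cop_cmult(1) sw_antl[OF lin_pr(1)] by (simp add: mult_ac)
  also have "\<dots> = (\<Sum>p\<in>UNIV. axis p 1 \<cdot> Y (axis p 1) * f \<cdot> u)"
    by (subst sw_counit(2)) (intro lin_intros linv_id, simp)
  finally show ?thesis by (simp add: sum_distrib_right)
qed

lemma lam_integral: "lv \<star> f = (f \<cdot> u) *s lv"
proof (rule pr_eqI')
  fix h
  let ?y = "\<lambda>p. ant S (ant S p) \<odot> h"
  have "(lv \<star> f) \<cdot> h = (\<Sum>i\<in>UNIV. sw (\<lambda>a b. axis i 1 \<cdot> (ant S (ant S (axis i 1)) \<odot> a) * f \<cdot> b) h)"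
    by (simp add: pr_bm lv lam_def trc_def sum_distrib_right cop_sum)
  also have "\<dots> = (\<Sum>i\<in>UNIV. sw (\<lambda>p q. sw (\<lambda>a b. axis i 1 \<cdot> a * f \<cdot> (ant S q \<odot> b)) (?y p)) (axis i 1))"
    by (rule sum.cong[OF refl], rule sw_twist) (intro bilI lin_intros)
  also have "\<dots> = lam h * f \<cdot> u" unfolding trc_collapse by (simp add: lam_def trc_def)
  finally show "(lv \<star> f) \<cdot> h = ((f \<cdot> u) *s lv) \<cdot> h" by (simp add: pr_scale lv)
qed

text \<open>Cyclicity of the trace, applied to right multiplication by \<open>a\<close> and the map
  that defines \<open>lam\<close>; S^2 appears because it is applied to x a.\<close>

lemma lam_nakayama: "lam (b \<odot> a) = lam (ant S (ant S a) \<odot> b)"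
proof -
  have "lam (ant S (ant S a) \<odot> b) = trc (\<lambda>x. ant S (ant S (x \<odot> a)) \<odot> b)"
    by (simp add: lam_def ant_mul mul_assoc)
  also have "\<dots> = trc (\<lambda>x. ant S (ant S x) \<odot> b \<odot> a)"
    by (rule trc_comm[of "\<lambda>z. ant S (ant S z) \<odot> b" "\<lambda>x. x \<odot> a"]) (intro lin_intros)+
  finally show ?thesis by (simp add: lam_def mul_assoc)
qed

end

text \<open>A two-sided integral with counit one is the form in which semisimplicity of a Hopf
  algebra is used. The dual will turn out to be an instance too, see
  \<open>dual_int\<close>.\<close>

locale hopf_int = fin_hopf M u D e S
  for M :: "'i::finite \<Rightarrow> 'i \<Rightarrow> 'i \<Rightarrow> 'k::{alg_closed_field,field_char_0}" and u :: "'k ^ 'i"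
    and D e S +
  fixes L :: "'k ^ 'i"
  assumes L_left: "x \<odot> L = (e \<cdot> x) *s L" and L_right: "L \<odot> x = (e \<cdot> x) *s L"
    and L_norm [simp]: "e \<cdot> L = 1"
begin

text \<open>Insert S(r) s in the first leg, which is the counit. The remaining pair (s, q) acts on
  the coproduct of \<open>L\<close> as a coproduct, so together with \<open>L\<close> it is absorbed
  by the integral.\<close>

lemma L_shift_left:
  assumes F: "bil F" shows "sw (\<lambda>a b. F a (h \<odot> b)) L = sw (\<lambda>a b. F (ant S h \<odot> a) b) L"
proof -
  note b = bil1[OF F] bil2[OF F]
  let ?G = "\<lambda>z q. sw (\<lambda>a b. F (z \<odot> a) (q \<odot> b)) L"
  have "sw (\<lambda>a b. F a (h \<odot> b)) L = sw (\<lambda>p q. e \<cdot> p * ?G u q) h"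
    by (subst sw_counit) (intro lin_intros b, simp)
  also have "\<dots> = sw (\<lambda>p q. sw (\<lambda>r s. ?G (ant S r \<odot> s) q) p) h"
    by (rule cop_cong, subst sw_antl[of "\<lambda>z. ?G z _"]) (intro lin_intros b, simp)
  also have "\<dots> = sw (\<lambda>r w. sw (\<lambda>s q. ?G (ant S r \<odot> s) q) w) h" by (rule coassoc)
  also have "\<dots> = sw (\<lambda>r w. sw (\<lambda>a b. F (ant S r \<odot> a) b) L * e \<cdot> w) h"
  proof (rule cop_cong)
    fix r w
    have "sw (\<lambda>s q. ?G (ant S r \<odot> s) q) w = sw (\<lambda>a b. F (ant S r \<odot> a) b) (w \<odot> L)"
      by (subst sw_mul) (intro bilI lin_intros b, simp add: mul_assoc)
    thus "sw (\<lambda>s q. ?G (ant S r \<odot> s) q) w = sw (\<lambda>a b. F (ant S r \<odot> a) b) L * e \<cdot> w"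
      by (simp add: L_left linD(2)[OF lin_cop] mult.commute)
  qed
  also have "\<dots> = sw (\<lambda>a b. F (ant S h \<odot> a) b) L"
    by (rule sw_counit(2)[of "\<lambda>r. sw (\<lambda>a b. F (ant S r \<odot> a) b) L"]) (intro lin_intros b)
  finally show ?thesis .
qed

lemma lam_L [simp]: "lam L = 1"
proof -
  have "lam L = (\<Sum>i\<in>UNIV. e $ i * L $ i)" by (simp add: lam_def trc_def L_left)
  also have "\<dots> = 1" by (simp only: pr_def[symmetric] L_norm)
  finally show ?thesis .
qed

text \<open>\<open>L_shift_left\<close> moves \<open>x\<close> to the second leg, and there lam(L_1)
  L_2 = 1 because \<open>lam\<close> is an integral with value 1 at \<open>L\<close>. So
  \<open>lam\<close> is a Frobenius form with dual bases taken from the coproduct of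
  \<open>L\<close>.\<close>

lemma fourier: "sw (\<lambda>a b. lam (ant S x \<odot> a) * f \<cdot> b) L = f \<cdot> x"
proof -
  define f' where "f' = vof (\<lambda>y. f \<cdot> (x \<odot> y))"
  have f': "f' \<cdot> y = f \<cdot> (x \<odot> y)" for y unfolding f'_def by (rule vof_pr) (intro lin_intros)
  have "sw (\<lambda>a b. lv \<cdot> (ant S x \<odot> a) * f \<cdot> b) L = sw (\<lambda>a b. lv \<cdot> a * f \<cdot> (x \<odot> b)) L"
    by (rule L_shift_left[symmetric, of "\<lambda>a b. lv \<cdot> a * f \<cdot> b"]) (intro bilI lin_intros)
  also have "\<dots> = (lv \<star> f') \<cdot> L" by (simp add: pr_bm f')
  also have "\<dots> = f \<cdot> x" by (simp add: lam_integral pr_scale f' lv)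
  finally show ?thesis by (simp add: lv)
qed

lemma ant_inj: "ant S x = ant S y \<Longrightarrow> x = y"
  by (rule pr_eqI) (metis fourier)

lemma linv_linear: "linv T \<Longrightarrow> Vector_Spaces.linear (*s) (*s) T"
  by (auto simp: linv_def Vector_Spaces.linear_iff vec.vector_space_axioms)

lemma ant_surj: "\<exists>y. ant S y = x"
proof -
  have "surj (ant S)"
    using vec.linear_inj_imp_surj[OF linv_linear[OF linv_ant]] ant_inj by (auto simp: inj_def)
  thus ?thesis by (metis surjD)
qed

text \<open>Maschke: for a linear projection p onto \<open>I\<close>, averaging with the integral
  gives a module projection, and c = L_1 p(S(L_2)) is its value at the unit.\<close>

lemma semisimple: assumes I: "left_id I" shows "\<exists>c\<in>I. \<forall>x\<in>I. x \<odot> c = x"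
proof -
  have I': "vec.subspace I" "\<And>h x. x \<in> I \<Longrightarrow> h \<odot> x \<in> I" using I by (auto simp: left_id_def)
  obtain p where p: "Vector_Spaces.linear (*s) (*s) p" "range p \<subseteq> I" "\<And>x. x \<in> I \<Longrightarrow> p x = x"
    using vec.linear_exists_left_inverse_on[OF vec.linear_ident I'(1)] by auto
  have lp: "linv p" using p(1) by (auto simp: linv_def Vector_Spaces.linear_iff)
  define c where "c = (\<chi> i. sw (\<lambda>a b. axis i 1 \<cdot> (a \<odot> p (ant S b))) L)"
  have lb: "lin (\<lambda>x. sw (\<lambda>a b. x \<cdot> (a \<odot> p (ant S b))) L)" by (intro lin_intros)
  have c: "f \<cdot> c = sw (\<lambda>a b. f \<cdot> (a \<odot> p (ant S b))) L" for f
    by (subst lin_basis[OF lb]) (simp add: c_def pr_def[of f] del: pr_axis)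
  have "c \<in> I"
  proof -
    have "c = (\<Sum>l\<in>UNIV. \<Sum>i\<in>UNIV. \<Sum>j\<in>UNIV. (L $ l * D i j l) *s (axis i 1 \<odot> p (ant S (axis j 1))))"
      by (rule pr_eqI) (simp only: c cop_def pr_sum pr_scale)
    moreover have "a \<odot> p b \<in> I" for a b by (rule I'(2)) (use p(2) in blast)
    ultimately show ?thesis using I'(1) by (simp add: vec.subspace_sum vec.subspace_scale)
  qed
  moreover have "x \<odot> c = x" if x: "x \<in> I" for x
  proof (rule pr_eqI)
    fix f
    obtain h where h: "x = ant S h" using ant_surj by metis
    define f' where "f' = vof (\<lambda>y. f \<cdot> (x \<odot> y))"
    have f': "f' \<cdot> y = f \<cdot> (x \<odot> y)" for y unfolding f'_def by (rule vof_pr) (intro lin_intros)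
    have "f \<cdot> (x \<odot> c) = sw (\<lambda>a b. f \<cdot> (ant S h \<odot> a \<odot> p (ant S b))) L" by (simp add: f'[symmetric] c) (simp add: f' h mul_assoc)
    also have "\<dots> = sw (\<lambda>a b. f \<cdot> (a \<odot> p (ant S (h \<odot> b)))) L"
      by (rule L_shift_left[symmetric, of "\<lambda>a b. f \<cdot> (a \<odot> p (ant S b))"])
        (intro bilI lin_intros linv_comp[OF lp])
    also have "\<dots> = sw (\<lambda>a b. f \<cdot> (a \<odot> p (ant S b \<odot> x))) L" by (simp add: ant_mul h)
    also have "\<dots> = sw (\<lambda>a b. f \<cdot> (a \<odot> (ant S b \<odot> x))) L"
      using I'(2)[OF x] p(3) by simp
    also have "\<dots> = f \<cdot> x"
      using sw_antr[of "\<lambda>y. f \<cdot> (y \<odot> x)" L] by (simp add: lin_prE linv_bm mul_assoc)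
    finally show "f \<cdot> (x \<odot> c) = f \<cdot> x" .
  qed
  ultimately show ?thesis by blast
qed

lemma ant_dual_surj: "\<exists>g. \<forall>x. g \<cdot> ant S x = f \<cdot> x"
proof -
  obtain T where T: "\<And>x. ant S (T x) = x" using ant_surj by metis
  have T': "T (ant S x) = x" for x using ant_inj T by blast
  have "linv T" unfolding linv_def by (metis T ant_add ant_scale ant_inj)
  hence "vof (\<lambda>x. f \<cdot> T x) \<cdot> ant S x = f \<cdot> x" for x
    by (subst vof_pr) (auto intro!: lin_prE simp: T')
  thus ?thesis by blast
qed

text \<open>The Fourier formula says that one square matrix is a left inverse of another, hence it is also a
  right inverse.\<close>

lemma fourier_flip: "sw (\<lambda>a b. f \<cdot> a * lam (ant S b \<odot> y)) L = f \<cdot> y"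
proof -
  define A :: "'k ^ 'i ^ 'i" where "A = (\<chi> i j. \<Sum>l\<in>UNIV. L $ l * D i j l)"
  define B :: "'k ^ 'i ^ 'i" where "B = (\<chi> k i. lam (ant S (axis k 1) \<odot> axis i 1))"
  have swA: "sw F L = (\<Sum>i\<in>UNIV. \<Sum>j\<in>UNIV. A $ i $ j * F (axis i 1) (axis j 1))" for F
  proof -
    have "sw F L = (\<Sum>i\<in>UNIV. \<Sum>l\<in>UNIV. \<Sum>j\<in>UNIV. L $ l * D i j l * F (axis i 1) (axis j 1))"
      unfolding cop_def by (rule sum.swap)
    also have "\<dots> = (\<Sum>i\<in>UNIV. \<Sum>j\<in>UNIV. \<Sum>l\<in>UNIV. L $ l * D i j l * F (axis i 1) (axis j 1))"
      by (rule sum.cong[OF refl], rule sum.swap)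
    finally show ?thesis by (simp add: A_def sum_distrib_right)
  qed
  have "B ** A = mat 1"
    unfolding vec_eq_iff
  proof (intro allI)
    fix k j
    have "(B ** A) $ k $ j = sw (\<lambda>a b. lam (ant S (axis k 1) \<odot> a) * axis j 1 \<cdot> b) L"
      unfolding swA by (simp add: matrix_matrix_mult_def B_def) (simp add: axis_app delta_mult mult.commute)
    thus "(B ** A) $ k $ j = mat 1 $ k $ j" unfolding fourier by (simp add: mat_def axis_app)
  qed
  hence AB: "A ** B = mat 1" by (simp add: matrix_left_right_inverse)
  have 1: "sw (\<lambda>a b. axis i 1 \<cdot> a * lam (ant S b \<odot> axis k 1)) L = axis i 1 \<cdot> axis k 1" for i k
  proof -
    have "sw (\<lambda>a b. axis i 1 \<cdot> a * lam (ant S b \<odot> axis k 1)) L = 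
      (\<Sum>i'\<in>UNIV. if i' = i then (\<Sum>j\<in>UNIV. A $ i $ j * B $ j $ k) else 0)"
      unfolding swA B_def by (intro sum.cong refl) (simp add: axis_app)
    also have "\<dots> = (A ** B) $ i $ k" by (simp add: matrix_matrix_mult_def)
    also have "\<dots> = axis i 1 \<cdot> axis k 1" unfolding AB by (simp add: mat_def axis_app)
    finally show ?thesis .
  qed
  have "sw (\<lambda>a b. f \<cdot> a * lv \<cdot> (ant S b \<odot> axis k 1)) L = f \<cdot> axis k 1" for k
    by (rule lin_eqI[of "\<lambda>f. sw (\<lambda>a b. f \<cdot> a * lv \<cdot> (ant S b \<odot> axis k 1)) L" "\<lambda>f. f \<cdot> axis k 1"])
      ((intro lin_intros)+, unfold lv, rule 1)
  hence "sw (\<lambda>a b. f \<cdot> a * lv \<cdot> (ant S b \<odot> y)) L = f \<cdot> y"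
    by (rule lin_eqI[of "\<lambda>y. sw (\<lambda>a b. f \<cdot> a * lv \<cdot> (ant S b \<odot> y)) L" "\<lambda>y. f \<cdot> y", rotated 2]) (intro lin_intros)+
  thus ?thesis by (simp add: lv)
qed

text \<open>By \<open>fourier_flip\<close>, nu(y) is the convolution of \<open>nu\<close> with some
  functional, evaluated at \<open>L\<close>; the integral property reduces that functional to its
  value at the unit.\<close>

lemma integral_unique:
  assumes "\<And>f. nu \<star> f = (f \<cdot> u) *s nu" shows "nu = (nu \<cdot> L) *s lv"
proof (rule pr_eqI')
  fix y
  define g where "g = vof (\<lambda>b. lv \<cdot> (ant S b \<odot> y))"
  have g: "g \<cdot> b = lam (ant S b \<odot> y)" for b
    unfolding g_def by (subst vof_pr) (intro lin_intros, simp add: lv)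
  have "nu \<cdot> y = (nu \<star> g) \<cdot> L" by (simp add: pr_bm g fourier_flip)
  also have "\<dots> = lam y * nu \<cdot> L" by (simp add: assms pr_scale g)
  finally show "nu \<cdot> y = ((nu \<cdot> L) *s lv) \<cdot> y" by (simp add: pr_scale lv)
qed

text \<open>The distinguished grouplike element: left multiplication by a functional preserves the
  line of integrals, and \<open>a0\<close> is the resulting algebra map on the dual.\<close>

definition a0 where "a0 = (\<chi> i. (axis i 1 \<star> lv) \<cdot> L)"

lemma a0: "f \<star> lv = (f \<cdot> a0) *s lv"
proof -
  have "f \<star> lv = ((f \<star> lv) \<cdot> L) *s lv"
    by (rule integral_unique) (simp add: cmul_assoc lam_integral bm_scale)
  also have "(f \<star> lv) \<cdot> L = f \<cdot> a0"
    using lin_basis[of "\<lambda>f. (f \<star> lv) \<cdot> L" f] by (simp add: a0_def pr_def[of f] lin_prE2 linv_bm)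
  finally show ?thesis .
qed

lemma grp_a0: "grp a0"
proof -
  have nz: "lv \<noteq> 0" using lv[of L] by auto
  have "(f \<star> g) \<cdot> a0 = f \<cdot> a0 * g \<cdot> a0" for f g
  proof -
    have "((f \<star> g) \<cdot> a0) *s lv = f \<star> (g \<star> lv)" by (simp add: a0[symmetric] cmul_assoc)
    also have "\<dots> = (f \<cdot> a0 * g \<cdot> a0) *s lv" by (simp add: a0 bm_scale)
    finally show ?thesis using nz by simp
  qed
  moreover have "e \<cdot> a0 = 1" using a0[of e] nz by (metis cmul_1(1) vec.scale_cancel_right vec.scale_one)
  ultimately show ?thesis by (simp add: grp_def)
qed

lemma ant_L: "ant S L = L"
proof -
  have "ant S L \<odot> y = (e \<cdot> y) *s ant S L" for y
  proof -
    obtain x where x: "y = ant S x" using ant_surj by metis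
    have "ant S L \<odot> ant S x = ant S (x \<odot> L)" by (simp add: ant_mul)
    thus ?thesis by (simp add: x L_left ant_scale)
  qed
  from this[of L] show ?thesis by (simp add: L_left)
qed

text \<open>Translation by the inverse of \<open>a0\<close>, followed by the antipode and
  \<open>lam\<close>, is again an integral. It takes the value 1 at \<open>L\<close>, so uniqueness
  identifies it with \<open>lam\<close>.\<close>

lemma lam_ant: "lam (ant S h) = lam (a0 \<odot> h)"
proof -
  define b where "b = ant S a0"
  have b: "b \<odot> a0 = u" "a0 \<odot> b = u" "grp b" using grp_inv[OF grp_a0] grp_ant[OF grp_a0] by (simp_all add: b_def)
  have Sb: "ant S b = a0" 
  proof -
    have "ant S b = ant S b \<odot> (b \<odot> a0)" by (simp add: b)
    also have "\<dots> = a0" by (simp add: mul_assoc[symmetric] grp_inv[OF b(3)])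
    finally show ?thesis .
  qed
  define nu where "nu = vof (\<lambda>x. lv \<cdot> ant S (b \<odot> x))"
  have nu: "nu \<cdot> x = lv \<cdot> ant S (b \<odot> x)" for x unfolding nu_def by (rule vof_pr) (intro lin_intros)
  have "nu \<star> f = (f \<cdot> u) *s nu" for f
  proof (rule pr_eqI')
    fix h
    define f' where "f' = vof (\<lambda>y. f \<cdot> (a0 \<odot> y))"
    have f': "f' \<cdot> y = f \<cdot> (a0 \<odot> y)" for y unfolding f'_def by (rule vof_pr) (intro lin_intros)
    obtain f'' where f'': "\<And>y. f'' \<cdot> ant S y = f' \<cdot> y" using ant_dual_surj[of f'] by auto
    have "(nu \<star> f) \<cdot> h = sw (\<lambda>x y. lv \<cdot> ant S (b \<odot> x) * f' \<cdot> (b \<odot> y)) h"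
      by (simp add: pr_bm nu f' mul_assoc[symmetric] b)
    also have "\<dots> = sw (\<lambda>x y. lv \<cdot> ant S x * f' \<cdot> y) (b \<odot> h)"
      by (subst sw_mul, intro bilI lin_intros, subst sw_grp[OF b(3)]) (intro bilI lin_intros, simp)
    also have "\<dots> = sw (\<lambda>x y. f'' \<cdot> x * lv \<cdot> y) (ant S (b \<odot> h))"
      by (subst sw_ant) (intro bilI lin_intros, simp add: f'' mult.commute)
    also have "\<dots> = f'' \<cdot> a0 * lam (ant S (b \<odot> h))"
      unfolding pr_bm[symmetric] a0 by (simp add: pr_scale lv)
    also have "f'' \<cdot> a0 = f \<cdot> u" using f''[of b] by (simp add: Sb f' b)
    finally show "(nu \<star> f) \<cdot> h = ((f \<cdot> u) *s nu) \<cdot> h" by (simp add: pr_scale nu lv)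
  qed
  from integral_unique[OF this] have "nu = (nu \<cdot> L) *s lv" .
  moreover have "nu \<cdot> L = 1" using b(3) by (simp add: nu L_left ant_scale ant_L lv grp_def)
  ultimately have "nu = lv" by simp
  hence "lv \<cdot> ant S (b \<odot> (a0 \<odot> h)) = lv \<cdot> (a0 \<odot> h)" using nu by metis
  thus ?thesis by (simp add: mul_assoc[symmetric] b lv)
qed

lemma lam_nondeg: assumes "\<And>y. lam (x \<odot> y) = lam (z \<odot> y)" shows "x = z"
proof -
  obtain x' z' where xz: "x = ant S x'" "z = ant S z'" using ant_surj by metis
  have "x' = z'"
  proof (rule pr_eqI)
    fix f
    have "f \<cdot> x' = sw (\<lambda>a b. lam (x \<odot> a) * f \<cdot> b) L" unfolding xz by (rule fourier[symmetric])
    also have "\<dots> = sw (\<lambda>a b. lam (z \<odot> a) * f \<cdot> b) L" by (simp only: assms)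
    also have "\<dots> = f \<cdot> z'" unfolding xz by (rule fourier)
    finally show "f \<cdot> x' = f \<cdot> z'" .
  qed
  thus ?thesis using xz by simp
qed

text \<open>Radford's formula for S^4. \<open>lam_ant\<close> trades a factor \<open>a0\<close> for
  an antipode and \<open>lam_nakayama\<close> rotates a product at the cost of S^2. Alternating them
  twice puts S^4 on \<open>x\<close>, and nondegeneracy removes \<open>lam\<close>. As
  \<open>L\<close> is two-sided, only conjugation by \<open>a0\<close> appears.\<close>

theorem ant_fourth: "a0 \<odot> x = ant S (ant S (ant S (ant S x))) \<odot> a0"
proof (rule lam_nondeg)
  fix y
  have "lam (a0 \<odot> x \<odot> y) = lam (ant S y \<odot> ant S x)"
    unfolding mul_assoc lam_ant[symmetric] ant_mul ..
  also have "\<dots> = lam (ant S (ant S (ant S x)) \<odot> ant S y)" by (rule lam_nakayama)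
  also have "\<dots> = lam (a0 \<odot> (y \<odot> ant S (ant S x)))" unfolding lam_ant[symmetric] ant_mul ..
  also have "\<dots> = lam (a0 \<odot> y \<odot> ant S (ant S x))" unfolding mul_assoc ..
  also have "\<dots> = lam (ant S (ant S (ant S (ant S x))) \<odot> (a0 \<odot> y))" by (rule lam_nakayama)
  finally show "lam (a0 \<odot> x \<odot> y) = lam (ant S (ant S (ant S (ant S x))) \<odot> a0 \<odot> y)" unfolding mul_assoc .
qed

end

section \<open>Characters of a semisimple algebra\<close>

context ss_alg
begin

text \<open>A single choice for all four components, so that they belong to the same
  decomposition.\<close>

definition "WD = (SOME w :: ('k ^ 'i) set \<times> ('k ^ 'i \<Rightarrow> 'k ^ 'i) \<times> ('k ^ 'i \<Rightarrow> 'k ^ 'i \<Rightarrow> 'k ^ 'i) \<times> ('k ^ 'i \<Rightarrow> 'k ^ 'i \<Rightarrow> 'k ^ 'i \<Rightarrow> 'k).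
    case w of (P, r, E, c) \<Rightarrow> wed P r E c)"
definition "P0 = fst WD"
definition "r0 = fst (snd WD)"
definition "E0 = fst (snd (snd WD))"
definition "c0 = snd (snd (snd WD))"

lemma wed0: "wed P0 r0 E0 c0"
proof -
  obtain P r E c where "wed (P :: ('k ^ 'i) set) r E c" using wedderburn by blast
  hence "\<exists>w :: ('k ^ 'i) set \<times> ('k ^ 'i \<Rightarrow> 'k ^ 'i) \<times> ('k ^ 'i \<Rightarrow> 'k ^ 'i \<Rightarrow> 'k ^ 'i) \<times> ('k ^ 'i \<Rightarrow> 'k ^ 'i \<Rightarrow> 'k ^ 'i \<Rightarrow> 'k).
      case w of (P, r, E, c) \<Rightarrow> wed P r E c" by (intro exI[of _ "(P, r, E, c)"]) simp
  from someI_ex[OF this, folded WD_def] show ?thesis unfolding P0_def r0_def E0_def c0_def by (simp add: split_beta)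
qed

definition blk where "blk p = {q\<in>P0. r0 q = r0 p}"

definition "J = {p\<in>P0. r0 p = p}"

lemma fin [simp]: "finite P0" "finite (blk p)" "finite J"
  using wed0 by (auto simp: wed_def blk_def J_def)

lemma blk_in: "q \<in> blk p \<Longrightarrow> q \<in> P0" by (simp add: blk_def)
lemma J_in: "p \<in> J \<Longrightarrow> p \<in> P0" by (simp add: J_def)
lemma blk_sym: "q \<in> blk p \<Longrightarrow> blk q = blk p" by (auto simp: blk_def)
lemma blk_self: "p \<in> P0 \<Longrightarrow> p \<in> blk p" by (auto simp: blk_def)
lemma r0_J: "p \<in> P0 \<Longrightarrow> r0 p \<in> J" "p \<in> P0 \<Longrightarrow> p \<in> blk (r0 p)"
  using wed0 by (auto simp: wed_def J_def blk_def)

lemma blk_J_disj: "p \<in> J \<Longrightarrow> q \<in> J \<Longrightarrow> s \<in> blk p \<Longrightarrow> s \<in> blk q \<Longrightarrow> p = q"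
  by (auto simp: blk_def J_def)

lemma E_mul:
  assumes "p \<in> P0" "q \<in> blk p" "s \<in> P0" "t \<in> blk s"
  shows "E0 p q \<odot> E0 s t = (if q = s then E0 p t else 0)"
  using wed0 assms unfolding wed_def blk_def by simp

lemma c_E:
  assumes "p \<in> P0" "q \<in> blk p" "s \<in> P0" "t \<in> blk s"
  shows "c0 p q (E0 s t) = (if p = s \<and> q = t then 1 else 0)"
  using wed0 assms unfolding wed_def blk_def by simp

lemma c_lin: "p \<in> P0 \<Longrightarrow> q \<in> blk p \<Longrightarrow> lin (c0 p q)"
  using wed0 unfolding wed_def blk_def by simp

lemma E_unit: "(\<Sum>p\<in>P0. E0 p p) = u"
  using wed0 unfolding wed_def by simp

lemma E_expand: "x = (\<Sum>(p,q)\<in>Sigma P0 blk. c0 p q x *s E0 p q)"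
proof -
  have "x = (\<Sum>(p,q)\<in>{(p,q). p \<in> P0 \<and> q \<in> P0 \<and> r0 p = r0 q}. c0 p q x *s E0 p q)"
    using wed0 unfolding wed_def by blast
  also have "{(p,q). p \<in> P0 \<and> q \<in> P0 \<and> r0 p = r0 q} = Sigma P0 blk" by (auto simp: blk_def)
  finally show ?thesis .
qed

lemma E_expand': "x = (\<Sum>p\<in>P0. \<Sum>q\<in>blk p. c0 p q x *s E0 p q)"
  using E_expand[of x] by (simp add: sum.Sigma)

lemma E_left:
  assumes p: "p \<in> P0" "s \<in> blk p" shows "E0 s p \<odot> x = (\<Sum>q\<in>blk p. c0 p q x *s E0 s q)"
proof -
  have s: "s \<in> P0" "p \<in> blk s" using p blk_in blk_sym blk_self by auto
  have "E0 s p \<odot> x = (\<Sum>a\<in>P0. \<Sum>q\<in>blk a. c0 a q x *s (E0 s p \<odot> E0 a q))"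
    by (subst E_expand'[of x]) (simp add: bm_sum bm_scale)
  also have "\<dots> = (\<Sum>a\<in>P0. if a = p then (\<Sum>q\<in>blk p. c0 p q x *s E0 s q) else 0)"
    by (intro sum.cong refl) (auto simp: E_mul[OF s])
  finally show ?thesis using p by simp
qed

lemma E_right:
  assumes p: "p \<in> P0" "s \<in> blk p" shows "x \<odot> E0 p s = (\<Sum>q\<in>blk p. c0 q p x *s E0 q s)"
proof -
  have sb: "s \<in> blk q \<longleftrightarrow> q \<in> blk p" if "q \<in> P0" for q using p that by (auto simp: blk_def)
  have "x \<odot> E0 p s = (\<Sum>q\<in>P0. \<Sum>a\<in>blk q. c0 q a x *s (E0 q a \<odot> E0 p s))"
    by (subst E_expand'[of x]) (simp add: bm_sum bm_scale)
  also have "\<dots> = (\<Sum>q\<in>P0. \<Sum>a\<in>blk q. if a = p then c0 q p x *s E0 q s else 0)"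
    using p by (intro sum.cong refl) (auto simp: E_mul)
  also have "\<dots> = (\<Sum>q\<in>P0. if q \<in> blk p then c0 q p x *s E0 q s else 0)"
    using p by (intro sum.cong refl) (auto simp: blk_def)
  also have "\<dots> = (\<Sum>q\<in>blk p. c0 q p x *s E0 q s)"
    by (simp add: sum.If_cases) (intro sum.cong, auto simp: blk_def)
  finally show ?thesis .
qed

lemma E_sandwich:
  assumes p: "p \<in> P0" "s \<in> blk p" "q \<in> blk p" "t \<in> blk p"
  shows "E0 s p \<odot> x \<odot> E0 q t = c0 p q x *s E0 s t"
proof -
  have b: "blk s = blk p" "blk q = blk p" "s \<in> P0" "q \<in> P0" using p blk_sym blk_in by auto
  have "E0 s p \<odot> x \<odot> E0 q t = (\<Sum>a\<in>blk p. c0 p a x *s (E0 s a \<odot> E0 q t))"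
    by (simp add: E_left[OF p(1,2)] bm_sum bm_scale)
  also have "\<dots> = (\<Sum>a\<in>blk p. if a = q then c0 p q x *s E0 s t else 0)"
    using p b by (intro sum.cong refl) (auto simp: E_mul)
  finally show ?thesis using p by simp
qed

lemma c_mul:
  assumes p: "p \<in> P0" "q \<in> blk p"
  shows "c0 p q (x \<odot> y) = (\<Sum>s\<in>blk p. c0 p s x * c0 s q y)"
proof -
  have q: "q \<in> P0" "p \<in> blk q" "blk q = blk p" using p blk_in blk_sym blk_self by auto
  have "c0 p q (x \<odot> y) *s E0 p q = E0 p p \<odot> (x \<odot> y) \<odot> E0 q q"
    using E_sandwich[of p p q q "x \<odot> y"] p q blk_self by auto
  also have "\<dots> = (E0 p p \<odot> x) \<odot> (y \<odot> E0 q q)" by (simp add: mul_assoc)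
  also have "\<dots> = (\<Sum>s\<in>blk p. c0 p s x *s (E0 p s \<odot> (\<Sum>t\<in>blk p. c0 t q y *s E0 t q)))"
    using E_left[of p p x] E_right[of q q y] p q blk_self by (simp only: bm_sum(1) bm_scale(1))
  also have "\<dots> = (\<Sum>s\<in>blk p. c0 p s x *s (\<Sum>t\<in>blk p. if t = s then c0 s q y *s E0 p q else 0))"
  proof (intro sum.cong refl, rule arg_cong[where f = "\<lambda>v. _ *s v"])
    fix s assume s: "s \<in> blk p"
    have "E0 p s \<odot> E0 t q = (if s = t then E0 p q else 0)" if "t \<in> blk p" for t
      using that s p q blk_in blk_sym[OF that] by (intro E_mul) auto
    thus "E0 p s \<odot> (\<Sum>t\<in>blk p. c0 t q y *s E0 t q) = (\<Sum>t\<in>blk p. if t = s then c0 s q y *s E0 p q else 0)"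
      by (subst bm_sum(2), intro sum.cong refl) (auto simp: bm_scale)
  qed
  also have "\<dots> = (\<Sum>s\<in>blk p. c0 p s x * c0 s q y) *s E0 p q" by (simp add: vec.scale_sum_left)
  finally show ?thesis using linD(2)[OF c_lin[OF p]] by (metis (no_types, lifting) c_E mult.right_neutral p)
qed

lemma E_u: assumes "p \<in> P0" "q \<in> blk p" shows "c0 p q u = (if p = q then 1 else 0)"
proof -
  have "c0 p q u = (\<Sum>s\<in>P0. c0 p q (E0 s s))" using lin_sum[OF c_lin[OF assms], of "\<lambda>s. E0 s s" P0] by (simp add: E_unit)
  also have "\<dots> = (\<Sum>s\<in>P0. if s = p then (if p = q then 1 else 0) else 0)"
    using assms by (intro sum.cong refl) (auto simp: c_E blk_self)
  finally show ?thesis using assms by simp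
qed

definition chi :: "'k ^ 'i \<Rightarrow> 'k ^ 'i" where "chi p = vof (\<lambda>x. \<Sum>q\<in>blk p. c0 q q x)"

lemma chi: assumes "p \<in> J" shows "chi p \<cdot> x = (\<Sum>q\<in>blk p. c0 q q x)"
  unfolding chi_def by (rule vof_pr) (intro lin_sumI c_lin blk_in blk_self, assumption)

definition Irr where "Irr = chi ` J"

lemma chi_comm: assumes "p \<in> J" shows "chi p \<cdot> (x \<odot> y) = chi p \<cdot> (y \<odot> x)"
proof -
  have 1: "chi p \<cdot> (x \<odot> y) = (\<Sum>q\<in>blk p. \<Sum>s\<in>blk p. c0 q s x * c0 s q y)" for x y
    unfolding chi[OF assms] using blk_in blk_self blk_sym by (intro sum.cong refl) (auto simp: c_mul)
  show ?thesis unfolding 1 by (subst sum.swap) (simp add: mult.commute)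
qed

lemma chi_unit: assumes "p \<in> J" shows "chi p \<cdot> u = of_nat (card (blk p))"
proof -
  have "chi p \<cdot> u = (\<Sum>q\<in>blk p. 1)" unfolding chi[OF assms]
    using blk_in blk_self by (intro sum.cong refl) (auto simp: E_u)
  thus ?thesis by simp
qed

lemma card_blk_pos: "p \<in> P0 \<Longrightarrow> card (blk p) > 0"
  using blk_self by (auto simp: card_gt_0_iff)

lemma chi_E: assumes "p \<in> J" "q \<in> P0" "s \<in> blk q"
  shows "chi p \<cdot> E0 q s = (if q \<in> blk p \<and> q = s then 1 else 0)"
proof -
  have "chi p \<cdot> E0 q s = (\<Sum>t\<in>blk p. if t = q then (if q = s then 1 else 0) else 0)" unfolding chi[OF assms(1)]
    using assms blk_in blk_self by (intro sum.cong refl) (auto simp: c_E)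
  thus ?thesis by auto
qed

lemma inj_chi: "inj_on chi J"
proof (rule inj_onI)
  fix p q assume pq: "p \<in> J" "q \<in> J" "chi p = chi q"
  have "chi p \<cdot> E0 p p = 1" using pq by (subst chi_E) (auto simp: J_in blk_self)
  hence "p \<in> blk q" using pq by (simp add: chi_E J_in blk_self split: if_splits)
  thus "p = q" using pq blk_J_disj blk_self J_in by blast
qed

text \<open>On the block \<open>x\<close> becomes an idempotent matrix. Its trace is its rank, and
  rank zero means that the matrix vanishes.\<close>

lemma chi_idem:
  assumes p: "p \<in> J" and e: "x \<odot> x = x"
  shows "\<exists>m::nat. m \<le> card (blk p) \<and> chi p \<cdot> x = of_nat m \<and> (m = 0 \<longrightarrow> (\<forall>y. chi p \<cdot> (x \<odot> y) = 0))"
proof -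
  have "\<exists>m::nat. m \<le> card (blk p) \<and> (\<Sum>a\<in>blk p. c0 a a x) = of_nat m \<and> (m = 0 \<longrightarrow> (\<forall>a\<in>blk p. \<forall>b\<in>blk p. c0 a b x = 0))"
  proof (rule idempotent_trace_nat)
    fix a c assume "a \<in> blk p" "c \<in> blk p"
    thus "(\<Sum>b\<in>blk p. c0 a b x * c0 b c x) = c0 a c x"
      using c_mul[of a c x x] e blk_in blk_sym by auto
  qed simp
  then obtain m where m: "m \<le> card (blk p)" "(\<Sum>a\<in>blk p. c0 a a x) = of_nat m" 
    "m = 0 \<longrightarrow> (\<forall>a\<in>blk p. \<forall>b\<in>blk p. c0 a b x = 0)" by blast
  have "chi p \<cdot> (x \<odot> y) = 0" if "m = 0" for y
    unfolding chi[OF p]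
  proof (intro sum.neutral ballI)
    fix q assume q: "q \<in> blk p"
    show "c0 q q (x \<odot> y) = 0" using c_mul[of q q x y] q m that blk_in blk_sym[OF q] by simp
  qed
  thus ?thesis using m by (intro exI[of _ m]) (auto simp: chi[OF p])
qed

text \<open>A trace function vanishes on off-diagonal matrix units and is constant on the diagonal
  units of a block, since these are conjugate within the block.\<close>

lemma trace_expand:
  assumes f: "\<And>x y. f \<cdot> (x \<odot> y) = f \<cdot> (y \<odot> x)"
  shows "f = (\<Sum>p\<in>J. (f \<cdot> E0 p p) *s chi p)"
proof (rule pr_eqI')
  fix x
  have fE: "f \<cdot> E0 p q = (if p = q then f \<cdot> E0 (r0 p) (r0 p) else 0)" if pq: "p \<in> P0" "q \<in> blk p" for p q
  proof (cases "p = q")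
    case True
    let ?r = "r0 p"
    have r: "?r \<in> P0" "p \<in> blk ?r" "?r \<in> blk p" using r0_J[OF pq(1)] J_in by (auto simp: blk_def pq)
    have "E0 p ?r \<odot> E0 ?r p = E0 p p" "E0 ?r p \<odot> E0 p ?r = E0 ?r ?r" using E_mul[of p ?r ?r p] E_mul[of ?r p p ?r] pq r by auto
    thus ?thesis using f[of "E0 p ?r" "E0 ?r p"] True by simp
  next
    case False
    have q: "q \<in> P0" "q \<in> blk q" using pq blk_in blk_self by auto
    have "E0 p q \<odot> E0 q q = E0 p q" "E0 q q \<odot> E0 p q = 0" using E_mul[of p q q q] E_mul[of q q p q] pq q False by auto
    thus ?thesis using f[of "E0 p q" "E0 q q"] False by simp
  qed
  have "f \<cdot> x = (\<Sum>p\<in>P0. \<Sum>q\<in>blk p. c0 p q x * f \<cdot> E0 p q)"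
    by (subst E_expand'[of x]) (simp add: pr_sum pr_scale)
  also have "\<dots> = (\<Sum>p\<in>P0. \<Sum>q\<in>blk p. if q = p then c0 p p x * f \<cdot> E0 (r0 p) (r0 p) else 0)"
    by (intro sum.cong refl) (auto simp: fE)
  also have "\<dots> = (\<Sum>p\<in>P0. c0 p p x * f \<cdot> E0 (r0 p) (r0 p))" using blk_self by (intro sum.cong refl) simp
  also have "\<dots> = (\<Sum>j\<in>J. \<Sum>p\<in>{p\<in>P0. r0 p = j}. c0 p p x * f \<cdot> E0 (r0 p) (r0 p))"
    by (rule sum.group[symmetric]) (use r0_J in auto)
  also have "\<dots> = (\<Sum>j\<in>J. (f \<cdot> E0 j j) * chi j \<cdot> x)"
    by (intro sum.cong refl) (auto simp: chi sum_distrib_left mult.commute blk_def J_def intro!: sum.cong)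
  finally show "f \<cdot> x = (\<Sum>p\<in>J. (f \<cdot> E0 p p) *s chi p) \<cdot> x" by (simp add: pr_sum pr_scale)
qed

lemma trc_E: "linv T \<Longrightarrow> trc T = (\<Sum>p\<in>P0. \<Sum>q\<in>blk p. c0 p q (T (E0 p q)))"
proof -
  assume T: "linv T"
  have "trc T = (\<Sum>s\<in>Sigma P0 blk. (\<lambda>(p,q). c0 p q) s (T ((\<lambda>(p,q). E0 p q) s)))"
  proof (rule trc_family)
    fix x show "x = (\<Sum>s\<in>Sigma P0 blk. (\<lambda>(p,q). c0 p q) s x *s (\<lambda>(p,q). E0 p q) s)"
      using E_expand[of x] by (simp add: split_beta)
  qed (auto intro: c_lin T)
  thus ?thesis by (simp add: sum.Sigma split_beta)
qed

lemma sum_P0: "(\<Sum>p\<in>P0. f p) = (\<Sum>j\<in>J. \<Sum>p\<in>blk j. f p)"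
proof -
  have "(\<Sum>p\<in>P0. f p) = (\<Sum>j\<in>J. \<Sum>p\<in>{p\<in>P0. r0 p = j}. f p)"
    by (rule sum.group[symmetric]) (use r0_J in auto)
  also have "\<dots> = (\<Sum>j\<in>J. \<Sum>p\<in>blk j. f p)" by (intro sum.cong refl) (auto simp: blk_def J_def)
  finally show ?thesis .
qed

text \<open>Every row of a matrix block is a copy of the simple module, and the number of rows is
  the degree.\<close>

lemma trc_right: "trc (\<lambda>x. x \<odot> h) = (\<Sum>j\<in>J. of_nat (card (blk j)) * chi j \<cdot> h)"
proof -
  have "trc (\<lambda>x. x \<odot> h) = (\<Sum>p\<in>P0. \<Sum>q\<in>blk p. c0 q q h)"
    unfolding trc_E[OF linv_bm(1)]
  proof (intro sum.cong refl)
    fix p q assume pq: "p \<in> P0" "q \<in> blk p"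
    have "c0 p q (E0 p q \<odot> h) = (\<Sum>s\<in>blk p. c0 p s (E0 p q) * c0 s q h)" by (rule c_mul[OF pq])
    also have "\<dots> = (\<Sum>s\<in>blk p. if s = q then c0 q q h else 0)"
      using pq by (intro sum.cong refl) (auto simp: c_E)
    finally show "c0 p q (E0 p q \<odot> h) = c0 q q h" using pq by simp
  qed
  also have "\<dots> = (\<Sum>j\<in>J. \<Sum>p\<in>blk j. \<Sum>q\<in>blk j. c0 q q h)"
    unfolding sum_P0 by (intro sum.cong refl) (auto dest: blk_sym)
  also have "\<dots> = (\<Sum>j\<in>J. of_nat (card (blk j)) * chi j \<cdot> h)" by (simp add: chi)
  finally show ?thesis .
qed

lemma card_sum: "(\<Sum>j\<in>J. card (blk j) ^ 2) = CARD('i)"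
proof -
  have "of_nat CARD('i) = trc (\<lambda>x::'k^'i. x \<odot> u)" by (simp add: trc_def)
  also have "\<dots> = of_nat (\<Sum>j\<in>J. card (blk j) ^ 2)"
    unfolding trc_right by (simp add: chi_unit power2_eq_square)
  finally have "(of_nat CARD('i) :: 'k) = of_nat (\<Sum>j\<in>J. card (blk j) ^ 2)" .
  thus ?thesis by (subst (asm) of_nat_eq_iff) simp
qed

text \<open>Nondegeneracy of the trace form: multiplication by a matrix unit followed by the
  character reads off one matrix coefficient.\<close>

lemma chi_separate:
  assumes "\<And>p y. p \<in> J \<Longrightarrow> chi p \<cdot> (x \<odot> y) = 0" shows "x = 0"
proof -
  have "c0 p q x = 0" if pq: "p \<in> P0" "q \<in> blk p" for p q
  proof -
    let ?j = "r0 p"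
    have q: "q \<in> P0" "p \<in> blk q" "q \<in> blk q" "blk q = blk p" using pq blk_in blk_self blk_sym by auto
    have "chi ?j \<cdot> (x \<odot> E0 q p) = (\<Sum>s\<in>blk q. c0 s q x * chi ?j \<cdot> E0 s p)"
      using q by (simp add: E_right pr_sum pr_scale)
    also have "\<dots> = (\<Sum>s\<in>blk q. if s = p then c0 p q x else 0)"
      using q pq r0_J[OF pq(1)] by (intro sum.cong refl) (auto simp: chi_E blk_def)
    finally show ?thesis using q assms[OF r0_J(1)[OF pq(1)]] by simp
  qed
  hence "x = (\<Sum>p\<in>P0. \<Sum>q\<in>blk p. 0)" by (subst E_expand'[of x]) simp
  thus ?thesis by simp
qed

definition rep where
  "rep X R \<longleftrightarrow> finite X \<and> (\<forall>a\<in>X. \<forall>b\<in>X. lin (R a b)) \<and>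
    (\<forall>x y. \<forall>a\<in>X. \<forall>c\<in>X. R a c (x \<odot> y) = (\<Sum>b\<in>X. R a b x * R b c y))"

text \<open>The multiplicity of an irreducible character is the trace of the idempotent matrix that
  represents a primitive idempotent, hence a natural number.\<close>

lemma rep_char:
  assumes R: "rep X R" shows "\<exists>m::'k ^ 'i \<Rightarrow> nat. vof (\<lambda>x. \<Sum>a\<in>X. R a a x) = (\<Sum>f\<in>Irr. of_nat (m f) *s f)"
proof -
  let ?f = "vof (\<lambda>x. \<Sum>a\<in>X. R a a x)"
  have f: "?f \<cdot> x = (\<Sum>a\<in>X. R a a x)" for x
    using R by (intro vof_pr lin_sumI) (auto simp: rep_def)
  have "?f \<cdot> (x \<odot> y) = ?f \<cdot> (y \<odot> x)" for x y
  proof -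
    have 1: "?f \<cdot> (x \<odot> y) = (\<Sum>a\<in>X. \<Sum>b\<in>X. R a b x * R b a y)" for x y
      unfolding f using R by (simp add: rep_def)
    show ?thesis unfolding 1 by (subst sum.swap) (simp add: mult.commute)
  qed
  hence e: "?f = (\<Sum>p\<in>J. (?f \<cdot> E0 p p) *s chi p)" by (rule trace_expand)
  have "\<exists>m::nat. ?f \<cdot> E0 p p = of_nat m" if p: "p \<in> J" for p
  proof -
    have "\<exists>m::nat. m \<le> card X \<and> (\<Sum>a\<in>X. R a a (E0 p p)) = of_nat m \<and> (m = 0 \<longrightarrow> (\<forall>a\<in>X. \<forall>b\<in>X. R a b (E0 p p) = 0))"
    proof (rule idempotent_trace_nat)
      fix a c assume "a \<in> X" "c \<in> X"
      moreover have "E0 p p \<odot> E0 p p = E0 p p" using E_mul[of p p p p] p J_in blk_self by auto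
      ultimately show "(\<Sum>b\<in>X. R a b (E0 p p) * R b c (E0 p p)) = R a c (E0 p p)"
        using R unfolding rep_def by metis
    qed (use R in \<open>simp add: rep_def\<close>)
    thus ?thesis by (auto simp: f)
  qed
  then obtain m where m: "\<And>p. p \<in> J \<Longrightarrow> ?f \<cdot> E0 p p = of_nat (m p)" by metis
  have "?f = (\<Sum>p\<in>J. of_nat (m (the_inv_into J chi (chi p))) *s chi p)"
    by (subst e, intro sum.cong refl) (simp add: m the_inv_into_f_f inj_chi)
  also have "\<dots> = (\<Sum>f\<in>Irr. of_nat (m (the_inv_into J chi f)) *s f)"
    unfolding Irr_def by (simp add: sum.reindex inj_chi)
  finally show ?thesis by (intro exI[of _ "\<lambda>f. m (the_inv_into J chi f)"])
qed

end

section \<open>Roots of unity and automorphisms of finite order\<close>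

definition prim_root :: "nat \<Rightarrow> 'a::field \<Rightarrow> bool" where
  "prim_root m w \<longleftrightarrow> (\<forall>l. w ^ l = 1 \<longleftrightarrow> m dvd l)"

lemma prim_rootD: "prim_root m w \<Longrightarrow> w ^ m = 1"
  by (simp add: prim_root_def)

lemma root_prime_coprime:
  fixes w :: "'a::field"
  assumes p: "prime (p::nat)" "w ^ p = 1" "w ^ t = 1" "\<not> p dvd t" shows "w = 1"
proof -
  have "coprime p t" using p prime_imp_coprime by blast
  moreover obtain x y where "p * x = t * y + gcd p t" using bezout_nat[of p t] p(1) by (auto simp: prime_gt_0_nat)
  ultimately have "w ^ (p * x) = w ^ (t * y) * w" by simp
  thus ?thesis using p by (simp add: power_mult)
qed

text \<open>The order is built up one prime at a time. A p-th root \<open>w\<close> of a primitive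
  root of order m' works unless w^m' = 1. In that case p does not divide m', and a factor of order p
  repairs it.\<close>

lemma prim_root_exists:
  assumes "m > 0" shows "\<exists>w::'k::{alg_closed_field,field_char_0}. prim_root m w"
  using assms
proof (induction m rule: less_induct)
  case (less m)
  show ?case
  proof (cases "m = 1")
    case True thus ?thesis by (intro exI[of _ 1]) (simp add: prim_root_def)
  next
    case False
    then obtain p where p: "prime p" "p dvd m" using prime_factor_nat by blast
    then obtain m' where m: "m = p * m'" by (auto elim: dvdE)
    have m': "m' > 0" "m' < m" using less.prems p(1) prime_gt_1_nat[OF p(1)] by (auto simp: m)
    then obtain w' :: 'k where w': "prim_root m' w'" using less.IH by blast
    have p0: "p > 0" using p(1) prime_gt_0_nat by blast
    have ok: "prim_root m w" if w: "w ^ p = w'" "w ^ m' \<noteq> 1" for w :: 'k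
    proof -
      have "w ^ l = 1 \<longleftrightarrow> m dvd l" for l
      proof
        assume "m dvd l"
        then obtain t where "l = m * t" by blast
        hence "w ^ l = (w' ^ m') ^ t" by (simp add: m power_mult w(1))
        thus "w ^ l = 1" using prim_rootD[OF w'] by simp
      next
        assume l: "w ^ l = 1"
        have "w' ^ l = (w ^ l) ^ p" by (simp add: w(1)[symmetric] power_mult[symmetric] mult.commute)
        hence "m' dvd l" using l w' by (simp add: prim_root_def)
        then obtain t where t: "l = m' * t" by blast
        have "(w ^ m') ^ p = w' ^ m'" by (simp add: w(1)[symmetric] power_mult[symmetric] mult.commute)
        hence "(w ^ m') ^ p = 1" using prim_rootD[OF w'] by simp
        moreover have "(w ^ m') ^ t = 1" using l by (simp add: t power_mult)
        ultimately have "p dvd t" using root_prime_coprime[OF p(1)] w(2) by blast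
        thus "m dvd l" by (simp add: t m)
      qed
      thus ?thesis by (simp add: prim_root_def)
    qed
    obtain w :: 'k where w: "w ^ p = w'" using nth_root_exists[OF p0] by blast
    show ?thesis
    proof (cases "w ^ m' = 1")
      case False thus ?thesis using ok[OF w] by blast
    next
      case True
      have npm: "\<not> p dvd m'"
      proof
        assume "p dvd m'"
        then obtain s where s: "m' = p * s" by blast
        hence "w' ^ s = 1" using True by (simp add: power_mult w)
        hence "m' dvd s" using w' by (simp add: prim_root_def)
        thus False using s m' prime_gt_1_nat[OF p(1)] by (auto dest!: dvd_imp_le)
      qed
      \<comment> \<open>A root of 1 + x + ... + x^(p-1) is a p-th root of unity, and it differs from
        1 because the sum equals p at 1.\<close>
      obtain z :: 'k where z: "(\<Sum>k\<le>p-1. 1 * z ^ k) = 0"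
        using alg_closed[of "p - 1" "\<lambda>_. 1::'k"] prime_gt_1_nat[OF p(1)] by auto
      have "{..p-1} = {..<p}" using p0 by auto
      hence z': "(\<Sum>k<p. z ^ k) = 0" using z by simp
      hence "z \<noteq> 1" using p0 by auto
      moreover have zp: "z ^ p = 1" using z' power_diff_1_eq[of z p] by (simp add: lessThan_atLeast0)
      ultimately have "z ^ m' \<noteq> 1" using root_prime_coprime[OF p(1)] npm by blast
      moreover have "(w * z) ^ p = w'" by (simp add: power_mult_distrib w zp)
      ultimately show ?thesis using ok[of "w * z"] True by (auto simp: power_mult_distrib)
    qed
  qed
qed

lemma prim_root_sum:
  fixes w :: "'a::field_char_0"
  assumes w: "prim_root m w" and m: "m > 0"
  shows "(\<Sum>j<m. w ^ (j * n)) = (if m dvd n then of_nat m else 0)"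
proof (cases "m dvd n")
  case True
  hence "w ^ n = 1" using w by (simp add: prim_root_def)
  hence "w ^ (j * n) = 1" for j by (simp add: power_mult mult.commute[of j])
  thus ?thesis using True by simp
next
  case False
  hence "w ^ n \<noteq> 1" using w by (simp add: prim_root_def)
  moreover have "(w ^ n) ^ m = 1" using prim_rootD[OF w] by (simp add: power_mult[symmetric] mult.commute[of n]) (simp add: power_mult)
  hence "(w ^ n - 1) * (\<Sum>j<m. (w ^ n) ^ j) = 0" using power_diff_1_eq[of "w ^ n" m] by (simp add: lessThan_atLeast0)
  ultimately show ?thesis using False by (simp add: power_mult[symmetric] mult.commute)
qed

lemma prim_root_nonzero: "prim_root m w \<Longrightarrow> m > 0 \<Longrightarrow> w \<noteq> 0"
  unfolding prim_root_def by (metis dvd_refl power_0_left zero_neq_one less_numeral_extra(3))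

section \<open>Rational polynomials as a common source of relations in two fields\<close>

text \<open>The same rational polynomial is evaluated in \<open>k\<close> and in the complex
  numbers, which allows vanishing to be carried from one to the other.\<close>

definition ev :: "rat poly \<Rightarrow> 'a::field_char_0 \<Rightarrow> 'a" where "ev p x = poly (map_poly of_rat p) x"

lemma ev_pCons [simp]: "ev (pCons a p) x = of_rat a + x * ev p x"
  by (simp add: ev_def map_poly_pCons)

lemma ev_0 [simp]: "ev 0 x = 0" by (simp add: ev_def)

lemma ev_add [simp]: "ev (p + q) x = ev p x + ev q x"
  by (induction p q rule: poly_induct2) (simp_all add: of_rat_add algebra_simps)

lemma ev_smult [simp]: "ev (smult a p) x = of_rat a * ev p x"
  by (induction p) (simp_all add: of_rat_mult algebra_simps)

lemma ev_mult [simp]: "ev (p * q) x = ev p x * ev q x"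
  by (induction p) (simp_all add: algebra_simps)

lemma ev_sum [simp]: "ev (sum f A) x = (\<Sum>a\<in>A. ev (f a) x)"
  by (induction A rule: infinite_finite_induct) auto

lemma ev_1 [simp]: "ev 1 x = 1" unfolding one_pCons by (simp only: ev_pCons) simp

lemma ev_monom [simp]: "ev (monom a n) x = of_rat a * x ^ n"
  by (induction n) (simp_all add: monom_0 monom_Suc)

lemma ev_root_poly: "ev (monom 1 m - 1) y = y ^ m - 1"
  using ev_add[of "monom 1 m - 1" 1 y] by (simp add: algebra_simps)

text \<open>The two roots have the same minimal polynomial over the rational numbers.\<close>

lemma transfer_root:
  fixes w :: "'k::field_char_0"
  assumes C: "ev C w = 0" and w: "w ^ m = 1" and m: "m > 0"
  shows "\<exists>z::complex. z ^ m = 1 \<and> ev C z = 0"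
proof -
  define Q where "Q p \<longleftrightarrow> p \<noteq> 0 \<and> ev p w = 0" for p
  let ?x = "monom 1 m - 1 :: rat poly"
  note em = ev_root_poly
  have "coeff ?x m \<noteq> coeff 0 m" using m by simp
  hence "?x \<noteq> 0" by metis
  hence "Q ?x" using w by (simp add: Q_def em)
  then obtain p where p: "Q p" "\<And>q. Q q \<Longrightarrow> degree p \<le> degree q"
    using ex_has_least_nat[of Q ?x degree] by auto
  have dvd: "p dvd q" if "ev q w = 0" for q
  proof -
    have "q = q div p * p + q mod p" by simp
    hence "ev q w = ev (q div p) w * ev p w + ev (q mod p) w" by (metis ev_add ev_mult)
    hence 0: "ev (q mod p) w = 0" using p(1) that by (simp add: Q_def)
    have "q mod p = 0"
    proof (rule ccontr)
      assume nz: "q mod p \<noteq> 0"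
      hence "degree p \<le> degree (q mod p)" using p(2) 0 by (simp add: Q_def)
      moreover have "degree (q mod p) < degree p" using p(1) nz degree_mod_less'[of p q] by (simp add: Q_def)
      ultimately show False by simp
    qed
    thus ?thesis by (simp add: mod_eq_0_iff_dvd)
  qed
  have "degree p > 0"
  proof (rule ccontr)
    assume "\<not> degree p > 0"
    then obtain a where "p = [:a:]" by (auto elim: degree_eq_zeroE)
    thus False using p(1) by (simp add: Q_def)
  qed
  hence "degree (map_poly of_rat p :: complex poly) > 0" by (simp add: degree_map_poly)
  then obtain z :: complex where z: "ev p z = 0" unfolding ev_def using alg_closed_imp_poly_has_root by blast
  obtain q where "C = p * q" using dvd[OF C] by blast
  hence "ev C z = 0" using z by simp
  obtain q where "?x = p * q" using dvd[of ?x] w by (auto simp: em)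
  hence "ev ?x z = 0" using z by (metis ev_mult mult_zero_left)
  thus ?thesis using \<open>ev C z = 0\<close> by (auto simp: em)
qed

section \<open>Powers of an element and its spectral projections\<close>

context fin_alg
begin

definition pw where "pw x n = ((\<lambda>y. x \<odot> y) ^^ n) u"

lemma pw_0 [simp]: "pw x 0 = u" and pw_Suc [simp]: "pw x (Suc n) = x \<odot> pw x n"
  by (simp_all add: pw_def)

lemma pw_add: "pw x (a + b) = pw x a \<odot> pw x b"
  by (induction a) (simp_all add: mul_assoc)

lemma pw_scale: "pw (c *s x) n = (c ^ n) *s pw x n"
  by (induction n) (simp_all add: bm_scale)

text \<open>If \<open>t ^ (m + 1) = t\<close>, then \<open>t\<close> is diagonalizable with eigenvalues zero or \<open>m\<close>-th roots of unity;
  \<open>cyc w m t j\<close> is the projection on the eigenspace of \<open>w ^ j\<close>.\<close>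

definition cyc where
  "cyc w m t j = (1 / of_nat m) *s (\<Sum>l\<in>{1..m}. (inverse w ^ (j * l)) *s pw t l)"

text \<open>The element \<open>t\<close> need not be invertible, so its zeroth power may differ from
  its m-th one. Periodicity therefore starts at exponent 1, and all windows are
  \<open>{1..m}\<close>.\<close>

lemma periodic_sum:
  fixes g :: "nat \<Rightarrow> 'b::ab_group_add"
  assumes "\<And>n. n \<ge> 1 \<Longrightarrow> g (n + m) = g n"
  shows "(\<Sum>b\<in>{1..m}. g (a + b)) = (\<Sum>b\<in>{1..m}. g b)"
proof (induction a)
  case (Suc a)
  have "(\<Sum>b\<in>{1..m}. g (Suc a + b)) = (\<Sum>b\<in>{1..m}. g (a + b))"
  proof -
    have "(\<Sum>b\<in>{1..m}. g (Suc a + b)) + g (a + 1) = (\<Sum>b\<in>{1..Suc m}. g (a + b))"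
    proof -
      have "(\<Sum>b\<in>{1..Suc m}. g (a + b)) = g (a + 1) + (\<Sum>b\<in>{Suc 1..Suc m}. g (a + b))"
        by (subst sum.atLeast_Suc_atMost) auto
      also have "(\<Sum>b\<in>{Suc 1..Suc m}. g (a + b)) = (\<Sum>b\<in>{1..m}. g (Suc a + b))"
        by (subst sum.atLeast_Suc_atMost_Suc_shift) simp
      finally show ?thesis by simp
    qed
    also have "\<dots> = (\<Sum>b\<in>{1..m}. g (a + b)) + g (a + 1)"
      using assms[of "a + 1"] by (simp add: algebra_simps)
    finally show ?thesis by simp
  qed
  thus ?case using Suc by simp
qed simp

context
  fixes t :: "'k ^ 'i" and m :: nat and w :: 'k
  assumes t: "pw t (Suc m) = t" and m: "m > 0" and w: "prim_root m w"
begin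

lemma pw_period: "n \<ge> 1 \<Longrightarrow> pw t (n + m) = pw t n"
proof -
  assume "n \<ge> 1"
  then obtain k where n: "n = k + 1" by (metis add.commute le_Suc_ex)
  have "pw t (k + Suc m) = pw t k \<odot> pw t (Suc m)" by (rule pw_add)
  also have "\<dots> = pw t k \<odot> pw t 1" unfolding t by simp
  also have "\<dots> = pw t (k + 1)" by (rule pw_add[symmetric])
  finally show ?thesis by (simp add: n)
qed

lemma w_inv: "inverse w ^ m = 1" "w * inverse w = 1"
  using prim_rootD[OF w] prim_root_nonzero[OF w m] by (auto simp: power_inverse)

lemma cyc_idem: "cyc w m t j \<odot> cyc w m t j = cyc w m t j"
proof -
  define g where "g n = (inverse w ^ (j * n)) *s pw t n" for n
  have gm: "g (n + m) = g n" if "n \<ge> 1" for n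
  proof -
    have "inverse w ^ (j * (n + m)) = inverse w ^ (j * n) * (inverse w ^ m) ^ j"
      by (simp only: distrib_left power_add power_mult[symmetric] mult.commute[of m])
    thus ?thesis using w_inv(1) by (simp only: g_def pw_period[OF that]) simp
  qed
  have gg: "g a \<odot> g b = g (a + b)" for a b
    by (simp add: g_def bm_scale pw_add algebra_simps power_add)
  have c: "cyc w m t j = (1 / of_nat m) *s (\<Sum>l\<in>{1..m}. g l)" by (simp add: cyc_def g_def)
  have "(\<Sum>l\<in>{1..m}. g l) \<odot> (\<Sum>l\<in>{1..m}. g l) = (\<Sum>a\<in>{1..m}. \<Sum>b\<in>{1..m}. g (a + b))"
    by (subst bm_sum(1), subst bm_sum(2)) (simp add: gg)
  also have "\<dots> = of_nat m *s (\<Sum>l\<in>{1..m}. g l)"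
  proof -
    have "(\<Sum>b\<in>{1..m}. g (a + b)) = (\<Sum>b\<in>{1..m}. g b)" for a
      by (rule periodic_sum) (rule gm)
    thus ?thesis by (simp only: vec.sum_constant_scale) simp
  qed
  finally show ?thesis using m by (simp add: c bm_scale)
qed

lemma cyc_sum: assumes l: "l \<ge> 1" shows "(\<Sum>j<m. (w ^ (j * l)) *s cyc w m t j) = pw t l"
proof -
  have main: "(\<Sum>j<m. (w ^ (j * l)) *s cyc w m t j) = pw t l" if l: "1 \<le> l" "l \<le> m" for l
  proof -
    have "(\<Sum>j<m. (w ^ (j * l)) *s cyc w m t j) 
      = (\<Sum>j<m. \<Sum>l'\<in>{1..m}. (1 / of_nat m * (w ^ (j * l) * inverse w ^ (j * l'))) *s pw t l')"
      unfolding cyc_def vec.scale_sum_right by (simp add: mult_ac)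
    also have "\<dots> = (\<Sum>l'\<in>{1..m}. (1 / of_nat m * (\<Sum>j<m. w ^ (j * l) * inverse w ^ (j * l'))) *s pw t l')"
      by (subst sum.swap) (simp add: vec.scale_sum_left sum_distrib_left)
    also have "\<dots> = (\<Sum>l'\<in>{1..m}. if l' = l then pw t l else 0)"
    proof (rule sum.cong[OF refl])
      fix l' assume l': "l' \<in> {1..m}"
      \<comment> \<open>Adding m to the exponent replaces the negative power of \<open>w\<close> by
        a natural one, as orthogonality of roots of unity requires.\<close>
      have "w ^ (j * l) * inverse w ^ (j * l') = w ^ (j * (l + (m - l')))" for j
      proof -
        have "w ^ (j * (l + (m - l'))) * w ^ (j * l') = w ^ (j * l) * (w ^ m) ^ j"
        proof -
          have "l + (m - l') + l' = l + m" using l' by simp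
          hence "j * (l + (m - l')) + j * l' = j * l + m * j" by (metis distrib_left mult.commute)
          thus ?thesis by (simp only: power_add[symmetric] power_mult[symmetric])
        qed
        also have "w ^ m = 1" by (rule prim_rootD[OF w])
        finally have "w ^ (j * (l + (m - l'))) * w ^ (j * l') * inverse w ^ (j * l') = w ^ (j * l) * inverse w ^ (j * l')" by simp
        moreover have "w ^ (j * l') * inverse w ^ (j * l') = 1" using w_inv(2) by (simp add: power_mult_distrib[symmetric])
        ultimately show ?thesis by (simp add: mult.assoc)
      qed
      hence "(\<Sum>j<m. w ^ (j * l) * inverse w ^ (j * l')) = (if m dvd l + (m - l') then of_nat m else 0)"
        by (simp add: prim_root_sum[OF w m])
      also have "m dvd l + (m - l') \<longleftrightarrow> l' = l"
      proof
        assume "m dvd l + (m - l')"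
        then obtain q where q: "l + (m - l') = m * q" by blast
        moreover have "l + (m - l') < m * 2" "l + (m - l') > 0" using l l' by auto
        ultimately have "m * q < m * 2" "m * q > 0" by auto
        hence "q = 1" by auto
        thus "l' = l" using q l l' by auto
      qed (use l in auto)
      finally show "(1 / of_nat m * (\<Sum>j<m. w ^ (j * l) * inverse w ^ (j * l'))) *s pw t l' = (if l' = l then pw t l else 0)"
        using m by simp
    qed
    also have "\<dots> = pw t l" using l by simp
    finally show ?thesis .
  qed
  show ?thesis using l
  proof (induction l rule: less_induct)
    case (less l)
    show ?case
    proof (cases "l \<le> m")
      case True thus ?thesis using main less.prems by blast
    next
      case False
      then obtain k where k: "l = k + m" "k \<ge> 1" "k < l"
        using m that[of "l - m"] by force
      have "w ^ (j * l) = w ^ (j * k)" for j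

      proof -
        have "w ^ (j * (k + m)) = w ^ (j * k) * (w ^ m) ^ j"
          by (simp only: distrib_left power_add power_mult[symmetric] mult.commute[of m])
        thus ?thesis using prim_rootD[OF w] by (simp add: k(1))
      qed
      thus ?thesis using less.IH[OF k(3) k(2)] pw_period[OF k(2)] by (simp add: k(1))
    qed
  qed
qed

end

end

section \<open>The trace of an automorphism of finite order\<close>

context ss_alg
begin

lemma c_chi: assumes p: "p \<in> J" and ab: "a \<in> blk p" "b \<in> blk p"
  shows "c0 a b x = chi p \<cdot> (x \<odot> E0 b a)"
proof -
  have b: "b \<in> P0" "a \<in> blk b" "blk b = blk p" using ab blk_in blk_sym by auto
  have "chi p \<cdot> (x \<odot> E0 b a) = (\<Sum>q\<in>blk b. c0 q b x * chi p \<cdot> E0 q a)"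
    by (simp add: E_right[OF b(1,2)] pr_sum pr_scale)
  also have "\<dots> = (\<Sum>q\<in>blk b. if q = a then c0 a b x else 0)"
    using b ab blk_in blk_sym by (intro sum.cong refl) (auto simp: chi_E[OF p])
  finally show ?thesis using b by simp
qed

text \<open>The numbers \<open>r j\<close> are the multiplicities of the eigenvalues w^j of
  \<open>t\<close> in the representation. The eigenvalue zero is invisible in them, hence the
  restriction to exponents at least 1.\<close>

lemma cyc_chi:
  assumes p: "p \<in> J" and t: "pw t (Suc m) = t" and m: "m > 0" and w: "prim_root m w"
  obtains r :: "nat \<Rightarrow> nat" where "\<And>j. chi p \<cdot> cyc w m t j = of_nat (r j)"
    "\<And>l. l \<ge> 1 \<Longrightarrow> chi p \<cdot> pw t l = (\<Sum>j<m. of_nat (r j) * w ^ (j * l))"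
proof -
  have "\<exists>n::nat. chi p \<cdot> cyc w m t j = of_nat n" for j
    using chi_idem[OF p cyc_idem[OF t m w, of j]] by blast
  then obtain r :: "nat \<Rightarrow> nat" where r: "\<And>j. chi p \<cdot> cyc w m t j = of_nat (r j)" by metis
  have "chi p \<cdot> pw t l = (\<Sum>j<m. of_nat (r j) * w ^ (j * l))" if "l \<ge> 1" for l
    unfolding cyc_sum[OF t m w that, symmetric] by (simp add: pr_sum pr_scale r mult.commute)
  thus ?thesis using that r by blast
qed

text \<open>The central idempotent that is the unit of the block of \<open>p\<close>.\<close>

definition z0 where "z0 p = (\<Sum>q\<in>blk p. E0 q q)"

lemma z0_c: assumes "p \<in> P0" "a \<in> P0" "b \<in> blk a" shows "c0 a b (z0 p) = (if a = b \<and> a \<in> blk p then 1 else 0)"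
proof -
  have "c0 a b (z0 p) = (\<Sum>q\<in>blk p. if q = a then (if a = b then 1 else 0) else 0)"
    unfolding z0_def lin_sum[OF c_lin[OF assms(2,3)]] using assms blk_in blk_self
    by (intro sum.cong refl) (auto simp: c_E)
  thus ?thesis by auto
qed

lemma c_eq: assumes "\<And>a b. a \<in> P0 \<Longrightarrow> b \<in> blk a \<Longrightarrow> c0 a b x = c0 a b y" shows "x = y"
  by (subst E_expand'[of x], subst E_expand'[of y]) (simp add: assms)

lemma c_z0: assumes "p \<in> P0" "a \<in> P0" "b \<in> blk a"
  shows "c0 a b (x \<odot> z0 p) = (if a \<in> blk p then c0 a b x else 0)"
    "c0 a b (z0 p \<odot> x) = (if a \<in> blk p then c0 a b x else 0)"
proof -
  have b: "b \<in> P0" "blk b = blk a" using assms blk_in blk_sym by auto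
  have ab: "b \<in> blk p \<longleftrightarrow> a \<in> blk p" using assms by (auto simp: blk_def)
  have "c0 a b (x \<odot> z0 p) = (\<Sum>s\<in>blk a. if s = b then (if b \<in> blk p then c0 a b x else 0) else 0)"
    unfolding c_mul[OF assms(2,3)]
  proof (intro sum.cong refl)
    fix s assume s: "s \<in> blk a"
    have "s \<in> P0" "b \<in> blk s" using s assms b blk_in blk_sym by auto
    thus "c0 a s x * c0 s b (z0 p) = (if s = b then (if b \<in> blk p then c0 a b x else 0) else 0)"
      by (simp add: z0_c[OF assms(1)])
  qed
  thus "c0 a b (x \<odot> z0 p) = (if a \<in> blk p then c0 a b x else 0)" using assms ab by simp
  have "c0 a b (z0 p \<odot> x) = (\<Sum>s\<in>blk a. if s = a then (if a \<in> blk p then c0 a b x else 0) else 0)"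
    unfolding c_mul[OF assms(2,3)] using assms by (intro sum.cong refl) (auto simp: z0_c)
  thus "c0 a b (z0 p \<odot> x) = (if a \<in> blk p then c0 a b x else 0)" using assms blk_self by simp
qed

lemma z0_central: "p \<in> P0 \<Longrightarrow> z0 p \<odot> x = x \<odot> z0 p"
  by (rule c_eq) (simp add: c_z0)

lemma z0_idem: assumes p: "p \<in> P0" shows "z0 p \<odot> z0 p = z0 p"
proof (rule c_eq)
  fix a b assume ab: "a \<in> P0" "b \<in> blk a"
  show "c0 a b (z0 p \<odot> z0 p) = c0 a b (z0 p)"
    unfolding c_z0(1)[OF p ab] z0_c[OF p ab] by auto
qed

lemma chi_z0: "p \<in> J \<Longrightarrow> chi p \<cdot> z0 p = of_nat (card (blk p))"
proof -
  assume p: "p \<in> J"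
  have "chi p \<cdot> z0 p = (\<Sum>q\<in>blk p. 1)" unfolding chi[OF p]
    using p J_in blk_in blk_self by (intro sum.cong refl) (simp add: z0_c)
  thus ?thesis by simp
qed

text \<open>Schur's lemma: \<open>E0 q q\<close> factors through \<open>p\<close>, so the
  coefficient at \<open>p\<close> is the scalar for all of the block.\<close>

lemma central_block:
  assumes p: "p \<in> P0" and y: "\<And>x. y \<odot> x = x \<odot> y" shows "z0 p \<odot> y = c0 p p y *s z0 p"
proof -
  have "E0 q q \<odot> y = c0 p p y *s E0 q q" if q: "q \<in> blk p" for q
  proof -
    have q': "q \<in> P0" "p \<in> blk p" "p \<in> blk q" using p q blk_in blk_self blk_sym by auto
    have "E0 q q = E0 q p \<odot> E0 p q" using E_mul[of q p p q] p q q' by simp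
    hence "E0 q q \<odot> y = E0 q p \<odot> y \<odot> E0 p q" using y[of "E0 p q"] by (simp add: mul_assoc)
    also have "\<dots> = c0 p p y *s E0 q q" by (rule E_sandwich) (use p q q' in auto)
    finally show ?thesis .
  qed
  thus ?thesis by (simp add: z0_def bm_sum(1) vec.scale_sum_right)
qed

context
  fixes \<sigma> :: "'k ^ 'i \<Rightarrow> 'k ^ 'i" and m :: nat and w :: 'k
  assumes \<sigma>: "linv \<sigma>" and \<sigma>_mul: "\<And>x y. \<sigma> (x \<odot> y) = \<sigma> x \<odot> \<sigma> y" and \<sigma>_order: "\<And>x. (\<sigma> ^^ m) x = x"
    and m: "m > 0" and w: "prim_root m w"
begin

text \<open>Skolem-Noether: the hypothesis on \<open>y\<close> says that \<sigma> does not move the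
  block away, and then \<sigma> is conjugation by some \<open>t\<close> on it. As the m-th power of
  \<sigma> is the identity, t^m is central, hence a scalar on the block, and division by an m-th
  root normalizes it.\<close>

lemma block_conjugator:
  assumes p: "p \<in> J" and y: "\<sigma> (E0 p p) \<odot> y \<odot> E0 p p \<noteq> 0"
  shows "\<exists>t. (\<forall>x. t \<odot> x = \<sigma> x \<odot> t) \<and> z0 p \<odot> t = t \<and> pw t m = z0 p"
proof -
  note pP = J_in[OF p]
  \<comment> \<open>The relations of the matrix units make this sum an intertwiner for every
    \<open>y\<close>; the hypothesis on \<open>y\<close> only guarantees that it is nonzero.\<close>
  define t0 where "t0 = (\<Sum>q\<in>blk p. \<sigma> (E0 q p) \<odot> y \<odot> E0 p q)"
  have pb: "p \<in> blk q" "q \<in> P0" "blk q = blk p" if "q \<in> blk p" for q using that blk_in blk_sym blk_self pP by auto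
  have base: "t0 \<odot> E0 a b = \<sigma> (E0 a b) \<odot> t0" if ab: "a \<in> P0" "b \<in> blk a" for a b
  proof -
    have iff: "a \<in> blk p \<longleftrightarrow> b \<in> blk p" using ab by (auto simp: blk_def)
    have "t0 \<odot> E0 a b = (\<Sum>q\<in>blk p. \<sigma> (E0 q p) \<odot> y \<odot> (E0 p q \<odot> E0 a b))"
      by (simp add: t0_def bm_sum(1) mul_assoc)
    also have "\<dots> = (\<Sum>q\<in>blk p. if q = a then \<sigma> (E0 a p) \<odot> y \<odot> E0 p b else 0)"
      using ab pP by (intro sum.cong refl) (simp add: E_mul)
    also have "\<dots> = (if a \<in> blk p then \<sigma> (E0 a p) \<odot> y \<odot> E0 p b else 0)" by simp
    finally have 1: "t0 \<odot> E0 a b = \<dots>" .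
    have "\<sigma> (E0 a b) \<odot> t0 = (\<Sum>q\<in>blk p. \<sigma> (E0 a b \<odot> E0 q p) \<odot> y \<odot> E0 p q)"
      by (simp add: t0_def bm_sum(2) mul_assoc \<sigma>_mul)
    also have "\<dots> = (\<Sum>q\<in>blk p. if q = b then \<sigma> (E0 a p) \<odot> y \<odot> E0 p b else 0)"
    proof (intro sum.cong refl)
      fix q assume q: "q \<in> blk p"
      show "\<sigma> (E0 a b \<odot> E0 q p) \<odot> y \<odot> E0 p q = (if q = b then \<sigma> (E0 a p) \<odot> y \<odot> E0 p b else 0)"
        by (simp add: E_mul[OF ab pb(2)[OF q] pb(1)[OF q]] linv_0[OF \<sigma>])
    qed
    finally show ?thesis using 1 iff by simp
  qed
  have conj0: "t0 \<odot> x = \<sigma> x \<odot> t0" for x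
    by (subst (1 2) E_expand'[of x]) (simp add: bm_sum bm_scale linv_sum[OF \<sigma>] linvD[OF \<sigma>] base)
  have t0z: "t0 \<odot> z0 p = t0"
  proof -
    have "E0 p q \<odot> z0 p = E0 p q" if q: "q \<in> blk p" for q
    proof -
      have "E0 p q \<odot> z0 p = (\<Sum>s\<in>blk p. if s = q then E0 p q else 0)"
        unfolding z0_def bm_sum(2) using E_mul[OF pP q pb(2) blk_self[OF pb(2)]] by (intro sum.cong refl) simp
      thus ?thesis using q by simp
    qed
    thus ?thesis by (simp add: t0_def bm_sum(1) mul_assoc)
  qed
  define t where "t = z0 p \<odot> t0"
  have conj: "t \<odot> x = \<sigma> x \<odot> t" for x
    by (metis t_def mul_assoc conj0 z0_central[OF pP])
  have zt: "z0 p \<odot> t = t" by (simp add: t_def mul_assoc[symmetric] z0_idem[OF pP])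
  have "t0 \<noteq> 0"
  proof
    assume "t0 = 0"
    hence "t0 \<odot> E0 p p = 0" by simp
    moreover have "t0 \<odot> E0 p p = (\<Sum>q\<in>blk p. \<sigma> (E0 q p) \<odot> y \<odot> (E0 p q \<odot> E0 p p))"
      by (simp add: t0_def bm_sum(1) mul_assoc)
    moreover have "\<dots> = (\<Sum>q\<in>blk p. if q = p then \<sigma> (E0 p p) \<odot> y \<odot> E0 p p else 0)"
      using pP blk_self by (intro sum.cong refl) (simp add: E_mul)
    ultimately show False using y blk_self[OF pP] by simp
  qed
  then obtain a b where ab: "a \<in> P0" "b \<in> blk a" "c0 a b t0 \<noteq> 0"
    using c_eq[of t0 0] lin_0[OF c_lin] by metis
  have abp: "a \<in> blk p" using c_z0(1)[OF pP ab(1,2), of t0] ab(3) by (simp add: t0z split: if_splits)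
  hence bbp: "b \<in> blk p" using ab(2) blk_sym[OF abp] by simp
  define \<kappa> where "\<kappa> = c0 a b t"
  have \<kappa>: "\<kappa> \<noteq> 0" using ab abp by (simp add: \<kappa>_def t_def c_z0[OF pP])
  \<comment> \<open>Up to the nonzero scalar \<kappa>, \<open>B\<close> inverts \<open>t\<close> on
    the block, so no power of \<open>t\<close> vanishes.\<close>
  define B where "B = (\<Sum>c\<in>blk p. E0 c a \<odot> \<sigma> (E0 b c))"
  have Bt: "B \<odot> t = \<kappa> *s z0 p"
  proof -
    have "B \<odot> t = (\<Sum>c\<in>blk p. E0 c a \<odot> t \<odot> E0 b c)"
      by (simp add: B_def bm_sum(1) mul_assoc conj)
    also have "\<dots> = (\<Sum>c\<in>blk p. \<kappa> *s E0 c c)"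
      unfolding \<kappa>_def by (intro sum.cong refl E_sandwich) (use ab(1,2) blk_sym[OF abp] in auto)
    finally show ?thesis by (simp add: z0_def vec.scale_sum_right)
  qed
  have zpw: "z0 p \<odot> pw t (Suc n) = pw t (Suc n)" for n by (simp add: mul_assoc[symmetric] zt)
  have tnz: "pw t (Suc n) \<noteq> 0" for n
  proof (induction n)
    case 0 
    have "t \<noteq> 0" using \<kappa> lin_0[OF c_lin[OF ab(1,2)]] by (auto simp: \<kappa>_def)
    thus ?case by simp
  next
    case (Suc n)
    have "B \<odot> pw t (Suc (Suc n)) = (B \<odot> t) \<odot> pw t (Suc n)" by (simp add: mul_assoc)
    also have "\<dots> = \<kappa> *s pw t (Suc n)" by (simp only: Bt bm_scale zpw)
    finally show ?case using Suc \<kappa> by auto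
  qed
  have "pw t n \<odot> x = (\<sigma> ^^ n) x \<odot> pw t n" for n x
  proof (induction n)
    case (Suc n)
    have "pw t (Suc n) \<odot> x = t \<odot> ((\<sigma> ^^ n) x \<odot> pw t n)" by (simp add: mul_assoc Suc)
    also have "\<dots> = \<sigma> ((\<sigma> ^^ n) x) \<odot> (t \<odot> pw t n)" by (metis mul_assoc conj)
    finally show ?case by simp
  qed simp
  hence cen: "pw t m \<odot> x = x \<odot> pw t m" for x by (simp add: \<sigma>_order)
  obtain m' where m': "m = Suc m'" using m by (cases m) auto
  define c where "c = c0 p p (pw t m)"
  have tm: "pw t m = c *s z0 p" using central_block[OF pP cen] zpw[of m'] by (simp add: c_def m')
  have "c \<noteq> 0" using tm tnz[of m'] m' by auto
  obtain k where k: "k ^ m = c" using nth_root_exists[OF m] by blast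
  have "k \<noteq> 0" using k \<open>c \<noteq> 0\<close> m by (auto simp: power_0_left)
  show ?thesis
  proof (intro exI[of _ "(1 / k) *s t"] conjI allI)
    show "pw ((1 / k) *s t) m = z0 p"
      using k \<open>c \<noteq> 0\<close> by (simp add: pw_scale tm power_divide)
  qed (simp_all add: bm_scale conj zt)
qed

definition bt where "bt p = (\<Sum>a\<in>blk p. \<Sum>b\<in>blk p. c0 a b (\<sigma> (E0 a b)))"

lemma trc_bt: "trc \<sigma> = (\<Sum>p\<in>J. bt p)"
  unfolding trc_E[OF \<sigma>] sum_P0 bt_def by (intro sum.cong refl) (auto dest: blk_sym)

text \<open>A block that is moved contributes nothing to the trace. On a fixed block, \<sigma> is
  conjugation by \<open>t\<close>, and its trace is chi(t) times chi of the inverse of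
  \<open>t\<close>; \<open>r j\<close> counts the eigenvalues w^j of \<open>t\<close>.\<close>

lemma block_trace:
  assumes p: "p \<in> J"
  shows "bt p = 0 \<or> (\<exists>r::nat \<Rightarrow> nat. (\<Sum>j<m. r j) = card (blk p) \<and>
    bt p = (\<Sum>j<m. of_nat (r j) * w ^ j) * (\<Sum>j<m. of_nat (r j) * w ^ (j * (2 * m - 1))) \<and>
    (\<forall>j<m. r j = card (blk p) \<longrightarrow> (\<forall>a\<in>blk p. \<forall>b\<in>blk p. \<forall>x. c0 a b (\<sigma> x) = c0 a b x)))"
proof (cases "\<exists>y. \<sigma> (E0 p p) \<odot> y \<odot> E0 p p \<noteq> 0")
  case False
  note pP = J_in[OF p]
  have "c0 a b (\<sigma> (E0 a b)) = 0" if ab: "a \<in> blk p" "b \<in> blk p" for a b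
  proof -
    have b: "a \<in> P0" "b \<in> P0" "blk a = blk p" "blk b = blk p" "p \<in> blk p" using ab blk_in blk_sym pP blk_self by auto
    have 1: "E0 a b = E0 a p \<odot> E0 p p \<odot> E0 p b" "E0 b b = E0 b p \<odot> E0 p p \<odot> E0 p b"
      using ab b pP by (simp_all add: E_mul)
    have "\<sigma> (E0 a b) \<odot> E0 b b = \<sigma> (E0 a p) \<odot> (\<sigma> (E0 p p) \<odot> (\<sigma> (E0 p b) \<odot> E0 b p) \<odot> E0 p p) \<odot> E0 p b"
      unfolding 1 \<sigma>_mul by (simp add: mul_assoc)
    hence "\<sigma> (E0 a b) \<odot> E0 b b = 0" using False by simp
    hence "E0 a a \<odot> \<sigma> (E0 a b) \<odot> E0 b b = 0" by (simp add: mul_assoc)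
    moreover have "E0 a a \<odot> \<sigma> (E0 a b) \<odot> E0 b b = c0 a b (\<sigma> (E0 a b)) *s E0 a b"
      by (rule E_sandwich) (use ab b blk_self in auto)
    moreover have "c0 a b (E0 a b) = 1" "c0 a b 0 = 0" using ab b lin_0[OF c_lin[of a b]] by (simp_all add: c_E)
    ultimately show ?thesis by (metis vec.scale_eq_0_iff zero_neq_one)
  qed
  thus ?thesis by (simp add: bt_def)
next
  case True
  note pP = J_in[OF p]
  from True block_conjugator[OF p] obtain t where t: "\<And>x. t \<odot> x = \<sigma> x \<odot> t" "z0 p \<odot> t = t" "pw t m = z0 p" by metis
  have ts: "pw t (Suc m) = t" using t z0_central[OF pP, of t] by simp
  obtain r :: "nat \<Rightarrow> nat" where r: "\<And>j. chi p \<cdot> cyc w m t j = of_nat (r j)"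
    "\<And>l. l \<ge> 1 \<Longrightarrow> chi p \<cdot> pw t l = (\<Sum>j<m. of_nat (r j) * w ^ (j * l))"
    using cyc_chi[OF p ts m w] by blast
  have "(of_nat (card (blk p)) :: 'k) = of_nat (\<Sum>j<m. r j)"
    using r(2)[of m] m prim_rootD[OF w] by (simp add: t chi_z0[OF p] power_mult mult.commute[of _ m])
  hence rs: "(\<Sum>j<m. r j) = card (blk p)" by (simp only: of_nat_eq_iff)
  \<comment> \<open>The inverse of \<open>t\<close> on the block. The exponent 2 m - 1 is used
    instead of m - 1 because it is at least 1 even for m = 1.\<close>
  define B where "B = pw t (2 * m - 1)"
  have tB: "t \<odot> B = z0 p"
  proof -
    have "m + m = Suc (2 * m - 1)" using m by simp
    hence "t \<odot> B = pw t (m + m)" by (simp only: B_def pw_Suc)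
    also have "\<dots> = z0 p" by (simp only: pw_add t z0_idem[OF pP])
    finally show ?thesis .
  qed
  have cab: "c0 a b (\<sigma> (E0 a b)) = c0 a a t * c0 b b B" if ab: "a \<in> blk p" "b \<in> blk p" for a b
  proof -
    have b: "a \<in> P0" "b \<in> P0" "blk a = blk p" "blk b = blk p" using ab blk_in blk_sym by auto
    have "c0 a b (\<sigma> (E0 a b)) = c0 a b (\<sigma> (E0 a b) \<odot> (t \<odot> B))" using ab b by (simp add: tB c_z0[OF pP])
    also have "\<sigma> (E0 a b) \<odot> (t \<odot> B) = t \<odot> (E0 a b \<odot> B)" by (metis mul_assoc t(1))
    also have "c0 a b \<dots> = (\<Sum>s\<in>blk p. c0 a s t * c0 s b (E0 a b \<odot> B))" using ab b by (simp add: c_mul)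
    also have "\<dots> = (\<Sum>s\<in>blk p. if s = a then c0 a a t * c0 b b B else 0)"
    proof (intro sum.cong refl)
      fix s assume s: "s \<in> blk p"
      have s': "s \<in> P0" "blk s = blk p" using s blk_in blk_sym by auto
      have "c0 s b (E0 a b \<odot> B) = (\<Sum>v\<in>blk p. c0 s v (E0 a b) * c0 v b B)" using s' ab b by (simp add: c_mul)
      also have "\<dots> = (\<Sum>v\<in>blk p. if v = b then (if s = a then c0 b b B else 0) else 0)"
        using s' ab b by (intro sum.cong refl) (simp add: c_E)
      finally show "c0 a s t * c0 s b (E0 a b \<odot> B) = (if s = a then c0 a a t * c0 b b B else 0)" using ab by simp
    qed
    finally show ?thesis using ab by simp
  qed
  have "bt p = chi p \<cdot> t * chi p \<cdot> B"
    unfolding bt_def chi[OF p] by (simp add: cab sum_product)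
  also have "chi p \<cdot> t = (\<Sum>j<m. of_nat (r j) * w ^ j)" using r(2)[of 1] by simp
  also have "chi p \<cdot> B = (\<Sum>j<m. of_nat (r j) * w ^ (j * (2 * m - 1)))" unfolding B_def using m by (intro r(2)) simp
  finally have bt: "bt p = (\<Sum>j<m. of_nat (r j) * w ^ j) * (\<Sum>j<m. of_nat (r j) * w ^ (j * (2 * m - 1)))" .
  \<comment> \<open>With a single eigenvalue \<open>t\<close> is a scalar on the block, so
    conjugation by it is trivial there.\<close>
  have "c0 a b (\<sigma> x) = c0 a b x" if j: "j < m" "r j = card (blk p)" and ab: "a \<in> blk p" "b \<in> blk p" for j a b x
  proof -
    have r0: "r j' = 0" if "j' < m" "j' \<noteq> j" for j'
    proof -
      have "(\<Sum>j\<in>{..<m} - {j}. r j) = 0" using rs j sum.remove[of "{..<m}" j r] by simp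
      thus ?thesis using that by simp
    qed
    have c0': "c0 a b (cyc w m t j') = 0" if "j' < m" "j' \<noteq> j" "a \<in> blk p" "b \<in> blk p" for j' a b
    proof -
      obtain n :: nat where n: "chi p \<cdot> cyc w m t j' = of_nat n" "n = 0 \<longrightarrow> (\<forall>y. chi p \<cdot> (cyc w m t j' \<odot> y) = 0)"
        using chi_idem[OF p cyc_idem[OF ts m w, of j']] by blast
      have "(of_nat n :: 'k) = of_nat (r j')" using n(1) r(1) by simp
      hence "n = 0" using r0 that by simp
      thus ?thesis using n(2) by (simp add: c_chi[OF p that(3,4)])
    qed
    have grp_class: "c0 a b (pw t l) = w ^ (j * l) * c0 a b (cyc w m t j)" if "a \<in> blk p" "b \<in> blk p" "l \<ge> 1" for a b l
    proof -
      have b: "a \<in> P0" "b \<in> blk a" using that blk_in blk_sym by auto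
      have "c0 a b (pw t l) = (\<Sum>j'<m. w ^ (j' * l) * c0 a b (cyc w m t j'))"
        unfolding cyc_sum[OF ts m w that(3), symmetric] by (simp add: lin_sum[OF c_lin[OF b]] linD(2)[OF c_lin[OF b]])
      also have "\<dots> = (\<Sum>j'<m. if j' = j then w ^ (j * l) * c0 a b (cyc w m t j) else 0)"
        using that by (intro sum.cong refl) (simp add: c0')
      finally show ?thesis using j by simp
    qed
    have ct: "c0 a b t = (if a = b then w ^ j else 0)" if "a \<in> blk p" "b \<in> blk p" for a b
    proof -
      have b: "a \<in> P0" "b \<in> blk a" using that blk_in blk_sym by auto
      have "c0 a b (cyc w m t j) = c0 a b (z0 p)" using grp_class[OF that, of m] m prim_rootD[OF w]
        by (simp add: t power_mult mult.commute[of _ m])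
      thus ?thesis using grp_class[OF that, of 1] b that by (simp add: z0_c[OF pP])
    qed
    have b: "a \<in> P0" "b \<in> blk a" "blk a = blk p" "b \<in> P0" "blk b = blk p" using ab blk_in blk_sym by auto
    have "c0 a b (t \<odot> x) = (\<Sum>s\<in>blk p. if s = a then w ^ j * c0 a b x else 0)"
      unfolding c_mul[OF b(1,2)] b(3) using ab by (intro sum.cong refl) (simp add: ct)
    moreover have "c0 a b (\<sigma> x \<odot> t) = (\<Sum>s\<in>blk p. if s = b then c0 a b (\<sigma> x) * w ^ j else 0)"
      unfolding c_mul[OF b(1,2)] b(3) using ab by (intro sum.cong refl) (simp add: ct)
    ultimately show ?thesis using ab t(1)[of x] prim_root_nonzero[OF w m] by auto
  qed
  thus ?thesis using rs bt by blast
qed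

text \<open>Evaluated at a complex root of unity, the trace becomes a sum of squared absolute values.\<close>

lemma trc_nonzero:
  assumes p: "p \<in> J" "card (blk p) = 1" "\<And>x. chi p \<cdot> \<sigma> x = chi p \<cdot> x"
  shows "trc \<sigma> \<noteq> 0"
proof
  assume 0: "trc \<sigma> = 0"
  define F where "F = {q\<in>J. bt q \<noteq> 0}"
  have "\<forall>q\<in>F. \<exists>r::nat \<Rightarrow> nat. bt q = (\<Sum>j<m. of_nat (r j) * w ^ j) * (\<Sum>j<m. of_nat (r j) * w ^ (j * (2 * m - 1)))"
  proof
    fix q assume "q \<in> F"
    hence "q \<in> J" "bt q \<noteq> 0" by (auto simp: F_def)
    thus "\<exists>r::nat \<Rightarrow> nat. bt q = (\<Sum>j<m. of_nat (r j) * w ^ j) * (\<Sum>j<m. of_nat (r j) * w ^ (j * (2 * m - 1)))"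
      using block_trace[of q] by blast
  qed
  then obtain r :: "_ \<Rightarrow> nat \<Rightarrow> nat" where r: "\<And>q. q \<in> F \<Longrightarrow> 
     bt q = (\<Sum>j<m. of_nat (r q j) * w ^ j) * (\<Sum>j<m. of_nat (r q j) * w ^ (j * (2 * m - 1)))" by metis
  \<comment> \<open>A fixed block of degree one contributes exactly 1; this summand is kept apart
    because it makes the sum strictly positive.\<close>
  have bp: "bt p = 1"
  proof -
    obtain p' where "blk p = {p'}" using p(2) by (auto simp: card_1_singleton_iff)
    hence bl: "blk p = {p}" using blk_self[OF J_in[OF p(1)]] by auto
    have "bt p = chi p \<cdot> \<sigma> (E0 p p)" by (simp add: bt_def chi[OF p(1)] bl)
    thus ?thesis using p J_in blk_self by (simp add: chi_E)
  qed
  define C :: "rat poly" where "C = 1 + (\<Sum>q\<in>F - {p}. (\<Sum>j<m. monom (of_nat (r q j)) j) * (\<Sum>j<m. monom (of_nat (r q j)) (j * (2 * m - 1))))"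
  have finF: "finite F" and pF: "p \<in> F" using p bp by (auto simp: F_def)
  have "trc \<sigma> = (\<Sum>q\<in>F. bt q)" unfolding trc_bt by (rule sum.mono_neutral_right) (auto simp: F_def)
  also have "\<dots> = 1 + (\<Sum>q\<in>F - {p}. bt q)" using finF pF bp by (simp add: sum.remove)
  also have "\<dots> = ev C w" by (simp add: C_def r)
  finally have "ev C w = 0" using 0 by simp
  then obtain z :: complex where z: "z ^ m = 1" "ev C z = 0"
    using transfer_root prim_rootD[OF w] m by blast
  have "cmod z ^ m = 1" using z(1) by (metis norm_one norm_power)
  hence "cmod z = 1" using m power_eq_imp_eq_base[of "cmod z" m 1] by simp
  hence zc: "z * cnj z = 1" by (simp add: complex_norm_square[symmetric])
  have pc: "z ^ (j * (2 * m - 1)) = cnj (z ^ j)" for j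
  proof -
    have "m + m = Suc (2 * m - 1)" using m by simp
    hence "z ^ (2 * m - 1) * z = z ^ (m + m)" by (simp only: power_Suc2)
    hence "z ^ (2 * m - 1) * z = 1" by (simp add: power_add z(1))
    hence "z ^ (2 * m - 1) = cnj z" using zc by (metis mult.assoc mult.commute mult.right_neutral)
    thus ?thesis by (metis complex_cnj_power mult.commute power_mult)
  qed
  have "ev C z = 1 + (\<Sum>q\<in>F - {p}. (\<Sum>j<m. of_nat (r q j) * z ^ j) * cnj (\<Sum>j<m. of_nat (r q j) * z ^ j))"
    using pc by (simp add: C_def)
  also have "\<dots> = complex_of_real (1 + (\<Sum>q\<in>F - {p}. (cmod (\<Sum>j<m. of_nat (r q j) * z ^ j))\<^sup>2))"
    unfolding complex_norm_square[symmetric] by simp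
  finally have "complex_of_real (1 + (\<Sum>q\<in>F - {p}. (cmod (\<Sum>j<m. of_nat (r q j) * z ^ j))\<^sup>2)) = 0"
    using z(2) by (simp only:)
  hence "1 + (\<Sum>q\<in>F - {p}. (cmod (\<Sum>j<m. of_nat (r q j) * z ^ j))\<^sup>2) = 0"
    by (simp only: of_real_eq_0_iff)
  moreover have "(\<Sum>q\<in>F - {p}. (cmod (\<Sum>j<m. of_nat (r q j) * z ^ j))\<^sup>2) \<ge> 0" by (intro sum_nonneg) simp
  ultimately show False by linarith
qed

end

end

section \<open>The antipode of a semisimple Hopf algebra is an involution\<close>

sublocale hopf_int \<subseteq> ss_alg M u
  by unfold_locales (rule semisimple)

lemma trc_idem_nat:
  fixes T :: "'k::field_char_0 ^ 'i::finite \<Rightarrow> 'k ^ 'i"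
  assumes T: "linv T" "\<And>x. T (T x) = T x"
  shows "\<exists>m::nat. trc T = of_nat m"
proof -
  have "\<exists>m::nat. m \<le> card (UNIV :: 'i set) \<and> (\<Sum>a\<in>UNIV. T (axis a 1) $ a) = of_nat m \<and>
     (m = 0 \<longrightarrow> (\<forall>a\<in>UNIV. \<forall>b\<in>UNIV. T (axis b 1) $ a = 0))"
  proof (rule idempotent_trace_nat)
    fix a c :: 'i
    have "T (T (axis c 1)) $ a = (\<Sum>b\<in>UNIV. T (axis b 1) $ a * T (axis c 1) $ b)"
      by (subst linv_basis[OF T(1), of "T (axis c 1)"]) (simp add: mult.commute)
    thus "(\<Sum>b\<in>UNIV. T (axis b 1) $ a * T (axis c 1) $ b) = T (axis c 1) $ a" by (simp add: T(2))
  qed simp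
  thus ?thesis by (auto simp: trc_def)
qed

lemma trc_minus: "trc (\<lambda>x. f x - g x) = trc f - trc g"
  by (simp add: trc_def sum_subtractf)

text \<open>\<open>T\<close> is the difference of the projections onto its eigenspaces for 1 and -1,
  and the trace of each projection is a natural number.\<close>

lemma trc_periodic_int:
  fixes T :: "'k::field_char_0 ^ 'i::finite \<Rightarrow> 'k ^ 'i"
  assumes T: "linv T" "\<And>x. T (T (T x)) = T x"
  shows "\<exists>m::int. trc T = of_int m"
proof -
  have l: "linv (\<lambda>x. T (T x))" by (rule linv_comp[OF T(1) T(1)])
  define A where "A x = (1/2) *s (T (T x) + T x)" for x
  define B where "B x = (1/2) *s (T (T x) - T x)" for x
  have lA: "linv A" unfolding A_def by (intro linv_scale linv_add l T)
  have lB: "linv B" using linv_diff[OF T(1)] linv_diff[OF l]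
    by (auto simp: B_def linv_def linvD[OF T(1)] vec.scale_right_diff_distrib vec.scale_right_distrib algebra_simps)
  have "A (A x) = A x" "B (B x) = B x" for x
    unfolding A_def B_def
    by (simp_all add: linvD[OF T(1)] linv_diff[OF T(1)] T(2) vec_eq_iff field_simps)
  then obtain a b :: nat where ab: "trc A = of_nat a" "trc B = of_nat b" using trc_idem_nat lA lB by metis
  have "T = (\<lambda>x. A x - B x)" by (auto simp: A_def B_def vec_eq_iff field_simps)
  hence "trc T = trc A - trc B" using trc_minus[of A B] by simp
  thus ?thesis by (intro exI[of _ "int a - int b"]) (simp add: ab)
qed

context fin_hopf
begin

lemma grp_pw: "grp g \<Longrightarrow> grp (pw g n)"
  by (induction n) (auto intro: grp_u grp_mul)

text \<open>Dedekind's argument: grouplike elements are characters of the dual algebra. Evaluate the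
  relation on a product of f and h, subtract f(g) times its value on h, and the term of
  \<open>g\<close> disappears.\<close>

lemma grp_indep:
  assumes "finite A" "\<And>a. a \<in> A \<Longrightarrow> grp a" "(\<Sum>a\<in>A. c a *s a) = 0" "a \<in> A" shows "c a = 0"
  using assms
proof (induction A arbitrary: c a rule: finite_induct)
  case (insert g A)
  have 0: "c a = 0" if a: "a \<in> A" for a
  proof -
    have "a \<noteq> g" using a insert.hyps by auto
    then obtain f where f: "f \<cdot> a \<noteq> f \<cdot> g" using pr_eqI by metis
    have "(\<Sum>a\<in>A. (c a * (f \<cdot> a - f \<cdot> g)) *s a) = 0"
    proof (rule pr_eqI)
      fix h
      have "(\<Sum>a\<in>A. c a * h \<cdot> a) + c g * h \<cdot> g = 0"
        using arg_cong[OF insert.prems(2), of "\<lambda>x. h \<cdot> x"] insert.hyps by (simp add: pr_sum pr_add pr_scale algebra_simps)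
      moreover have "(\<Sum>a\<in>A. c a * (f \<cdot> a * h \<cdot> a)) + c g * (f \<cdot> g * h \<cdot> g) = 0"
        using arg_cong[OF insert.prems(2), of "\<lambda>x. (f \<star> h) \<cdot> x"] insert.hyps insert.prems(1)
        by (simp add: pr_sum pr_add pr_scale grp_def algebra_simps)
      ultimately have "(\<Sum>a\<in>A. c a * (f \<cdot> a * h \<cdot> a)) - f \<cdot> g * (\<Sum>a\<in>A. c a * h \<cdot> a) = 0"
        by (simp add: eq_neg_iff_add_eq_0[symmetric])
      thus "h \<cdot> (\<Sum>a\<in>A. (c a * (f \<cdot> a - f \<cdot> g)) *s a) = h \<cdot> 0"
        by (simp only: pr_sum pr_scale pr_0) (simp add: sum_distrib_left algebra_simps sum_subtractf)
    qed
    from insert.IH[OF _ this a] insert.prems(1) have "c a * (f \<cdot> a - f \<cdot> g) = 0" by simp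
    thus ?thesis using f by simp
  qed
  have "g \<noteq> 0" using insert.prems(1)[of g] by (auto simp: grp_def)
  moreover have "c g *s g = 0" using insert.prems(2) insert.hyps 0 by simp
  ultimately show ?case using insert.prems(3) 0 by auto
qed simp

lemma grp_cancel: assumes g: "grp g" and eq: "g \<odot> x = g \<odot> y" shows "x = y"
proof -
  have "ant S g \<odot> (g \<odot> x) = ant S g \<odot> (g \<odot> y)" using eq by simp
  thus ?thesis by (simp add: mul_assoc[symmetric] grp_inv[OF g])
qed

lemma grp_pw_cancel: assumes g: "grp g" and eq: "pw g (i + j) = pw g i" shows "pw g j = u"
  using grp_cancel[OF grp_pw[OF g, of i], of "pw g j" u] eq by (simp add: pw_add)

text \<open>If all powers were distinct, they would be linearly independent, which the finite
  dimension forbids.\<close>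

lemma grp_order: assumes g: "grp g" shows "\<exists>N>0. pw g N = u"
proof (rule ccontr)
  assume no: "\<not> (\<exists>N>0. pw g N = u)"
  have inj: "inj (pw g)"
  proof (rule injI)
    fix i j assume eq: "pw g i = pw g j"
    show "i = j"
    proof (rule ccontr)
      assume "i \<noteq> j"
      then consider k where "j = i + k" "k > 0" | k where "i = j + k" "k > 0"
        by (metis less_imp_add_positive nat_neq_iff)
      thus False using grp_pw_cancel[OF g] eq no by cases metis+
    qed
  qed
  obtain a where a: "\<exists>i\<le>CARD('i). a i \<noteq> 0" "(\<Sum>i\<le>CARD('i). a i *s pw g i) = 0"
    using linear_relation[of "pw g"] by blast
  have "(\<Sum>x\<in>pw g ` {..CARD('i)}. a (inv (pw g) x) *s x) = 0"
    using a(2) inj by (simp add: sum.reindex inj_on_def inj_def)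
  hence "a i = 0" if "i \<le> CARD('i)" for i
    using grp_indep[of "pw g ` {..CARD('i)}" "\<lambda>x. a (inv (pw g) x)" "pw g i"] that inj grp_pw[OF g] by auto
  thus False using a(1) by blast
qed

text \<open>The reason is that \<open>H \<otimes> V\<close> is a sum of copies of \<open>H\<close> for every \<open>H\<close>-module \<open>V\<close>.\<close>

lemma regular_absorb:
  assumes t: "\<And>x y. t \<cdot> (x \<odot> y) = t \<cdot> (y \<odot> x)"
  shows "sw (\<lambda>a b. trc (\<lambda>x. a \<odot> x) * t \<cdot> b) h = (t \<cdot> u) * trc (\<lambda>x. h \<odot> x)"
proof -
  have ins: "sw (\<lambda>a b. F (a \<odot> x) b) h = sw (\<lambda>p q. sw (\<lambda>a b. F a (b \<odot> ant S q)) (h \<odot> p)) x" if F: "bil F" for F x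
  proof -
    note b = bil1[OF F] bil2[OF F]
    have "sw (\<lambda>p q. sw (\<lambda>a b. F a (b \<odot> ant S q)) (h \<odot> p)) x
      = sw (\<lambda>p q. sw (\<lambda>s t. sw (\<lambda>a b. F (a \<odot> s) (b \<odot> t \<odot> ant S q)) h) p) x"
      by (rule cop_cong, subst sw_mul, intro bilI lin_intros b, rule cop_swap)
    also have "\<dots> = sw (\<lambda>s w. sw (\<lambda>t q. sw (\<lambda>a b. F (a \<odot> s) (b \<odot> (t \<odot> ant S q))) h) w) x"
      by (subst coassoc) (simp add: mul_assoc)
    also have "\<dots> = sw (\<lambda>s w. sw (\<lambda>a b. F (a \<odot> s) b) h * e \<cdot> w) x"
      by (rule cop_cong, subst sw_antr[of "\<lambda>z. sw (\<lambda>a b. F (a \<odot> _) (b \<odot> z)) h"]) (intro lin_intros b, simp)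
    also have "\<dots> = sw (\<lambda>a b. F (a \<odot> x) b) h"
      by (rule sw_counit(2)[of "\<lambda>s. sw (\<lambda>a b. F (a \<odot> s) b) h"]) (intro lin_intros b)
    finally show ?thesis by simp
  qed
  have "sw (\<lambda>a b. trc (\<lambda>x. a \<odot> x) * t \<cdot> b) h = (\<Sum>i\<in>UNIV. sw (\<lambda>a b. axis i 1 \<cdot> (a \<odot> axis i 1) * t \<cdot> b) h)"
    by (simp add: trc_def sum_distrib_right cop_sum)
  also have "\<dots> = (\<Sum>i\<in>UNIV. sw (\<lambda>p q. sw (\<lambda>a b. axis i 1 \<cdot> a * t \<cdot> (b \<odot> ant S q)) (h \<odot> p)) (axis i 1))"
    by (rule sum.cong[OF refl], rule ins) (intro bilI lin_intros)
  also have "\<dots> = (\<Sum>i\<in>UNIV. sw (\<lambda>p q. sw (\<lambda>a b. axis i 1 \<cdot> a * t \<cdot> (ant S q \<odot> b)) (h \<odot> p)) (axis i 1))"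
    by (subst t) (rule refl)
  also have "\<dots> = trc (\<lambda>x. h \<odot> x) * t \<cdot> u" unfolding trc_collapse by (simp add: trc_def)
  finally show ?thesis by (simp add: mult.commute)
qed

definition reg where "reg = vof (\<lambda>h. trc (\<lambda>x. h \<odot> x))"

lemma reg: "reg \<cdot> h = trc (\<lambda>x. h \<odot> x)"
  unfolding reg_def by (rule vof_pr) (simp add: lin_def trc_def bm_add bm_scale sum.distrib sum_distrib_left)

lemma reg_comm: "reg \<cdot> (x \<odot> y) = reg \<cdot> (y \<odot> x)"
  unfolding reg mul_assoc by (rule trc_comm) (intro lin_intros)+

lemma reg_reg: "reg \<star> reg = of_nat CARD('i) *s reg"
proof (rule pr_eqI')
  fix h
  have "reg \<cdot> u = of_nat CARD('i)" by (simp add: reg trc_def)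
  thus "(reg \<star> reg) \<cdot> h = (of_nat CARD('i) *s reg) \<cdot> h"
    using regular_absorb[OF reg_comm, of h] by (simp add: pr_bm pr_scale reg[symmetric])
qed

end

context ss_alg
begin

text \<open>The functional is a combination of irreducible characters with natural coefficients, and
  its value 1 at the unit leaves room for one summand of degree one.\<close>

lemma linear_char:
  assumes f: "\<And>x y. f \<cdot> (x \<odot> y) = f \<cdot> x * f \<cdot> y" "f \<cdot> u = 1"
  shows "\<exists>p\<in>J. chi p = f \<and> card (blk p) = 1"
proof -
  have "rep {()} (\<lambda>_ _. \<lambda>x. f \<cdot> x)" by (auto simp: rep_def f lin_pr)
  from rep_char[OF this] obtain m :: "_ \<Rightarrow> nat" where "vof (\<lambda>x. f \<cdot> x) = (\<Sum>g\<in>Irr. of_nat (m g) *s g)" by auto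
  moreover have "vof (\<lambda>x. f \<cdot> x) = f" by (simp add: vof_def vec_eq_iff)
  ultimately have m: "f = (\<Sum>p\<in>J. of_nat (m (chi p)) *s chi p)" unfolding Irr_def by (simp add: sum.reindex inj_chi)
  have "(1::'k) = f \<cdot> u" using f by simp
  also have "\<dots> = of_nat (\<Sum>p\<in>J. m (chi p) * card (blk p))"
    by (subst m) (simp add: pr_sum pr_scale chi_unit)
  finally have "of_nat (\<Sum>p\<in>J. m (chi p) * card (blk p)) = (of_nat 1 :: 'k)" by simp
  hence 1: "(\<Sum>p\<in>J. m (chi p) * card (blk p)) = 1" by (simp only: of_nat_eq_iff)
  then obtain p where p: "p \<in> J" "m (chi p) * card (blk p) = 1" "\<And>q. q \<in> J \<Longrightarrow> q \<noteq> p \<Longrightarrow> m (chi q) * card (blk q) = 0"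
    using sum_eq_1_iff[OF fin(3), of "\<lambda>p. m (chi p) * card (blk p)"] by auto
  have "m (chi q) = 0" if "q \<in> J" "q \<noteq> p" for q using p(3)[OF that] card_blk_pos[OF J_in[OF that(1)]] by (metis mult_eq_0_iff less_irrefl)
  hence "f = (\<Sum>q\<in>J. if q = p then chi p else 0)" by (subst m, intro sum.cong refl) (use p in auto)
  thus ?thesis using p by auto
qed

end

context hopf_int
begin

abbreviation sg where "sg x \<equiv> ant S (ant S x)"

lemma sg_lin: "linv sg" by (intro lin_intros)
lemma sg_mul: "sg (x \<odot> y) = sg x \<odot> sg y" by (simp add: ant_mul)

text \<open>By \<open>ant_fourth\<close>, S^4 is conjugation by \<open>a0\<close>, which has finite
  order.\<close>

lemma sg_finite_order: "\<exists>N>0. \<forall>x. (sg ^^ N) x = x"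
proof -
  obtain N where N: "N > 0" "pw a0 N = u" using grp_order[OF grp_a0] by blast
  have "(sg ^^ (2 * n)) x \<odot> pw a0 n = pw a0 n \<odot> x" for n x
  proof (induction n)
    case (Suc n)
    have "(sg ^^ (2 * Suc n)) x \<odot> pw a0 (Suc n) = (sg (sg ((sg ^^ (2 * n)) x)) \<odot> a0) \<odot> pw a0 n"
      by (simp add: mul_assoc)
    also have "\<dots> = a0 \<odot> ((sg ^^ (2 * n)) x \<odot> pw a0 n)" by (simp only: ant_fourth[symmetric] mul_assoc)
    also have "\<dots> = pw a0 (Suc n) \<odot> x" by (simp add: Suc mul_assoc)
    finally show ?case .
  qed simp
  from this[of N] show ?thesis using N by (intro exI[of _ "2 * N"]) simp
qed

text \<open>\<open>lam u\<close> is the trace of S^2. The counit is the character of a block of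
  degree one that S^2 fixes, so \<open>trc_nonzero\<close> applies.\<close>

lemma trc_sg_nonzero: "lam u \<noteq> 0"
proof -
  obtain N where N: "N > 0" "\<And>x. (sg ^^ N) x = x" using sg_finite_order by blast
  obtain w :: 'k where w: "prim_root N w" using prim_root_exists[OF N(1)] by blast
  obtain p where p: "p \<in> J" "chi p = e" "card (blk p) = 1" using linear_char[of e] counit_unit by auto
  have "trc sg \<noteq> 0" by (rule trc_nonzero[OF sg_lin sg_mul N(2) N(1) w p(1,3)]) (simp add: p(2))
  thus ?thesis by (simp add: lam_def)
qed

text \<open>The defining equation of \<open>a0\<close> is evaluated at the unit, where
  \<open>lam\<close> does not vanish. The dual is therefore unimodular, and
  \<open>ant_fourth\<close> becomes S^4 = id.\<close>

lemma a0_u: "a0 = u"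
proof (rule pr_eqI)
  fix f
  have "(f \<star> lv) \<cdot> u = ((f \<cdot> a0) *s lv) \<cdot> u" by (simp only: a0)
  thus "f \<cdot> a0 = f \<cdot> u" using trc_sg_nonzero by (simp add: pr_scale lv)
qed

lemma sg_sg: "sg (sg x) = x" using ant_fourth[of x] by (simp add: a0_u)

lemma lv_left: "f \<star> lv = (f \<cdot> u) *s lv" using a0[of f] by (simp add: a0_u)

text \<open>With \<open>\<tau>\<close> the character of the regular representation, \<open>\<tau>/n\<close> is an idempotent of the dual and the
  trace of \<open>S\<^sup>2\<close> on the ideal that it generates is \<open>Tr(S\<^sup>2)/n\<close>.\<close>

lemma trc_sg_divisible: "\<exists>z::int. lam u = of_nat CARD('i) * of_int z"
proof -
  let ?n = "of_nat CARD('i) :: 'k"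
  have n: "?n \<noteq> 0" by simp
  define td where "td = fin_hopf.lv D S'"
  have td: "td \<cdot> f = trc (\<lambda>g. ant S' (ant S' g) \<star> f)" for f
    using fin_hopf.lv[OF dual, of f] by (simp add: td_def fin_hopf.lam_def[OF dual])
  \<comment> \<open>The trace integral for the dual lies on the line of \<open>L\<close>. Its counit
    is the trace of the transpose of S^2, which equals the trace of S^2.\<close>
  have tdL: "td = lam u *s L"
  proof -
    have "td \<odot> x = (e \<cdot> x) *s td" for x
      using fin_hopf.lam_integral[OF dual, of x] by (simp add: td_def pr_comm)
    from this[of L] have "td = (e \<cdot> td) *s L" by (simp add: L_left)
    moreover have "e \<cdot> td = lam u"
    proof -
      have a: "ant S (axis i 1) = (\<chi> j. S i j)" "ant S' (axis i 1) = (\<chi> j. S j i)" for i 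
        by (simp_all add: vec_eq_iff ant_axis)
      have "e \<cdot> td = (\<Sum>i\<in>UNIV. \<Sum>j\<in>UNIV. S j i * S i j)"
        unfolding pr_comm[of e] td by (simp add: trc_def a) (simp add: ant_def)
      also have "\<dots> = lam u" unfolding lam_def trc_def by (simp add: a) (simp add: ant_def mult.commute)
      finally show ?thesis .
    qed
    ultimately show ?thesis by simp
  qed
  define e0 where "e0 = (1 / ?n) *s reg"
  have e0: "e0 \<star> e0 = e0" by (simp add: e0_def bm_scale reg_reg)
  have "reg \<cdot> L = 1"
  proof -
    have "reg \<cdot> L = (\<Sum>i\<in>UNIV. e $ i * L $ i)" by (simp add: reg trc_def L_right)
    also have "\<dots> = 1" by (simp only: pr_def[symmetric] L_norm)
    finally show ?thesis .
  qed
  hence 1: "lam u / ?n = trc (\<lambda>g. ant S' (ant S' g) \<star> e0)"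
    using td[of e0] by (simp add: tdL e0_def pr_scale pr_comm)
  have Ue: "ant S' (ant S' e0) = e0"
  proof -
    have "reg \<cdot> sg h = reg \<cdot> h" for h
    proof -
      have "reg \<cdot> sg h = trc (\<lambda>x. sg (h \<odot> sg x))" unfolding reg by (simp add: sg_mul sg_sg)
      also have "\<dots> = trc (\<lambda>x. h \<odot> sg (sg x))" by (rule trc_comm) (intro lin_intros)+
      finally show ?thesis by (simp add: reg sg_sg)
    qed
    hence "ant S' (ant S' reg) = reg" by (intro pr_eqI') (simp add: pr_ant)
    thus ?thesis by (simp add: e0_def ant_scale)
  qed
  have U2: "ant S' (ant S' (ant S' (ant S' g))) = g" for g
    by (rule pr_eqI') (simp add: pr_ant[symmetric] sg_sg)
  have Um: "ant S' (ant S' (f \<star> g)) = ant S' (ant S' f) \<star> ant S' (ant S' g)" for f g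
    by (simp add: fin_hopf.ant_mul[OF dual])
  let ?T = "\<lambda>g. ant S' (ant S' g) \<star> e0"
  have "\<exists>z::int. trc ?T = of_int z"
    by (rule trc_periodic_int) (intro lin_intros, simp add: Um Ue U2 cmul_assoc e0)
  then obtain z :: int where "lam u / ?n = of_int z" using 1 by auto
  thus ?thesis using n by (intro exI[of _ z]) (simp add: field_simps)
qed

text \<open>On a fixed block of degree d, S^2 is conjugation by an element with r_0 eigenvalues 1
  and r_1 eigenvalues -1, so the block contributes (r_0 - r_1)^2, at most d^2 = (r_0 + r_1)^2. The
  total is a positive multiple of n, while the squares of the degrees sum to n. Hence equality holds
  in every block, and there the conjugation is trivial.\<close>

theorem ant_involution: "ant S (ant S x) = x"
proof -
  have w: "prim_root 2 (-1 :: 'k)"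
    unfolding prim_root_def
  proof
    fix l :: nat
    show "(- 1 :: 'k) ^ l = 1 \<longleftrightarrow> 2 dvd l" by (cases "even l") simp_all
  qed
  have o: "(sg ^^ 2) x = x" for x by (simp add: numeral_2_eq_2 sg_sg)
  note bt = block_trace[OF sg_lin sg_mul o pos2 w]
  have ex: "\<exists>s::int. bt sg p = of_int s \<and> 0 \<le> s \<and> s \<le> int (card (blk p) ^ 2) \<and>
     (s = int (card (blk p) ^ 2) \<longrightarrow> (\<forall>a\<in>blk p. \<forall>b\<in>blk p. \<forall>x. c0 a b (sg x) = c0 a b x))" if p: "p \<in> J" for p
    using bt[OF p]
  proof (elim disjE exE conjE)
    assume "bt sg p = 0"
    thus ?thesis using card_blk_pos[OF J_in[OF p]] by (intro exI[of _ 0]) auto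
  next
    fix r :: "nat \<Rightarrow> nat"
    assume r: "(\<Sum>j<2. r j) = card (blk p)"
      "bt sg p = (\<Sum>j<2. of_nat (r j) * (- 1) ^ j) * (\<Sum>j<2. of_nat (r j) * (- 1) ^ (j * (2 * 2 - 1)))"
      "\<forall>j<2. r j = card (blk p) \<longrightarrow> (\<forall>a\<in>blk p. \<forall>b\<in>blk p. \<forall>x. c0 a b (sg x) = c0 a b x)"
    define s where "s = (int (r 0) - int (r 1))\<^sup>2"
    have c: "card (blk p) = r 0 + r 1" using r(1) by (simp add: numeral_2_eq_2)
    have "int (card (blk p) ^ 2) - s = 4 * int (r 0) * int (r 1)"
      by (simp add: s_def c power2_eq_square algebra_simps)
    hence h: "int (card (blk p) ^ 2) = s + 4 * int (r 0) * int (r 1)" by simp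
    have fx: "\<forall>a\<in>blk p. \<forall>b\<in>blk p. \<forall>x. c0 a b (sg x) = c0 a b x" if "s = int (card (blk p) ^ 2)"
    proof -
      have "r 0 = 0 \<or> r 1 = 0" using h that by simp
      thus ?thesis using r(3)[rule_format, of 0] r(3)[rule_format, of 1] c by auto
    qed
    have b: "bt sg p = of_int s" using r(2) by (simp add: s_def numeral_2_eq_2 power2_eq_square)
    have "0 \<le> s" by (simp add: s_def)
    moreover have "s \<le> int (card (blk p) ^ 2)" unfolding h by simp
    ultimately show ?thesis using b fx by blast
  qed
  then obtain s where s: "\<And>p. p \<in> J \<Longrightarrow> bt sg p = of_int (s p) \<and> 0 \<le> s p \<and> s p \<le> int (card (blk p) ^ 2) \<and>
     (s p = int (card (blk p) ^ 2) \<longrightarrow> (\<forall>a\<in>blk p. \<forall>b\<in>blk p. \<forall>x. c0 a b (sg x) = c0 a b x))" by metis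
  have "lam u = (\<Sum>p\<in>J. bt sg p)" using trc_bt[OF sg_lin sg_mul o pos2 w] by (simp add: lam_def)
  also have "\<dots> = of_int (\<Sum>p\<in>J. s p)" using s by simp
  finally have l: "lam u = of_int (\<Sum>p\<in>J. s p)" .
  have tot: "(\<Sum>p\<in>J. int (card (blk p) ^ 2)) = int CARD('i)" using card_sum by (simp only: of_nat_sum[symmetric])
  obtain z :: int where "lam u = of_nat CARD('i) * of_int z" using trc_sg_divisible by blast
  hence "(of_int (\<Sum>p\<in>J. s p) :: 'k) = of_int (int CARD('i) * z)" by (simp add: l)
  hence z: "(\<Sum>p\<in>J. s p) = int CARD('i) * z" by (simp only: of_int_eq_iff)
  have "(\<Sum>p\<in>J. s p) \<noteq> 0" using trc_sg_nonzero l by (metis of_int_0)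
  moreover have "(\<Sum>p\<in>J. s p) \<ge> 0" using s by (intro sum_nonneg) auto
  ultimately have "int CARD('i) * z > 0" using z by linarith
  hence "z \<ge> 1" by (simp add: zero_less_mult_iff)
  hence "(\<Sum>p\<in>J. int (card (blk p) ^ 2)) \<le> (\<Sum>p\<in>J. s p)" unfolding tot z by simp
  moreover have "(\<Sum>p\<in>J. s p) \<le> (\<Sum>p\<in>J. int (card (blk p) ^ 2))" using s by (intro sum_mono) auto
  ultimately have "(\<Sum>p\<in>J. int (card (blk p) ^ 2) - s p) = 0" by (simp add: sum_subtractf)
  hence eq: "s p = int (card (blk p) ^ 2)" if "p \<in> J" for p
    using that s by (subst (asm) sum_nonneg_eq_0_iff) auto
  show ?thesis
  proof (rule c_eq)
    fix a b assume ab: "a \<in> P0" "b \<in> blk a"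
    hence "r0 a \<in> J" "a \<in> blk (r0 a)" "b \<in> blk (r0 a)" using r0_J[OF ab(1)] blk_sym by auto
    thus "c0 a b (sg x) = c0 a b x" using s eq by blast
  qed
qed

lemma lam_right: "lam h = trc (\<lambda>x. x \<odot> h)" by (simp add: lam_def ant_involution)

lemma lam_u: "lam u = of_nat CARD('i)" by (simp add: lam_right trc_def)

lemma dual_int: "hopf_int D e M u S' ((1 / of_nat CARD('i)) *s lv)"
  by (intro hopf_int.intro dual hopf_int_axioms.intro)
    (simp_all add: bm_scale lam_integral lv_left pr_scale lv lam_u pr_comm[of u] vec.scale_left_commute)

end

section \<open>The character ring\<close>

context ss_alg
begin

definition dg where "dg f = card (blk (the_inv_into J chi f))"

lemma dg_chi: "p \<in> J \<Longrightarrow> dg (chi p) = card (blk p)"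
  by (simp add: dg_def the_inv_into_f_f inj_chi)

lemma Irr_cases: assumes "f \<in> Irr" obtains p where "p \<in> J" "f = chi p"
  using assms by (auto simp: Irr_def)

lemma finite_Irr [simp]: "finite Irr" by (simp add: Irr_def)

lemma dg_pos: "f \<in> Irr \<Longrightarrow> dg f > 0"
  by (auto elim!: Irr_cases simp: dg_chi card_blk_pos J_in)

lemma Irr_u: "f \<in> Irr \<Longrightarrow> f \<cdot> u = of_nat (dg f)"
  by (auto elim!: Irr_cases simp: dg_chi chi_unit)

lemma Irr_comm: "f \<in> Irr \<Longrightarrow> f \<cdot> (x \<odot> y) = f \<cdot> (y \<odot> x)"
  by (auto elim!: Irr_cases simp: chi_comm)

lemma sum_Irr: "(\<Sum>f\<in>Irr. h f) = (\<Sum>p\<in>J. h (chi p))"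
  unfolding Irr_def by (simp add: sum.reindex inj_chi)

lemma sum_dg: "(\<Sum>f\<in>Irr. (dg f)\<^sup>2) = CARD('i)"
  using card_sum by (simp add: sum_Irr dg_chi)

lemma Irr_idem:
  assumes f: "f \<in> Irr" and x: "x \<odot> x = x"
  shows "\<exists>m::nat. m \<le> dg f \<and> f \<cdot> x = of_nat m \<and> (m = 0 \<longrightarrow> (\<forall>y. f \<cdot> (x \<odot> y) = 0)) \<and>
    (m = dg f \<longrightarrow> (\<forall>y. f \<cdot> (x \<odot> y) = f \<cdot> y))"
proof -
  obtain p where p: "p \<in> J" "f = chi p" using f by (rule Irr_cases)
  obtain m :: nat where m: "m \<le> dg f" "f \<cdot> x = of_nat m" "m = 0 \<longrightarrow> (\<forall>y. f \<cdot> (x \<odot> y) = 0)"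
    using chi_idem[OF p(1) x] by (auto simp: p dg_chi)
  have "f \<cdot> (x \<odot> y) = f \<cdot> y" if "m = dg f" for y
  proof -
    have "(u - x) \<odot> (u - x) = u - x" by (simp add: bm_diff x)
    then obtain k :: nat where k: "f \<cdot> (u - x) = of_nat k" "k = 0 \<longrightarrow> (\<forall>y. f \<cdot> ((u - x) \<odot> y) = 0)"
      using chi_idem[OF p(1)] by (auto simp: p)
    have "f \<cdot> (u - x) = 0" using m(2) that by (simp add: pr_diff Irr_u[OF f])
    hence "k = 0" using k(1) by simp
    hence "f \<cdot> ((u - x) \<odot> y) = 0" using k(2) by blast
    thus ?thesis by (simp add: bm_diff pr_diff)
  qed
  thus ?thesis using m by blast
qed

lemma Irr_separate: "(\<And>f y. f \<in> Irr \<Longrightarrow> f \<cdot> (x \<odot> y) = 0) \<Longrightarrow> x = 0"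
  by (rule chi_separate) (simp add: Irr_def)

lemma Irr_linear: assumes f: "f \<in> Irr" and d: "dg f = 1"
  shows "f \<cdot> (x \<odot> y) = f \<cdot> x * f \<cdot> y"
proof -
  obtain p where p: "p \<in> J" "f = chi p" using f by (rule Irr_cases)
  then obtain p' where "blk p = {p'}" using d by (auto simp: dg_chi card_1_singleton_iff)
  hence b: "blk p = {p}" using blk_self[OF J_in[OF p(1)]] by auto
  have "c0 p p (x \<odot> y) = (\<Sum>s\<in>blk p. c0 p s x * c0 s p y)" by (rule c_mul) (use p J_in b in auto)
  thus ?thesis by (simp add: p chi b)
qed

lemma linear_Irr: "(\<And>x y. f \<cdot> (x \<odot> y) = f \<cdot> x * f \<cdot> y) \<Longrightarrow> f \<cdot> u = 1 \<Longrightarrow> f \<in> Irr \<and> dg f = 1"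
  using linear_char[of f] by (auto simp: Irr_def dg_chi)

lemma reg_Irr: "trc (\<lambda>x. x \<odot> h) = (\<Sum>f\<in>Irr. of_nat (dg f) *s f) \<cdot> h"
  by (simp add: trc_right sum_Irr dg_chi pr_sum pr_scale)

end

context hopf_int
begin

lemma lam_comm: "lam (x \<odot> y) = lam (y \<odot> x)"
  using lam_nakayama[of x y] by (simp only: ant_involution)

abbreviation star where "star f \<equiv> ant S' f"

lemma star_star [simp]: "star (star f) = f"
  by (rule pr_eqI') (simp add: pr_ant[symmetric] ant_involution)

lemma star_mul: "star (f \<star> g) = star g \<star> star f"
  by (rule fin_hopf.ant_mul[OF dual])

text \<open>The inner product of characters: evaluation at \<open>L\<close> extracts the coefficient
  of the trivial character.\<close>

definition ip where "ip f g = (f \<star> star g) \<cdot> L"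

lemma ip_lin: "ip (f + f') g = ip f g + ip f' g" "ip (c *s f) g = c * ip f g"
   "ip f (g + g') = ip f g + ip f g'" "ip f (c *s g) = c * ip f g"
  by (simp_all add: ip_def bm_add bm_scale pr_add pr_scale ant_add ant_scale)

lemma ip_sum: "ip (sum h A) g = (\<Sum>a\<in>A. ip (h a) g)" "ip g (sum h A) = (\<Sum>a\<in>A. ip g (h a))"
  by (simp_all add: ip_def bm_sum pr_sum ant_sum)

lemma lv_Irr: "lv = (\<Sum>f\<in>Irr. of_nat (dg f) *s f)"
  by (rule pr_eqI') (simp only: lv lam_right reg_Irr)

lemma dual_reg: "fin_hopf.lv D S' = of_nat CARD('i) *s L"
proof -
  interpret d: hopf_int D e M u S' "(1 / of_nat CARD('i)) *s lv" by (rule dual_int)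
  have "d.lv \<odot> x = (e \<cdot> x) *s d.lv" for x
    using d.lam_integral[of x] by (simp add: pr_comm)
  from this[of L] have "d.lv = (e \<cdot> d.lv) *s L" by (simp add: L_left)
  moreover have "e \<cdot> d.lv = of_nat CARD('i)" using d.lv[of e] d.lam_u by (simp add: pr_comm)
  ultimately show ?thesis by simp
qed

text \<open>The integral functional of the dual is a trace function there, by cyclicity and S^2 =
  id, and it is a multiple of \<open>L\<close>.\<close>

lemma L_cocomm: "(f \<star> g) \<cdot> L = (g \<star> f) \<cdot> L"
proof -
  interpret d: hopf_int D e M u S' "(1 / of_nat CARD('i)) *s lv" by (rule dual_int)
  have "d.lv \<cdot> (f \<star> g) = d.lv \<cdot> (g \<star> f)" unfolding d.lv by (subst d.lam_nakayama) simp
  thus ?thesis by (simp add: dual_reg pr_scale pr_comm)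
qed

lemma ip_sym: "ip f g = ip g f"
proof -
  have "ip f g = star (f \<star> star g) \<cdot> L" unfolding ip_def by (subst (2) ant_L[symmetric]) (simp only: pr_ant star_star)
  thus ?thesis by (simp add: star_mul ip_def)
qed

lemma ip_adj: "ip (f \<star> g) h = ip f (h \<star> star g)" "ip (f \<star> g) h = ip g (star f \<star> h)"
  by (simp_all add: ip_def star_mul cmul_assoc) (metis L_cocomm cmul_assoc)

lemma ip_star: "ip (star f) (star g) = ip f g"
  by (metis L_cocomm ip_def ip_sym star_star)

lemma e_Irr: "e \<in> Irr" and dg_e [simp]: "dg e = 1"
  using linear_Irr[of e] counit_unit by auto

lemma chi_z0': assumes p: "p \<in> J" "q \<in> J" shows "chi p \<cdot> (x \<odot> z0 q) = (if p = q then chi p \<cdot> x else 0)"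
proof -
  have "chi p \<cdot> (x \<odot> z0 q) = (\<Sum>a\<in>blk p. if p = q then c0 a a x else 0)"
    unfolding chi[OF p(1)]
  proof (intro sum.cong refl)
    fix a assume a: "a \<in> blk p"
    have "a \<in> blk q \<longleftrightarrow> p = q" using a p blk_J_disj by blast
    thus "c0 a a (x \<odot> z0 q) = (if p = q then c0 a a x else 0)"
      using c_z0(1)[OF J_in[OF p(2)] blk_in[OF a] blk_self[OF blk_in[OF a]]] by simp
  qed
  thus ?thesis using chi[OF p(2)] by auto
qed

text \<open>The Fourier formula shows that the element \<open>G\<close> represents \<open>g\<close>
  with respect to \<open>lam\<close>. The unit of the block of \<open>g\<close>, divided by the
  degree, represents it too, so nondegeneracy identifies the two elements.\<close>

lemma ip_Irr: assumes "f \<in> Irr" "g \<in> Irr" shows "ip f g = (if f = g then 1 else 0)"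
proof -
  obtain p where p: "p \<in> J" "f = chi p" using assms(1) by (rule Irr_cases)
  obtain q where q: "q \<in> J" "g = chi q" using assms(2) by (rule Irr_cases)
  define d where "d = (of_nat (card (blk q)) :: 'k)"
  have d: "d \<noteq> 0" using card_blk_pos[OF J_in[OF q(1)]] unfolding d_def by (metis of_nat_eq_0_iff less_irrefl)
  define G where "G = (\<chi> i. sw (\<lambda>a b. axis i 1 \<cdot> a * g \<cdot> ant S b) L)"
  have G: "h \<cdot> G = sw (\<lambda>a b. h \<cdot> a * g \<cdot> ant S b) L" for h
    by (subst lin_basis[of "\<lambda>h. sw (\<lambda>a b. h \<cdot> a * g \<cdot> ant S b) L"], intro lin_intros linv_id)
      (simp add: G_def pr_def[of h] del: pr_axis)
  have "lam (x \<odot> G) = lam (x \<odot> ((1 / d) *s z0 q))" for x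
  proof -
    define h where "h = vof (\<lambda>a. lv \<cdot> (x \<odot> a))"
    have h: "h \<cdot> a = lam (x \<odot> a)" for a unfolding h_def by (subst vof_pr) (intro lin_intros, simp add: lv)
    have "lam (x \<odot> G) = sw (\<lambda>a b. lam (x \<odot> a) * g \<cdot> ant S b) L" unfolding h[symmetric] by (rule G)
    also have "\<dots> = g \<cdot> x" using fourier[of "ant S x" "star g"] by (simp add: ant_involution pr_ant[symmetric])
    also have "\<dots> = lam (x \<odot> ((1 / d) *s z0 q))"
    proof -
      have "lam (x \<odot> z0 q) = (\<Sum>p\<in>J. if p = q then d * g \<cdot> x else 0)"
        unfolding lv[symmetric] lv_Irr sum_Irr pr_sum pr_scale
        by (intro sum.cong refl) (simp add: chi_z0' q dg_chi d_def)
      hence "lam (x \<odot> z0 q) = d * g \<cdot> x" using q by simp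
      thus ?thesis using d linD(2)[OF lin_lam, of "1/d" "x \<odot> z0 q"] by (simp add: bm_scale)
    qed
    finally show ?thesis .
  qed
  hence "lam (G \<odot> x) = lam (((1 / d) *s z0 q) \<odot> x)" for x
    using lam_comm[of G x] lam_comm[of "(1 / d) *s z0 q" x] by (simp only:)
  hence GG: "G = (1 / d) *s z0 q" by (rule lam_nondeg)
  have "ip f g = f \<cdot> G" by (simp add: ip_def G pr_bm pr_ant)
  also have "\<dots> = (1 / d) * f \<cdot> (u \<odot> z0 q)" by (simp add: GG pr_scale)
  also have "\<dots> = (if p = q then 1 else 0)" using d by (simp add: p chi_z0' q chi_unit d_def del: mul_1)
  finally show ?thesis using p q inj_chi by (auto simp: inj_on_def)
qed

text \<open>The product is the character of the tensor product of two matrix representations, whose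
  matrix entries are given by \<open>R\<close>.\<close>

lemma Irr_mult: assumes "f \<in> Irr" "g \<in> Irr"
  shows "\<exists>m::'k ^ 'i \<Rightarrow> nat. f \<star> g = (\<Sum>h\<in>Irr. of_nat (m h) *s h)"
proof -
  obtain p where p: "p \<in> J" "f = chi p" using assms(1) by (rule Irr_cases)
  obtain q where q: "q \<in> J" "g = chi q" using assms(2) by (rule Irr_cases)
  define R where "R = (\<lambda>(a,b) (c,d). sw (\<lambda>s t. c0 a c s * c0 b d t))"
  have grp_class: "lin (c0 a c)" if "a \<in> blk p" "c \<in> blk p" for a c using that blk_in blk_sym by (auto intro: c_lin)
  have cl': "lin (c0 a c)" if "a \<in> blk q" "c \<in> blk q" for a c using that blk_in blk_sym by (auto intro: c_lin)
  have "rep (blk p \<times> blk q) R"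
    unfolding rep_def
  proof (intro conjI ballI allI)
    fix x y z z' assume "z \<in> blk p \<times> blk q" "z' \<in> blk p \<times> blk q"
    then obtain a b c d where z: "z = (a,b)" "z' = (c,d)" "a \<in> blk p" "c \<in> blk p" "b \<in> blk q" "d \<in> blk q" by auto
    have b: "a \<in> P0" "blk a = blk p" "b \<in> P0" "blk b = blk q" using z blk_in blk_sym by auto
    have "R z z' (x \<odot> y) = sw (\<lambda>s t. sw (\<lambda>s' t'. c0 a c (s \<odot> s') * c0 b d (t \<odot> t')) y) x"
      unfolding R_def z using z by (simp add: sw_mul bil_prod grp_class cl')
    also have "\<dots> = sw (\<lambda>s t. sw (\<lambda>s' t'. \<Sum>v\<in>blk p \<times> blk q. (c0 a (fst v) s * c0 b (snd v) t) * (c0 (fst v) c s' * c0 (snd v) d t')) y) x"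
      by (rule cop_cong, rule cop_cong) (use z b in \<open>simp add: c_mul sum_product sum.cartesian_product split_beta mult_ac\<close>)
    also have "\<dots> = (\<Sum>v\<in>blk p \<times> blk q. R z v x * R v z' y)"
      by (simp add: cop_sum cop_cmult R_def z split_beta)
    finally show "R z z' (x \<odot> y) = (\<Sum>v\<in>blk p \<times> blk q. R z v x * R v z' y)" .
  qed (auto simp: R_def lin_cop)
  from rep_char[OF this] obtain m :: "'k ^ 'i \<Rightarrow> nat" where
    "vof (\<lambda>x. \<Sum>a\<in>blk p \<times> blk q. R a a x) = (\<Sum>f\<in>Irr. of_nat (m f) *s f)" by blast
  moreover have "vof (\<lambda>x. \<Sum>a\<in>blk p \<times> blk q. R a a x) = f \<star> g"
  proof (rule pr_eqI')
    fix x
    have "vof (\<lambda>x. \<Sum>a\<in>blk p \<times> blk q. R a a x) \<cdot> x = (\<Sum>a\<in>blk p \<times> blk q. R a a x)"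
      by (rule vof_pr) (auto intro!: lin_sumI simp: R_def lin_cop)
    also have "\<dots> = (f \<star> g) \<cdot> x"
      by (simp add: R_def pr_bm p q chi cop_sum[symmetric] sum_product sum.cartesian_product split_beta)
    finally show "vof (\<lambda>x. \<Sum>a\<in>blk p \<times> blk q. R a a x) \<cdot> x = (f \<star> g) \<cdot> x" .
  qed
  ultimately show ?thesis by auto
qed

lemma ip_comb: "g \<in> Irr \<Longrightarrow> ip (\<Sum>h\<in>Irr. c h *s h) g = c g"
proof -
  assume g: "g \<in> Irr"
  have "ip (\<Sum>h\<in>Irr. c h *s h) g = (\<Sum>h\<in>Irr. if h = g then c g else 0)"
    unfolding ip_sum ip_lin using g by (intro sum.cong refl) (simp add: ip_Irr)
  thus ?thesis using g by simp
qed

text \<open>The dual representation has this character; norm one makes it irreducible.\<close>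

lemma star_Irr: assumes f: "f \<in> Irr" shows "star f \<in> Irr \<and> dg (star f) = dg f"
proof -
  obtain p where p: "p \<in> J" "f = chi p" using f by (rule Irr_cases)
  have "rep (blk p) (\<lambda>a b x. c0 b a (ant S x))"
    unfolding rep_def
  proof (intro conjI ballI allI)
    fix a b assume ab: "a \<in> blk p" "b \<in> blk p"
    have b: "b \<in> P0" "a \<in> blk b" "blk b = blk p" using ab blk_in blk_sym by auto
    show "lin (\<lambda>x. c0 b a (ant S x))" using b by (intro lin_comp[OF c_lin] linv_ant)
    fix x y
    show "c0 b a (ant S (x \<odot> y)) = (\<Sum>s\<in>blk p. c0 s a (ant S x) * c0 b s (ant S y))"
      using c_mul[OF b(1,2), of "ant S y" "ant S x"] by (simp add: ant_mul b(3) mult.commute)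
  qed simp
  from rep_char[OF this] obtain m :: "'k ^ 'i \<Rightarrow> nat" where
    m: "vof (\<lambda>x. \<Sum>a\<in>blk p. c0 a a (ant S x)) = (\<Sum>f\<in>Irr. of_nat (m f) *s f)" by blast
  have "vof (\<lambda>x. \<Sum>a\<in>blk p. c0 a a (ant S x)) = star f"
  proof (rule pr_eqI')
    fix x
    have "vof (\<lambda>x. \<Sum>a\<in>blk p. c0 a a (ant S x)) \<cdot> x = (\<Sum>a\<in>blk p. c0 a a (ant S x))"
      by (rule vof_pr) (intro lin_sumI lin_comp[OF c_lin] linv_ant blk_in blk_self)
    thus "vof (\<lambda>x. \<Sum>a\<in>blk p. c0 a a (ant S x)) \<cdot> x = star f \<cdot> x"
      by (simp add: pr_ant[symmetric] p chi)
  qed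
  hence sf: "star f = (\<Sum>h\<in>Irr. of_nat (m h) *s h)" using m by simp
  have "(1 :: 'k) = ip (star f) (star f)" using f by (simp add: ip_star ip_Irr)
  also have "\<dots> = (\<Sum>h\<in>Irr. of_nat (m h) * ip h (star f))" by (subst sf) (simp add: ip_sum ip_lin)
  also have "\<dots> = (\<Sum>h\<in>Irr. of_nat (m h) * of_nat (m h))"
    by (intro sum.cong refl, subst ip_sym, subst sf) (simp add: ip_comb)
  also have "\<dots> = of_nat (\<Sum>h\<in>Irr. m h * m h)" by simp
  finally have "of_nat (\<Sum>h\<in>Irr. m h * m h) = (of_nat 1 :: 'k)" by simp
  hence "(\<Sum>h\<in>Irr. m h * m h) = 1" by (simp only: of_nat_eq_iff)
  then obtain h where h: "h \<in> Irr" "m h * m h = 1" "\<And>h'. h' \<in> Irr \<Longrightarrow> h' \<noteq> h \<Longrightarrow> m h' * m h' = 0"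
    using sum_eq_1_iff[OF finite_Irr, of "\<lambda>h. m h * m h"] by auto
  have "star f = (\<Sum>h'\<in>Irr. if h' = h then h else 0)"
    unfolding sf using h by (intro sum.cong refl) auto
  hence sh: "star f = h" using h by simp
  have "(of_nat (dg h) :: 'k) = of_nat (dg f)"
    using Irr_u[OF h(1)] Irr_u[OF f] by (simp add: sh[symmetric] pr_ant[symmetric])
  thus ?thesis using h sh by simp
qed

end

section \<open>Multiplicities\<close>

context hopf_int
begin

lemma Irr_L: "f \<in> Irr \<Longrightarrow> f \<cdot> L = (if f = e then 1 else 0)"
  using ip_Irr[OF _ e_Irr] fin_hopf.ant_u[OF dual] by (simp add: ip_def)

text \<open>Characters of modules. The nonnegative integer coefficients move counting arguments from
  the field to the natural numbers.\<close>

definition Ch where "Ch = {x. \<exists>m::'k ^ 'i \<Rightarrow> nat. x = (\<Sum>h\<in>Irr. of_nat (m h) *s h)}"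

definition mlt where "mlt x h = (THE m::nat. ip x h = of_nat m)"

lemma Ch_ex: "x \<in> Ch \<Longrightarrow> h \<in> Irr \<Longrightarrow> \<exists>m::nat. ip x h = of_nat m"
  by (auto simp: Ch_def ip_comb)

lemma mltI: "ip x h = of_nat m \<Longrightarrow> mlt x h = m"
  unfolding mlt_def by (rule the_equality) auto

lemma ip_mlt: "x \<in> Ch \<Longrightarrow> h \<in> Irr \<Longrightarrow> ip x h = of_nat (mlt x h)"
  using Ch_ex mltI by metis

lemma Ch_expand: assumes "x \<in> Ch" shows "x = (\<Sum>h\<in>Irr. of_nat (mlt x h) *s h)"
proof -
  obtain m :: "'k ^ 'i \<Rightarrow> nat" where m: "x = (\<Sum>h\<in>Irr. of_nat (m h) *s h)" using assms by (auto simp: Ch_def)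
  have "mlt x h = m h" if "h \<in> Irr" for h using that by (intro mltI) (simp add: m ip_comb)
  thus ?thesis by (subst m) (auto intro!: sum.cong)
qed

lemma Ch_Irr: assumes "f \<in> Irr" shows "f \<in> Ch"
proof -
  have "f = (\<Sum>h\<in>Irr. of_nat (if h = f then 1 else 0) *s h)"
    using assms by (simp add: if_distrib[of "\<lambda>c. c *s _"] if_distrib[of of_nat] cong: if_cong)
  thus ?thesis unfolding Ch_def by (intro CollectI exI[of _ "\<lambda>h. if h = f then 1 else 0"])
qed

lemma Ch_0: "0 \<in> Ch"
  unfolding Ch_def by (intro CollectI exI[of _ "\<lambda>_. 0"]) simp

lemma Ch_add: "x \<in> Ch \<Longrightarrow> y \<in> Ch \<Longrightarrow> x + y \<in> Ch"
proof -
  assume "x \<in> Ch" "y \<in> Ch"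
  then obtain m m' :: "'k ^ 'i \<Rightarrow> nat" where "x = (\<Sum>h\<in>Irr. of_nat (m h) *s h)" "y = (\<Sum>h\<in>Irr. of_nat (m' h) *s h)"
    by (auto simp: Ch_def)
  hence "x + y = (\<Sum>h\<in>Irr. of_nat (m h + m' h) *s h)" by (simp add: sum.distrib vec.scale_left_distrib)
  thus ?thesis unfolding Ch_def by (intro CollectI exI[of _ "\<lambda>h. m h + m' h"])
qed

lemma Ch_sum: "(\<And>a. a \<in> A \<Longrightarrow> f a \<in> Ch) \<Longrightarrow> sum f A \<in> Ch"
  by (induction A rule: infinite_finite_induct) (auto intro: Ch_0 Ch_add)

lemma Ch_scale: "x \<in> Ch \<Longrightarrow> of_nat k *s x \<in> Ch"
  by (induction k) (auto simp: vec.scale_left_distrib intro: Ch_0 Ch_add)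

lemma Ch_mul: assumes "x \<in> Ch" "y \<in> Ch" shows "x \<star> y \<in> Ch"
proof -
  obtain m m' :: "'k ^ 'i \<Rightarrow> nat" where m: "x = (\<Sum>h\<in>Irr. of_nat (m h) *s h)" "y = (\<Sum>h\<in>Irr. of_nat (m' h) *s h)"
    using assms by (auto simp: Ch_def)
  have "f \<star> g \<in> Ch" if "f \<in> Irr" "g \<in> Irr" for f g using Irr_mult[OF that] by (simp add: Ch_def)
  thus ?thesis unfolding m bm_sum bm_scale by (auto intro!: Ch_sum Ch_scale)
qed

lemma Ch_star: "x \<in> Ch \<Longrightarrow> star x \<in> Ch"
proof -
  assume "x \<in> Ch"
  then obtain m :: "'k ^ 'i \<Rightarrow> nat" where m: "x = (\<Sum>h\<in>Irr. of_nat (m h) *s h)" by (auto simp: Ch_def)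
  show ?thesis unfolding m ant_sum ant_scale by (intro Ch_sum Ch_scale) (simp add: Ch_Irr star_Irr)
qed

lemmas Ch_intros = Ch_mul Ch_star Ch_Irr

lemma mlt_Irr: "f \<in> Irr \<Longrightarrow> g \<in> Irr \<Longrightarrow> mlt f g = (if f = g then 1 else 0)"
  by (rule mltI) (simp add: ip_Irr)

lemma ip_Ch: assumes "x \<in> Ch" "y \<in> Ch" shows "ip x y = of_nat (\<Sum>h\<in>Irr. mlt x h * mlt y h)"
proof -
  have "ip x y = (\<Sum>h\<in>Irr. of_nat (mlt x h) * ip h y)" by (subst Ch_expand[OF assms(1)]) (simp add: ip_sum ip_lin)
  also have "\<dots> = (\<Sum>h\<in>Irr. of_nat (mlt x h) * of_nat (mlt y h))"
    using assms by (intro sum.cong refl) (simp add: ip_sym[of _ y] ip_mlt)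
  finally show ?thesis by simp
qed

lemma Ch_u: assumes "x \<in> Ch" shows "x \<cdot> u = of_nat (\<Sum>h\<in>Irr. mlt x h * dg h)"
  by (subst Ch_expand[OF assms]) (simp add: pr_sum pr_scale Irr_u)

lemma mlt_dg: assumes "f \<in> Irr" "g \<in> Irr" shows "(\<Sum>h\<in>Irr. mlt (f \<star> g) h * dg h) = dg f * dg g"
proof -
  have "(of_nat (\<Sum>h\<in>Irr. mlt (f \<star> g) h * dg h) :: 'k) = of_nat (dg f * dg g)"
    using Ch_u[of "f \<star> g"] assms by (simp add: Ch_intros Irr_u)
  thus ?thesis by (simp only: of_nat_eq_iff)
qed

text \<open>Frobenius reciprocity, a consequence of the adjunction \<open>ip_adj\<close>.\<close>

lemma mlt_adj:
  assumes "f \<in> Irr" "g \<in> Irr" "h \<in> Irr"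
  shows "mlt (f \<star> g) h = mlt (h \<star> star g) f" "mlt (f \<star> g) h = mlt (star f \<star> h) g"
proof -
  have "ip (f \<star> g) h = of_nat (mlt (h \<star> star g) f)"
    unfolding ip_adj(1) by (subst ip_sym) (simp add: ip_mlt Ch_intros assms)
  thus "mlt (f \<star> g) h = mlt (h \<star> star g) f" by (rule mltI)
  have "ip (f \<star> g) h = of_nat (mlt (star f \<star> h) g)"
    unfolding ip_adj(2) by (subst ip_sym) (simp add: ip_mlt Ch_intros assms)
  thus "mlt (f \<star> g) h = mlt (star f \<star> h) g" by (rule mltI)
qed

lemma mlt_star: "x \<in> Ch \<Longrightarrow> h \<in> Irr \<Longrightarrow> mlt (star x) (star h) = mlt x h"
  by (rule mltI) (simp add: ip_star ip_mlt)

lemma norm1_Irr: assumes x: "x \<in> Ch" and n: "ip x x = 1" shows "x \<in> Irr"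
proof -
  have "(of_nat (\<Sum>h\<in>Irr. mlt x h * mlt x h) :: 'k) = of_nat 1" using n by (simp add: ip_Ch[OF x x])
  hence "(\<Sum>h\<in>Irr. mlt x h * mlt x h) = 1" by (simp only: of_nat_eq_iff)
  then obtain h where h: "h \<in> Irr" "mlt x h * mlt x h = 1" "\<And>h'. h' \<in> Irr \<Longrightarrow> h' \<noteq> h \<Longrightarrow> mlt x h' * mlt x h' = 0"
    using sum_eq_1_iff[OF finite_Irr, of "\<lambda>h. mlt x h * mlt x h"] by auto
  have "x = (\<Sum>h'\<in>Irr. if h' = h then h else 0)"
    using h by (subst Ch_expand[OF x], intro sum.cong refl) auto
  thus ?thesis using h by simp
qed

section \<open>The group of linear characters and its action on irreducible characters\<close>

definition Lin where "Lin = {f\<in>Irr. dg f = 1}"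

lemma Lin_Irr: "f \<in> Lin \<Longrightarrow> f \<in> Irr" and Lin_dg: "f \<in> Lin \<Longrightarrow> dg f = 1" by (auto simp: Lin_def)

lemma finite_Lin [simp]: "finite Lin" by (simp add: Lin_def)

lemma e_Lin [simp]: "e \<in> Lin" by (simp add: Lin_def e_Irr)

lemma Lin_grp: "Lin = {f. fin_hopf.grp M u f}"
proof -
  have "f \<in> Lin \<longleftrightarrow> f \<cdot> u = 1 \<and> (\<forall>x y. f \<cdot> (x \<odot> y) = f \<cdot> x * f \<cdot> y)" for f
    using Irr_linear linear_Irr by (auto simp: Lin_def Irr_u)
  moreover have "fin_hopf.grp M u f \<longleftrightarrow> f \<cdot> u = 1 \<and> (\<forall>x y. f \<cdot> (x \<odot> y) = f \<cdot> x * f \<cdot> y)" for f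
    by (simp add: fin_hopf.grp_def[OF dual] pr_comm)
  ultimately show ?thesis by auto
qed

lemma Lin_mul: "f \<in> Lin \<Longrightarrow> g \<in> Lin \<Longrightarrow> f \<star> g \<in> Lin"
  unfolding Lin_grp by (simp add: fin_hopf.grp_mul[OF dual])

lemma Lin_star: "f \<in> Lin \<Longrightarrow> star f \<in> Lin"
  unfolding Lin_grp by (simp add: fin_hopf.grp_ant[OF dual])

lemma Lin_inv: "f \<in> Lin \<Longrightarrow> star f \<star> f = e" "f \<in> Lin \<Longrightarrow> f \<star> star f = e"
  unfolding Lin_grp by (simp_all add: fin_hopf.grp_inv[OF dual])

lemma Lin_cancel: "f \<in> Lin \<Longrightarrow> f \<star> x = f \<star> y \<Longrightarrow> x = y" "f \<in> Lin \<Longrightarrow> x \<star> f = y \<star> f \<Longrightarrow> x = y"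
  by (metis Lin_inv(1) cmul_assoc cmul_1(1)) (metis Lin_inv(2) cmul_assoc cmul_1(2))

lemma Lin_act: assumes "f \<in> Lin" "x \<in> Irr" 
  shows "f \<star> x \<in> Irr" "dg (f \<star> x) = dg x" "x \<star> f \<in> Irr" "dg (x \<star> f) = dg x"
proof -
  have "ip (f \<star> x) (f \<star> x) = 1"
    unfolding ip_adj(2) cmul_assoc[symmetric] using assms by (simp add: Lin_inv ip_Irr)
  thus 1: "f \<star> x \<in> Irr" using assms by (intro norm1_Irr) (simp_all add: Ch_intros Lin_Irr)
  have "ip (x \<star> f) (x \<star> f) = 1"
    unfolding ip_adj(1) cmul_assoc using assms by (simp add: Lin_inv ip_Irr)
  thus 2: "x \<star> f \<in> Irr" using assms by (intro norm1_Irr) (simp_all add: Ch_intros Lin_Irr)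
  have "(of_nat (dg (f \<star> x)) :: 'k) = of_nat (dg x)" "(of_nat (dg (x \<star> f)) :: 'k) = of_nat (dg x)"
    using Irr_u[OF 1] Irr_u[OF 2] Irr_u[OF Lin_Irr[OF assms(1)]] Irr_u[OF assms(2)] Lin_dg[OF assms(1)] by simp_all
  thus "dg (f \<star> x) = dg x" "dg (x \<star> f) = dg x" by simp_all
qed

text \<open>Reciprocity turns the multiplicity into that of one irreducible character in another,
  because multiplication by the invertible \<open>f\<close> preserves irreducibility.\<close>

lemma mlt_Lin: assumes "f \<in> Lin" "x \<in> Irr" "y \<in> Irr"
  shows "mlt (x \<star> star y) f = (if f \<star> y = x then 1 else 0)"
    "mlt (star x \<star> y) f = (if x \<star> f = y then 1 else 0)"
proof -
  have "mlt (x \<star> star y) f = mlt (f \<star> y) x" using assms by (subst mlt_adj(1)) (simp_all add: star_Irr Lin_Irr)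
  thus "mlt (x \<star> star y) f = (if f \<star> y = x then 1 else 0)" using assms by (simp add: mlt_Irr Lin_act)
  have "mlt (star x \<star> y) f = mlt (x \<star> f) y" using assms by (subst mlt_adj(2)) (simp_all add: star_Irr Lin_Irr)
  thus "mlt (star x \<star> y) f = (if x \<star> f = y then 1 else 0)" using assms by (simp add: mlt_Irr Lin_act)
qed

section \<open>Idempotents of the character ring and the divisibility that they imply\<close>

abbreviation dIrr where "dIrr \<equiv> ss_alg.Irr D e"
abbreviation ddg where "ddg \<equiv> ss_alg.dg D e"

lemma dual_ss: "ss_alg D e"
  using hopf_int.semisimple[OF dual_int] C by (auto intro!: ss_alg.intro ss_alg_axioms.intro)

lemma dual_L: "of_nat CARD('i) *s L = (\<Sum>g\<in>dIrr. of_nat (ddg g) *s g)"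
  using hopf_int.lv_Irr[OF dual_int] by (simp add: dual_reg)

text \<open>Both sides of the second equation are the dimension of the right ideal that \<open>f\<close> generates.\<close>

lemma idem_dim:
  assumes "f \<star> f = f"
  shows "\<exists>r::'k ^ 'i \<Rightarrow> nat. (\<forall>g\<in>dIrr. g \<cdot> f = of_nat (r g)) \<and>
     of_nat CARD('i) * (f \<cdot> L) = of_nat (\<Sum>g\<in>dIrr. ddg g * r g)"
proof -
  have "\<forall>g\<in>dIrr. \<exists>m::nat. g \<cdot> f = of_nat m" using ss_alg.Irr_idem[OF dual_ss _ assms] by blast
  then obtain r :: "'k ^ 'i \<Rightarrow> nat" where r: "\<And>g. g \<in> dIrr \<Longrightarrow> g \<cdot> f = of_nat (r g)" by metis
  have "of_nat CARD('i) * (f \<cdot> L) = (of_nat CARD('i) *s L) \<cdot> f" by (simp add: pr_scale pr_comm)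
  also have "\<dots> = of_nat (\<Sum>g\<in>dIrr. ddg g * r g)" unfolding dual_L by (simp add: pr_sum pr_scale r)
  finally show ?thesis using r by blast
qed

text \<open>\<open>cdg \<mu>\<close> is the formal codegree of a homomorphism \<open>\<mu>\<close> from the character ring to \<open>k\<close>.\<close>

definition cdg where "cdg \<mu> = (\<Sum>f\<in>Irr. \<mu> f * \<mu> (star f))"
text \<open>The idempotent of the character ring on whose span every character acts through
  \<mu>.\<close>

definition cid where "cid \<mu> = (1 / cdg \<mu>) *s (\<Sum>f\<in>Irr. \<mu> (star f) *s f)"

lemma star_bij: "bij_betw star Irr Irr"
  by (rule bij_betwI[of _ _ _ star]) (auto simp: star_Irr)

context
  fixes \<mu> :: "'k ^ 'i \<Rightarrow> 'k"
  assumes \<mu>: "\<And>f g. f \<in> Irr \<Longrightarrow> g \<in> Irr \<Longrightarrow> (\<Sum>h\<in>Irr. of_nat (mlt (f \<star> g) h) * \<mu> h) = \<mu> f * \<mu> g"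
    and \<mu>e: "\<mu> e = 1" and nz: "cdg \<mu> \<noteq> 0"
begin

text \<open>Reciprocity and duality exchange the roles of \<open>g\<close> and \<open>h\<close> in
  the multiplicities of f g. The inner sum then runs over the constituents of the dual of
  \<open>h\<close> times \<open>f\<close>, where the homomorphism property applies.\<close>

lemma cid_absorb: assumes f: "f \<in> Irr" shows "f \<star> cid \<mu> = \<mu> f *s cid \<mu>"
proof -
  define c where "c = (\<Sum>f\<in>Irr. \<mu> (star f) *s f)"
  have "f \<star> g = (\<Sum>h\<in>Irr. of_nat (mlt (f \<star> g) h) *s h)" if "g \<in> Irr" for g
    using that f by (intro Ch_expand Ch_intros)
  hence "f \<star> c = (\<Sum>g\<in>Irr. \<Sum>h\<in>Irr. (\<mu> (star g) * of_nat (mlt (f \<star> g) h)) *s h)"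
    unfolding c_def bm_sum bm_scale by (intro sum.cong refl) (metis (no_types, lifting) vec.scale_sum_right vec.scale_scale sum.cong)
  also have "\<dots> = (\<Sum>h\<in>Irr. (\<Sum>g\<in>Irr. \<mu> (star g) * of_nat (mlt (f \<star> g) h)) *s h)"
    by (subst sum.swap) (simp add: vec.scale_sum_left)
  also have "\<dots> = (\<Sum>h\<in>Irr. (\<mu> f * \<mu> (star h)) *s h)"
  proof (intro sum.cong refl arg_cong[where f = "\<lambda>c. c *s _"])
    fix h assume h: "h \<in> Irr"
    have "mlt (f \<star> g) h = mlt (star h \<star> f) (star g)" if g: "g \<in> Irr" for g
      using mlt_adj(2)[OF f g h] mlt_star[of "star f \<star> h" g] f g h
      by (simp add: Ch_intros star_Irr star_mul)
    hence "(\<Sum>g\<in>Irr. \<mu> (star g) * of_nat (mlt (f \<star> g) h)) = (\<Sum>g\<in>Irr. of_nat (mlt (star h \<star> f) (star g)) * \<mu> (star g))"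
      by (intro sum.cong refl) (simp add: mult.commute)
    also have "\<dots> = (\<Sum>g\<in>Irr. of_nat (mlt (star h \<star> f) g) * \<mu> g)"
      by (rule sum.reindex_bij_betw[OF star_bij])
    also have "\<dots> = \<mu> f * \<mu> (star h)" using \<mu>[of "star h" f] f h by (simp add: star_Irr mult.commute)
    finally show "(\<Sum>g\<in>Irr. \<mu> (star g) * of_nat (mlt (f \<star> g) h)) = \<mu> f * \<mu> (star h)" .
  qed
  also have "\<dots> = \<mu> f *s c" by (simp add: c_def vec.scale_sum_right)
  finally show ?thesis by (simp add: cid_def c_def[symmetric] bm_scale vec.scale_left_commute)
qed

lemma cid_idem: "cid \<mu> \<star> cid \<mu> = cid \<mu>"
proof -
  have "cid \<mu> \<star> cid \<mu> = (1 / cdg \<mu>) *s (\<Sum>f\<in>Irr. \<mu> (star f) *s (f \<star> cid \<mu>))"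
    by (subst (1) cid_def) (simp add: bm_scale bm_sum)
  also have "\<dots> = (1 / cdg \<mu>) *s (\<Sum>f\<in>Irr. (\<mu> f * \<mu> (star f)) *s cid \<mu>)"
    by (simp add: cid_absorb mult.commute)
  also have "\<dots> = cid \<mu>" using nz by (simp add: vec.scale_sum_left[symmetric] cdg_def[symmetric])
  finally show ?thesis .
qed

text \<open>Only the trivial character is nonzero at \<open>L\<close>. Together with
  \<open>idem_dim\<close>, this makes n divided by the codegree a natural number.\<close>

lemma cid_L: "cid \<mu> \<cdot> L = 1 / cdg \<mu>"
proof -
  have "(\<Sum>f\<in>Irr. \<mu> (star f) * f \<cdot> L) = (\<Sum>f\<in>Irr. if f = e then 1 else 0)"
    using \<mu>e fin_hopf.ant_u[OF dual] by (intro sum.cong refl) (auto simp: Irr_L)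
  thus ?thesis using e_Irr by (simp add: cid_def pr_scale pr_sum)
qed

text \<open>Evaluation at a grouplike element is multiplicative; if it does not kill the idempotent
  of \<mu>, absorption forces it to coincide with \<mu>.\<close>

lemma cid_grp: assumes g: "grp g" and z: "cid \<mu> \<cdot> g \<noteq> 0" and f: "f \<in> Irr" shows "f \<cdot> g = \<mu> f"
proof -
  have "(f \<star> cid \<mu>) \<cdot> g = (\<mu> f *s cid \<mu>) \<cdot> g" by (simp only: cid_absorb[OF f])
  hence "f \<cdot> g * cid \<mu> \<cdot> g = \<mu> f * cid \<mu> \<cdot> g" using g by (simp add: grp_def pr_scale)
  thus ?thesis using z by simp
qed

end

text \<open>A closed set is the set of irreducible characters of a quotient Hopf algebra, which has dimension
  \<open>qdim Q\<close>; \<open>qid Q\<close> is the normalized integral in its dual.\<close>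

definition closed where
  "closed Q \<longleftrightarrow> Q \<subseteq> Irr \<and> e \<in> Q \<and> (\<forall>f\<in>Q. star f \<in> Q) \<and> (\<forall>f\<in>Q. \<forall>g\<in>Q. \<forall>h\<in>Irr. mlt (f \<star> g) h \<noteq> 0 \<longrightarrow> h \<in> Q)"

definition qdim where "qdim Q = (\<Sum>f\<in>Q. (dg f)\<^sup>2)"
definition qid where "qid Q = (1 / of_nat (qdim Q)) *s (\<Sum>f\<in>Q. of_nat (dg f) *s f)"

context
  fixes Q assumes Q: "closed Q"
begin

lemma Q_sub: "f \<in> Q \<Longrightarrow> f \<in> Irr" and Q_fin [simp]: "finite Q"
  using Q finite_subset[OF _ finite_Irr] by (auto simp: closed_def)

lemma qdim_pos: "qdim Q > 0"
proof -
  have "(dg e)\<^sup>2 \<le> qdim Q" unfolding qdim_def using Q by (intro member_le_sum) (auto simp: closed_def)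
  thus ?thesis by simp
qed

text \<open>The coefficients are compared one by one. By reciprocity, closedness keeps the relevant
  constituents inside \<open>Q\<close> for h in \<open>Q\<close> and excludes them for the other h,
  and the degrees add up by \<open>mlt_dg\<close>.\<close>

lemma qid_absorb: assumes f: "f \<in> Q" shows "f \<star> qid Q = of_nat (dg f) *s qid Q"
proof -
  define c where "c = (\<Sum>f\<in>Q. of_nat (dg f) *s f)"
  have c: "c \<in> Ch" unfolding c_def by (intro Ch_sum Ch_scale Ch_Irr Q_sub)
  have ipc: "ip c h = (if h \<in> Q then of_nat (dg h) else 0)" if h: "h \<in> Irr" for h
  proof -
    have "ip c h = (\<Sum>g\<in>Q. if g = h then of_nat (dg h) else 0)"
      unfolding c_def ip_sum ip_lin using h Q_sub by (intro sum.cong refl) (simp add: ip_Irr)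
    thus ?thesis by simp
  qed
  have "ip (f \<star> c) h = ip (of_nat (dg f) *s c) h" if h: "h \<in> Irr" for h
  proof -
    have "star f \<in> Q" using f Q unfolding closed_def by blast
    hence sf: "star f \<in> Q" "star f \<in> Irr" "f \<in> Irr" using f by (simp_all add: Q_sub)
    have "ip (f \<star> c) h = (\<Sum>g\<in>Q. of_nat (dg g) * of_nat (mlt (star f \<star> h) g))"
      unfolding c_def bm_sum bm_scale ip_sum ip_lin
      using h sf Q_sub by (intro sum.cong refl) (simp add: ip_mlt Ch_intros mlt_adj(2)[of f _ h])
    also have "\<dots> = (if h \<in> Q then of_nat (dg f * dg h) else 0)"
    proof (cases "h \<in> Q")
      case True
      have z: "mlt (star f \<star> h) g = 0" if "g \<in> Irr" "g \<notin> Q" for g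
        using Q True sf(1) that unfolding closed_def by blast
      have "(\<Sum>g\<in>Q. dg g * mlt (star f \<star> h) g) = (\<Sum>g\<in>Irr. mlt (star f \<star> h) g * dg g)"
        by (rule sum.mono_neutral_cong_left) (use z Q_sub in auto)
      also have "\<dots> = dg f * dg h" using mlt_dg[OF sf(2) h] star_Irr[OF sf(3)] by simp
      finally have "(\<Sum>g\<in>Q. of_nat (dg g) * of_nat (mlt (star f \<star> h) g)) = (of_nat (dg f * dg h) :: 'k)"
        by (simp only: of_nat_sum[symmetric] of_nat_mult[symmetric])
      thus ?thesis using True by simp
    next
      case False
      have "mlt (star f \<star> h) g = 0" if g: "g \<in> Q" for g
      proof -
        have "mlt (star f \<star> h) g = mlt (f \<star> g) h" using mlt_adj(2)[of f g h] sf g h Q_sub by simp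
        thus ?thesis using Q f g h False unfolding closed_def by metis
      qed
      thus ?thesis using False by simp
    qed
    finally show ?thesis by (simp add: ip_lin ipc[OF h])
  qed
  moreover have "f \<star> c \<in> Ch" "of_nat (dg f) *s c \<in> Ch" using c f Q_sub by (auto intro: Ch_intros Ch_scale)
  ultimately have "f \<star> c = of_nat (dg f) *s c" 
    by (subst Ch_expand[of "f \<star> c"], simp, subst Ch_expand[of "of_nat (dg f) *s c"], simp)
      (intro sum.cong refl, metis ip_mlt)
  thus ?thesis by (simp add: qid_def c_def[symmetric] bm_scale vec.scale_left_commute)
qed

lemma qid_idem: "qid Q \<star> qid Q = qid Q"
proof -
  have "qid Q \<star> qid Q = (1 / of_nat (qdim Q)) *s (\<Sum>f\<in>Q. of_nat (dg f) *s (f \<star> qid Q))"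
    by (subst (1) qid_def) (simp add: bm_scale bm_sum)
  also have "\<dots> = (1 / of_nat (qdim Q)) *s (\<Sum>f\<in>Q. of_nat ((dg f)\<^sup>2) *s qid Q)"
    by (simp add: qid_absorb power2_eq_square)
  also have "\<dots> = qid Q" using qdim_pos by (simp add: vec.scale_sum_left[symmetric] qdim_def[symmetric] of_nat_sum[symmetric] del: of_nat_power of_nat_sum)
  finally show ?thesis .
qed

lemma qid_L: "qid Q \<cdot> L = 1 / of_nat (qdim Q)"
proof -
  have "(\<Sum>f\<in>Q. of_nat (dg f) * f \<cdot> L) = (\<Sum>f\<in>Q. if f = e then 1 else 0)"
    using Q_sub by (intro sum.cong refl) (simp add: Irr_L)
  thus ?thesis using Q by (simp add: qid_def pr_scale pr_sum closed_def)
qed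

text \<open>\<open>idem_dim\<close> for the normalized integral of the quotient, whose value at
  \<open>L\<close> is the inverse of its dimension.\<close>

theorem qdim_dvd:
  "\<exists>r::'k ^ 'i \<Rightarrow> nat. (\<forall>g\<in>dIrr. g \<cdot> qid Q = of_nat (r g)) \<and> (\<Sum>g\<in>dIrr. ddg g * r g) * qdim Q = CARD('i)"
proof -
  obtain r :: "'k ^ 'i \<Rightarrow> nat" where r: "\<forall>g\<in>dIrr. g \<cdot> qid Q = of_nat (r g)"
    "of_nat CARD('i) * (qid Q \<cdot> L) = (of_nat (\<Sum>g\<in>dIrr. ddg g * r g) :: 'k)" using idem_dim[OF qid_idem] by blast
  have "(of_nat ((\<Sum>g\<in>dIrr. ddg g * r g) * qdim Q) :: 'k) = of_nat CARD('i)"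
    using r(2) qdim_pos by (simp add: qid_L field_simps del: of_nat_sum)
  hence "(\<Sum>g\<in>dIrr. ddg g * r g) * qdim Q = CARD('i)" by (simp only: of_nat_eq_iff)
  thus ?thesis using r(1) by blast
qed

end

end

section \<open>The possible degrees in dimension 40\<close>

context hopf_int
begin

definition deg_mlt where "deg_mlt x d = (\<Sum>f\<in>{f\<in>Irr. dg f = d}. mlt x f)"
definition deg_count where "deg_count d = card {f\<in>Irr. dg f = d}"

lemma deg_count_1: "deg_count 1 = card Lin" by (simp add: deg_count_def Lin_def)

lemma mlt_le_deg_mlt: "h \<in> Irr \<Longrightarrow> mlt x h \<le> deg_mlt x (dg h)"
  unfolding deg_mlt_def by (rule member_le_sum) auto

lemma deg_mlt_zero: "(\<And>h. h \<in> Irr \<Longrightarrow> dg h = d \<Longrightarrow> mlt x h = 0) \<Longrightarrow> deg_mlt x d = 0"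
  by (auto simp: deg_mlt_def)

lemma deg_mlt_pos: assumes "deg_mlt x d > 0" obtains h where "h \<in> Irr" "dg h = d" "mlt x h > 0"
  using assms unfolding deg_mlt_def by (metis (mono_tags, lifting) less_irrefl mem_Collect_eq neq0_conv sum.neutral)

definition stab where "stab x = {f\<in>Lin. f \<star> x = x}"

lemma stab_sub: "stab x \<subseteq> Lin" "finite (stab x)" "e \<in> stab x"
  using finite_subset[OF _ finite_Lin] by (auto simp: stab_def)

lemma deg_mlt_Lin_star: assumes "x \<in> Irr" shows "deg_mlt (x \<star> star x) 1 = card (stab x)"
proof -
  have "deg_mlt (x \<star> star x) 1 = (\<Sum>f\<in>Lin. if f \<star> x = x then 1 else 0)"
    unfolding deg_mlt_def Lin_def[symmetric] using assms by (intro sum.cong refl) (simp add: mlt_Lin)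
  also have "\<dots> = card (stab x)" by (simp add: stab_def sum.If_cases Int_def conj_commute)
  finally show ?thesis .
qed

lemma orbit_fiber:
  assumes y: "y \<in> (\<lambda>f. f \<star> x) ` Lin" shows "card {f\<in>Lin. f \<star> x = y} = card (stab x)"
proof -
  obtain g where g: "g \<in> Lin" "y = g \<star> x" using y by auto
  have "bij_betw (\<lambda>f. g \<star> f) (stab x) {f\<in>Lin. f \<star> x = y}"
  proof (rule bij_betwI[of _ _ _ "\<lambda>f. star g \<star> f"])
    show "(\<lambda>f. g \<star> f) \<in> stab x \<rightarrow> {f\<in>Lin. f \<star> x = y}" using g by (auto simp: stab_def Lin_mul cmul_assoc)
    show "(\<lambda>f. star g \<star> f) \<in> {f\<in>Lin. f \<star> x = y} \<rightarrow> stab x"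
      using g by (auto simp: stab_def Lin_mul Lin_star cmul_assoc) (simp add: cmul_assoc[symmetric] Lin_inv)
  qed (auto simp: cmul_assoc[symmetric] Lin_inv g)
  from bij_betw_same_card[OF this] show ?thesis by simp
qed

lemma orbit_stab:
  assumes x: "x \<in> Irr" shows "card Lin = card ((\<lambda>f. f \<star> x) ` Lin) * card (stab x)"
proof -
  have "card Lin = (\<Sum>y\<in>(\<lambda>f. f \<star> x) ` Lin. card {f\<in>Lin. f \<star> x = y})"
    using sum.image_gen[of Lin "\<lambda>_. 1::nat" "\<lambda>f. f \<star> x"] by simp
  thus ?thesis by (simp add: orbit_fiber)
qed

lemma orbit_le: assumes x: "x \<in> Irr" shows "card ((\<lambda>f. f \<star> x) ` Lin) \<le> deg_count (dg x)"
  unfolding deg_count_def using x by (intro card_mono) (auto simp: Lin_act)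

lemma closed_Lin: "closed Lin"
  unfolding closed_def using Lin_Irr Lin_star Lin_mul e_Lin by (auto simp: mlt_Irr split: if_splits)

lemma card_Lin_dvd: "card Lin dvd CARD('i)"
proof -
  have "qdim Lin = card Lin" by (simp add: qdim_def Lin_dg)
  thus ?thesis using qdim_dvd[OF closed_Lin] by (metis dvd_triv_right)
qed

lemma mlt_self_star: "x \<in> Irr \<Longrightarrow> mlt (x \<star> star x) e = 1"
  using mlt_Lin(1)[of e x x] by simp

lemma mlt_Lin_le: "x \<in> Irr \<Longrightarrow> y \<in> Irr \<Longrightarrow> f \<in> Lin \<Longrightarrow> mlt (x \<star> y) f \<le> 1"
  using mlt_Lin(1)[of f x "star y"] by (simp add: star_Irr)

lemma deg_mlt_Lin_le: "x \<in> Irr \<Longrightarrow> y \<in> Irr \<Longrightarrow> deg_mlt (x \<star> y) 1 \<le> card Lin"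
  unfolding deg_mlt_def Lin_def[symmetric] using sum_bounded_above[of Lin "mlt (x \<star> y)" 1] mlt_Lin_le[of x y] by fastforce

lemma mlt_two_le_deg_mlt:
  assumes "h \<in> Irr" "h' \<in> Irr" "h \<noteq> h'" "dg h = d" "dg h' = d" shows "mlt x h + mlt x h' \<le> deg_mlt x d"
proof -
  have "(\<Sum>f\<in>{h,h'}. mlt x f) \<le> deg_mlt x d" unfolding deg_mlt_def using assms by (intro sum_mono2) auto
  thus ?thesis using assms by simp
qed

text \<open>The fusion rules of the symmetric group on three letters: the degree 4 of l l is used up
  by e, g and l. Dimension 6 will contradict divisibility of 40.\<close>

lemma closed_of_dim_6:
  assumes g: "g \<in> Lin" "g \<noteq> e" "Lin = {e, g}" and l: "l \<in> Irr" "dg l = 2" "star l = l" "g \<star> l = l"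
    and m: "mlt (l \<star> l) l = 1"
  shows "closed {e, g, l} \<and> qdim {e, g, l} = 6"
proof
  have lg: "l \<star> g = l"
  proof -
    have "star (g \<star> l) = l \<star> star g" by (simp add: star_mul l(3))
    moreover have "star g = g" using Lin_star[OF g(1)] g by (metis insertE singletonD star_star fin_hopf.ant_u[OF dual])
    ultimately show ?thesis using l by simp
  qed
  have gg: "star g = g" "g \<star> g = e"
  proof -
    show "star g = g" using Lin_star[OF g(1)] g by (metis insertE singletonD star_star fin_hopf.ant_u[OF dual])
    thus "g \<star> g = e" using Lin_inv[OF g(1)] by simp
  qed
  have el: "e \<noteq> l" "g \<noteq> l" using l(2) dg_e Lin_dg[OF g(1)] by (metis numeral_One numeral_eq_iff semiring_norm(85))+
  have ll: "h \<in> {e, g, l}" if h: "h \<in> Irr" "mlt (l \<star> l) h \<noteq> 0" for h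
  proof (rule ccontr)
    assume no: "h \<notin> {e, g, l}"
    have "mlt (l \<star> l) e = 1" "mlt (l \<star> l) g = 1" using mlt_self_star[OF l(1)] mlt_Lin(1)[OF g(1) l(1,1)] l by simp_all
    moreover have "e \<noteq> g" "e \<noteq> h" "g \<noteq> h" "l \<noteq> h" using no g by auto
    moreover have "(\<Sum>f\<in>{e,g,l,h}. mlt (l \<star> l) f * dg f) \<le> (\<Sum>f\<in>Irr. mlt (l \<star> l) f * dg f)"
      using h l g Lin_Irr e_Irr by (intro sum_mono2) auto
    ultimately have "1 + (1 + (2 + mlt (l \<star> l) h * dg h)) \<le> 4"
      using no el g m l Lin_dg[OF g(1)] mlt_dg[OF l(1,1)] by simp
    thus False using h dg_pos[OF h(1)] by simp
  qed
  show "closed {e, g, l}"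
    unfolding closed_def
    using l g lg gg ll e_Irr Lin_Irr fin_hopf.ant_u[OF dual] by (auto simp: mlt_Irr split: if_splits)
  show "qdim {e, g, l} = 6" using el g l Lin_dg[OF g(1)] by (simp add: qdim_def)
qed

lemma ip_norm: "x \<in> Ch \<Longrightarrow> ip x x = of_nat (\<Sum>h\<in>Irr. (mlt x h)\<^sup>2)"
  by (simp add: ip_Ch power2_eq_square)

context
  assumes n40: "CARD('i) = 40"
begin

lemma dg_le: "f \<in> Irr \<Longrightarrow> dg f \<le> 6"
proof -
  assume f: "f \<in> Irr"
  have "(dg f)\<^sup>2 \<le> (\<Sum>f\<in>Irr. (dg f)\<^sup>2)" using f by (intro member_le_sum) auto
  hence "(dg f)\<^sup>2 \<le> 40" by (simp add: sum_dg n40)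
  hence "(dg f)\<^sup>2 < 7\<^sup>2" by simp
  hence "dg f < 7" using power2_less_imp_less by blast
  thus ?thesis by simp
qed

lemma deg_count_pos: "h \<in> Irr \<Longrightarrow> deg_count (dg h) > 0"
  unfolding deg_count_def by (auto simp: card_gt_0_iff)

lemma dg_cases:
  assumes h: "h \<in> Irr"
  shows "dg h = 1 \<or> dg h = 2 \<or> dg h = 3 \<or> dg h = 4 \<and> deg_count 4 > 0 \<or> dg h = 5 \<and> deg_count 5 > 0 \<or> dg h = 6 \<and> deg_count 6 > 0"
proof -
  have "dg h = 1 \<or> dg h = 2 \<or> dg h = 3 \<or> dg h = 4 \<or> dg h = 5 \<or> dg h = 6"
    using dg_pos[OF h] dg_le[OF h] by presburger
  thus ?thesis using deg_count_pos[OF h] by metis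
qed

lemma sum_by_dg: fixes h :: "_ \<Rightarrow> nat" 
  shows "(\<Sum>f\<in>Irr. h f) = (\<Sum>d\<in>{1..6}. \<Sum>f\<in>{f\<in>Irr. dg f = d}. h f)"
  by (rule sum.group[symmetric]) (use dg_le dg_pos in \<open>auto simp: Suc_le_eq\<close>)

lemma six: "{1..6::nat} = {1,2,3,4,5,6}" by auto

lemma deg_count_sum: "deg_count 1 + 4 * deg_count 2 + 9 * deg_count 3 + 16 * deg_count 4 + 25 * deg_count 5 + 36 * deg_count 6 = 40"
proof -
  have "(\<Sum>f\<in>Irr. (dg f)\<^sup>2) = (\<Sum>d\<in>{1..6}. d\<^sup>2 * deg_count d)"
    unfolding sum_by_dg by (intro sum.cong refl) (simp add: deg_count_def)
  thus ?thesis unfolding sum_dg n40 six by (simp add: power2_eq_square)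
qed

lemma deg_mlt_sum: assumes "f \<in> Irr" "g \<in> Irr"
  shows "deg_mlt (f \<star> g) 1 + 2 * deg_mlt (f \<star> g) 2 + 3 * deg_mlt (f \<star> g) 3 + 4 * deg_mlt (f \<star> g) 4 + 5 * deg_mlt (f \<star> g) 5 + 6 * deg_mlt (f \<star> g) 6 = dg f * dg g"
proof -
  have "(\<Sum>h\<in>Irr. mlt (f \<star> g) h * dg h) = (\<Sum>d\<in>{1..6}. d * deg_mlt (f \<star> g) d)"
    unfolding sum_by_dg by (intro sum.cong refl) (simp add: deg_mlt_def sum_distrib_left mult.commute)
  thus ?thesis unfolding mlt_dg[OF assms] six by simp
qed

lemma deg_count_am: "deg_count d = 0 \<Longrightarrow> deg_mlt x d = 0"
  by (auto simp: deg_count_def deg_mlt_def)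

lemma qdim_not_6_22: "closed Q \<Longrightarrow> qdim Q \<noteq> 6" "closed Q \<Longrightarrow> qdim Q \<noteq> 22"
proof -
  assume "closed Q"
  hence "qdim Q dvd 40" using qdim_dvd[of Q] n40 by (metis dvd_triv_right)
  thus "qdim Q \<noteq> 6" "qdim Q \<noteq> 22" by (auto simp: dvd_def) presburger+
qed

text \<open>A special case of the theorem of Nichols and Richmond.\<close>

lemma fixed_deg2:
  assumes c: "deg_count 4 = 0" "deg_count 5 = 0" "deg_count 6 = 0" and c1: "card Lin \<le> 2" and l: "l \<in> Irr" "dg l = 2"
  shows "\<exists>g\<in>Lin. g \<noteq> e \<and> g \<star> l = l"
proof (rule ccontr)
  assume no: "\<not> (\<exists>g\<in>Lin. g \<noteq> e \<and> g \<star> l = l)"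
  note am0 = deg_count_am[OF c(1)] deg_count_am[OF c(2)] deg_count_am[OF c(3)]
  have sl: "star l \<in> Irr" "dg (star l) = 2" using star_Irr[OF l(1)] l by auto
  define x where "x = l \<star> star l"
  have "stab l = {e}" using no by (auto simp: stab_def)
  hence a1: "deg_mlt x 1 = 1" using deg_mlt_Lin_star[OF l(1)] by (simp add: x_def)
  have "deg_mlt x 1 + 2 * deg_mlt x 2 + 3 * deg_mlt x 3 = 4" using deg_mlt_sum[OF l(1) sl(1)] am0 l sl by (simp add: x_def)
  \<comment> \<open>The degree 4 of \<open>x\<close> contains a single linear character, so the rest
    is one character c of degree three.\<close>
  hence a: "deg_mlt x 3 = 1" "deg_mlt x 2 = 0" using a1 by presburger+
  obtain c where ch: "c \<in> Irr" "dg c = 3" "mlt x c > 0" using deg_mlt_pos[of x 3] a by auto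
  have xc: "mlt x c = 1" using mlt_le_deg_mlt[OF ch(1), of x] ch a by simp
  have xCh: "x \<in> Ch" unfolding x_def by (intro Ch_intros l)
  have xe: "x = e + c"
  proof -
    have "mlt x h = (if h = e then 1 else 0) + (if h = c then 1 else 0)" if h: "h \<in> Irr" for h
    proof -
      consider "dg h = 1" | "dg h = 2" | "dg h = 3" using dg_cases[OF h] c by auto
      thus ?thesis
      proof cases
        case 1
        hence "h \<in> Lin" using h by (simp add: Lin_def)
        hence "mlt x h = (if h = e then 1 else 0)" using mlt_Lin(1)[of h l l] l no by (auto simp: x_def)
        thus ?thesis using 1 ch by auto
      next
        case 2 thus ?thesis using mlt_le_deg_mlt[OF h, of x] a ch by auto
      next
        case 3 thus ?thesis using mlt_two_le_deg_mlt[OF h ch(1), of 3 x] a xc ch by auto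
      qed
    qed
    hence "x = (\<Sum>h\<in>Irr. (if h = e then e else 0) + (if h = c then c else 0))"
      by (subst Ch_expand[OF xCh], intro sum.cong refl) (auto simp: vec.scale_left_distrib)
    thus ?thesis using e_Irr ch by (simp add: sum.distrib)
  qed
  have sc: "star c = c"
  proof -
    have "star x = x" by (simp add: x_def star_mul)
    hence "star c = c" using xe fin_hopf.ant_u[OF dual] by (simp add: ant_add)
    thus ?thesis .
  qed
  have lincl: "mlt (c \<star> l) h = 0" if h: "h \<in> Lin" for h
  proof -
    have "mlt (c \<star> l) h = mlt (h \<star> star l) c" using h by (intro mlt_adj(1) ch l Lin_Irr)
    thus ?thesis using Lin_act[OF h sl(1)] sl ch by (auto simp: mlt_Irr)
  qed
  have cl1: "deg_mlt (c \<star> l) 1 = 0" by (rule deg_mlt_zero) (use lincl in \<open>auto simp: Lin_def\<close>)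
  have cll: "mlt (c \<star> l) l = 1" using mlt_adj(1)[OF ch(1) l(1,1)] xc by (simp add: x_def)
  have grp_class: "deg_mlt (c \<star> l) 1 + 2 * deg_mlt (c \<star> l) 2 + 3 * deg_mlt (c \<star> l) 3 = 6" using deg_mlt_sum[OF ch(1) l(1)] am0 l ch by simp
  have "deg_mlt (c \<star> l) 2 \<ge> 1" using mlt_le_deg_mlt[OF l(1), of "c \<star> l"] cll l by simp
  hence cl2: "deg_mlt (c \<star> l) 2 = 3" using grp_class cl1 by presburger
  have clCh: "c \<star> l \<in> Ch" and ccCh: "c \<star> c \<in> Ch" by (intro Ch_intros ch l)+
  \<comment> \<open>The norm of c l is the multiplicity of c in c c plus one, by adjunction. Its
    constituents of degree two, three in number with multiplicity, make it at least 3.\<close>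
  have cc: "mlt (c \<star> c) c \<ge> 2"
  proof -
    have "ip (c \<star> l) (c \<star> l) = ip c (c \<star> (l \<star> star l))" by (simp only: ip_adj(1) cmul_assoc)
    also have "\<dots> = ip (c \<star> c) c + 1" 
      unfolding x_def[symmetric] xe using ch by (simp add: bm_add ip_lin ip_sym[of c "c \<star> c"] ip_Irr)
    also have "\<dots> = of_nat (mlt (c \<star> c) c + 1)" using ccCh ch by (simp add: ip_mlt)
    finally have "(of_nat (\<Sum>h\<in>Irr. (mlt (c \<star> l) h)\<^sup>2) :: 'k) = of_nat (mlt (c \<star> c) c + 1)" by (simp only: ip_norm[OF clCh])
    hence "(\<Sum>h\<in>Irr. (mlt (c \<star> l) h)\<^sup>2) = mlt (c \<star> c) c + 1" by (simp only: of_nat_eq_iff)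
    moreover have "deg_mlt (c \<star> l) 2 \<le> (\<Sum>h\<in>Irr. (mlt (c \<star> l) h)\<^sup>2)"
    proof -
      have "deg_mlt (c \<star> l) 2 \<le> (\<Sum>h\<in>{f\<in>Irr. dg f = 2}. (mlt (c \<star> l) h)\<^sup>2)"
        unfolding deg_mlt_def by (intro sum_mono) (simp add: power2_nat_le_imp_le power2_eq_square)
      also have "\<dots> \<le> (\<Sum>h\<in>Irr. (mlt (c \<star> l) h)\<^sup>2)" by (intro sum_mono2) auto
      finally show ?thesis .
    qed
    ultimately show ?thesis using cl2 by simp
  qed
  have ccs: "deg_mlt (c \<star> c) 1 + 2 * deg_mlt (c \<star> c) 2 + 3 * deg_mlt (c \<star> c) 3 = 9" using deg_mlt_sum[OF ch(1,1)] am0 ch by simp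
  have cc3: "deg_mlt (c \<star> c) 3 \<ge> 2" using mlt_le_deg_mlt[OF ch(1), of "c \<star> c"] cc ch by simp
  have cce: "mlt (c \<star> c) e = 1" using mlt_self_star[OF ch(1)] sc by simp
  have "deg_mlt (c \<star> c) 1 \<ge> 1" using mlt_le_deg_mlt[OF e_Irr, of "c \<star> c"] cce by simp
  moreover have "deg_mlt (c \<star> c) 1 \<le> 2" using deg_mlt_Lin_le[OF ch(1,1)] c1 by simp
  ultimately have ccm: "deg_mlt (c \<star> c) 1 = 1" "deg_mlt (c \<star> c) 2 = 1" "deg_mlt (c \<star> c) 3 = 2" using ccs cc3 by presburger+
  have ccc: "mlt (c \<star> c) c = 2" using mlt_le_deg_mlt[OF ch(1), of "c \<star> c"] cc ch ccm by simp
  obtain y where y: "y \<in> Irr" "dg y = 2" "mlt (c \<star> c) y > 0" using deg_mlt_pos[of "c \<star> c" 2] ccm by auto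
  have ccy: "mlt (c \<star> c) y = 1" using mlt_le_deg_mlt[OF y(1), of "c \<star> c"] y ccm by simp
  \<comment> \<open>The degree 9 is now used up: c c = e + y + 2 c with y of degree two.\<close>
  have ccz: "mlt (c \<star> c) h = (if h = e then 1 else 0) + (if h = y then 1 else 0) + (if h = c then 2 else 0)" if h: "h \<in> Irr" for h
  proof -
    consider "dg h = 1" | "dg h = 2" | "dg h = 3" using dg_cases[OF h] c by auto
    thus ?thesis
    proof cases
      case 1 thus ?thesis using mlt_two_le_deg_mlt[OF h e_Irr, of 1 "c \<star> c"] ccm cce ch y by auto
    next
      case 2 thus ?thesis using mlt_two_le_deg_mlt[OF h y(1), of 2 "c \<star> c"] ccm ccy ch y by auto
    next
      case 3 thus ?thesis using mlt_two_le_deg_mlt[OF h ch(1), of 3 "c \<star> c"] ccm ccc ch y by auto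
    qed
  qed
  have ccz_y: "h = y" if "h \<in> Irr" "mlt (c \<star> c) h = 1" "h \<noteq> e" "h \<noteq> c" for h
  proof (rule ccontr)
    assume "h \<noteq> y"
    hence "mlt (c \<star> c) h = 0" by (subst ccz[OF that(1)]) (simp only: that if_False add_0)
    thus False using that(2) by simp
  qed
  have sy: "star y = y"
  proof -
    have "mlt (star (c \<star> c)) (star y) = 1" using mlt_star[OF ccCh y(1)] ccy by simp
    hence "mlt (c \<star> c) (star y) = 1" by (simp add: star_mul sc)
    moreover have "dg (star y) = 2" using star_Irr[OF y(1)] y(2) by simp
    hence "star y \<noteq> e" "star y \<noteq> c" using ch(2) dg_e by (metis numeral_One numeral_eq_iff num.distinct(1), fastforce)
    ultimately show ?thesis using ccz_y[OF conjunct1[OF star_Irr[OF y(1)]]] by blast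
  qed
  have cyCh: "c \<star> y \<in> Ch" and yyCh: "y \<star> y \<in> Ch" by (intro Ch_intros ch y)+
  have cyc: "mlt (c \<star> y) c = 1" using mlt_adj(2)[OF ch(1) y(1) ch(1)] sc ccy by simp
  have cylin: "mlt (c \<star> y) h = 0" if h: "h \<in> Lin" for h
  proof -
    have "mlt (c \<star> y) h = mlt (h \<star> star y) c" using h by (intro mlt_adj(1) ch y Lin_Irr)
    thus ?thesis using Lin_act[OF h y(1)] sy y ch by (auto simp: mlt_Irr)
  qed
  have cy1: "deg_mlt (c \<star> y) 1 = 0" by (rule deg_mlt_zero) (use cylin in \<open>auto simp: Lin_def\<close>)
  have cys: "deg_mlt (c \<star> y) 1 + 2 * deg_mlt (c \<star> y) 2 + 3 * deg_mlt (c \<star> y) 3 = 6" using deg_mlt_sum[OF ch(1) y(1)] am0 y ch by simp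
  have "deg_mlt (c \<star> y) 3 \<ge> 1" using mlt_le_deg_mlt[OF ch(1), of "c \<star> y"] cyc ch by simp
  hence cy3: "deg_mlt (c \<star> y) 3 = 2" "deg_mlt (c \<star> y) 2 = 0" using cys cy1 by presburger+
  have norm: "(\<Sum>h\<in>Irr. (mlt (c \<star> y) h)\<^sup>2) = 2"
  proof -
    have "mlt (c \<star> y) h \<le> 1" if h: "h \<in> Irr" "dg h = 3" for h
      using mlt_two_le_deg_mlt[OF h(1) ch(1), of 3 "c \<star> y"] h ch cyc cy3 by (cases "h = c") auto
    hence le: "(mlt (c \<star> y) h)\<^sup>2 = mlt (c \<star> y) h" if "h \<in> Irr" "dg h = 3" for h
      using that by (metis le_SucE le_zero_eq One_nat_def one_power2 power_zero_numeral)
    have "(\<Sum>h\<in>Irr. (mlt (c \<star> y) h)\<^sup>2) = (\<Sum>h\<in>{f\<in>Irr. dg f = 3}. (mlt (c \<star> y) h)\<^sup>2)"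
    proof (rule sum.mono_neutral_right)
      show "\<forall>h\<in>Irr - {f \<in> Irr. dg f = 3}. (mlt (c \<star> y) h)\<^sup>2 = 0"
      proof (intro ballI, rule ccontr)
        fix h assume h: "h \<in> Irr - {f \<in> Irr. dg f = 3}" "(mlt (c \<star> y) h)\<^sup>2 \<noteq> 0"
        hence hI: "h \<in> Irr" and "mlt (c \<star> y) h > 0" by auto
        hence "deg_mlt (c \<star> y) (dg h) > 0" using mlt_le_deg_mlt[OF hI, of "c \<star> y"] by simp
        hence "dg h = 3" using cy1 cy3 c dg_cases[OF hI] by auto
        thus False using h by simp
      qed
    qed auto
    also have "\<dots> = deg_mlt (c \<star> y) 3" unfolding deg_mlt_def by (intro sum.cong refl) (simp add: le)
    finally show ?thesis using cy3 by simp
  qed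
  \<comment> \<open>Writing the norm 2 of c y as the inner product of c c and y y forces y to occur
    exactly once in y y.\<close>
  have "ip (c \<star> y) (c \<star> y) = ip (c \<star> c) (y \<star> y)"
  proof -
    have "ip (c \<star> y) (c \<star> y) = ip c (c \<star> (y \<star> y))" by (simp only: ip_adj(1) cmul_assoc sy)
    also have "\<dots> = ip (c \<star> c) (y \<star> y)" by (simp only: ip_adj(2)[of c] sc ip_sym[of c])
    finally show ?thesis .
  qed
  also have "\<dots> = of_nat (\<Sum>h\<in>Irr. mlt (c \<star> c) h * mlt (y \<star> y) h)" by (rule ip_Ch[OF ccCh yyCh])
  finally have "(of_nat 2 :: 'k) = of_nat (\<Sum>h\<in>Irr. mlt (c \<star> c) h * mlt (y \<star> y) h)" by (simp only: ip_norm[OF cyCh] norm)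
  hence "2 = (\<Sum>h\<in>Irr. mlt (c \<star> c) h * mlt (y \<star> y) h)" by (simp only: of_nat_eq_iff)
  also have "\<dots> = (\<Sum>h\<in>Irr. (if h = e then mlt (y \<star> y) e else 0) + (if h = y then mlt (y \<star> y) y else 0) + (if h = c then 2 * mlt (y \<star> y) c else 0))"
    using y ch by (intro sum.cong refl) (auto simp: ccz)
  also have "\<dots> = mlt (y \<star> y) e + mlt (y \<star> y) y + 2 * mlt (y \<star> y) c"
    using y ch e_Irr by (simp add: sum.distrib)
  also have "mlt (y \<star> y) e = 1" using mlt_self_star[OF y(1)] sy by simp
  finally have yy: "mlt (y \<star> y) y = 1" by presburger
  have yye: "mlt (y \<star> y) e = 1" using mlt_self_star[OF y(1)] sy by simp
  have yys: "deg_mlt (y \<star> y) 1 + 2 * deg_mlt (y \<star> y) 2 + 3 * deg_mlt (y \<star> y) 3 = 4" using deg_mlt_sum[OF y(1,1)] am0 y by simp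
  have "deg_mlt (y \<star> y) 2 \<ge> 1" using mlt_le_deg_mlt[OF y(1), of "y \<star> y"] yy y by simp
  moreover have "deg_mlt (y \<star> y) 1 \<ge> 1" using mlt_le_deg_mlt[OF e_Irr, of "y \<star> y"] yye by simp
  ultimately have yy1: "deg_mlt (y \<star> y) 1 = 2" using yys by presburger
  \<comment> \<open>The remaining degree in y y is a second linear character. It fixes y, so e, g
    and y form the closed set of dimension 6.\<close>
  have "\<exists>g\<in>Lin. g \<noteq> e \<and> mlt (y \<star> y) g \<noteq> 0"
  proof (rule ccontr)
    assume n: "\<not> (\<exists>g\<in>Lin. g \<noteq> e \<and> mlt (y \<star> y) g \<noteq> 0)"
    have "deg_mlt (y \<star> y) 1 = (\<Sum>f\<in>Lin. if f = e then 1 else 0)"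
      unfolding deg_mlt_def Lin_def[symmetric] using n yye by (intro sum.cong refl) auto
    thus False using yy1 by simp
  qed
  then obtain g where g: "g \<in> Lin" "g \<noteq> e" "mlt (y \<star> y) g \<noteq> 0" by blast
  have "{e, g} = Lin" using c1 g by (intro card_seteq) auto
  hence "Lin = {e, g}" by simp
  moreover have "g \<star> y = y" using mlt_Lin(1)[OF g(1) y(1,1)] g(3) sy by (auto split: if_splits)
  ultimately have "closed {e, g, y} \<and> qdim {e, g, y} = 6" by (intro closed_of_dim_6 g y sy yy)
  thus False using qdim_not_6_22(1) by blast
qed

end

end

section \<open>The possible orders of the group of linear characters\<close>

text \<open>The variables count the irreducible characters of degrees 1 to 6, and \<open>a\<close>
  runs over the divisors of 40. The squares of the larger degrees bound their numbers, and for each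
  choice a linear equation is left.\<close>

lemma degree_equation:
  fixes a b c d f g :: nat
  assumes eq: "a + 4 * b + 9 * c + 16 * d + 25 * f + 36 * g = 40"
  shows "a = 1 \<Longrightarrow> d = 0 \<and> f = 0 \<and> g = 0 \<and> b = 3"
    "a = 2 \<Longrightarrow> b = 1 \<or> b = 5 \<and> c = 2 \<and> d = 0 \<and> f = 0 \<and> g = 0"
    "a = 4 \<Longrightarrow> g = 1 \<and> c = 0 \<and> f = 0 \<and> b = 0 \<and> d = 0 \<or> c = 4 \<and> b = 0 \<and> d = 0 \<and> f = 0 \<and> g = 0 \<or> c = 0 \<and> f = 0 \<and> g = 0"
    "a = 5 \<Longrightarrow> b = 2" "a = 8 \<Longrightarrow> c = 0 \<and> f = 0 \<and> g = 0" "a = 10 \<Longrightarrow> b = 3"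
    "a = 20 \<Longrightarrow> c = 0 \<and> f = 0 \<and> g = 0 \<and> (d = 0 \<or> b = 1)"
    "a = 40 \<Longrightarrow> b = 0 \<and> c = 0 \<and> d = 0 \<and> f = 0 \<and> g = 0"
proof -
  have "c = 0 \<or> c = 1 \<or> c = 2 \<or> c = 3 \<or> c = 4" "d = 0 \<or> d = 1 \<or> d = 2" "f = 0 \<or> f = 1" "g = 0 \<or> g = 1"
    using eq by linarith+
  note cs = this eq
  show "a = 1 \<Longrightarrow> d = 0 \<and> f = 0 \<and> g = 0 \<and> b = 3"
    using cs by (elim disjE; hypsubst; presburger)
  show "a = 2 \<Longrightarrow> b = 1 \<or> b = 5 \<and> c = 2 \<and> d = 0 \<and> f = 0 \<and> g = 0"
    using cs by (elim disjE; hypsubst; presburger)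
  show "a = 4 \<Longrightarrow> g = 1 \<and> c = 0 \<and> f = 0 \<and> b = 0 \<and> d = 0 \<or> c = 4 \<and> b = 0 \<and> d = 0 \<and> f = 0 \<and> g = 0 \<or> c = 0 \<and> f = 0 \<and> g = 0"
    using cs by (elim disjE; hypsubst; presburger)
  show "a = 5 \<Longrightarrow> b = 2" "a = 8 \<Longrightarrow> c = 0 \<and> f = 0 \<and> g = 0" "a = 10 \<Longrightarrow> b = 3"
    using cs by (elim disjE; hypsubst; presburger)+
  show "a = 20 \<Longrightarrow> c = 0 \<and> f = 0 \<and> g = 0 \<and> (d = 0 \<or> b = 1)"
    using cs by (elim disjE; hypsubst; presburger)
  show "a = 40 \<Longrightarrow> b = 0 \<and> c = 0 \<and> d = 0 \<and> f = 0 \<and> g = 0"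
    using cs by (elim disjE; hypsubst; presburger)
qed

context hopf_int
begin

lemma deg_mlt_dg_le: 
  assumes "f \<in> Irr" "g \<in> Irr" shows "deg_mlt (f \<star> g) 1 \<le> dg f * dg g"
proof -
  have "deg_mlt (f \<star> g) 1 \<le> (\<Sum>h\<in>{h\<in>Irr. dg h = 1}. mlt (f \<star> g) h * dg h)" unfolding deg_mlt_def by (intro sum_mono) auto
  also have "\<dots> \<le> (\<Sum>h\<in>Irr. mlt (f \<star> g) h * dg h)" by (intro sum_mono2) auto
  finally show ?thesis by (simp only: mlt_dg[OF assms])
qed

lemma stab_le: "x \<in> Irr \<Longrightarrow> card (stab x) \<le> (dg x)\<^sup>2"
  using deg_mlt_dg_le[of x "star x"] deg_mlt_Lin_star[of x] star_Irr[of x] by (simp add: power2_eq_square)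

lemma stab_pos: "card (stab x) > 0"
  using stab_sub[of x] by (auto simp: card_gt_0_iff)

lemma deg_count_ex: assumes "deg_count d > 0" obtains x where "x \<in> Irr" "dg x = d"
  using assms unfolding deg_count_def by (auto simp: card_gt_0_iff)

lemma Lin_pair: assumes "card Lin = 2" obtains g where "g \<noteq> e" "Lin = {e, g}"
  using assms e_Lin unfolding card_2_iff by (metis insertE insert_commute singletonD)

context
  assumes n40: "CARD('i) = 40"
begin

lemmas deg_count_sum40 = deg_count_sum[OF n40, unfolded deg_count_1]

lemma card_Lin_cases: "card Lin \<in> {1,2,4,5,8,10,20,40}"
proof -
  have "card Lin dvd 40" using card_Lin_dvd n40 by simp
  moreover have "card Lin \<le> 40" using calculation by (rule dvd_imp_le) simp
  ultimately have "card Lin \<in> set (filter (\<lambda>d. d dvd 40) [0..<41])" by simp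
  also have "filter (\<lambda>d. d dvd 40) [0..<41] = [1,2,4,5,8,10,20,40::nat]" by code_simp
  finally show ?thesis by simp
qed

lemma card_Lin_not_1: "card Lin \<noteq> 1"
proof
  assume a: "card Lin = 1"
  have "deg_count 4 = 0 \<and> deg_count 5 = 0 \<and> deg_count 6 = 0 \<and> deg_count 2 = 3" using degree_equation(1)[OF deg_count_sum40 a] by blast
  then obtain l where "l \<in> Irr" "dg l = 2" "deg_count 4 = 0" "deg_count 5 = 0" "deg_count 6 = 0" using deg_count_ex[of 2] by auto
  from fixed_deg2[OF n40 this(3-5) _ this(1,2)] a obtain g where "g \<in> Lin" "g \<noteq> e" by auto
  hence "card {e, g} \<le> card Lin" by (intro card_mono) auto
  thus False using \<open>g \<noteq> e\<close> a by simp
qed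

text \<open>A unique character of degree two is self-dual and fixed by \<open>g\<close>, which gives
  a closed set of dimension 6. With five of them, \<open>Lin\<close> and the characters of degree
  two form a closed set of dimension 2 + 5 * 4 = 22. Neither number divides 40.\<close>

lemma card_Lin_not_2: "card Lin \<noteq> 2"
proof
  assume a: "card Lin = 2"
  then obtain g where g: "g \<noteq> e" "Lin = {e, g}" by (rule Lin_pair)
  have gL: "g \<in> Lin" using g by simp
  have cs: "deg_count 2 = 1 \<or> deg_count 2 = 5 \<and> deg_count 3 = 2 \<and> deg_count 4 = 0 \<and> deg_count 5 = 0 \<and> deg_count 6 = 0"
    using degree_equation(2)[OF deg_count_sum40 a] by blast
  thus False
  proof
    assume c: "deg_count 2 = 1"
    then obtain l where l: "{f\<in>Irr. dg f = 2} = {l}" unfolding deg_count_def by (auto simp: card_1_singleton_iff)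
    have uniq: "f = l" if "f \<in> Irr" "dg f = 2" for f using l that by blast
    have lI: "l \<in> Irr" "dg l = 2" using l by blast+
    have sl: "star l = l" using star_Irr[OF lI(1)] lI by (intro uniq) auto
    have gl: "g \<star> l = l" using Lin_act[OF gL lI(1)] lI by (intro uniq) auto
    have "stab l = Lin" using g gl by (auto simp: stab_def)
    hence a1: "deg_mlt (l \<star> l) 1 = 2" using deg_mlt_Lin_star[OF lI(1)] sl a by simp
    hence "deg_mlt (l \<star> l) 2 = 1" using deg_mlt_sum[OF n40 lI(1,1)] lI by presburger
    moreover have "deg_mlt (l \<star> l) 2 = mlt (l \<star> l) l" by (simp add: deg_mlt_def l)
    ultimately have "closed {e, g, l} \<and> qdim {e, g, l} = 6" by (intro closed_of_dim_6 gL g lI sl gl) simp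
    thus False using qdim_not_6_22(1)[OF n40] by blast
  next
    assume c: "deg_count 2 = 5 \<and> deg_count 3 = 2 \<and> deg_count 4 = 0 \<and> deg_count 5 = 0 \<and> deg_count 6 = 0"
    have fx: "f \<star> l = l" if "l \<in> Irr" "dg l = 2" "f \<in> Lin" for f l
      using fixed_deg2[OF n40 _ _ _ _ that(1,2)] c a g that by auto
    define Q where "Q = Lin \<union> {f\<in>Irr. dg f = 2}"
    have dQ: "h \<in> Q \<longleftrightarrow> h \<in> Irr \<and> dg h \<noteq> 3" for h
      using dg_cases[OF n40, of h] c by (auto simp: Q_def Lin_def)
    \<comment> \<open>A constituent of degree three would leave exactly one linear constituent. But
      every linear character fixes the characters of degree two, so either both linear characters
      occur or none.\<close>
    have no3: "dg h \<noteq> 3" if l: "l \<in> Irr" "dg l = 2" "l' \<in> Irr" "dg l' = 2" and h: "h \<in> Irr" "mlt (l \<star> l') h \<noteq> 0" for l l' h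
    proof
      assume h3: "dg h = 3"
      define x where "x = l \<star> l'"
      have "deg_mlt x 1 + 2 * deg_mlt x 2 + 3 * deg_mlt x 3 = 4" using deg_mlt_sum[OF n40 l(1,3)] l c by (simp add: x_def deg_count_am[OF n40])
      moreover have "deg_mlt x 3 > 0" using mlt_le_deg_mlt[OF h(1), of x] h h3 by (simp add: x_def)
      ultimately have "deg_mlt x 1 = 1" by presburger
      moreover have "deg_mlt x 1 = (\<Sum>f\<in>Lin. if star l' = l then 1 else 0)"
        unfolding deg_mlt_def Lin_def[symmetric]
      proof (intro sum.cong refl)
        fix f assume f: "f \<in> Lin"
        have s: "star l' \<in> Irr" "dg (star l') = 2" using star_Irr[OF l(3)] l by auto
        have "mlt x f = (if f \<star> star l' = l then 1 else 0)" using mlt_Lin(1)[OF f l(1) s(1)] by (simp add: x_def)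
        thus "mlt x f = (if star l' = l then 1 else 0)" by (simp only: fx[OF s f])
      qed
      ultimately show False using a by (auto split: if_splits)
    qed
    have "closed Q" unfolding closed_def
    proof (intro conjI ballI impI)
      show "Q \<subseteq> Irr" "e \<in> Q" by (auto simp: Q_def Lin_def e_Irr)
      show "star f \<in> Q" if "f \<in> Q" for f using that star_Irr[of f] by (auto simp: dQ)
      show "h \<in> Q" if f: "f \<in> Q" and k: "k \<in> Q" and h: "h \<in> Irr" "mlt (f \<star> k) h \<noteq> 0" for f k h
      proof (cases "dg f = 2 \<and> dg k = 2")
        case True thus ?thesis using no3[of f k h] f k h by (simp add: dQ)
      next
        case False
        hence "f \<in> Lin \<or> k \<in> Lin" using f k by (auto simp: Q_def)
        thus ?thesis
        proof
          assume fL: "f \<in> Lin"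
          have kI: "k \<in> Irr" "dg k \<noteq> 3" using k by (simp_all add: dQ)
          show ?thesis using Lin_act[OF fL kI(1)] h kI by (auto simp: mlt_Irr dQ split: if_splits)
        next
          assume kL: "k \<in> Lin"
          have fI: "f \<in> Irr" "dg f \<noteq> 3" using f by (simp_all add: dQ)
          show ?thesis using Lin_act[OF kL fI(1)] h fI by (auto simp: mlt_Irr dQ split: if_splits)
        qed
      qed
    qed
    moreover have "qdim Q = 22"
    proof -
      have "qdim Q = qdim Lin + qdim {f\<in>Irr. dg f = 2}" unfolding qdim_def Q_def by (rule sum.union_disjoint) (auto simp: Lin_def)
      thus ?thesis using a c by (simp add: qdim_def Lin_dg deg_count_def)
    qed
    ultimately show False using qdim_not_6_22(2)[OF n40] by blast
  qed
qed

text \<open>In the two unwanted cases all nonlinear characters have one degree d. The product of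
  such a character with its dual then has degree d^2 = s + d q, with s the order of a stabilizer, so
  6 or 3 would divide s; but s is 1, 2 or 4.\<close>

lemma degrees_if_card_Lin_4: assumes a: "card Lin = 4" shows "deg_count 3 = 0 \<and> deg_count 5 = 0 \<and> deg_count 6 = 0"
proof -
  have st: "card (stab x) = 1 \<or> card (stab x) = 2 \<or> card (stab x) = 4" if "x \<in> Irr" for x
  proof -
    have d: "card (stab x) dvd 4" using orbit_stab[OF that] a by (metis dvd_triv_right)
    hence "card (stab x) \<le> 4" by (rule dvd_imp_le) simp
    hence "card (stab x) = 1 \<or> card (stab x) = 2 \<or> card (stab x) = 3 \<or> card (stab x) = 4" using stab_pos[of x] by linarith
    moreover have "\<not> (3::nat) dvd 4" by presburger
    ultimately show ?thesis using d by metis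
  qed
  have "deg_count 6 = 1 \<and> deg_count 3 = 0 \<and> deg_count 5 = 0 \<and> deg_count 2 = 0 \<and> deg_count 4 = 0 \<or> deg_count 3 = 4 \<and> deg_count 2 = 0 \<and> deg_count 4 = 0 \<and> deg_count 5 = 0 \<and> deg_count 6 = 0
     \<or> deg_count 3 = 0 \<and> deg_count 5 = 0 \<and> deg_count 6 = 0"
    using degree_equation(3)[OF deg_count_sum40 a] by blast
  moreover have False if c: "deg_count 6 = 1 \<and> deg_count 3 = 0 \<and> deg_count 5 = 0 \<and> deg_count 2 = 0 \<and> deg_count 4 = 0"
  proof -
    obtain x where x: "x \<in> Irr" "dg x = 6" using deg_count_ex[of 6] c by auto
    hence "card (stab x) + 6 * deg_mlt (x \<star> star x) 6 = 36"
      using deg_mlt_sum[OF n40 x(1) conjunct1[OF star_Irr[OF x(1)]]] deg_mlt_Lin_star[OF x(1)] c star_Irr[OF x(1)] by (simp add: deg_count_am[OF n40])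
    moreover have "False" if "p + 6 * q = 36" "p = 1 \<or> p = 2 \<or> p = 4" for p q :: nat using that by presburger
    ultimately show False using st[OF x(1)] by blast
  qed
  moreover have False if c: "deg_count 3 = 4 \<and> deg_count 2 = 0 \<and> deg_count 4 = 0 \<and> deg_count 5 = 0 \<and> deg_count 6 = 0"
  proof -
    obtain x where x: "x \<in> Irr" "dg x = 3" using deg_count_ex[of 3] c by auto
    hence "card (stab x) + 3 * deg_mlt (x \<star> star x) 3 = 9"
      using deg_mlt_sum[OF n40 x(1) conjunct1[OF star_Irr[OF x(1)]]] deg_mlt_Lin_star[OF x(1)] c star_Irr[OF x(1)] by (simp add: deg_count_am[OF n40])
    moreover have "False" if "p + 3 * q = 9" "p = 1 \<or> p = 2 \<or> p = 4" for p q :: nat using that by presburger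
    ultimately show False using st[OF x(1)] by blast
  qed
  ultimately show ?thesis by blast
qed

text \<open>Orbit and stabilizer for a character of degree two: the stabilizer counts linear
  constituents in a product of degree four.\<close>

lemma orbit_bound: 
  assumes "deg_count 2 > 0" shows "\<exists>r s. 0 < s \<and> s \<le> 4 \<and> r \<le> deg_count 2 \<and> card Lin = r * s"
proof -
  obtain x where x: "x \<in> Irr" "dg x = 2" using deg_count_ex[OF assms] .
  show ?thesis using orbit_stab[OF x(1)] orbit_le[OF x(1)] stab_le[OF x(1)] stab_pos[of x] x(2) by auto
qed

text \<open>The orders 5 and 10, and order 20 with a single character of degree two, leave too few
  characters of degree two for an orbit with stabilizer of order at most 4.\<close>

theorem degree_types:
  obtains "card Lin = 4" "\<forall>f\<in>Irr. dg f \<in> {1,2,4}" | "card Lin = 8" "\<forall>f\<in>Irr. dg f \<in> {1,2,4}"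
    | "card Lin = 20" "\<forall>f\<in>Irr. dg f \<in> {1,2}" | "card Lin = 40" "\<forall>f\<in>Irr. dg f = 1"
proof -
  have dc: "dg f \<in> {1,2,4}" if "deg_count 3 = 0" "deg_count 5 = 0" "deg_count 6 = 0" "f \<in> Irr" for f
    using dg_cases[OF n40 that(4)] deg_count_pos[OF n40 that(4)] that(1-3) by auto
  have dc': "dg f \<in> {1,2}" if "deg_count 3 = 0" "deg_count 5 = 0" "deg_count 6 = 0" "deg_count 4 = 0" "f \<in> Irr" for f
    using dc[OF that(1-3,5)] deg_count_pos[OF n40 that(5)] that(4) by auto
  consider "card Lin = 1" | "card Lin = 2" | "card Lin = 4" | "card Lin = 5" | "card Lin = 8" | "card Lin = 10"
     | "card Lin = 20" | "card Lin = 40" using card_Lin_cases by auto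
  thus thesis
  proof cases
    case 1 thus thesis using card_Lin_not_1 by blast
  next
    case 2 thus thesis using card_Lin_not_2 by blast
  next
    case 3 thus thesis using degrees_if_card_Lin_4 dc that(1) by blast
  next
    case 4
    have "deg_count 2 = 2" using degree_equation(4)[OF deg_count_sum40 4] by blast
    then obtain r s :: nat where rs: "s \<le> 4" "r \<le> 2" "r * s = 5" using orbit_bound 4 by fastforce
    hence "r = 0 \<or> r = 1 \<or> r = 2" by presburger
    thus thesis using rs by (elim disjE; simp; presburger?)
  next
    case 5
    have "deg_count 3 = 0 \<and> deg_count 5 = 0 \<and> deg_count 6 = 0" using degree_equation(5)[OF deg_count_sum40 5] by blast
    thus thesis using dc that(2) 5 by blast
  next
    case 6
    have "deg_count 2 = 3" using degree_equation(6)[OF deg_count_sum40 6] by blast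
    then obtain r s :: nat where rs: "s \<le> 4" "r \<le> 3" "r * s = 10" using orbit_bound 6 by fastforce
    hence "r = 0 \<or> r = 1 \<or> r = 2 \<or> r = 3" by presburger
    thus thesis using rs by (elim disjE; simp; presburger?)
  next
    case 7
    have c: "deg_count 3 = 0 \<and> deg_count 5 = 0 \<and> deg_count 6 = 0 \<and> (deg_count 4 = 0 \<or> deg_count 2 = 1)" using degree_equation(7)[OF deg_count_sum40 7] by blast
    moreover have "deg_count 2 \<noteq> 1"
    proof
      assume "deg_count 2 = 1"
      then obtain r s :: nat where rs: "s \<le> 4" "r \<le> 1" "r * s = 20" using orbit_bound 7 by fastforce
      hence "r = 0 \<or> r = 1" by presburger
      thus False using rs by (elim disjE; simp)
    qed
    ultimately show thesis using dc' that(3) 7 by blast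
  next
    case 8
    have "deg_count 2 = 0 \<and> deg_count 3 = 0 \<and> deg_count 4 = 0 \<and> deg_count 5 = 0 \<and> deg_count 6 = 0" using degree_equation(8)[OF deg_count_sum40 8] by blast
    hence "dg f = 1" if "f \<in> Irr" for f using dc'[OF _ _ _ _ that] deg_count_pos[OF n40 that] by auto
    thus thesis using that(4) 8 by blast
  qed
qed

end

end

section \<open>Involutions\<close>

lemma even_card_involution:
  assumes "finite X" "\<And>x. x \<in> X \<Longrightarrow> \<sigma> x \<in> X" "\<And>x. x \<in> X \<Longrightarrow> \<sigma> (\<sigma> x) = x"
  shows "even (card X) \<longleftrightarrow> even (card {x\<in>X. \<sigma> x = x})"
  using assms
proof (induction "card X" arbitrary: X rule: less_induct)
  case less
  show ?case
  proof (cases "\<exists>x\<in>X. \<sigma> x \<noteq> x")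
    case False
    hence "{x\<in>X. \<sigma> x = x} = X" by auto
    thus ?thesis by simp
  next
    case True
    then obtain x where x: "x \<in> X" "\<sigma> x \<noteq> x" by blast
    define Y where "Y = X - {x, \<sigma> x}"
    have c: "card X = card Y + 2"
    proof -
      have "card Y = card X - card {x, \<sigma> x}" unfolding Y_def using less.prems x by (intro card_Diff_subset) auto
      moreover have "card {x, \<sigma> x} \<le> card X" using less.prems x by (intro card_mono) auto
      ultimately show ?thesis using x by simp
    qed
    have "even (card Y) \<longleftrightarrow> even (card {x\<in>Y. \<sigma> x = x})"
    proof (rule less.hyps)
      show "card Y < card X" using c by simp
      show "finite Y" using less.prems(1) by (simp add: Y_def)
      show "\<sigma> z \<in> Y" if "z \<in> Y" for z
        using that less.prems(2)[of z] less.prems(3)[of z] less.prems(3)[OF x(1)] unfolding Y_def by auto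
      show "\<sigma> (\<sigma> z) = z" if "z \<in> Y" for z using that less.prems(3)[of z] by (simp add: Y_def)
    qed
    moreover have "{z\<in>Y. \<sigma> z = z} = {z\<in>X. \<sigma> z = z}" using x less.prems(3)[OF x(1)] by (auto simp: Y_def)
    ultimately show ?thesis using c by simp
  qed
qed

context hopf_int
begin

section \<open>The finite group of grouplike elements and the parity of idempotents\<close>

definition Gm where "Gm = {g. grp g}"

lemma Gm_Lin: "Gm = hopf_int.Lin D e"
  using hopf_int.Lin_grp[OF dual_int] by (simp add: Gm_def)

lemma Gm_fin [simp]: "finite Gm" unfolding Gm_Lin by (rule hopf_int.finite_Lin[OF dual_int])

lemma Gm_grp: "g \<in> Gm \<Longrightarrow> grp g" by (simp add: Gm_def)

lemma Gm_ops [simp]: "u \<in> Gm" "g \<in> Gm \<Longrightarrow> h \<in> Gm \<Longrightarrow> g \<odot> h \<in> Gm" "g \<in> Gm \<Longrightarrow> ant S g \<in> Gm"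
  by (simp_all add: Gm_def grp_u grp_mul grp_ant)

lemma Gm_pw [simp]: "g \<in> Gm \<Longrightarrow> pw g n \<in> Gm" by (simp add: Gm_def grp_pw)

lemma Gm_inv: "g \<in> Gm \<Longrightarrow> ant S g \<odot> g = u" "g \<in> Gm \<Longrightarrow> g \<odot> ant S g = u"
  by (simp_all add: Gm_def grp_inv)

lemma Gm_eval: "g \<in> Gm \<Longrightarrow> (f \<star> h) \<cdot> g = f \<cdot> g * h \<cdot> g" "g \<in> Gm \<Longrightarrow> e \<cdot> g = 1"
  by (simp_all add: Gm_def grp_def)

lemma Gm_dIrr: "Gm \<subseteq> dIrr" "g \<in> dIrr \<Longrightarrow> g \<in> Gm \<longleftrightarrow> ddg g = 1"
  unfolding Gm_Lin hopf_int.Lin_def[OF dual_int] by auto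

lemma lagrange_Gm:
  assumes T: "T \<subseteq> Gm" "u \<in> T" "\<And>x y. x \<in> T \<Longrightarrow> y \<in> T \<Longrightarrow> x \<odot> y \<in> T" "\<And>x. x \<in> T \<Longrightarrow> ant S x \<in> T"
  shows "card T dvd card Gm"
proof -
  define c where "c g = (\<lambda>t. g \<odot> t) ` T" for g
  have cg: "c h = c g \<longleftrightarrow> h \<in> c g" if g: "g \<in> Gm" and h: "h \<in> Gm" for g h
  proof
    assume "c h = c g"
    moreover have "h \<in> c h" unfolding c_def using T(2) by (intro image_eqI[of _ _ u]) simp_all
    ultimately show "h \<in> c g" by simp
  next
    assume "h \<in> c g"
    then obtain t where t: "t \<in> T" "h = g \<odot> t" by (auto simp: c_def)
    have "g \<odot> s = h \<odot> (ant S t \<odot> s)" for s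
      using t T(1) by (simp add: mul_assoc) (simp add: mul_assoc[symmetric] Gm_inv subsetD)
    moreover have "ant S t \<odot> s \<in> T" if "s \<in> T" for s using that t T by blast
    ultimately have "c g \<subseteq> c h" unfolding c_def by (metis image_eqI image_subsetI)
    moreover have "c h \<subseteq> c g"
    proof
      fix x assume "x \<in> c h"
      then obtain s where s: "s \<in> T" "x = g \<odot> (t \<odot> s)" by (auto simp: c_def t mul_assoc)
      show "x \<in> c g" unfolding c_def s(2) by (rule imageI) (rule T(3)[OF t(1) s(1)])
    qed
    ultimately show "c h = c g" by blast
  qed
  have fib: "card {h\<in>Gm. c h = C} = card T" if C: "C \<in> c ` Gm" for C
  proof -
    obtain g where g: "g \<in> Gm" "C = c g" using C by auto
    have "c g \<subseteq> Gm" using g(1) T(1) by (auto simp: c_def)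
    hence "{h\<in>Gm. c h = C} = c g" using cg[OF g(1)] g(2) by blast
    hence "{h\<in>Gm. c h = C} = (\<lambda>t. g \<odot> t) ` T" by (simp only: c_def)
    moreover have "inj_on (\<lambda>t. g \<odot> t) T" by (rule inj_onI) (rule grp_cancel[OF Gm_grp[OF g(1)]])
    ultimately show ?thesis by (simp add: card_image)
  qed
  have "card Gm = (\<Sum>C\<in>c ` Gm. card {h\<in>Gm. c h = C})"
    using sum.image_gen[of Gm "\<lambda>_. 1::nat" c] by simp
  thus ?thesis using fib by simp
qed

lemma Gm_order: assumes g: "g \<in> Gm" shows "pw g (card Gm) = u"
proof -
  define m where "m = (LEAST m. m > 0 \<and> pw g m = u)"
  have m: "m > 0" "pw g m = u" using LeastI_ex[OF grp_order[OF Gm_grp[OF g], unfolded]] by (auto simp: m_def)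
  have less: "pw g l \<noteq> u" if "0 < l" "l < m" for l using not_less_Least[of l] that by (auto simp: m_def)
  have mult: "pw g (m * k) = u" for k by (induction k) (simp_all add: pw_add m)
  have red: "pw g l = pw g (l mod m)" for l
    by (metis div_mult_mod_eq mult.commute mul_1(1) mult pw_add)
  define T where "T = pw g ` {..<m}"
  have inT: "pw g l \<in> T" for l unfolding T_def using red[of l] m by (intro image_eqI[of _ _ "l mod m"]) auto
  have inj: "inj_on (pw g) {..<m}"
  proof (rule linorder_inj_onI')
    fix i j assume ij: "i \<in> {..<m}" "j \<in> {..<m}" "i < j"
    show "pw g i \<noteq> pw g j"
    proof
      assume "pw g i = pw g j"
      hence "pw g (j - i) = u" using ij by (intro grp_pw_cancel[OF Gm_grp[OF g], of i]) simp
      moreover have "0 < j - i" "j - i < m" using ij by auto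
      ultimately show False using less by blast
    qed
  qed
  have "card T dvd card Gm"
  proof (rule lagrange_Gm)
    show "T \<subseteq> Gm" using g by (auto simp: T_def)
    show "u \<in> T" using inT[of 0] by simp
    show "x \<odot> y \<in> T" if "x \<in> T" "y \<in> T" for x y
      using that inT by (auto simp: T_def pw_add[symmetric])
    show "ant S x \<in> T" if x: "x \<in> T" for x
    proof -
      obtain l where l: "l < m" "x = pw g l" using x by (auto simp: T_def)
      have "x \<odot> pw g (m - l) = u" using l m by (simp add: pw_add[symmetric])
      hence "x \<odot> pw g (m - l) = x \<odot> ant S x" using Gm_inv(2)[of x] g l by simp
      hence "pw g (m - l) = ant S x" using grp_cancel[OF Gm_grp[of x]] g l by simp
      thus ?thesis using inT by metis
    qed
  qed
  moreover have "card T = m" unfolding T_def using inj by (simp add: card_image)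
  ultimately obtain k where "card Gm = m * k" by auto
  thus ?thesis by (simp add: mult)
qed

lemma Gm_idem: "f \<star> f = f \<Longrightarrow> g \<in> Gm \<Longrightarrow> f \<cdot> g = 0 \<or> f \<cdot> g = 1"
  using Gm_eval(1)[of g f f] by (metis mult_cancel_right1)

text \<open>Modulo 2 the sum of \<open>idem_dim\<close> retains only its terms of degree one. These
  belong to grouplike elements, on which an idempotent takes the value 0 or 1.\<close>

lemma idem_parity:
  assumes dd: "\<forall>g\<in>dIrr. ddg g \<in> {1,2,4}" and f: "f \<star> f = f"
  shows "\<exists>m::nat. of_nat CARD('i) * (f \<cdot> L) = of_nat m \<and> (even m \<longleftrightarrow> even (card {g\<in>Gm. f \<cdot> g = 1})) \<and> card {g\<in>Gm. f \<cdot> g = 1} \<le> m"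
proof -
  obtain r :: "'k ^ 'i \<Rightarrow> nat" where r: "\<forall>g\<in>dIrr. g \<cdot> f = of_nat (r g)"
     "of_nat CARD('i) * (f \<cdot> L) = (of_nat (\<Sum>g\<in>dIrr. ddg g * r g) :: 'k)" using idem_dim[OF f] by blast
  have fin: "finite dIrr" by (rule ss_alg.finite_Irr[OF dual_ss])
  have "(\<Sum>g\<in>dIrr. ddg g * r g) = (\<Sum>g\<in>Gm. ddg g * r g) + (\<Sum>g\<in>dIrr - Gm. ddg g * r g)"
    using sum.subset_diff[OF Gm_dIrr(1) fin] by (simp add: add.commute)
  moreover have "even (\<Sum>g\<in>dIrr - Gm. ddg g * r g)"
  proof (intro dvd_sum)
    fix g assume g: "g \<in> dIrr - Gm"
    hence "ddg g \<in> {1,2,4}" "ddg g \<noteq> 1" using dd Gm_dIrr(2)[of g] by blast+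
    thus "even (ddg g * r g)" by auto
  qed
  moreover have "(\<Sum>g\<in>Gm. ddg g * r g) = card {g\<in>Gm. f \<cdot> g = 1}"
  proof -
    have "(\<Sum>g\<in>Gm. ddg g * r g) = (\<Sum>g\<in>Gm. if f \<cdot> g = 1 then 1 else 0)"
    proof (intro sum.cong refl)
      fix g assume g: "g \<in> Gm"
      hence "ddg g = 1" using Gm_dIrr by blast
      moreover have rg: "f \<cdot> g = of_nat (r g)" using r(1) g Gm_dIrr(1) pr_comm[of f g] by auto
      moreover have "r g = (if f \<cdot> g = 1 then 1 else 0)" using Gm_idem[OF f g] unfolding rg by auto
      ultimately show "ddg g * r g = (if f \<cdot> g = 1 then 1 else 0)" by simp
    qed
    also have "\<dots> = card {g\<in>Gm. f \<cdot> g = 1}" by (simp add: sum.If_cases Int_def conj_commute)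
    finally show ?thesis .
  qed
  ultimately have "even (\<Sum>g\<in>dIrr. ddg g * r g) \<longleftrightarrow> even (card {g\<in>Gm. f \<cdot> g = 1})"
    "card {g\<in>Gm. f \<cdot> g = 1} \<le> (\<Sum>g\<in>dIrr. ddg g * r g)" by simp_all
  thus ?thesis using r(2) by blast
qed

text \<open>The grouplike elements that characters cannot distinguish from \<open>g\<close>. The
  companion \<open>grp_norm g\<close> is the formal codegree of evaluation at
  \<open>g\<close>.\<close>

definition grp_class where "grp_class g = {h\<in>Gm. \<forall>f\<in>Irr. f \<cdot> h = f \<cdot> g}"
definition grp_norm where "grp_norm g = (\<Sum>f\<in>Irr. f \<cdot> g * f \<cdot> ant S g)"

text \<open>The idempotent of evaluation at \<open>g\<close> takes the value 1 exactly on
  \<open>grp_class g\<close>, so \<open>idem_parity\<close> counts this class.\<close>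

lemma class_parity:
  assumes dd: "\<forall>g\<in>dIrr. ddg g \<in> {1,2,4}" and g: "g \<in> Gm" and nz: "grp_norm g \<noteq> 0"
  shows "\<exists>m::nat. of_nat m * grp_norm g = of_nat CARD('i) \<and> (even m \<longleftrightarrow> even (card (grp_class g)))"
proof -
  define \<mu> where "\<mu> f = f \<cdot> g" for f
  have c: "cdg \<mu> = grp_norm g" by (simp add: cdg_def grp_norm_def \<mu>_def pr_ant[symmetric])
  have hom: "(\<Sum>h\<in>Irr. of_nat (mlt (f \<star> f') h) * \<mu> h) = \<mu> f * \<mu> f'" if f: "f \<in> Irr" "f' \<in> Irr" for f f'
  proof -
    have "(f \<star> f') \<cdot> g = (\<Sum>h\<in>Irr. of_nat (mlt (f \<star> f') h) * \<mu> h)"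
      by (subst Ch_expand[of "f \<star> f'"]) (simp_all add: Ch_intros f pr_sum pr_scale \<mu>_def)
    thus ?thesis using Gm_eval(1)[OF g] by (simp add: \<mu>_def)
  qed
  have me: "\<mu> e = 1" using Gm_eval(2)[OF g] by (simp add: \<mu>_def)
  have nz': "cdg \<mu> \<noteq> 0" using nz c by simp
  note ci = cid_idem[OF hom me nz'] cid_L[OF hom me nz'] cid_grp[OF hom me nz']
  have "{h\<in>Gm. cid \<mu> \<cdot> h = 1} = grp_class g"
  proof (intro equalityI subsetI)
    fix h assume h: "h \<in> {h\<in>Gm. cid \<mu> \<cdot> h = 1}"
    hence "f \<cdot> h = \<mu> f" if "f \<in> Irr" for f using ci(3)[of h f] that by (simp add: Gm_grp)
    thus "h \<in> grp_class g" using h by (simp add: grp_class_def \<mu>_def)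
  next
    fix h assume h: "h \<in> grp_class g"
    hence "(\<Sum>f\<in>Irr. \<mu> (star f) * f \<cdot> h) = (\<Sum>f\<in>Irr. \<mu> f * \<mu> (star f))"
      by (intro sum.cong refl) (simp add: grp_class_def \<mu>_def)
    hence "cid \<mu> \<cdot> h = 1" using nz' by (simp add: cid_def pr_scale pr_sum cdg_def)
    thus "h \<in> {h\<in>Gm. cid \<mu> \<cdot> h = 1}" using h by (simp add: grp_class_def)
  qed
  with idem_parity[OF dd ci(1)] obtain m :: nat where m: "of_nat CARD('i) * (cid \<mu> \<cdot> L) = of_nat m"
    "even m \<longleftrightarrow> even (card (grp_class g))" by auto
  have "of_nat m * grp_norm g = of_nat CARD('i)" 
  proof -
    have "cid \<mu> \<cdot> L = 1 / grp_norm g" using ci(2) c by simp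
    thus ?thesis using nz by (simp add: m(1)[symmetric])
  qed
  thus ?thesis using m(2) by blast
qed

text \<open>The sum is the integral \<open>lam\<close> at \<open>g\<close>. If it were nonzero, the
  integral property would give f(g) = f(u) for every functional f.\<close>

lemma sum_dg_Gm: assumes g: "g \<in> Gm" "g \<noteq> u" shows "(\<Sum>f\<in>Irr. of_nat (dg f) * f \<cdot> g) = 0"
proof -
  have "lam g = 0"
  proof (rule ccontr)
    assume nz: "lam g \<noteq> 0"
    have "g = u"
    proof (rule pr_eqI)
      fix f
      have "(lv \<star> f) \<cdot> g = ((f \<cdot> u) *s lv) \<cdot> g" by (simp only: lam_integral)
      thus "f \<cdot> g = f \<cdot> u" using nz by (simp add: Gm_eval[OF g(1)] pr_scale lv)
    qed
    thus False using g by simp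
  qed
  thus ?thesis unfolding lv[symmetric] lv_Irr by (simp add: pr_sum pr_scale)
qed

lemma dg_value: assumes "g \<in> Gm" "\<And>f. f \<in> Irr \<Longrightarrow> f \<cdot> g = of_nat (dg f)" shows "g = u"
proof (rule ccontr)
  assume "g \<noteq> u"
  hence "(\<Sum>f\<in>Irr. of_nat (dg f) * f \<cdot> g) = 0" using sum_dg_Gm assms by blast
  hence "(of_nat (\<Sum>f\<in>Irr. (dg f)\<^sup>2) :: 'k) = 0" using assms(2) by (simp add: power2_eq_square)
  thus False by (simp only: sum_dg of_nat_eq_0_iff) simp
qed

text \<open>(u + h) / 2 is an idempotent; if it has rank m in the representation, then f(h) = 2 m -
  dg f. The extreme ranks mean that \<open>h\<close> acts as 1 or as -1.\<close>

lemma involution_value: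
  assumes h: "h \<odot> h = u" and f: "f \<in> Irr"
  shows "\<exists>z::int. f \<cdot> h = of_int z \<and> \<bar>z\<bar> \<le> int (dg f) \<and> even (z - int (dg f)) \<and>
    (z = int (dg f) \<longrightarrow> (\<forall>x. f \<cdot> (h \<odot> x) = f \<cdot> x)) \<and> (z = - int (dg f) \<longrightarrow> (\<forall>x. f \<cdot> (h \<odot> x) = - (f \<cdot> x)))"
proof -
  define p where "p = (1/2) *s (u + h)"
  have p: "p \<odot> p = p"
  proof -
    have "(u + h) \<odot> (u + h) = u + h + (h + u)" by (simp add: bm_add h)
    also have "\<dots> = 2 *s (u + h)" unfolding vec_eq_iff by (simp only: vector_add_component vector_smult_component) simp
    finally show ?thesis by (simp add: p_def bm_scale)
  qed
  have hp: "h = 2 *s p - u" by (simp add: p_def)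
  from Irr_idem[OF f p] obtain m :: nat where m: "m \<le> dg f" "f \<cdot> p = of_nat m" "m = 0 \<longrightarrow> (\<forall>y. f \<cdot> (p \<odot> y) = 0)"
    "m = dg f \<longrightarrow> (\<forall>y. f \<cdot> (p \<odot> y) = f \<cdot> y)" by blast
  have hx: "f \<cdot> (h \<odot> x) = 2 * f \<cdot> (p \<odot> x) - f \<cdot> x" for x
    by (subst hp) (simp add: bm_diff bm_scale pr_diff pr_scale)
  have "f \<cdot> h = of_int (2 * int m - int (dg f))" by (subst hp) (simp add: pr_diff pr_scale m Irr_u[OF f])
  thus ?thesis using m hx by (intro exI[of _ "2 * int m - int (dg f)"]) auto
qed

text \<open>The extremal values make \<open>h\<close> act by a sign in every irreducible
  representation, and irreducible characters separate elements.\<close>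

lemma central_involution:
  assumes h: "h \<odot> h = u" and s: "\<And>f. f \<in> Irr \<Longrightarrow> (f \<cdot> h)\<^sup>2 = of_nat ((dg f)\<^sup>2)"
  shows "h \<odot> x = x \<odot> h"
proof -
  have "h \<odot> x - x \<odot> h = 0"
  proof (rule Irr_separate)
    fix f y assume f: "f \<in> Irr"
    obtain z where z: "f \<cdot> h = of_int z"
      "z = int (dg f) \<longrightarrow> (\<forall>x. f \<cdot> (h \<odot> x) = f \<cdot> x)" "z = - int (dg f) \<longrightarrow> (\<forall>x. f \<cdot> (h \<odot> x) = - (f \<cdot> x))"
      using involution_value[OF h f] by blast
    have "(of_int (z\<^sup>2) :: 'k) = of_int ((int (dg f))\<^sup>2)" using s[OF f] by (simp add: z)
    hence "z\<^sup>2 = (int (dg f))\<^sup>2" by (simp only: of_int_eq_iff)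
    hence "\<exists>c. \<forall>x. f \<cdot> (h \<odot> x) = c * f \<cdot> x" using z unfolding power2_eq_iff
      by (metis mult_1 mult_minus_left)
    then obtain c where c: "\<And>x. f \<cdot> (h \<odot> x) = c * f \<cdot> x" by blast
    have "f \<cdot> (h \<odot> x \<odot> y) = c * f \<cdot> (x \<odot> y)" by (simp add: mul_assoc c)
    moreover have "f \<cdot> (x \<odot> h \<odot> y) = c * f \<cdot> (x \<odot> y)"
      using Irr_comm[OF f, of x "h \<odot> y"] Irr_comm[OF f, of x y] by (simp add: mul_assoc c)
    ultimately show "f \<cdot> ((h \<odot> x - x \<odot> h) \<odot> y) = 0" by (simp add: bm_diff pr_diff)
  qed
  thus ?thesis by simp
qed

definition central_inv where "central_inv g \<longleftrightarrow> grp g \<and> g \<noteq> u \<and> g \<odot> g = u \<and> (\<forall>x. g \<odot> x = x \<odot> g)"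

lemma nrm_involution: assumes "g \<in> Gm" "g \<odot> g = u" shows "ant S g = g" "grp_norm g = (\<Sum>f\<in>Irr. (f \<cdot> g)\<^sup>2)"
proof -
  have "g \<odot> ant S g = g \<odot> g" using assms by (simp add: Gm_inv)
  thus "ant S g = g" by (rule grp_cancel[OF Gm_grp[OF assms(1)]])
  thus "grp_norm g = (\<Sum>f\<in>Irr. (f \<cdot> g)\<^sup>2)" by (simp add: grp_norm_def power2_eq_square)
qed

text \<open>For an involution in a class of odd size, the codegree N is a divisor of 40 with odd
  quotient, hence 40 or 8. The odd class exists because the number of involutions in a group of even
  order is odd.\<close>

lemma involution_exists:
  assumes dd: "\<forall>g\<in>dIrr. ddg g \<in> {1,2,4}" and ev: "even (card Gm)" and n40: "CARD('i) = 40"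
    and no: "\<And>g. \<not> central_inv g"
  shows "\<exists>g\<in>Gm. g \<noteq> u \<and> g \<odot> g = u \<and> (\<Sum>f\<in>Irr. (f \<cdot> g)\<^sup>2) = 8"
proof -
  define I where "I = {g\<in>Gm. ant S g = g} - {u}"
  have Isq: "g \<odot> g = u" if "g \<in> I" for g using that Gm_inv(1)[of g] by (auto simp: I_def)
  have ai: "ant S (ant S g) = g" for g by (rule ant_involution)
  have "even (card {g\<in>Gm. ant S g = g})"
    using even_card_involution[of Gm "ant S"] ev ai by simp
  moreover have "card {g\<in>Gm. ant S g = g} = Suc (card I)"
    unfolding I_def by (rule card.remove) (simp_all add: ant_u)
  ultimately have oddI: "odd (card I)" by simp
  \<comment> \<open>Some class contains an odd number of involutions. Inversion maps this class to
    itself, and its fixed points are just these involutions, so the class itself has odd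
    size.\<close>
  have "\<exists>g\<in>I. odd (card {h\<in>I. grp_class h = grp_class g})"
  proof (rule ccontr)
    assume "\<not> ?thesis"
    hence "even (\<Sum>C\<in>grp_class ` I. card {h\<in>I. grp_class h = C})" by (intro dvd_sum) auto
    moreover have "card I = (\<Sum>C\<in>grp_class ` I. card {h\<in>I. grp_class h = C})"
      using sum.image_gen[of I "\<lambda>_. 1::nat" grp_class] by (simp add: I_def)
    ultimately show False using oddI by simp
  qed
  then obtain g where g: "g \<in> I" "odd (card {h\<in>I. grp_class h = grp_class g})" by blast
  have gG: "g \<in> Gm" "g \<noteq> u" "g \<odot> g = u" "ant S g = g" using g(1) Isq by (auto simp: I_def)
  have ucl: "u \<notin> grp_class g"
  proof
    assume "u \<in> grp_class g"
    hence "f \<cdot> g = of_nat (dg f)" if "f \<in> Irr" for f using that by (simp add: grp_class_def Irr_u)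
    thus False using dg_value[OF gG(1)] gG(2) by blast
  qed
  have "even (card (grp_class g)) \<longleftrightarrow> even (card {h\<in>grp_class g. ant S h = h})"
  proof (rule even_card_involution)
    show "finite (grp_class g)" by (rule finite_subset[OF _ Gm_fin]) (auto simp: grp_class_def)
    show "ant S h \<in> grp_class g" if h: "h \<in> grp_class g" for h
    proof -
      have "f \<cdot> ant S h = f \<cdot> g" if f: "f \<in> Irr" for f
      proof -
        have "f \<cdot> ant S h = star f \<cdot> h" by (simp add: pr_ant)
        also have "\<dots> = star f \<cdot> g" using h star_Irr[OF f] by (simp add: grp_class_def)
        also have "\<dots> = f \<cdot> g" by (simp add: pr_ant[symmetric] gG)
        finally show ?thesis .
      qed
      thus ?thesis using h by (simp add: grp_class_def)
    qed
  qed (rule ai)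
  moreover have "{h\<in>grp_class g. ant S h = h} = {h\<in>I. grp_class h = grp_class g}"
  proof -
    have "h \<in> grp_class g \<longleftrightarrow> grp_class h = grp_class g" if "h \<in> Gm" for h
    proof
      show "h \<in> grp_class g \<Longrightarrow> grp_class h = grp_class g" by (auto simp: grp_class_def)
      have "h \<in> grp_class h" using that by (simp add: grp_class_def)
      thus "grp_class h = grp_class g \<Longrightarrow> h \<in> grp_class g" by simp
    qed
    moreover have "grp_class g \<subseteq> Gm" by (auto simp: grp_class_def)
    ultimately show ?thesis using ucl by (auto simp: I_def)
  qed
  ultimately have od: "odd (card (grp_class g))" using g(2) by simp
  have nr: "grp_norm g = (\<Sum>f\<in>Irr. (f \<cdot> g)\<^sup>2)" using nrm_involution gG by blast
  obtain z :: "'k ^ 'i \<Rightarrow> int" where z: "\<And>f. f \<in> Irr \<Longrightarrow> f \<cdot> g = of_int (z f)" "\<And>f. f \<in> Irr \<Longrightarrow> \<bar>z f\<bar> \<le> int (dg f)"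
    using involution_value[OF gG(3)] by metis
  define N where "N = (\<Sum>f\<in>Irr. (z f)\<^sup>2)"
  have nN: "grp_norm g = of_int N" unfolding nr N_def by (simp add: z)
  have zle: "(z f)\<^sup>2 \<le> (int (dg f))\<^sup>2" if "f \<in> Irr" for f using z(2)[OF that] by (simp add: abs_le_square_iff[symmetric])
  have "z e = 1" using z(1)[OF e_Irr] Gm_eval(2)[OF gG(1)] by simp
  hence "N \<ge> 1" unfolding N_def using member_le_sum[of e Irr "\<lambda>f. (z f)\<^sup>2"] e_Irr by simp
  hence "grp_norm g \<noteq> 0" by (simp add: nN)
  from class_parity[OF dd gG(1) this] obtain m :: nat where m: "of_nat m * grp_norm g = of_nat CARD('i)" "odd m" using od by blast
  have "(of_int (int m * N) :: 'k) = of_int 40" using m(1) n40 by (simp add: nN)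
  hence mN: "int m * N = 40" by (simp only: of_int_eq_iff)
  hence "m dvd 40" by (metis dvd_triv_left int_dvd_int_iff of_nat_numeral)
  hence "m \<le> 40" by (rule dvd_imp_le) simp
  hence "m \<in> set (filter (\<lambda>d. d dvd 40 \<and> \<not> 2 dvd d) [0..<41])" using \<open>m dvd 40\<close> m(2) by simp
  also have "filter (\<lambda>d. d dvd 40 \<and> \<not> 2 dvd d) [0..<41] = [1,5::nat]" by code_simp
  finally have "m = 1 \<or> m = 5" by simp
  hence "N = 40 \<or> N = 8" using mN by auto
  \<comment> \<open>The squared degrees also sum to 40, so N = 40 makes every value extremal and
    \<open>g\<close> central.\<close>
  moreover have "N \<noteq> 40"
  proof
    assume "N = 40"
    hence "(\<Sum>f\<in>Irr. (int (dg f))\<^sup>2 - (z f)\<^sup>2) = 0" using arg_cong[OF sum_dg, of int] n40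
      by (simp add: sum_subtractf N_def)
    hence eq: "(z f)\<^sup>2 = (int (dg f))\<^sup>2" if "f \<in> Irr" for f
      using sum_nonneg_eq_0_iff[of Irr "\<lambda>f. (int (dg f))\<^sup>2 - (z f)\<^sup>2"] zle that by force
    have "(f \<cdot> g)\<^sup>2 = of_nat ((dg f)\<^sup>2)" if f: "f \<in> Irr" for f
      using arg_cong[OF eq[OF f], of "of_int :: _ \<Rightarrow> 'k"] z(1)[OF f] by simp
    hence "central_inv g" unfolding central_inv_def using central_involution[OF gG(3)] gG Gm_grp by blast
    thus False using no by blast
  qed
  ultimately have "(\<Sum>f\<in>Irr. (f \<cdot> g)\<^sup>2) = 8" using nN nr by simp
  thus ?thesis using gG by blast
qed

end

section \<open>Character values of elements of order dividing eight, in Z[sqrt 2]\<close>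

lemma sqrt2_irrational:
  fixes x y :: int assumes "x\<^sup>2 = 2 * y\<^sup>2" shows "x = 0" "y = 0"
proof -
  have main: "x\<^sup>2 = 2 * y\<^sup>2 \<Longrightarrow> x = 0 \<and> y = 0" for x y :: int
  proof (induction "nat \<bar>x\<bar>" arbitrary: x y rule: less_induct)
    case less
    have "even (x\<^sup>2)" using less.prems by simp
    hence "even x" by simp
    then obtain x' where x': "x = 2 * x'" by blast
    have y2: "y\<^sup>2 = 2 * x'\<^sup>2" using less.prems by (simp add: x' power2_eq_square)
    hence "even (y\<^sup>2)" by simp
    hence "even y" by simp
    then obtain y' where y': "y = 2 * y'" by blast
    have x2: "x'\<^sup>2 = 2 * y'\<^sup>2" using y2 by (simp add: y' power2_eq_square)
    show ?case
    proof (cases "x = 0")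
      case True thus ?thesis using less.prems by simp
    next
      case False
      hence "nat \<bar>x'\<bar> < nat \<bar>x\<bar>" by (auto simp: x')
      from less.hyps[OF this x2] False show ?thesis by (simp add: x')
    qed
  qed
  show "x = 0" "y = 0" using main[OF assms] by blast+
qed

lemma sqrt2_indep:
  fixes s :: "'a::field_char_0" and a b :: int
  assumes s: "s\<^sup>2 = 2" and eq: "of_int a + of_int b * s = 0" shows "a = 0" "b = 0"
proof -
  have "of_int a = - (of_int b * s)" using eq by (simp add: eq_neg_iff_add_eq_0)
  hence "(of_int a)\<^sup>2 = (of_int b)\<^sup>2 * s\<^sup>2" by (simp add: power_mult_distrib)
  hence "(of_int (a\<^sup>2) :: 'a) = of_int (2 * b\<^sup>2)" by (simp add: s mult.commute)
  hence "a\<^sup>2 = 2 * b\<^sup>2" by (simp only: of_int_eq_iff)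
  thus "a = 0" "b = 0" by (rule sqrt2_irrational)+
qed

lemma prim_root8:
  assumes "prim_root 8 (w::'a::field)" shows "w ^ 4 = -1"
proof -
  have "w ^ 8 = 1" "w ^ 4 \<noteq> 1" using assms by (simp_all add: prim_root_def)
  hence "(w ^ 4 - 1) * (w ^ 4 + 1) = 0" by (simp add: algebra_simps power_add[symmetric])
  thus ?thesis using \<open>w ^ 4 \<noteq> 1\<close> by (simp add: eq_neg_iff_add_eq_0)
qed

text \<open>The second factor is the conjugate of the first under the exchange of w and its inverse
  - w^3. For integer coefficients the product lies in Z[sqrt 2], since w - w^3 is a square root of
  2.\<close>

lemma root8_norm:
  fixes w :: "'a::field" and a b c d :: 'a
  assumes "w ^ 4 = -1"
  shows "(a + b * w + c * w^2 + d * w^3) * (a - d * w - c * w^2 - b * w^3) =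
    (a\<^sup>2 + b\<^sup>2 + c\<^sup>2 + d\<^sup>2) + (a * b + b * c + c * d - a * d) * (w - w^3)"
proof -
  have w5: "w ^ 5 = - w" "w ^ 6 = - (w ^ 2)"
    using assms by (simp_all add: eval_nat_numeral mult.assoc)
  have "(a + b * w + c * w^2 + d * w^3) * (a - d * w - c * w^2 - b * w^3) =
     a\<^sup>2 + (a * b - a * d) * w + (- a * c - b * d + a * c) * w^2 + (a * d - b * c - a * b - c * d) * w^3
     - (b\<^sup>2 + c\<^sup>2 + d\<^sup>2) * w^4 - (b * c + c * d) * w^5 - b * d * w^6"
    by (simp add: algebra_simps eval_nat_numeral)
  thus ?thesis unfolding w5 assms by (simp add: algebra_simps)
qed

lemma sum_lessThan_8: "(\<Sum>j<8. h j) = h 0 + h 1 + h 2 + h 3 + h 4 + h 5 + h 6 + h (7::nat)"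
  by (simp add: eval_nat_numeral add_ac)

context hopf_int
begin

lemma pw_u [simp]: "pw u n = u" by (induction n) simp_all

lemma eigenvalues:
  assumes f: "f \<in> Irr" and g: "pw g m = u" and m: "m > 0" and w: "prim_root m w"
  obtains r :: "nat \<Rightarrow> nat" where "(\<Sum>j<m. r j) = dg f" "\<And>l. f \<cdot> pw g l = (\<Sum>j<m. of_nat (r j) * w ^ (j * l))"
proof -
  have gg: "pw g (Suc m) = g" by (simp add: g)
  obtain p where p: "p \<in> J" "f = chi p" using f by (rule Irr_cases)
  obtain r :: "nat \<Rightarrow> nat" where r: "\<And>l. l \<ge> 1 \<Longrightarrow> f \<cdot> pw g l = (\<Sum>j<m. of_nat (r j) * w ^ (j * l))"
    using cyc_chi[OF p(1) gg m w] p(2) by metis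
  have 0: "(\<Sum>j<m. of_nat (r j) * w ^ (j * m)) = (of_nat (\<Sum>j<m. r j) :: 'k)"
    using prim_rootD[OF w] by (simp add: power_mult mult.commute[of _ m])
  have "(of_nat (dg f) :: 'k) = of_nat (\<Sum>j<m. r j)"
    using r[of m] m unfolding 0 by (simp add: g Irr_u[OF f])
  hence s: "(\<Sum>j<m. r j) = dg f" by (simp only: of_nat_eq_iff)
  have "f \<cdot> pw g l = (\<Sum>j<m. of_nat (r j) * w ^ (j * l))" for l
  proof (cases "l = 0")
    case True
    thus ?thesis by (simp add: Irr_u[OF f] s of_nat_sum[symmetric] del: of_nat_sum)
  qed (simp add: r)
  thus thesis using that s by blast
qed

context
  fixes w :: 'k
  assumes w: "prim_root 8 w"
begin

lemma root_sq: "(w - w ^ 3)\<^sup>2 = 2"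
proof -
  have "(w - w ^ 3)\<^sup>2 = w\<^sup>2 - 2 * w ^ 4 + w\<^sup>2 * w ^ 4" by (simp add: power2_eq_square algebra_simps eval_nat_numeral)
  thus ?thesis unfolding prim_root8[OF w] by simp
qed

text \<open>The rational part \<open>A\<close> is a sum of four squares of differences of eigenvalue
  multiplicities and replaces the squared absolute value. It vanishes only if f(g) = 0, and it
  reaches the squared degree only if \<open>g\<close> acts as a scalar.\<close>

lemma abs_value:
  assumes f: "f \<in> Irr" and gG: "g \<in> Gm" and g: "pw g 8 = u"
  shows "\<exists>A B::int. f \<cdot> g * f \<cdot> ant S g = of_int A + of_int B * (w - w ^ 3) \<and> 0 \<le> A \<and> A \<le> (int (dg f))\<^sup>2 \<and>
    (A = 0 \<longrightarrow> f \<cdot> g = 0) \<and> (A = (int (dg f))\<^sup>2 \<longrightarrow> (\<exists>j. \<forall>l. f \<cdot> pw g l = of_nat (dg f) * w ^ (j * l)))"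
proof -
  note w4 = prim_root8[OF w]
  have w567: "w ^ 5 = - w" "w ^ 6 = - (w ^ 2)" "w ^ 7 = - (w ^ 3)"
    using w4 power_add[of w 4 1] power_add[of w 4 2] power_add[of w 4 3] by simp_all
  obtain r where r: "(\<Sum>j<8. r j) = dg f" "\<And>l. f \<cdot> pw g l = (\<Sum>j<8. of_nat (r j) * w ^ (j * l))"
    using eigenvalues[OF f g _ w] by auto
  \<comment> \<open>As w^4 = -1, the eigenvalues w^j and w^(j+4) are opposite, and only the
    differences of their multiplicities enter.\<close>
  define a b c d where abcd: "a = int (r 0) - int (r 4)" "b = int (r 1) - int (r 5)" "c = int (r 2) - int (r 6)" "d = int (r 3) - int (r 7)"
  have ag: "ant S g = pw g 7"
  proof -
    have "g \<odot> ant S g = g \<odot> pw g 7" using Gm_inv(2)[OF gG] g pw_Suc[of g 7] by simp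
    thus ?thesis by (rule grp_cancel[OF Gm_grp[OF gG]])
  qed
  have fg: "f \<cdot> g = of_int a + of_int b * w + of_int c * w^2 + of_int d * w^3"
    using r(2)[of 1] unfolding sum_lessThan_8 by (simp add: w4 w567 abcd algebra_simps power2_eq_square)
  have p8: "w ^ (8 * n + k) = w ^ k" for n k by (simp add: power_add power_mult prim_rootD[OF w])
  have p7: "w ^ 14 = - (w ^ 2)" "w ^ 21 = - w" "w ^ 28 = -1" "w ^ 35 = w ^ 3" "w ^ 42 = w ^ 2" "w ^ 49 = w"
    using p8[of 1 6] p8[of 2 5] p8[of 3 4] p8[of 4 3] p8[of 5 2] p8[of 6 1] w4 w567 by simp_all
  have fg': "f \<cdot> ant S g = of_int a - of_int d * w - of_int c * w^2 - of_int b * w^3"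
    unfolding ag r(2) sum_lessThan_8 by (simp add: w4 w567 p7 abcd algebra_simps)
  define A B where "A = a\<^sup>2 + b\<^sup>2 + c\<^sup>2 + d\<^sup>2" and "B = a * b + b * c + c * d - a * d"
  have eq: "f \<cdot> g * f \<cdot> ant S g = of_int A + of_int B * (w - w ^ 3)"
    unfolding fg fg' root8_norm[OF w4] by (simp add: A_def B_def)
  have A0: "0 \<le> A" by (simp add: A_def)
  have le2: "(int x - int y)\<^sup>2 \<le> (int x)\<^sup>2 + (int y)\<^sup>2" for x y by (simp add: power2_eq_square algebra_simps)
  have Ar: "A \<le> (\<Sum>j<8. (int (r j))\<^sup>2)"
    using le2[of "r 0" "r 4"] le2[of "r 1" "r 5"] le2[of "r 2" "r 6"] le2[of "r 3" "r 7"]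
    unfolding sum_lessThan_8 A_def abcd by linarith
  have rle: "r j \<le> dg f" if "j < 8" for j using that member_le_sum[of j "{..<8}" r] r(1) by simp
  have rr: "(int (r j))\<^sup>2 \<le> int (r j) * int (dg f)" if "j < 8" for j
    using rle[OF that] by (simp add: power2_eq_square mult_left_mono)
  have D: "(\<Sum>j<8. int (r j) * int (dg f)) = (int (dg f))\<^sup>2"
    using arg_cong[OF r(1), of int] by (simp add: sum_distrib_right[symmetric] power2_eq_square)
  have rD: "(\<Sum>j<8. (int (r j))\<^sup>2) \<le> (int (dg f))\<^sup>2" unfolding D[symmetric] using rr by (intro sum_mono) auto
  have "f \<cdot> g = 0" if "A = 0"
  proof -
    have "a = 0 \<and> b = 0 \<and> c = 0 \<and> d = 0" using that unfolding A_def by (simp add: add_nonneg_eq_0_iff)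
    thus ?thesis by (simp add: fg)
  qed
  moreover have "\<exists>j. \<forall>l. f \<cdot> pw g l = of_nat (dg f) * w ^ (j * l)" if eqA: "A = (int (dg f))\<^sup>2"
  proof -
    have "(\<Sum>j<8. int (r j) * int (dg f) - (int (r j))\<^sup>2) = 0" using eqA Ar rD D by (simp add: sum_subtractf)
    hence "int (r j) * int (dg f) - (int (r j))\<^sup>2 = 0" if "j < 8" for j
      using sum_nonneg_eq_0_iff[of "{..<8}" "\<lambda>j. int (r j) * int (dg f) - (int (r j))\<^sup>2"] rr that by force
    hence "int (r j) * (int (dg f) - int (r j)) = 0" if "j < 8" for j
      using that by (simp only: right_diff_distrib power2_eq_square)
    hence alt: "r j = 0 \<or> r j = dg f" if "j < 8" for j
      using that by (metis mult_eq_0_iff of_nat_eq_0_iff of_nat_eq_iff eq_iff_diff_eq_0)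
    have "\<exists>j<8. r j \<noteq> 0" using r(1) dg_pos[OF f] by (metis lessThan_iff sum.neutral less_irrefl)
    then obtain j where j0: "j < 8" "r j \<noteq> 0" by blast
    have j: "j < 8" "r j = dg f" using alt[OF j0(1)] j0 by simp_all
    have "r j + (\<Sum>i\<in>{..<8} - {j}. r i) = dg f" using r(1) sum.remove[of "{..<8}" j r] j by simp
    hence "(\<Sum>i\<in>{..<8} - {j}. r i) = 0" using j by simp
    hence z: "r i = 0" if "i < 8" "i \<noteq> j" for i using that by simp
    have "f \<cdot> pw g l = of_nat (dg f) * w ^ (j * l)" for l
    proof -
      have "f \<cdot> pw g l = (\<Sum>i<8. if i = j then of_nat (dg f) * w ^ (j * l) else 0)"
        unfolding r(2) using j z by (intro sum.cong refl) auto
      thus ?thesis using j by simp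
    qed
    thus ?thesis by blast
  qed
  ultimately show ?thesis using eq A0 Ar rD by (intro exI[of _ A] exI[of _ B]) auto
qed

text \<open>The two values make \<open>A\<close> maximal, so \<open>g\<close> acts by some w^j, and
  the value at \<open>g\<close> itself shows w^j = 1.\<close>

lemma scalar_power:
  assumes f: "f \<in> Irr" and g: "g \<in> Gm" "pw g 8 = u" and v: "f \<cdot> g = of_nat (dg f)" "star f \<cdot> g = of_nat (dg f)"
  shows "f \<cdot> pw g l = of_nat (dg f)"
proof -
  from abs_value[OF f g] obtain A B :: int where AB: "f \<cdot> g * f \<cdot> ant S g = of_int A + of_int B * (w - w ^ 3)"
    "A = (int (dg f))\<^sup>2 \<longrightarrow> (\<exists>j. \<forall>l. f \<cdot> pw g l = of_nat (dg f) * w ^ (j * l))" by blast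
  have "of_int (A - (int (dg f))\<^sup>2) + of_int B * (w - w ^ 3) = 0"
    using AB(1) v by (simp add: pr_ant[symmetric] power2_eq_square)
  from sqrt2_indep(1)[OF root_sq this] AB(2) obtain j where j: "\<forall>l. f \<cdot> pw g l = of_nat (dg f) * w ^ (j * l)" by auto
  from j[rule_format, of 1] v dg_pos[OF f] have "w ^ j = 1" by simp
  thus ?thesis using j by (simp add: power_mult)
qed

end

lemma two_power_involution:
  assumes g: "g \<noteq> u" "pw g 8 = u"
  shows "\<exists>l. pw g l \<noteq> u \<and> pw g l \<odot> pw g l = u"
proof -
  have d: "pw g l \<odot> pw g l = pw g (l + l)" for l by (simp add: pw_add)
  have 11: "1 + 1 = (2::nat)" by simp
  consider "pw g 2 = u" | "pw g 2 \<noteq> u" "pw g 4 = u" | "pw g 4 \<noteq> u" by blast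
  thus ?thesis
  proof cases
    case 1
    have "pw g 1 = g" by simp
    thus ?thesis using d[of 1, unfolded 11] g(1) 1 by metis
  next
    case 2 thus ?thesis using d[of 2] by (intro exI[of _ 2]) simp
  next
    case 3 thus ?thesis using d[of 4] g by (intro exI[of _ 4]) simp
  qed
qed

lemma qid_grp: assumes Q: "closed Q" and g: "g \<in> Gm"
  shows "qid Q \<cdot> g = 1 \<longleftrightarrow> (\<forall>f\<in>Q. f \<cdot> g = of_nat (dg f))"
proof
  assume q: "qid Q \<cdot> g = 1"
  show "\<forall>f\<in>Q. f \<cdot> g = of_nat (dg f)"
  proof
    fix f assume "f \<in> Q"
    hence "(f \<star> qid Q) \<cdot> g = (of_nat (dg f) *s qid Q) \<cdot> g" by (simp only: qid_absorb[OF Q])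
    thus "f \<cdot> g = of_nat (dg f)" by (simp add: Gm_eval[OF g] pr_scale q)
  qed
next
  assume v: "\<forall>f\<in>Q. f \<cdot> g = of_nat (dg f)"
  hence "qid Q \<cdot> g = (1 / of_nat (qdim Q)) * of_nat (qdim Q)"
    by (simp add: qid_def pr_scale pr_sum qdim_def power2_eq_square)
  thus "qid Q \<cdot> g = 1" using qdim_pos[OF Q] by simp
qed

context
  assumes n40: "CARD('i) = 40"
    and dd: "\<forall>g\<in>dIrr. ddg g \<in> {1,2,4}"
    and G8: "\<And>g. g \<in> Gm \<Longrightarrow> pw g 8 = u"
begin

text \<open>If \<open>g\<close> were nontrivial, one of its powers would be an involution h that
  acts trivially on \<open>Q\<close>. Multiplication by h permutes, without fixed points, the set
  where the integral of \<open>Q\<close> is 1, so this set has even size. But its parity is that of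
  40 / 8 = 5.\<close>

lemma closed8_separates:
  assumes Q: "closed Q" "qdim Q = 8" and g: "g \<in> Gm" and v: "\<And>f. f \<in> Q \<Longrightarrow> f \<cdot> g = of_nat (dg f)"
  shows "g = u"
proof (rule ccontr)
  assume gu: "g \<noteq> u"
  define T where "T = {g\<in>Gm. qid Q \<cdot> g = 1}"
  have T: "x \<in> T \<longleftrightarrow> x \<in> Gm \<and> (\<forall>f\<in>Q. f \<cdot> x = of_nat (dg f))" for x
    using qid_grp[OF Q(1)] by (auto simp: T_def)
  obtain w :: 'k where w: "prim_root 8 w" using prim_root_exists[of 8] by auto
  obtain l where l: "pw g l \<noteq> u" "pw g l \<odot> pw g l = u" using two_power_involution[OF gu G8[OF g]] by blast
  have QI: "f \<in> Irr" "star f \<in> Q" "dg (star f) = dg f" if "f \<in> Q" for f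
    using Q(1) that star_Irr[of f] unfolding closed_def by blast+
  define h where "h = pw g l"
  have hv: "f \<cdot> h = of_nat (dg f)" if f: "f \<in> Q" for f
    unfolding h_def using v[OF f] v[OF QI(2)[OF f]] QI[OF f] by (intro scalar_power[OF w] g G8) simp_all
  have hG: "h \<in> Gm" using g by (simp add: h_def)
  have hT: "h \<odot> x \<in> T" if x: "x \<in> T" for x
  proof -
    have "f \<cdot> (h \<odot> x) = of_nat (dg f)" if f: "f \<in> Q" for f
    proof -
      from involution_value[OF l(2) QI(1)[OF f]] obtain z where z: "f \<cdot> h = of_int z" "z = int (dg f) \<longrightarrow> (\<forall>x. f \<cdot> (h \<odot> x) = f \<cdot> x)"
        unfolding h_def by blast
      have "(of_int z :: 'k) = of_int (int (dg f))" using z(1) hv[OF f] by simp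
      hence "z = int (dg f)" by (simp only: of_int_eq_iff)
      thus ?thesis using z(2) x f by (simp add: T)
    qed
    thus ?thesis using x hG by (simp add: T)
  qed
  have "even (card T) \<longleftrightarrow> even (card {x\<in>T. h \<odot> x = x})"
  proof (rule even_card_involution)
    show "finite T" by (rule finite_subset[OF _ Gm_fin]) (auto simp: T_def)
    show "h \<odot> (h \<odot> x) = x" for x using l(2) by (simp add: h_def mul_assoc[symmetric])
  qed (rule hT)
  moreover have "{x\<in>T. h \<odot> x = x} = {}"
  proof -
    have "h \<odot> x \<noteq> x" if x: "x \<in> T" for x
    proof
      assume hx: "h \<odot> x = x"
      have xG: "x \<in> Gm" using x by (simp add: T_def)
      have "h = h \<odot> (x \<odot> ant S x)" by (simp add: Gm_inv(2)[OF xG])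
      also have "\<dots> = u" unfolding mul_assoc[symmetric] hx by (rule Gm_inv(2)[OF xG])
      finally show False using l(1) by (simp add: h_def)
    qed
    thus ?thesis by blast
  qed
  ultimately have ev: "even (card T)" by simp
  from idem_parity[OF dd qid_idem[OF Q(1)]] obtain m :: nat where m: "of_nat CARD('i) * (qid Q \<cdot> L) = (of_nat m :: 'k)"
    "even m \<longleftrightarrow> even (card T)" unfolding T_def by blast
  have "(of_nat m :: 'k) = of_nat 5" unfolding m(1)[symmetric] qid_L[OF Q(1)] Q(2) n40 by simp
  hence "m = 5" by (simp only: of_nat_eq_iff)
  thus False using m(2) ev by simp
qed

text \<open>\<open>closed8_separates\<close> for \<open>Lin\<close> makes all classes singletons, so
  40 divided by the codegree is odd. Comparing rational parts, the numbers \<open>A\<close> sum to 8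
  or to 40. The eight linear characters already account for 8, which leaves 0 for the others; the
  sum 40 would make a power of \<open>g\<close> a central involution.\<close>

lemma vanish:
  assumes Lin8: "card Lin = 8" and no: "\<And>g. \<not> central_inv g" and g: "g \<in> Gm" "g \<noteq> u" and f: "f \<in> Irr" "dg f \<noteq> 1"
  shows "f \<cdot> g = 0"
proof -
  obtain w :: 'k where w: "prim_root 8 w" using prim_root_exists[of 8] by auto
  define s where "s = w - w ^ 3"
  have cl1: "grp_class g = {g}"
  proof -
    have "h = g" if h: "h \<in> grp_class g" for h
    proof -
      have hG: "h \<in> Gm" using h by (simp add: grp_class_def)
      have "h \<odot> ant S g = u"
      proof (rule closed8_separates[OF closed_Lin])
        show "qdim Lin = 8" by (simp add: qdim_def Lin_dg Lin8)
        show "h \<odot> ant S g \<in> Gm" using hG g by simp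
        fix k assume k: "k \<in> Lin"
        have lin: "k \<cdot> (x \<odot> y) = k \<cdot> x * k \<cdot> y" for x y using k by (intro Irr_linear) (auto simp: Lin_def)
        have "k \<cdot> (h \<odot> ant S g) = k \<cdot> (g \<odot> ant S g)" using h Lin_Irr[OF k] by (simp add: lin grp_class_def)
        thus "k \<cdot> (h \<odot> ant S g) = of_nat (dg k)" using Irr_u[OF Lin_Irr[OF k]] by (simp add: Gm_inv g)
      qed
      hence "h \<odot> (ant S g \<odot> g) = u \<odot> g" by (simp add: mul_assoc[symmetric])
      thus "h = g" by (simp add: Gm_inv g)
    qed
    moreover have "g \<in> grp_class g" using g by (simp add: grp_class_def)
    ultimately show ?thesis by blast
  qed
  have "\<forall>k\<in>Irr. \<exists>A B::int. k \<cdot> g * k \<cdot> ant S g = of_int A + of_int B * s \<and> 0 \<le> A \<and> A \<le> (int (dg k))\<^sup>2 \<and>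
    (A = 0 \<longrightarrow> k \<cdot> g = 0) \<and> (A = (int (dg k))\<^sup>2 \<longrightarrow> (\<exists>j. \<forall>l. k \<cdot> pw g l = of_nat (dg k) * w ^ (j * l)))"
    unfolding s_def using abs_value[OF w _ g(1) G8[OF g(1)]] by blast
  then obtain A B :: "'k ^ 'i \<Rightarrow> int" where AB: "\<And>k. k \<in> Irr \<Longrightarrow> k \<cdot> g * k \<cdot> ant S g = of_int (A k) + of_int (B k) * s \<and> 0 \<le> A k \<and> A k \<le> (int (dg k))\<^sup>2 \<and>
    (A k = 0 \<longrightarrow> k \<cdot> g = 0) \<and> (A k = (int (dg k))\<^sup>2 \<longrightarrow> (\<exists>j. \<forall>l. k \<cdot> pw g l = of_nat (dg k) * w ^ (j * l)))" by metis
  define A' B' where "A' = (\<Sum>k\<in>Irr. A k)" and "B' = (\<Sum>k\<in>Irr. B k)"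
  have nA: "grp_norm g = of_int A' + of_int B' * s"
    using AB by (simp add: grp_norm_def A'_def B'_def sum.distrib sum_distrib_right)
  have LA: "A k \<ge> 1" if k: "k \<in> Lin" for k
  proof -
    have "k \<cdot> g * k \<cdot> ant S g = k \<cdot> (g \<odot> ant S g)" using k by (intro Irr_linear[symmetric]) (auto simp: Lin_def)
    hence "k \<cdot> g * k \<cdot> ant S g = 1" using Irr_u[OF Lin_Irr[OF k]] by (simp add: Gm_inv g Lin_dg[OF k])
    hence "k \<cdot> g \<noteq> 0" by auto
    hence "A k \<noteq> 0" "0 \<le> A k" using AB[OF Lin_Irr[OF k]] by auto
    thus ?thesis by simp
  qed
  have s2: "s\<^sup>2 = 2" unfolding s_def by (rule root_sq[OF w])
  have split: "A' = (\<Sum>k\<in>Lin. A k) + (\<Sum>k\<in>Irr - Lin. A k)"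
    unfolding A'_def using sum.subset_diff[of Lin Irr A] Lin_Irr by (auto simp: add.commute)
  have L8: "(\<Sum>k\<in>Lin. A k) \<ge> 8" using sum_mono[of Lin "\<lambda>_. 1" A] LA Lin8 by simp
  have R0: "(\<Sum>k\<in>Irr - Lin. A k) \<ge> 0" using AB by (intro sum_nonneg) auto
  have "grp_norm g \<noteq> 0"
  proof
    assume "grp_norm g = 0"
    hence "of_int A' + of_int B' * s = 0" by (simp add: nA)
    from sqrt2_indep(1)[OF s2 this] show False using split L8 R0 by linarith
  qed
  from class_parity[OF dd g(1) this] obtain m :: nat where m: "of_nat m * grp_norm g = of_nat CARD('i)" "odd m" using cl1 by auto
  have "of_int (int m * A' - 40) + of_int (int m * B') * s = 0"
    using m(1) n40 by (simp add: nA algebra_simps)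
  from sqrt2_indep(1)[OF s2 this] have mN: "int m * A' = 40" by simp
  hence md: "m dvd 40" by (metis dvd_triv_left int_dvd_int_iff of_nat_numeral)
  hence "m \<le> 40" by (rule dvd_imp_le) simp
  hence "m \<in> set (filter (\<lambda>d. d dvd 40 \<and> \<not> 2 dvd d) [0..<41])" using md m(2) by simp
  also have "filter (\<lambda>d. d dvd 40 \<and> \<not> 2 dvd d) [0..<41] = [1,5::nat]" by code_simp
  finally have "m = 1 \<or> m = 5" by simp
  hence "A' = 40 \<or> A' = 8" using mN by auto
  thus ?thesis
  proof
    assume "A' = 8"
    hence "(\<Sum>k\<in>Irr - Lin. A k) = 0" using split L8 R0 by linarith
    hence "A f = 0" using sum_nonneg_eq_0_iff[of "Irr - Lin" A] AB f by (auto simp: Lin_def)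
    thus ?thesis using AB[OF f(1)] by blast
  next
    assume A40: "A' = 40"
    have "int (\<Sum>k\<in>Irr. (dg k)\<^sup>2) = 40" by (simp only: sum_dg n40)
    hence "(\<Sum>k\<in>Irr. (int (dg k))\<^sup>2 - A k) = 0" using A40 by (simp add: sum_subtractf A'_def)
    hence eq: "A k = (int (dg k))\<^sup>2" if "k \<in> Irr" for k
      using sum_nonneg_eq_0_iff[of Irr "\<lambda>k. (int (dg k))\<^sup>2 - A k"] AB that by force
    obtain l where l: "pw g l \<noteq> u" "pw g l \<odot> pw g l = u" using two_power_involution[OF g(2) G8[OF g(1)]] by blast
    have "(k \<cdot> pw g l)\<^sup>2 = of_nat ((dg k)\<^sup>2)" if k: "k \<in> Irr" for k
    proof -
      obtain j where j: "\<And>l. k \<cdot> pw g l = of_nat (dg k) * w ^ (j * l)" using AB[OF k] eq[OF k] by blast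
      have "of_nat (dg k) * w ^ (j * (l + l)) = of_nat (dg k)" using j[of "l + l"] l(2) Irr_u[OF k] by (simp add: pw_add)
      moreover have "(of_nat (dg k) :: 'k) \<noteq> 0" using dg_pos[OF k] by (simp only: of_nat_eq_0_iff)
      ultimately have "w ^ (j * (l + l)) = 1" by (metis mult_cancel_left1)
      thus ?thesis by (simp add: j power_mult_distrib power_mult[symmetric] distrib_left mult_2_right)
    qed
    hence "central_inv (pw g l)" unfolding central_inv_def
      using central_involution[OF l(2)] l g Gm_grp[OF Gm_pw[OF g(1)]] by blast
    thus ?thesis using no by blast
  qed
qed

end

lemma involution_Gm: assumes ev: "even (card Gm)" shows "\<exists>g\<in>Gm. g \<noteq> u \<and> g \<odot> g = u"
proof -
  have "even (card {g\<in>Gm. ant S g = g})" using even_card_involution[of Gm "ant S"] ev by (simp add: ant_involution)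
  hence "{g\<in>Gm. ant S g = g} \<noteq> {u}" by auto
  then obtain g where "g \<in> Gm" "ant S g = g" "g \<noteq> u" using ant_u by fastforce
  thus ?thesis using Gm_inv(1)[of g] by auto
qed

text \<open>These are the characters on which \<open>g\<close> acts by a sign. In a product the two
  signs multiply, and equality in the triangle inequality forces this sign on every
  constituent.\<close>

lemma closed_scalar:
  assumes g: "g \<in> Gm" "g \<odot> g = u" shows "closed {f\<in>Irr. (f \<cdot> g)\<^sup>2 = of_nat ((dg f)\<^sup>2)}"
proof -
  obtain z :: "'k ^ 'i \<Rightarrow> int" where z: "\<And>f. f \<in> Irr \<Longrightarrow> f \<cdot> g = of_int (z f)" "\<And>f. f \<in> Irr \<Longrightarrow> \<bar>z f\<bar> \<le> int (dg f)"
    using involution_value[OF g(2)] by metis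
  have Q: "(f \<cdot> g)\<^sup>2 = of_nat ((dg f)\<^sup>2) \<longleftrightarrow> \<bar>z f\<bar> = int (dg f)" if f: "f \<in> Irr" for f
  proof -
    have "(f \<cdot> g)\<^sup>2 = of_nat ((dg f)\<^sup>2) \<longleftrightarrow> (of_int ((z f)\<^sup>2) :: 'k) = of_int ((int (dg f))\<^sup>2)"
      using z(1)[OF f] by simp
    also have "\<dots> \<longleftrightarrow> (z f)\<^sup>2 = (int (dg f))\<^sup>2" by (simp only: of_int_eq_iff)
    also have "\<dots> \<longleftrightarrow> \<bar>z f\<bar> = int (dg f)" unfolding power2_eq_iff by linarith
    finally show ?thesis .
  qed
  have ag: "ant S g = g" by (rule nrm_involution[OF g])
  show ?thesis unfolding closed_def
  proof (intro conjI ballI impI)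
    show "e \<in> {f\<in>Irr. (f \<cdot> g)\<^sup>2 = of_nat ((dg f)\<^sup>2)}" using Gm_eval(2)[OF g(1)] by (simp add: e_Irr)
    show "star f \<in> {f\<in>Irr. (f \<cdot> g)\<^sup>2 = of_nat ((dg f)\<^sup>2)}" if f: "f \<in> {f\<in>Irr. (f \<cdot> g)\<^sup>2 = of_nat ((dg f)\<^sup>2)}" for f
    proof -
      have "star f \<cdot> g = f \<cdot> g" by (simp add: pr_ant[symmetric] ag)
      thus ?thesis using f star_Irr[of f] by auto
    qed
    fix f k h assume fk: "f \<in> {f\<in>Irr. (f \<cdot> g)\<^sup>2 = of_nat ((dg f)\<^sup>2)}" "k \<in> {f\<in>Irr. (f \<cdot> g)\<^sup>2 = of_nat ((dg f)\<^sup>2)}"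
      and h: "h \<in> Irr" "mlt (f \<star> k) h \<noteq> 0"
    have I: "f \<in> Irr" "k \<in> Irr" using fk by auto
    have a: "\<bar>z f\<bar> = int (dg f)" "\<bar>z k\<bar> = int (dg k)" using fk Q by auto
    define m where "m = mlt (f \<star> k)"
    have "(of_int (z f * z k) :: 'k) = (f \<star> k) \<cdot> g" using z(1)[OF I(1)] z(1)[OF I(2)] Gm_eval(1)[OF g(1)] by simp
    also have "\<dots> = (\<Sum>h\<in>Irr. of_nat (m h) * (h \<cdot> g))"
      unfolding m_def by (subst Ch_expand[of "f \<star> k"]) (simp_all add: I Ch_intros pr_sum pr_scale)
    also have "\<dots> = of_int (\<Sum>h\<in>Irr. int (m h) * z h)" using z(1) by simp
    finally have zz: "z f * z k = (\<Sum>h\<in>Irr. int (m h) * z h)" by (simp only: of_int_eq_iff)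
    have dd: "int (dg f * dg k) = (\<Sum>h\<in>Irr. int (m h) * int (dg h))"
      using arg_cong[OF mlt_dg[OF I], of int] by (simp add: m_def)
    define \<sigma> :: int where "\<sigma> = (if z f * z k \<ge> 0 then 1 else -1)"
    have s: "\<bar>\<sigma>\<bar> = 1" "\<sigma> * (z f * z k) = \<bar>z f\<bar> * \<bar>z k\<bar>" by (auto simp: \<sigma>_def abs_mult[symmetric])
    have "(\<Sum>h\<in>Irr. int (m h) * (int (dg h) - \<sigma> * z h)) = (\<Sum>h\<in>Irr. int (m h) * int (dg h)) - \<sigma> * (\<Sum>h\<in>Irr. int (m h) * z h)"
      by (simp add: right_diff_distrib sum_subtractf sum_distrib_left mult.left_commute)
    also have "\<dots> = 0" unfolding zz[symmetric] dd[symmetric] s(2) a by simp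
    finally have 0: "(\<Sum>h\<in>Irr. int (m h) * (int (dg h) - \<sigma> * z h)) = 0" .
    have nn: "0 \<le> int (dg h) - \<sigma> * z h" if "h \<in> Irr" for h
      using z(2)[OF that] s(1) abs_mult[of \<sigma> "z h"] by (simp add: abs_le_iff) linarith
    have "int (m h) * (int (dg h) - \<sigma> * z h) = 0"
      using 0 sum_nonneg_eq_0_iff[of Irr "\<lambda>h. int (m h) * (int (dg h) - \<sigma> * z h)"] nn h(1) by force
    hence "int (dg h) = \<sigma> * z h" using h(2) by (simp add: m_def)
    hence "\<bar>z h\<bar> = int (dg h)" using s(1) abs_mult[of \<sigma> "z h"] by simp
    thus "h \<in> {f\<in>Irr. (f \<cdot> g)\<^sup>2 = of_nat ((dg f)\<^sup>2)}" using Q h by blast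
  qed auto
qed

context
  assumes n40: "CARD('i) = 40"
    and dd: "\<forall>g\<in>dIrr. ddg g \<in> {1,2,4}"
begin

text \<open>The common kernel of the linear characters has even size, because 40 / 20 = 2, and at
  most 2 elements; let g be the nontrivial one. The regular character vanishes at g: the linear part
  gives 20, so the characters of degree two, whose squares also sum to 20, must all take the value
  -2.\<close>

lemma central_20:
  assumes c: "card Lin = 20" and od: "\<forall>f\<in>Irr. dg f \<in> {1,2}" shows "\<exists>g. central_inv g"
proof -
  have qL: "qdim Lin = 20" by (simp add: qdim_def Lin_dg c)
  define A where "A = {g\<in>Gm. qid Lin \<cdot> g = 1}"
  from idem_parity[OF dd qid_idem[OF closed_Lin]] obtain m :: nat where
    m: "of_nat CARD('i) * (qid Lin \<cdot> L) = (of_nat m :: 'k)" "even m \<longleftrightarrow> even (card A)" "card A \<le> m"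
    unfolding A_def by blast
  have "(of_nat m :: 'k) = of_nat 2" unfolding m(1)[symmetric] qid_L[OF closed_Lin] qL n40 by simp
  hence "m = 2" by (simp only: of_nat_eq_iff)
  have A: "x \<in> A \<longleftrightarrow> x \<in> Gm \<and> (\<forall>f\<in>Lin. f \<cdot> x = 1)" for x
    using qid_grp[OF closed_Lin] by (auto simp: A_def Lin_dg)
  have lin: "f \<cdot> (x \<odot> y) = f \<cdot> x * f \<cdot> y" if "f \<in> Lin" for f x y using that by (intro Irr_linear) (auto simp: Lin_def)
  have uA: "u \<in> A" using Irr_u Lin_Irr by (simp add: A Lin_dg)
  have finA: "finite A" by (rule finite_subset[OF _ Gm_fin]) (auto simp: A_def)
  have "card A = 2" using m \<open>m = 2\<close> uA finA by (metis card_0_eq dvd_imp_le empty_iff even_numeral le_antisym neq0_conv)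
  then obtain g where g: "A = {u, g}" "g \<noteq> u" using uA unfolding card_2_iff by (metis insertE insert_commute singletonD)
  have gG: "g \<in> Gm" "\<And>f. f \<in> Lin \<Longrightarrow> f \<cdot> g = 1" using g A[of g] by auto
  have gg: "g \<odot> g = u"
  proof -
    have "g \<odot> g \<in> A" using gG by (simp add: A lin)
    moreover have "g \<odot> g \<noteq> g" using grp_cancel[OF Gm_grp[OF gG(1)], of g u] g(2) by auto
    ultimately show ?thesis using g by blast
  qed
  obtain z :: "'k ^ 'i \<Rightarrow> int" where z: "\<And>f. f \<in> Irr \<Longrightarrow> f \<cdot> g = of_int (z f)" "\<And>f. f \<in> Irr \<Longrightarrow> \<bar>z f\<bar> \<le> int (dg f)"
    using involution_value[OF gg] by metis
  have split: "(\<Sum>f\<in>Irr. h f) = (\<Sum>f\<in>Lin. h f) + (\<Sum>f\<in>Irr - Lin. h f)" for h :: "'k ^ 'i \<Rightarrow> int"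
    using sum.subset_diff[of Lin Irr h] Lin_Irr by (auto simp: add.commute)
  have d2: "dg f = 2" if "f \<in> Irr - Lin" for f using that od by (auto simp: Lin_def)
  have "(of_int (\<Sum>f\<in>Irr. int (dg f) * z f) :: 'k) = of_int 0" using sum_dg_Gm[OF gG(1) g(2)] z(1) by simp
  hence "(\<Sum>f\<in>Irr. int (dg f) * z f) = 0" by (simp only: of_int_eq_iff)
  moreover have "(\<Sum>f\<in>Lin. int (dg f) * z f) = 20"
  proof -
    have "z f = 1" if "f \<in> Lin" for f using z(1)[OF Lin_Irr[OF that]] gG(2)[OF that] by simp
    thus ?thesis by (simp add: Lin_dg c)
  qed
  ultimately have s1: "(\<Sum>f\<in>Irr - Lin. int (dg f) * z f) = - 20" using split by simp
  have "(\<Sum>f\<in>Irr. (int (dg f))\<^sup>2) = 40" using arg_cong[OF sum_dg, of int] n40 by simp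
  moreover have "(\<Sum>f\<in>Lin. (int (dg f))\<^sup>2) = 20" by (simp add: Lin_dg c)
  ultimately have s2: "(\<Sum>f\<in>Irr - Lin. (int (dg f))\<^sup>2) = 20" using split by simp
  have "(\<Sum>f\<in>Irr - Lin. int (dg f) * (int (dg f) + z f)) = 0"
    using s1 s2 by (simp add: distrib_left sum.distrib power2_eq_square)
  hence "int (dg f) * (int (dg f) + z f) = 0" if "f \<in> Irr - Lin" for f
    using sum_nonneg_eq_0_iff[of "Irr - Lin" "\<lambda>f. int (dg f) * (int (dg f) + z f)"] z(2) that by (force simp: abs_le_iff)
  hence zd: "z f = - int (dg f)" if "f \<in> Irr - Lin" for f using that d2[OF that] by fastforce
  have "(f \<cdot> g)\<^sup>2 = of_nat ((dg f)\<^sup>2)" if f: "f \<in> Irr" for f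
  proof (cases "f \<in> Lin")
    case True thus ?thesis using gG by (simp add: Lin_dg)
  next
    case False thus ?thesis using z(1)[OF f] zd[of f] f by simp
  qed
  thus ?thesis using central_involution[OF gg] gG gg g Gm_grp unfolding central_inv_def by blast
qed

lemma central_40:
  assumes ev: "even (card Gm)" and od: "\<forall>f\<in>Irr. dg f = 1" shows "\<exists>g. central_inv g"
proof -
  obtain g where g: "g \<in> Gm" "g \<noteq> u" "g \<odot> g = u" using involution_Gm[OF ev] by blast
  have "(f \<cdot> g)\<^sup>2 = of_nat ((dg f)\<^sup>2)" if f: "f \<in> Irr" for f
    using Irr_linear[OF f, of g g] od f Irr_u[OF f] by (simp add: g power2_eq_square)
  thus ?thesis using central_involution[OF g(3)] g Gm_grp unfolding central_inv_def by blast
qed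

text \<open>The linear characters contribute 4 to the sum 8 and all other values are even, so
  exactly one more character is nonzero at \<open>g\<close>, with value 2 or -2. The regular
  character vanishes at \<open>g\<close>, and the linear values sum to a number from -2 to 4; this
  forces degree 2, value -2, and the value 1 on all of \<open>Lin\<close>.\<close>

lemma special_character:
  assumes od: "\<forall>f\<in>Irr. dg f \<in> {1,2,4}" and c: "card Lin = 4"
    and g: "g \<in> Gm" "g \<noteq> u" "g \<odot> g = u" and s8: "(\<Sum>f\<in>Irr. (f \<cdot> g)\<^sup>2) = 8"
  shows "\<exists>l\<in>Irr. dg l = 2 \<and> l \<cdot> g = -2 \<and> (\<forall>f\<in>Lin. f \<cdot> g = 1) \<and> (\<forall>f\<in>Irr. f \<notin> Lin \<longrightarrow> f \<noteq> l \<longrightarrow> f \<cdot> g = 0)"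
proof -
  obtain z :: "'k ^ 'i \<Rightarrow> int" where z: "\<And>f. f \<in> Irr \<Longrightarrow> f \<cdot> g = of_int (z f)" "\<And>f. f \<in> Irr \<Longrightarrow> \<bar>z f\<bar> \<le> int (dg f)"
      "\<And>f. f \<in> Irr \<Longrightarrow> even (z f - int (dg f))"
    using involution_value[OF g(3)] by metis
  have split: "(\<Sum>f\<in>Irr. h f) = (\<Sum>f\<in>Lin. h f) + (\<Sum>f\<in>Irr - Lin. h f)" for h :: "'k ^ 'i \<Rightarrow> int"
    using sum.subset_diff[of Lin Irr h] Lin_Irr by (auto simp: add.commute)
  have zL: "z f = 1 \<or> z f = -1" if "f \<in> Lin" for f
    using z(2,3)[OF Lin_Irr[OF that]] Lin_dg[OF that] by (cases "z f = 0") auto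
  hence zL2: "(z f)\<^sup>2 = 1" if "f \<in> Lin" for f using that by fastforce
  have zn: "even (z f)" if "f \<in> Irr - Lin" for f
    using z(3)[of f] that od by (auto simp: Lin_def)
  have "(of_int (\<Sum>f\<in>Irr. (z f)\<^sup>2) :: 'k) = of_int 8" using s8 z(1) by simp
  hence "(\<Sum>f\<in>Irr. (z f)\<^sup>2) = 8" by (simp only: of_int_eq_iff)
  hence s4: "(\<Sum>f\<in>Irr - Lin. (z f)\<^sup>2) = 4" using split[of "\<lambda>f. (z f)\<^sup>2"] by (simp add: zL2 c)
  then obtain l where l: "l \<in> Irr - Lin" "z l \<noteq> 0" by (metis (no_types, lifting) power_zero_numeral sum.neutral zero_neq_numeral)
  have rem: "(\<Sum>f\<in>Irr - Lin. h f) = h l + (\<Sum>f\<in>Irr - Lin - {l}. h f)" for h :: "'k ^ 'i \<Rightarrow> int"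
    using l by (simp add: sum.remove)
  obtain q where q: "z l = 2 * q" using zn[OF l(1)] by blast
  have "q\<^sup>2 > 0" using q l by simp
  hence "(z l)\<^sup>2 \<ge> 4" by (simp add: q power2_eq_square)
  moreover have nn: "(\<Sum>f\<in>Irr - Lin - {l}. (z f)\<^sup>2) \<ge> 0" by (intro sum_nonneg) simp
  ultimately have zl4: "(z l)\<^sup>2 = 4" "(\<Sum>f\<in>Irr - Lin - {l}. (z f)\<^sup>2) = 0" using s4 rem[of "\<lambda>f. (z f)\<^sup>2"] by linarith+
  have z0: "z f = 0" if "f \<in> Irr - Lin - {l}" for f
    using sum_nonneg_eq_0_iff[of "Irr - Lin - {l}" "\<lambda>f. (z f)\<^sup>2"] zl4(2) that by simp
  have zl: "z l = 2 \<or> z l = -2"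
  proof -
    have "(z l)\<^sup>2 = 2\<^sup>2" using zl4 by simp
    thus ?thesis by (simp only: power2_eq_iff)
  qed
  have "(of_int (\<Sum>f\<in>Irr. int (dg f) * z f) :: 'k) = of_int 0" using sum_dg_Gm[OF g(1,2)] z(1) by simp
  hence "(\<Sum>f\<in>Irr. int (dg f) * z f) = 0" by (simp only: of_int_eq_iff)
  hence eq: "(\<Sum>f\<in>Lin. z f) + int (dg l) * z l = 0"
    unfolding split rem using z0 by (simp add: Lin_dg)
  have ze: "z e = 1" using z(1)[OF e_Irr] Gm_eval(2)[OF g(1)] by simp
  have Lr: "(\<Sum>f\<in>Lin. z f) = 1 + (\<Sum>f\<in>Lin - {e}. z f)" using ze by (simp add: sum.remove[of Lin e])
  have c3: "card (Lin - {e}) = 3" using c by simp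
  have "- 3 \<le> (\<Sum>f\<in>Lin - {e}. z f)" using sum_mono[of "Lin - {e}" "\<lambda>_. -1" z] zL c3 by fastforce
  moreover have le3: "(\<Sum>f\<in>Lin - {e}. z f) \<le> 3" using sum_mono[of "Lin - {e}" z "\<lambda>_. 1"] zL c3 by fastforce
  moreover have "dg l = 2 \<or> dg l = 4" using l od by (auto simp: Lin_def)
  ultimately have d2: "dg l = 2" "z l = -2" "(\<Sum>f\<in>Lin - {e}. z f) = 3" using eq zl unfolding Lr by auto
  have "(\<Sum>f\<in>Lin - {e}. 1 - z f) = 0" using d2(3) c3 by (simp add: sum_subtractf)
  hence z1: "z f = 1" if "f \<in> Lin" for f
    using sum_nonneg_eq_0_iff[of "Lin - {e}" "\<lambda>f. 1 - z f"] zL that ze by (cases "f = e") force+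
  show ?thesis
  proof (intro bexI[of _ l] conjI ballI impI)
    show "l \<in> Irr" "dg l = 2" "l \<cdot> g = -2" using l d2 z(1)[of l] by auto
    show "f \<cdot> g = 1" if "f \<in> Lin" for f using z1[OF that] z(1)[OF Lin_Irr[OF that]] by simp
    show "f \<cdot> g = 0" if "f \<in> Irr" "f \<notin> Lin" "f \<noteq> l" for f using z0[of f] z(1)[of f] that by simp
  qed
qed

end

end

section \<open>The special involution and the remaining fusion rules\<close>

lemma sum_const_vec: "(\<Sum>f\<in>A. x) = (of_nat (card A) :: 'k::field) *s (x :: 'k ^ 'i)"
  by (induction A rule: infinite_finite_induct) (simp_all add: vec.scale_left_distrib del: sum_constant)

context hopf_int
begin

lemma Lin_lin: "f \<in> Lin \<Longrightarrow> f \<cdot> (x \<odot> y) = f \<cdot> x * f \<cdot> y"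
  by (rule Irr_linear) (auto simp: Lin_def)

lemma star_qid: assumes Q: "closed Q" shows "star (qid Q) = qid Q"
proof -
  have sQ: "star f \<in> Q" if "f \<in> Q" for f using Q that unfolding closed_def by blast
  have "bij_betw star Q Q" by (rule bij_betwI[of _ _ _ star]) (auto simp: sQ)
  hence "(\<Sum>f\<in>Q. of_nat (dg (star f)) *s star f) = (\<Sum>f\<in>Q. (of_nat (dg f) :: 'k) *s f)"
    by (rule sum.reindex_bij_betw)
  moreover have "dg (star f) = dg f" if "f \<in> Q" for f using star_Irr[OF Q_sub[OF Q that]] by simp
  ultimately show ?thesis by (simp add: qid_def ant_scale ant_sum)
qed

lemma Gm_8: assumes "card Gm = 4 \<or> card Gm = 8" "g \<in> Gm" shows "pw g 8 = u"
proof -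
  have "pw g (card Gm) = u" by (rule Gm_order[OF assms(2)])
  moreover have "pw g 8 = pw g 4 \<odot> pw g 4" by (simp add: pw_add[symmetric])
  ultimately show ?thesis using assms(1) by auto
qed

text \<open>The characters that do not vanish at \<open>g\<close> are \<open>l\<close> and the linear ones; they form a closed set of
  dimension eight, and \<open>E\<close> is the normalized integral that belongs to it.\<close>

lemma special_involution:
  assumes n40: "CARD('i) = 40" and dd: "\<forall>g\<in>dIrr. ddg g \<in> {1,2,4}" and od: "\<forall>f\<in>Irr. dg f \<in> {1,2,4}" and c: "card Lin = 4" and cG: "card Gm = 4 \<or> card Gm = 8" and no: "\<And>g. \<not> central_inv g"
  shows "\<exists>g l E. g \<in> Gm \<and> g \<noteq> u \<and> g \<odot> g = u \<and> l \<in> Irr \<and> dg l = 2 \<and> (\<forall>x. l \<cdot> (g \<odot> x) = - (l \<cdot> x)) \<and>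
    (\<forall>f\<in>Irr. f \<notin> Lin \<longrightarrow> f \<noteq> l \<longrightarrow> f \<cdot> g = 0) \<and> E = (1 / 8) *s ((\<Sum>f\<in>Lin. f) + 2 *s l) \<and> E \<star> E = E \<and> star E = E \<and>
    (\<forall>h\<in>Gm. (\<forall>f\<in>Lin. f \<cdot> h = 1) \<longrightarrow> h = u \<or> h = g)"
proof -
  have ev: "even (card Gm)" using cG by auto
  note G8 = Gm_8[OF cG]
  obtain g where g: "g \<in> Gm" "g \<noteq> u" "g \<odot> g = u" "(\<Sum>f\<in>Irr. (f \<cdot> g)\<^sup>2) = 8"
    using involution_exists[OF dd ev n40 no] by blast
  obtain l where l: "l \<in> Irr" "dg l = 2" "l \<cdot> g = -2" "\<forall>f\<in>Lin. f \<cdot> g = 1"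
    "\<forall>f\<in>Irr. f \<notin> Lin \<longrightarrow> f \<noteq> l \<longrightarrow> f \<cdot> g = 0"
    using special_character[OF n40 dd od c g] by blast
  have lL: "l \<notin> Lin" using l(2) by (auto simp: Lin_def)
  define Q where "Q = Lin \<union> {l}"
  \<comment> \<open>Values 0 are not extremal, so the closed set of \<open>closed_scalar\<close>
    consists of \<open>Lin\<close> and \<open>l\<close>; its dimension is 4 + 4 = 8.\<close>
  have "{f\<in>Irr. (f \<cdot> g)\<^sup>2 = of_nat ((dg f)\<^sup>2)} = Q"
  proof (intro set_eqI iffI)
    fix f assume f: "f \<in> {f\<in>Irr. (f \<cdot> g)\<^sup>2 = of_nat ((dg f)\<^sup>2)}"
    show "f \<in> Q"
    proof (rule ccontr)
      assume "f \<notin> Q"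
      hence "f \<cdot> g = 0" using f l(5) by (auto simp: Q_def)
      hence "(of_nat ((dg f)\<^sup>2) :: 'k) = 0" using f by simp
      thus False using f dg_pos[of f] by (simp only: of_nat_eq_0_iff) simp
    qed
  next
    fix f assume "f \<in> Q"
    thus "f \<in> {f\<in>Irr. (f \<cdot> g)\<^sup>2 = of_nat ((dg f)\<^sup>2)}" using l Lin_Irr Lin_dg unfolding Q_def by auto
  qed
  hence Q: "closed Q" using closed_scalar[OF g(1,3)] by simp
  have qd: "qdim Q = 8" using lL by (simp add: qdim_def Q_def Lin_dg c l(2))
  have qe: "qid Q = (1 / 8) *s ((\<Sum>f\<in>Lin. f) + 2 *s l)"
    unfolding qid_def qd using lL by (simp add: Q_def Lin_dg l(2) add.commute)
  have neg: "l \<cdot> (g \<odot> x) = - (l \<cdot> x)" for x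
  proof -
    from involution_value[OF g(3) l(1)] obtain z where z: "l \<cdot> g = of_int z" "z = - int (dg l) \<longrightarrow> (\<forall>x. l \<cdot> (g \<odot> x) = - (l \<cdot> x))" by blast
    have "(of_int z :: 'k) = of_int (-2)" using z(1) l(3) by simp
    hence "z = -2" by (simp only: of_int_eq_iff)
    thus ?thesis using z(2) l(2) by simp
  qed
  \<comment> \<open>The integral of \<open>Q\<close> takes the value 0 or 1 at h, which leaves -2
    and 2 for l(h). The value 2 gives h = u, and -2 reduces to it after multiplication by g.\<close>
  have tr: "h = u \<or> h = g" if h: "h \<in> Gm" "\<forall>f\<in>Lin. f \<cdot> h = 1" for h
  proof -
    have sep: "x = u" if "x \<in> Gm" "\<forall>f\<in>Lin. f \<cdot> x = 1" "l \<cdot> x = 2" for x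
      using that by (intro closed8_separates[OF n40 dd G8 Q qd]) (auto simp: Q_def Lin_dg l(2))
    have "qid Q \<cdot> h = (1/8) * (4 + 2 * (l \<cdot> h))" unfolding qe using h(2) by (simp add: pr_scale pr_add pr_sum c)
    moreover have "l \<cdot> h + 2 = 4 * ((1/8) * (4 + 2 * (l \<cdot> h)))" by (simp add: distrib_left)
    ultimately have "l \<cdot> h + 2 = 4 * (qid Q \<cdot> h)" by (simp only:)
    with Gm_idem[OF qid_idem[OF Q] h(1)] have "l \<cdot> h + 2 = 0 \<or> l \<cdot> h + 2 = 2 + 2" by auto
    hence "l \<cdot> h = 2 \<or> l \<cdot> h = -2" unfolding add_right_cancel by (simp only: eq_neg_iff_add_eq_0) blast
    thus ?thesis
    proof
      assume "l \<cdot> h = 2" thus ?thesis using sep h by blast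
    next
      assume m2: "l \<cdot> h = -2"
      have "g \<odot> h = u" using h g l(4) m2 by (intro sep) (auto simp: neg Lin_lin)
      hence "g \<odot> (g \<odot> h) = g \<odot> u" by simp
      hence "h = g" by (simp add: mul_assoc[symmetric] g(3))
      thus ?thesis by simp
    qed
  qed
  show ?thesis
    by (intro exI[of _ g] exI[of _ l] exI[of _ "qid Q"] conjI g l allI ballI neg qe qid_idem[OF Q] star_qid[OF Q]) (use tr in blast)
qed

text \<open>The average of the grouplike elements is the integral that \<open>qid\<close> attaches
  to them on the dual side, hence an idempotent. Its rank in the representation is dg f divided by
  the order of \<open>Gm\<close>.\<close>

lemma average_nat:
  assumes f: "f \<in> Irr" and z: "\<And>g. g \<in> Gm \<Longrightarrow> g \<noteq> u \<Longrightarrow> f \<cdot> g = 0" shows "card Gm dvd dg f"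
proof -
  define P where "P = (1 / of_nat (card Gm)) *s (\<Sum>g\<in>Gm. g)"
  have "P = hopf_int.qid D e Gm"
    using hopf_int.Lin_dg[OF dual_int] by (simp add: P_def hopf_int.qid_def[OF dual_int] hopf_int.qdim_def[OF dual_int] Gm_Lin)
  hence "P \<odot> P = P" using hopf_int.qid_idem[OF dual_int hopf_int.closed_Lin[OF dual_int]] by (simp add: Gm_Lin)
  from Irr_idem[OF f this] obtain m :: nat where m: "f \<cdot> P = of_nat m" by blast
  have cG: "card Gm > 0" unfolding card_gt_0_iff using Gm_ops(1) Gm_fin by blast
  have "(\<Sum>g\<in>Gm. f \<cdot> g) = (\<Sum>g\<in>Gm. if g = u then of_nat (dg f) else 0)"
    using z by (intro sum.cong refl) (auto simp: Irr_u[OF f])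
  hence "f \<cdot> P = of_nat (dg f) / of_nat (card Gm)" by (simp add: P_def pr_scale pr_sum)
  moreover have "(of_nat (card Gm) :: 'k) \<noteq> 0" using cG by (metis of_nat_eq_0_iff less_irrefl)
  ultimately have "(of_nat (dg f) :: 'k) = of_nat (m * card Gm)" using m by (metis nonzero_eq_divide_eq of_nat_mult)
  hence "dg f = m * card Gm" by (simp only: of_nat_eq_iff)
  thus ?thesis by simp
qed

text \<open>The vector \<open>c\<close> spans the ideal of the character ring on which characters act by the
  homomorphism that sends \<open>\<rho>\<close> to \<open>X\<close>, \<open>\<rho>'\<close> to \<open>-X\<close> and \<open>\<kappa>\<close> to zero.\<close>

lemma fusion_core:
  assumes r: "\<rho> \<in> Irr" "\<rho>' \<in> Irr" "\<rho> \<noteq> \<rho>'" "dg \<rho> = 4" "dg \<rho>' = 4" "\<And>f. f \<in> Irr \<Longrightarrow> dg f = 4 \<Longrightarrow> f = \<rho> \<or> f = \<rho>'"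
    and self: "star \<rho> = \<rho>" "star \<rho>' = \<rho>'"
    and cS: "card Lin = 2 * card (stab \<rho>)"
    and l: "\<And>t. t \<in> Lin \<Longrightarrow> \<kappa> \<star> t = \<kappa>"
    and prod: "\<rho> \<star> \<rho> = (\<Sum>f\<in>stab \<rho>. f) + \<kappa> + y1 *s \<rho> + y2 *s \<rho>'"
    and X: "X\<^sup>2 = of_nat (card (stab \<rho>)) + (y1 - y2) * X"
  shows "\<exists>c t. t \<in> Lin \<and> c \<star> c = (2 * of_nat (card (stab \<rho>)) + 2 * X\<^sup>2) *s c \<and> t \<star> c = (-1) *s c \<and> \<rho> \<star> c = X *s c \<and> c \<cdot> L = 1"
proof -
  define S where "S = stab \<rho>"
  define S' where "S' = Lin - S"
  have SL: "S \<subseteq> Lin" "finite S" "e \<in> S" using stab_sub[of \<rho>] by (auto simp: S_def)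
  have cS': "card S' = card S" using cS SL by (simp add: S'_def S_def card_Diff_subset)
  have finS': "finite S'" by (simp add: S'_def)
  have act1: "f \<star> \<rho> = \<rho>" if "f \<in> S" for f using that by (simp add: S_def stab_def)
  have act2: "f \<star> \<rho> = \<rho>'" if "f \<in> S'" for f
    using that r(6)[of "f \<star> \<rho>"] Lin_act[of f \<rho>] r by (auto simp: S'_def S_def stab_def)
  have sS: "star f \<in> S" if "f \<in> S" for f
  proof -
    have fL: "f \<in> Lin" using that SL by blast
    have "star f \<star> (f \<star> \<rho>) = \<rho>" by (simp add: cmul_assoc[symmetric] Lin_inv fL)
    thus ?thesis using act1[OF that] fL by (simp add: S_def stab_def Lin_star)
  qed
  hence sS': "star f \<in> S'" if "f \<in> S'" for f using that sS[of "star f"] by (auto simp: S'_def Lin_star)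
  have ract: "\<rho> \<star> f = \<rho>" if "f \<in> S" for f
    using arg_cong[OF act1[OF sS[OF that]], of star] by (simp add: star_mul self)
  have ract2: "\<rho> \<star> f = \<rho>'" if "f \<in> S'" for f
    using arg_cong[OF act2[OF sS'[OF that]], of star] by (simp add: star_mul self)
  have SS: "f \<star> k \<in> S" if "f \<in> S" "k \<in> S" for f k
  proof -
    have "(f \<star> k) \<star> \<rho> = \<rho>" using that by (simp add: cmul_assoc act1)
    moreover have "f \<star> k \<in> Lin" using that SL by (intro Lin_mul) auto
    ultimately show ?thesis unfolding S_def stab_def by simp
  qed
  have SS': "f \<star> k \<in> S'" if "f \<in> S" "k \<in> S'" for f k
  proof -
    have L: "f \<in> Lin" "k \<in> Lin" using that SL by (auto simp: S'_def)
    have "\<rho> \<star> (f \<star> k) = \<rho>'" using that by (simp add: cmul_assoc[symmetric] ract ract2)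
    hence "f \<star> k \<notin> S" using ract r(3) by metis
    thus ?thesis using L by (simp add: S'_def Lin_mul)
  qed
  have S'S: "f \<star> k \<in> S'" if "f \<in> S'" "k \<in> S" for f k
  proof -
    have L: "f \<in> Lin" "k \<in> Lin" using that SL by (auto simp: S'_def)
    have "(f \<star> k) \<star> \<rho> = \<rho>'" using that by (simp add: cmul_assoc act1 act2)
    hence "f \<star> k \<notin> S" using act1 r(3) by metis
    thus ?thesis using L by (simp add: S'_def Lin_mul)
  qed
  have "card S > 0" using SL by (auto simp: card_gt_0_iff)
  \<comment> \<open>An element of the nontrivial coset of the stabilizer; it exchanges \<rho> and
    \<rho>'.\<close>
  then obtain t where t: "t \<in> S'" using cS' by (metis card.empty ex_in_conv less_irrefl)
  have tL: "t \<in> Lin" using t by (simp add: S'_def)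
  define a where "a = (\<Sum>f\<in>S. f)"
  define b where "b = (\<Sum>f\<in>S'. f)"
  have shift: "f \<star> (\<Sum>k\<in>A. k) = (\<Sum>k\<in>B. k)" if "f \<in> Lin" "\<And>k. k \<in> A \<Longrightarrow> f \<star> k \<in> B" "finite B" "card A = card B" for f A B
  proof -
    have inj: "inj_on (\<lambda>k. f \<star> k) A" by (rule inj_onI) (rule Lin_cancel(1)[OF that(1)])
    hence "(\<lambda>k. f \<star> k) ` A = B" using that by (intro card_subset_eq) (auto simp: card_image)
    hence "(\<Sum>k\<in>B. k) = (\<Sum>k\<in>A. f \<star> k)" using sum.reindex[OF inj, of "\<lambda>x. x"] by simp
    thus ?thesis by (simp add: bm_sum)
  qed
  have fa: "f \<star> a = a" "f \<star> b = b" if "f \<in> S" for f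
    unfolding a_def b_def using that SL finS' SS SS' by (auto intro!: shift)
  have ta: "t \<star> a = b" unfolding a_def b_def using t tL S'S finS' cS' by (intro shift) auto
  have S'S': "f \<star> k \<in> S" if "f \<in> S'" "k \<in> S'" for f k
  proof -
    have L: "f \<in> Lin" "k \<in> Lin" using that by (auto simp: S'_def)
    have "f \<star> k \<in> Lin" using L by (rule Lin_mul)
    moreover have "f \<star> k \<notin> S'"
    proof
      assume "f \<star> k \<in> S'"
      have "f \<star> a = b" unfolding a_def b_def using that(1) L S'S finS' cS' by (intro shift) auto
      hence "k \<in> S" if "f \<star> k \<in> S'"
      proof -
        have "(\<lambda>k. f \<star> k) ` S = S'"
          using S'S[OF \<open>f \<in> S'\<close>] finS' cS' Lin_cancel(1)[OF L(1)] by (intro card_subset_eq) (auto simp: card_image inj_on_def)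
        then obtain k' where "k' \<in> S" "f \<star> k' = f \<star> k" using \<open>f \<star> k \<in> S'\<close> by (metis imageE)
        thus "k \<in> S" using Lin_cancel(1)[OF L(1)] by metis
      qed
      thus False using \<open>f \<star> k \<in> S'\<close> that(2) by (simp add: S'_def)
    qed
    ultimately show ?thesis by (simp add: S'_def)
  qed
  have f'a: "f \<star> a = b" "f \<star> b = a" if "f \<in> S'" for f
    unfolding a_def b_def using that SL finS' cS' S'S S'S' by (auto intro!: shift simp: S'_def)
  have act1': "f \<star> \<rho>' = \<rho>'" if "f \<in> S" for f
    using act2[OF SS'[OF that t]] act2[OF t] by (simp add: cmul_assoc)
  have act2': "f \<star> \<rho>' = \<rho>" if "f \<in> S'" for f
    using act1[OF S'S'[OF that t]] act2[OF t] by (simp add: cmul_assoc)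
  have rt': "\<rho>' \<star> t = \<rho>"
    using arg_cong[OF act2'[OF sS'[OF t]], of star] by (simp add: star_mul self)
  have at: "a \<star> t = b"
  proof -
    have inj: "inj_on (\<lambda>k. k \<star> t) S" by (rule inj_onI) (rule Lin_cancel(2)[OF tL])
    hence "(\<lambda>k. k \<star> t) ` S = S'" using SS' t finS' cS' by (intro card_subset_eq) (auto simp: card_image)
    hence "(\<Sum>k\<in>S'. k) = (\<Sum>k\<in>S. k \<star> t)" using sum.reindex[OF inj, of "\<lambda>x. x"] by simp
    thus ?thesis by (simp add: bm_sum a_def b_def)
  qed
  define s where "s = (of_nat (card S) :: 'k)"
  have ra: "\<rho> \<star> a = s *s \<rho>" "\<rho> \<star> b = s *s \<rho>'"
    by (simp_all add: a_def b_def bm_sum ract ract2 s_def cS' sum_const_vec del: sum_constant)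
  have rr: "\<rho> \<star> \<rho> = a + \<kappa> + y1 *s \<rho> + y2 *s \<rho>'" using prod by (simp add: a_def S_def)
  have rr': "\<rho> \<star> \<rho>' = b + \<kappa> + y1 *s \<rho>' + y2 *s \<rho>"
    unfolding ract2[OF t, symmetric] cmul_assoc[symmetric] rr
    by (simp add: bm_add bm_scale at l tL ract2[OF t] rt')
  \<comment> \<open>\<open>Lin\<close> acts on this vector through the sign character with kernel
    \<open>stab \<rho>\<close>. The condition that \<rho> multiplies it by X is exactly the
    quadratic equation assumed for X.\<close>
  define c where "c = a - b + X *s (\<rho> - \<rho>')"
  have fc: "f \<star> c = c" if "f \<in> S" for f
    unfolding c_def using that by (simp add: bm_add bm_diff bm_scale fa act1 act1')
  have f'c: "f \<star> c = (-1) *s c" if "f \<in> S'" for f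
    unfolding c_def using that by (simp add: bm_add bm_diff bm_scale f'a act2 act2' vec_eq_iff algebra_simps)
  have rc: "\<rho> \<star> c = X *s c"
  proof -
    have "\<rho> \<star> c = s *s (\<rho> - \<rho>') + X *s (a - b + (y1 - y2) *s (\<rho> - \<rho>'))"
      unfolding c_def by (simp add: bm_add bm_diff bm_scale ra rr rr' vec_eq_iff algebra_simps)
    also have "\<dots> = X *s (a - b) + (s + (y1 - y2) * X) *s (\<rho> - \<rho>')"
      by (simp add: vec_eq_iff algebra_simps)
    also have "s + (y1 - y2) * X = X * X" using X by (simp add: s_def S_def power2_eq_square)
    finally show ?thesis by (simp add: c_def vec_eq_iff algebra_simps)
  qed
  have r'c: "\<rho>' \<star> c = (-X) *s c"
    unfolding act2[OF t, symmetric] cmul_assoc rc by (simp add: bm_scale f'c[OF t])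
  have "c \<star> c = a \<star> c - b \<star> c + X *s (\<rho> \<star> c - \<rho>' \<star> c)"
    by (subst (1) c_def) (simp add: bm_add bm_diff bm_scale)
  also have "a \<star> c = s *s c" by (simp add: a_def bm_sum fc s_def sum_const_vec del: sum_constant)
  also have "b \<star> c = (-s) *s c" by (simp add: b_def bm_sum f'c s_def cS' sum_const_vec sum_negf del: sum_constant)
  finally have cc: "c \<star> c = (2 * s + 2 * X\<^sup>2) *s c"
    unfolding rc r'c by (simp add: vec_eq_iff power2_eq_square algebra_simps)
  have "a \<cdot> L = (\<Sum>f\<in>S. if f = e then 1 else 0)" unfolding a_def pr_sum using SL Lin_Irr by (intro sum.cong refl Irr_L) auto
  moreover have "b \<cdot> L = (\<Sum>f\<in>S'. if f = e then 1 else 0)" unfolding b_def pr_sum using Lin_Irr by (intro sum.cong refl Irr_L) (auto simp: S'_def)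
  moreover have "\<rho> \<cdot> L = 0" "\<rho>' \<cdot> L = 0" using r dg_e by (auto simp: Irr_L)
  ultimately have "c \<cdot> L = 1" using SL finS' by (simp add: c_def pr_add pr_diff pr_scale S'_def)
  thus ?thesis using cc rc f'c[OF t] tL unfolding s_def S_def by blast
qed

end

text \<open>The equations come from \<open>card_Gm_not_4\<close>, where X is eliminated from m (2 s
  + 2 X^2) = 40 and X^2 = s + y X. The first has s = 2 and c = y^2, the second s = 4 and y^2 = 1.
  Nonnegativity of the square bounds m by 10, and the remaining values are checked.\<close>

lemma codegree_equation:
  fixes m :: nat and c :: int
  shows "(40 - 8 * int m)\<^sup>2 = c * (80 * int m - 8 * (int m)\<^sup>2) \<Longrightarrow> c = 1 \<or> c = 9 \<Longrightarrow> False"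
    "(40 - 16 * int m)\<^sup>2 = 80 * int m - 16 * (int m)\<^sup>2 \<Longrightarrow> False"
proof -
  have bd: "m \<in> {0,1,2,3,4,5,6,7,8,9,10}" if "0 \<le> 80 * int m - 8 * (int m)\<^sup>2"
  proof -
    have "int m * int m \<le> int m * 10" using that by (simp add: power2_eq_square)
    hence "m = 0 \<or> m \<le> 10" by (cases "m = 0") simp_all
    hence "m = 0 \<or> m = 1 \<or> m = 2 \<or> m = 3 \<or> m = 4 \<or> m = 5 \<or> m = 6 \<or> m = 7 \<or> m = 8 \<or> m = 9 \<or> m = 10" by presburger
    thus ?thesis by simp
  qed
  {
    assume eq: "(40 - 8 * int m)\<^sup>2 = c * (80 * int m - 8 * (int m)\<^sup>2)" and c: "c = 1 \<or> c = 9"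
    have "0 \<le> c * (80 * int m - 8 * (int m)\<^sup>2)" unfolding eq[symmetric] by simp
    hence "0 \<le> 80 * int m - 8 * (int m)\<^sup>2" using c by auto
    from bd[OF this] eq c show False by auto
  next
    assume eq: "(40 - 16 * int m)\<^sup>2 = 80 * int m - 16 * (int m)\<^sup>2"
    have "0 \<le> 80 * int m - 16 * (int m)\<^sup>2" unfolding eq[symmetric] by simp
    hence "0 \<le> 80 * int m - 8 * (int m)\<^sup>2" using zero_le_power2[of "int m"] by linarith
    from bd[OF this] eq show False by auto
  }
qed

lemma quadratic_root: fixes b c :: "'a::alg_closed_field" shows "\<exists>x. x\<^sup>2 = c + b * x"
proof -
  obtain x where "(\<Sum>k\<le>2. (\<lambda>k. if k = 0 then - c else if k = 1 then - b else 1) k * x ^ k) = 0"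
    using alg_closed[of 2 "\<lambda>k. if k = 0 then - c else if k = 1 then - b else 1"] by auto
  hence "- c - b * x + x\<^sup>2 = 0" by (simp add: eval_nat_numeral)
  hence "x\<^sup>2 = c + b * x" by (simp add: algebra_simps)
  thus ?thesis by blast
qed

context hopf_int
begin

lemma dual_Gm: "hopf_int.Gm M u = Lin"
  using hopf_int.Gm_def[OF dual_int] by (simp add: Lin_grp)

text \<open>With p the average of the linear characters, the value of p \<rho> at \<open>E\<close>
  is computed twice: from the definition of \<open>E\<close>, where only the unit contributes, and
  as an average of \<open>k\<close> over the orbit of \<rho>.\<close>

lemma orbit_sum:
  assumes E: "E = (1 / 8) *s ((\<Sum>g\<in>Gm. g) + 2 *s l')" and \<eta>: "\<eta> \<in> Lin" "\<And>x. l' \<cdot> (\<eta> \<star> x) = - (l' \<cdot> x)"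
    and \<rho>: "\<rho> \<in> Irr" and T: "\<And>g. g \<in> Gm \<Longrightarrow> \<forall>f\<in>Lin. f \<cdot> g = 1 \<Longrightarrow> g \<noteq> u \<Longrightarrow> \<rho> \<cdot> g = 0"
    and k: "\<And>f. f \<in> Irr \<Longrightarrow> f \<cdot> E = of_nat (k f)"
  shows "8 * (card (stab \<rho>) * (\<Sum>y\<in>(\<lambda>f. f \<star> \<rho>) ` Lin. k y)) = card Lin * dg \<rho>"
proof -
  define p where "p = qid Lin"
  have qL: "qdim Lin = card Lin" by (simp add: qdim_def Lin_dg)
  have cL: "card Lin > 0" unfolding card_gt_0_iff using e_Lin finite_Lin by blast
  have p: "p = (1 / of_nat (card Lin)) *s (\<Sum>f\<in>Lin. f)" by (simp add: p_def qid_def qL Lin_dg)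
  have pp: "p \<star> p = p" unfolding p_def by (rule qid_idem[OF closed_Lin])
  have \<eta>p: "\<eta> \<star> p = p" unfolding p_def using qid_absorb[OF closed_Lin \<eta>(1)] by (simp add: Lin_dg \<eta>(1))
  \<comment> \<open>\<eta> fixes p but acts as -1 on l', so the part of \<open>E\<close> along l'
    contributes nothing.\<close>
  have "l' \<cdot> (p \<star> \<rho>) = - (l' \<cdot> (p \<star> \<rho>))" using \<eta>(2)[of "p \<star> \<rho>"] by (simp add: cmul_assoc[symmetric] \<eta>p)
  hence l0: "(p \<star> \<rho>) \<cdot> l' = 0" by (simp add: pr_comm[of _ l'] eq_neg_iff_add_eq_0)
  have "(\<Sum>g\<in>Gm. (p \<star> \<rho>) \<cdot> g) = (\<Sum>g\<in>Gm. if g = u then of_nat (dg \<rho>) else 0)"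
  proof (intro sum.cong refl)
    fix g assume g: "g \<in> Gm"
    show "(p \<star> \<rho>) \<cdot> g = (if g = u then of_nat (dg \<rho>) else 0)"
    proof (cases "p \<cdot> g = 1")
      case True
      hence "\<forall>f\<in>Lin. f \<cdot> g = 1" using qid_grp[OF closed_Lin g] by (simp add: p_def Lin_dg)
      thus ?thesis using T[OF g] True by (auto simp: Gm_eval[OF g] Irr_u[OF \<rho>])
    next
      case False
      hence "p \<cdot> g = 0" using Gm_idem[OF pp g] by blast
      moreover have "g \<noteq> u"
      proof
        assume "g = u"
        hence "qid Lin \<cdot> g = 1" unfolding qid_grp[OF closed_Lin g] using Irr_u Lin_Irr by simp
        thus False using False by (simp add: p_def)
      qed
      ultimately show ?thesis by (simp add: Gm_eval[OF g])
    qed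
  qed
  hence 1: "(p \<star> \<rho>) \<cdot> E = of_nat (dg \<rho>) / 8" by (simp add: E pr_scale pr_add pr_sum l0)
  have "(\<Sum>f\<in>Lin. k (f \<star> \<rho>)) = (\<Sum>y\<in>(\<lambda>f. f \<star> \<rho>) ` Lin. \<Sum>f\<in>{f\<in>Lin. f \<star> \<rho> = y}. k (f \<star> \<rho>))"
    by (rule sum.image_gen) simp
  also have "\<dots> = (\<Sum>y\<in>(\<lambda>f. f \<star> \<rho>) ` Lin. card (stab \<rho>) * k y)"
    by (intro sum.cong refl) (simp add: orbit_fiber)
  finally have 2: "(\<Sum>f\<in>Lin. k (f \<star> \<rho>)) = card (stab \<rho>) * (\<Sum>y\<in>(\<lambda>f. f \<star> \<rho>) ` Lin. k y)"
    by (simp only: sum_distrib_left)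
  have "(p \<star> \<rho>) \<cdot> E = (1 / of_nat (card Lin)) * (\<Sum>f\<in>Lin. (f \<star> \<rho>) \<cdot> E)"
    by (simp add: p bm_scale bm_sum pr_scale pr_sum)
  also have "(\<Sum>f\<in>Lin. (f \<star> \<rho>) \<cdot> E) = of_nat (\<Sum>f\<in>Lin. k (f \<star> \<rho>))"
    by (simp add: k Lin_act \<rho>)
  finally have "of_nat (dg \<rho>) / 8 = (1 / of_nat (card Lin)) * (of_nat (\<Sum>f\<in>Lin. k (f \<star> \<rho>)) :: 'k)" by (simp only: 1)
  moreover have "(of_nat (card Lin) :: 'k) \<noteq> 0" using cL by (metis of_nat_eq_0_iff less_irrefl)
  ultimately have "(of_nat (8 * (\<Sum>f\<in>Lin. k (f \<star> \<rho>))) :: 'k) = of_nat (card Lin * dg \<rho>)"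
    by (simp add: field_simps del: of_nat_sum)
  hence "8 * (\<Sum>f\<in>Lin. k (f \<star> \<rho>)) = card Lin * dg \<rho>" by (simp only: of_nat_eq_iff)
  thus ?thesis unfolding 2 .
qed

text \<open>c / N is an idempotent with value 1 / N at \<open>L\<close>, which makes m = 40 / N a
  natural number. If m is odd, the idempotent is 1 at some grouplike element, and absorption yields
  the values of \<rho> and t there.\<close>

lemma codegree_fusion:
  assumes n40: "CARD('i) = 40" and dd: "\<forall>g\<in>dIrr. ddg g \<in> {1,2,4}"
    and c: "c \<star> c = N *s c" "t \<star> c = (-1) *s c" "\<rho> \<star> c = X *s c" "c \<cdot> L = 1" and N: "N \<noteq> 0"
  shows "\<exists>m::nat. of_nat m * N = 40 \<and> (odd m \<longrightarrow> (\<exists>g\<in>Gm. \<rho> \<cdot> g = X \<and> t \<cdot> g = -1))"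
proof -
  define f where "f = (1 / N) *s c"
  have f: "f \<star> f = f" using N c(1) by (simp add: f_def bm_scale)
  obtain m :: nat where m: "of_nat CARD('i) * (f \<cdot> L) = (of_nat m :: 'k)" "even m \<longleftrightarrow> even (card {g\<in>Gm. f \<cdot> g = 1})"
    using idem_parity[OF dd f] by blast
  have "of_nat m * N = 40" unfolding m(1)[symmetric] n40 using N by (simp add: f_def pr_scale c(4))
  moreover have "\<exists>g\<in>Gm. \<rho> \<cdot> g = X \<and> t \<cdot> g = -1" if "odd m"
  proof -
    have "{g\<in>Gm. f \<cdot> g = 1} \<noteq> {}" using m(2) that by (metis card.empty even_zero)
    then obtain g where g: "g \<in> Gm" "f \<cdot> g = 1" by blast
    have "\<rho> \<star> f = X *s f" "t \<star> f = (-1) *s f" by (simp_all add: f_def bm_scale c vec.scale_left_commute)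
    hence "(\<rho> \<star> f) \<cdot> g = (X *s f) \<cdot> g" "(t \<star> f) \<cdot> g = ((-1) *s f) \<cdot> g" by (simp_all only:)
    hence "\<rho> \<cdot> g = X" "t \<cdot> g = -1" unfolding Gm_eval[OF g(1)] pr_scale g(2) by simp_all
    thus ?thesis using g by blast
  qed
  ultimately show ?thesis by blast
qed

lemma orders_not_8_8:
  assumes n40: "CARD('i) = 40" and dd: "\<forall>g\<in>dIrr. ddg g \<in> {1,2,4}" and od: "\<forall>f\<in>Irr. dg f \<in> {1,2,4}"
    and c: "card Lin = 8" "card Gm = 8" and no: "\<And>g. \<not> central_inv g"
  shows False
proof -
  have "\<exists>f\<in>Irr. dg f \<noteq> 1"
  proof (rule ccontr)
    assume "\<not> ?thesis"
    hence "Irr = Lin" by (auto simp: Lin_def)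
    hence "CARD('i) = card Lin" using sum_dg by (simp add: Lin_dg)
    thus False using n40 c by simp
  qed
  then obtain f where f: "f \<in> Irr" "dg f \<noteq> 1" by blast
  have "f \<cdot> g = 0" if g: "g \<in> Gm" "g \<noteq> u" for g
    using vanish[OF n40 dd _ c(1) no g f] Gm_8[of _] c(2) by blast
  from average_nat[OF f(1) this] have "8 dvd dg f" by (simp add: c(2))
  moreover have "dg f = 2 \<or> dg f = 4" using f od by auto
  ultimately show False by auto
qed

text \<open>The special involution of the dual side supplies an idempotent \<open>E\<close> of H,
  the integral of an eight-dimensional Hopf subalgebra. Its values \<open>k\<close> tell the two
  characters of degree 4 apart and make them self-dual. The square of \<rho> is then known up to the
  way in which the multiplicity 3 is divided between \<rho> and \<rho>', and each division is
  refuted by a codegree.\<close>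

lemma card_Gm_not_4:
  assumes n40: "CARD('i) = 40" and dd: "\<forall>g\<in>dIrr. ddg g \<in> {1,2,4}" and od: "\<forall>f\<in>Irr. dg f \<in> {1,2,4}"
    and c: "card Lin = 4 \<or> card Lin = 8" "card Gm = 4"
    and no: "\<And>g. \<not> central_inv g" "\<And>f. \<not> hopf_int.central_inv D e M u f"
  shows False
proof -
  note G8 = Gm_8[OF disjI1[OF c(2)]]
  have "\<exists>\<eta> l' E. \<eta> \<in> Lin \<and> (\<forall>x. l' \<cdot> (\<eta> \<star> x) = - (l' \<cdot> x)) \<and> E = (1 / 8) *s ((\<Sum>g\<in>Gm. g) + 2 *s l') \<and> E \<odot> E = E \<and> ant S E = E"
    using hopf_int.special_involution[OF dual_int n40 od dd] no(2) c unfolding dual_Gm Gm_Lin[symmetric] by blast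
  then obtain \<eta> l' E where \<eta>: "\<eta> \<in> Lin" "\<And>x. l' \<cdot> (\<eta> \<star> x) = - (l' \<cdot> x)" and E: "E = (1 / 8) *s ((\<Sum>g\<in>Gm. g) + 2 *s l')"
    and EE: "E \<odot> E = E" "ant S E = E" by blast
  have "\<forall>f\<in>Irr. \<exists>m::nat. f \<cdot> E = of_nat m" using Irr_idem[OF _ EE(1)] by blast
  then obtain k :: "'k ^ 'i \<Rightarrow> nat" where k: "\<And>f. f \<in> Irr \<Longrightarrow> f \<cdot> E = of_nat (k f)" by metis
  have kstar: "k (star f) = k f" if f: "f \<in> Irr" for f
  proof -
    have "(of_nat (k (star f)) :: 'k) = of_nat (k f)"
      using k[OF f] k[of "star f"] star_Irr[OF f] by (simp add: pr_ant[symmetric] EE(2))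
    thus ?thesis by (simp only: of_nat_eq_iff)
  qed
  obtain l where l: "card Lin = 4 \<Longrightarrow> l \<in> Irr \<and> dg l = 2" and
    T0: "\<And>\<rho> g. \<rho> \<in> Irr \<Longrightarrow> \<rho> \<notin> Lin \<Longrightarrow> (card Lin = 4 \<Longrightarrow> \<rho> \<noteq> l) \<Longrightarrow> g \<in> Gm \<Longrightarrow> \<forall>f\<in>Lin. f \<cdot> g = 1 \<Longrightarrow> g \<noteq> u \<Longrightarrow> \<rho> \<cdot> g = 0"
  proof (cases "card Lin = 4")
    case True
    have "\<exists>g l. l \<in> Irr \<and> dg l = 2 \<and> (\<forall>f\<in>Irr. f \<notin> Lin \<longrightarrow> f \<noteq> l \<longrightarrow> f \<cdot> g = 0) \<and> (\<forall>h\<in>Gm. (\<forall>f\<in>Lin. f \<cdot> h = 1) \<longrightarrow> h = u \<or> h = g)"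
      using special_involution[OF n40 dd od True disjI1[OF c(2)] no(1)] by blast
    then obtain g l where l: "l \<in> Irr" "dg l = 2" "\<forall>f\<in>Irr. f \<notin> Lin \<longrightarrow> f \<noteq> l \<longrightarrow> f \<cdot> g = 0"
      "\<forall>h\<in>Gm. (\<forall>f\<in>Lin. f \<cdot> h = 1) \<longrightarrow> h = u \<or> h = g" by blast
    show thesis by (rule that[of l]) (use l True in blast)+
  next
    case False
    hence c8: "card Lin = 8" using c by blast
    have "g = u" if "g \<in> Gm" "\<forall>f\<in>Lin. f \<cdot> g = 1" for g
      by (rule closed8_separates[OF n40 dd G8 closed_Lin]) (use that c8 in \<open>auto simp: qdim_def Lin_dg\<close>)
    \<comment> \<open>No special character exists in this case; 0 is a dummy, as statements about
      \<open>l\<close> are guarded by \<open>card Lin = 4\<close>.\<close>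
    thus thesis using that[of 0] False by blast
  qed
  have osum: "8 * (card (stab \<rho>) * (\<Sum>y\<in>(\<lambda>f. f \<star> \<rho>) ` Lin. k y)) = card Lin * dg \<rho>"
    if "\<rho> \<in> Irr" "\<rho> \<notin> Lin" "card Lin = 4 \<Longrightarrow> \<rho> \<noteq> l" for \<rho>
    by (rule orbit_sum[OF E \<eta> that(1) T0[OF that] k])
  have cz: "deg_count 3 = 0" "deg_count 5 = 0" "deg_count 6 = 0" using od by (auto simp: deg_count_def)
  have d4: "dg \<rho> = 4" if \<rho>: "\<rho> \<in> Irr" "\<rho> \<notin> Lin" "card Lin = 4 \<Longrightarrow> \<rho> \<noteq> l" for \<rho>
  proof (rule ccontr)
    assume "dg \<rho> \<noteq> 4"
    hence d2: "dg \<rho> = 2" using \<rho> od by (auto simp: Lin_def)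
    from c(1) show False
    proof
      assume c4: "card Lin = 4"
      \<comment> \<open>\<open>orbit_sum\<close> reads 8 times this number = 4 * 2. The stabilizer
        is therefore trivial, and the product of \<rho> with its dual, of degree 4, would be one
        linear character plus constituents of even degree.\<close>
      hence "card (stab \<rho>) * (\<Sum>y\<in>(\<lambda>f. f \<star> \<rho>) ` Lin. k y) = 1" using osum[OF \<rho>] d2 by simp
      hence "card (stab \<rho>) = 1" by simp
      hence a1: "deg_mlt (\<rho> \<star> star \<rho>) 1 = 1" using deg_mlt_Lin_star[OF \<rho>(1)] by simp
      have "deg_mlt (\<rho> \<star> star \<rho>) 1 + 2 * deg_mlt (\<rho> \<star> star \<rho>) 2 + 4 * deg_mlt (\<rho> \<star> star \<rho>) 4 = 4"
        using deg_mlt_sum[OF n40 \<rho>(1) conjunct1[OF star_Irr[OF \<rho>(1)]]] star_Irr[OF \<rho>(1)] d2 by (simp add: deg_count_am[OF n40] cz)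
      moreover have False if "1 + 2 * p + 4 * q = 4" for p q :: nat using that by presburger
      ultimately show False unfolding a1 by blast
    next
      assume c8: "card Lin = 8"
      have "dg \<rho> \<noteq> 1" using d2 by simp
      hence "\<rho> \<cdot> g = 0" if "g \<in> Gm" "g \<noteq> u" for g
        using vanish[OF n40 dd G8 c8 no(1) that \<rho>(1)] by blast
      from average_nat[OF \<rho>(1) this] show False by (simp add: c(2) d2)
    qed
  qed
  have c4: "deg_count 4 = 2"
  proof -
    have "deg_count 2 = (if card Lin = 4 then 1 else 0)"
    proof -
      have "{f\<in>Irr. dg f = 2} = (if card Lin = 4 then {l} else {})"
        using d4 l by (auto simp: Lin_def split: if_splits) force+
      thus ?thesis by (simp add: deg_count_def)
    qed
    thus ?thesis using deg_count_sum[OF n40] cz c(1) unfolding deg_count_1 by auto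
  qed
  then obtain \<rho> \<rho>' where r: "{f\<in>Irr. dg f = 4} = {\<rho>, \<rho>'}" "\<rho> \<noteq> \<rho>'" unfolding deg_count_def card_2_iff by blast
  have rI: "\<rho> \<in> Irr" "\<rho>' \<in> Irr" "dg \<rho> = 4" "dg \<rho>' = 4" using r by blast+
  have r4: "f = \<rho> \<or> f = \<rho>'" if "f \<in> Irr" "dg f = 4" for f using r that by blast
  have rL: "\<rho> \<notin> Lin" "card Lin = 4 \<Longrightarrow> \<rho> \<noteq> l" using rI l by (auto simp: Lin_def)
  define Ob where "Ob = (\<lambda>f. f \<star> \<rho>) ` Lin"
  have Osub: "Ob \<subseteq> {\<rho>, \<rho>'}" 
  proof
    fix z assume "z \<in> Ob"
    then obtain f where f: "f \<in> Lin" "z = f \<star> \<rho>" by (auto simp: Ob_def)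
    show "z \<in> {\<rho>, \<rho>'}" using r4[of z] Lin_act(1,2)[OF f(1) rI(1)] f(2) rI(3) by simp
  qed
  have "\<rho> \<in> Ob" unfolding Ob_def using e_Lin by (intro image_eqI[of _ _ e]) auto
  have os: "8 * (card (stab \<rho>) * (\<Sum>y\<in>Ob. k y)) = card Lin * 4" using osum[OF rI(1) rL] rI by (simp add: Ob_def)
  have oc: "card Lin = card Ob * card (stab \<rho>)" using orbit_stab[OF rI(1)] by (simp add: Ob_def)
  have st: "card (stab \<rho>) > 0" by (rule stab_pos)
  \<comment> \<open>If \<open>Lin\<close> fixed \<rho>, then \<open>orbit_sum\<close> would give 2 k
    \<rho> = 1.\<close>
  have OO: "Ob = {\<rho>, \<rho>'}"
  proof (rule ccontr)
    assume "Ob \<noteq> {\<rho>, \<rho>'}"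
    hence Ob1: "Ob = {\<rho>}" using Osub \<open>\<rho> \<in> Ob\<close> by blast
    hence "8 * (card (stab \<rho>) * k \<rho>) = card (stab \<rho>) * 4" using os oc by simp
    hence "2 * k \<rho> = 1" using st by simp
    thus False by presburger
  qed
  have cS: "card Lin = 2 * card (stab \<rho>)" using oc OO r(2) by simp
  have "8 * (card (stab \<rho>) * (k \<rho> + k \<rho>')) = 8 * card (stab \<rho>)" using os cS OO r(2) by simp
  hence "k \<rho> + k \<rho>' = 1" using st by simp
  hence kk: "k \<rho> \<noteq> k \<rho>'" by presburger
  \<comment> \<open>Duality preserves both the degree and \<open>k\<close>, and \<open>k\<close>
    separates the two characters of degree 4.\<close>
  have self: "star \<rho> = \<rho>" "star \<rho>' = \<rho>'"
    using r4[of "star \<rho>"] r4[of "star \<rho>'"] star_Irr[OF rI(1)] star_Irr[OF rI(2)] kstar[OF rI(1)] kstar[OF rI(2)] kk rI by auto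
  define \<kappa> where "\<kappa> = (if card Lin = 4 then l else 0)"
  have l2: "f = l" if "f \<in> Irr" "dg f = 2" "card Lin = 4" for f
    using d4[of f] that by (auto simp: Lin_def)
  have \<kappa>t: "\<kappa> \<star> t = \<kappa>" if t: "t \<in> Lin" for t
    using l2[of "l \<star> t"] l Lin_act(3,4)[OF t, of l] by (auto simp: \<kappa>_def)
  define y1 y2 m where "y1 = mlt (\<rho> \<star> \<rho>) \<rho>" and "y2 = mlt (\<rho> \<star> \<rho>) \<rho>'" and "m = mlt (\<rho> \<star> \<rho>) l"
  have Irr_split: "Irr = Lin \<union> {\<rho>, \<rho>'} \<union> (if card Lin = 4 then {l} else {})"
    using d4 r4 rI l Lin_Irr by (auto split: if_splits)
  have sumI: "(\<Sum>h\<in>Irr. F h) = (\<Sum>h\<in>Lin. F h) + (F \<rho> + F \<rho>') + (if card Lin = 4 then F l else 0)" for F :: "'k ^ 'i \<Rightarrow> 'b::comm_monoid_add"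
  proof -
    have 1: "(\<Sum>h\<in>Lin \<union> {\<rho>, \<rho>'}. F h) = (\<Sum>h\<in>Lin. F h) + (F \<rho> + F \<rho>')"
      using rI r(2) by (subst sum.union_disjoint) (auto simp: Lin_def)
    show ?thesis
    proof (cases "card Lin = 4")
      case True
      hence "l \<notin> Lin \<union> {\<rho>, \<rho>'}" using l rI by (auto simp: Lin_def)
      thus ?thesis using 1 True by (subst Irr_split) (simp add: add.commute)
    next
      case False thus ?thesis using 1 by (subst Irr_split) simp
    qed
  qed
  have mL: "mlt (\<rho> \<star> \<rho>) h = (if h \<in> stab \<rho> then 1 else 0)" if "h \<in> Lin" for h
    using mlt_Lin(1)[OF that rI(1,1)] that by (simp add: self stab_def)
  have sumL: "(\<Sum>h\<in>Lin. if h \<in> stab \<rho> then G h else 0) = (\<Sum>h\<in>stab \<rho>. G h)" for G :: "'k ^ 'i \<Rightarrow> 'b::comm_monoid_add"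
    using stab_sub(1)[of \<rho>] by (simp add: sum.If_cases Int_absorb1)
  have deg: "card (stab \<rho>) + 4 * (y1 + y2) + (if card Lin = 4 then 2 * m else 0) = 16"
  proof -
    have "(\<Sum>h\<in>Lin. mlt (\<rho> \<star> \<rho>) h * dg h) = (\<Sum>h\<in>Lin. if h \<in> stab \<rho> then 1 else 0)"
      by (intro sum.cong refl) (simp add: mL Lin_dg)
    hence "(\<Sum>h\<in>Lin. mlt (\<rho> \<star> \<rho>) h * dg h) = card (stab \<rho>)" unfolding sumL by simp
    thus ?thesis using mlt_dg[OF rI(1,1)] l unfolding sumI by (auto simp: rI y1_def y2_def m_def)
  qed
  \<comment> \<open>The equation 2 + 4 (y1 + y2) + 2 m = 16 makes m odd, and the degree 8 of l
    \<rho> bounds m by 2.\<close>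
  have m1: "m = 1" if c4: "card Lin = 4"
  proof -
    have "m = mlt (l \<star> \<rho>) \<rho>" unfolding m_def using mlt_adj(1)[OF rI(1,1), of l] l[OF c4] by (simp add: self)
    hence "m * 4 \<le> (\<Sum>h\<in>Irr. mlt (l \<star> \<rho>) h * dg h)" using member_le_sum[OF rI(1), of "\<lambda>h. mlt (l \<star> \<rho>) h * dg h"] rI by simp
    hence "m \<le> 2" using mlt_dg[of l \<rho>] l[OF c4] rI by simp
    moreover have "2 + 4 * (y1 + y2) + 2 * m = 16" using deg cS c4 by simp
    moreover have "p = 1" if "p \<le> 2" "2 + 4 * q + 2 * p = 16" for p q :: nat using that by presburger
    ultimately show ?thesis by blast
  qed
  have y12: "y1 + y2 = 3" using deg cS c(1) m1 by auto
  have prod: "\<rho> \<star> \<rho> = (\<Sum>f\<in>stab \<rho>. f) + \<kappa> + of_nat y1 *s \<rho> + of_nat y2 *s \<rho>'"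
  proof -
    have "\<rho> \<star> \<rho> = (\<Sum>h\<in>Irr. of_nat (mlt (\<rho> \<star> \<rho>) h) *s h)" by (intro Ch_expand Ch_intros rI)
    also have "\<dots> = (\<Sum>h\<in>Lin. of_nat (mlt (\<rho> \<star> \<rho>) h) *s h) + (of_nat y1 *s \<rho> + of_nat y2 *s \<rho>') + (if card Lin = 4 then of_nat m *s l else 0)"
      unfolding sumI y1_def y2_def m_def ..
    also have "(\<Sum>h\<in>Lin. of_nat (mlt (\<rho> \<star> \<rho>) h) *s h) = (\<Sum>h\<in>Lin. if h \<in> stab \<rho> then h else 0)"
      by (intro sum.cong refl) (simp add: mL)
    also have "\<dots> = (\<Sum>f\<in>stab \<rho>. f)" by (rule sumL)
    also have "(if card Lin = 4 then of_nat m *s l else 0) = \<kappa>" using m1 by (simp add: \<kappa>_def)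
    finally show ?thesis by (simp add: add_ac)
  qed
  define s where "s = card (stab \<rho>)"
  define y where "y = int y1 - int y2"
  have s24: "s = 2 \<and> card Lin = 4 \<or> s = 4 \<and> card Lin = 8" using cS c(1) by (auto simp: s_def)
  have "y1 = 0 \<and> y2 = 3 \<or> y1 = 1 \<and> y2 = 2 \<or> y1 = 2 \<and> y2 = 1 \<or> y1 = 3 \<and> y2 = 0" using y12 by presburger
  hence yy: "y\<^sup>2 = 1 \<or> y = 3 \<or> y = -3" by (auto simp: y_def)
  \<comment> \<open>Every root X of the quadratic gives a homomorphism of codegree 2 s + 2 X^2.
    Eliminating X leaves an equation between integers.\<close>
  have main: "\<exists>m::nat. of_nat m * (2 * of_nat s + 2 * X\<^sup>2) = (40::'k) \<and> (40 - 4 * int s * int m)\<^sup>2 = y\<^sup>2 * (80 * int m - 4 * int s * (int m)\<^sup>2) \<and>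
      (odd m \<longrightarrow> (\<exists>g\<in>Gm. g \<noteq> u \<and> \<rho> \<cdot> g = X))" if X: "X\<^sup>2 = of_nat s + of_int y * X" for X :: 'k
  proof -
    define N where "N = 2 * of_nat s + 2 * X\<^sup>2"
    \<comment> \<open>N = 0 would give X^2 = - s and y X = - 2 s, hence - s y^2 = 4 s^2, which the
      signs forbid.\<close>
    have "N \<noteq> 0"
    proof
      assume "N = 0"
      hence "2 * (X\<^sup>2 + of_nat s) = 0" by (simp add: N_def algebra_simps)
      hence "X\<^sup>2 + of_nat s = 0" unfolding mult_eq_0_iff by simp
      hence XX: "X\<^sup>2 = - of_nat s" by (simp only: eq_neg_iff_add_eq_0)
      hence "of_int y * X = - (2 * of_nat s)" using X by (simp add: algebra_simps eq_neg_iff_add_eq_0)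
      hence "(of_int y * X)\<^sup>2 = (2 * of_nat s)\<^sup>2" by simp
      hence "(of_int (y\<^sup>2 * (- int s)) :: 'k) = of_int ((2 * int s)\<^sup>2)" by (simp add: power_mult_distrib XX)
      hence "y\<^sup>2 * (- int s) = (2 * int s)\<^sup>2" by (simp only: of_int_eq_iff)
      thus False using s24 yy by (auto simp: power2_eq_square)
    qed
    have "\<exists>c t. t \<in> Lin \<and> c \<star> c = N *s c \<and> t \<star> c = (-1) *s c \<and> \<rho> \<star> c = X *s c \<and> c \<cdot> L = 1"
      unfolding N_def s_def
      by (rule fusion_core[OF rI(1,2) r(2) rI(3,4) r4 self cS \<kappa>t prod]) (use X in \<open>simp_all add: s_def y_def\<close>)
    then obtain c t where ct: "t \<in> Lin" "c \<star> c = N *s c" "t \<star> c = (-1) *s c" "\<rho> \<star> c = X *s c" "c \<cdot> L = 1" by blast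
    from codegree_fusion[OF n40 dd ct(2-5) \<open>N \<noteq> 0\<close>] obtain m :: nat where
      m: "of_nat m * N = 40" "odd m \<Longrightarrow> \<exists>g\<in>Gm. \<rho> \<cdot> g = X \<and> t \<cdot> g = -1" by blast
    define q where "q = of_int y * X"
    define s' m' y' where "s' = (of_nat s :: 'k)" and "m' = (of_nat m :: 'k)" and "y' = (of_int y :: 'k)"
    have XX: "X\<^sup>2 = s' + q" using X by (simp add: q_def s'_def)
    have qq: "q\<^sup>2 = y'\<^sup>2 * (s' + q)" by (simp add: q_def y'_def power_mult_distrib XX)
    have "2 * (m' * q) = 40 - 4 * s' * m'" using m(1) by (simp add: N_def XX m'_def s'_def algebra_simps)
    hence e1: "2 * (m' * q) = 40 - 4 * s' * m'" "(40 - 4 * s' * m')\<^sup>2 = (2 * (m' * q))\<^sup>2" by simp_all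
    note e1(2)
    also have "(2 * (m' * q))\<^sup>2 = y'\<^sup>2 * (4 * m'\<^sup>2 * s' + 2 * m' * (2 * (m' * q)))"
      by (simp add: power_mult_distrib qq) (simp add: algebra_simps power2_eq_square)
    also have "\<dots> = y'\<^sup>2 * (80 * m' - 4 * s' * m'\<^sup>2)" unfolding e1(1) by (simp add: algebra_simps power2_eq_square)
    finally have "(of_int ((40 - 4 * int s * int m)\<^sup>2) :: 'k) = of_int (y\<^sup>2 * (80 * int m - 4 * int s * (int m)\<^sup>2))"
      by (simp add: s'_def m'_def y'_def)
    hence eq: "(40 - 4 * int s * int m)\<^sup>2 = y\<^sup>2 * (80 * int m - 4 * int s * (int m)\<^sup>2)" by (simp only: of_int_eq_iff)
    have "\<exists>g\<in>Gm. g \<noteq> u \<and> \<rho> \<cdot> g = X" if om: "odd m"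
    proof -
      obtain g where g: "g \<in> Gm" "\<rho> \<cdot> g = X" "t \<cdot> g = -1" using m(2)[OF om] by blast
      have "t \<cdot> u = 1" using Irr_u[OF Lin_Irr[OF ct(1)]] Lin_dg[OF ct(1)] by simp
      hence "g \<noteq> u" using g(3) by auto
      thus ?thesis using g by blast
    qed
    thus ?thesis using m(1) eq unfolding N_def by blast
  qed
  from s24 show False
  proof
    assume s2: "s = 2 \<and> card Lin = 4"
    obtain X :: 'k where "X\<^sup>2 = of_nat s + of_int y * X" using quadratic_root by blast
    from main[OF this] s2 obtain m :: nat where "(40 - 8 * int m)\<^sup>2 = y\<^sup>2 * (80 * int m - 8 * (int m)\<^sup>2)" by auto
    thus False by (rule codegree_equation(1)) (use yy in auto)
  next
    assume s4: "s = 4 \<and> card Lin = 8"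
    from yy show False
    proof
      assume y1: "y\<^sup>2 = 1"
      obtain X :: 'k where "X\<^sup>2 = of_nat s + of_int y * X" using quadratic_root by blast
      from main[OF this] s4 y1 obtain m :: nat where "(40 - 16 * int m)\<^sup>2 = 80 * int m - 16 * (int m)\<^sup>2" by auto
      thus False by (rule codegree_equation(2))
    next
      assume y3: "y = 3 \<or> y = -3"
      \<comment> \<open>A rational root of X^2 = 4 + y X for y = 3 or -3. Its codegree is 8 + 32 =
        40, so m = 1 is odd and \<rho> takes the nonzero value X at a nontrivial grouplike element,
        against \<open>vanish\<close>.\<close>
      define X :: 'k where "X = (if y = 3 then 4 else -4)"
      have X: "X\<^sup>2 = of_nat s + of_int y * X" "X\<^sup>2 = 16" "X \<noteq> 0" using s4 y3 by (auto simp: X_def)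
      from main[OF X(1)] obtain m :: nat where m: "of_nat m * (2 * of_nat s + 2 * X\<^sup>2) = (40::'k)"
        "odd m \<Longrightarrow> \<exists>g\<in>Gm. g \<noteq> u \<and> \<rho> \<cdot> g = X" by blast
      have "(of_nat (m * 40) :: 'k) = of_nat 40" using m(1) s4 by (simp add: X(2))
      hence "m * 40 = 40" by (simp only: of_nat_eq_iff)
      hence "m = 1" by simp
      then obtain g where g: "g \<in> Gm" "g \<noteq> u" "\<rho> \<cdot> g = X" using m(2) by auto
      have "\<rho> \<cdot> g = 0" using rI(3) s4 by (intro vanish[OF n40 dd G8 _ no(1) g(1,2) rI(1)]) simp_all
      thus False using g(3) X(3) by simp
    qed
  qed
qed

lemma degree_types_cases:
  assumes n40: "CARD('i) = 40"
  shows "(card Lin = 4 \<or> card Lin = 8) \<and> (\<forall>f\<in>Irr. dg f \<in> {1,2,4}) \<or> card Lin = 20 \<and> (\<forall>f\<in>Irr. dg f \<in> {1,2}) \<or>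
    card Lin = 40 \<and> (\<forall>f\<in>Irr. dg f = 1)"
  using degree_types[OF n40] by (metis (full_types))

theorem central_involution_40:
  assumes n40: "CARD('i) = 40"
  shows "(\<exists>g. central_inv g) \<or> (\<exists>f. hopf_int.central_inv D e M u f)"
proof (rule ccontr)
  assume "\<not> ?thesis"
  hence no: "\<And>g. \<not> central_inv g" "\<And>f. \<not> hopf_int.central_inv D e M u f" by blast+
  note tL = degree_types_cases[OF n40] and tG = hopf_int.degree_types_cases[OF dual_int n40, folded Gm_Lin]
  have od: "\<forall>f\<in>Irr. dg f \<in> {1,2,4}" using tL by fastforce
  have dd: "\<forall>g\<in>dIrr. ddg g \<in> {1,2,4}" using tG by fastforce
  have L: "card Lin = 4 \<or> card Lin = 8 \<or> card Lin = 20 \<or> card Lin = 40" using tL by blast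
  have G: "card Gm = 4 \<or> card Gm = 8 \<or> card Gm = 20 \<or> card Gm = 40" using tG by blast
  have "card Lin \<noteq> 20"
  proof
    assume c: "card Lin = 20"
    hence "\<forall>f\<in>Irr. dg f \<in> {1,2}" using tL by auto
    thus False using central_20[OF n40 dd c] no by blast
  qed
  moreover have "card Lin \<noteq> 40"
  proof
    assume c: "card Lin = 40"
    hence "\<forall>f\<in>Irr. dg f = 1" using tL by auto
    moreover have "even (card Gm)" using G by auto
    ultimately show False using central_40[OF n40 dd] no by blast
  qed
  moreover have "card Gm \<noteq> 20"
  proof
    assume c: "card Gm = 20"
    hence "\<forall>f\<in>dIrr. ddg f \<in> {1,2}" using tG by auto
    thus False using hopf_int.central_20[OF dual_int n40 od] c no unfolding Gm_Lin by blast
  qed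
  moreover have "card Gm \<noteq> 40"
  proof
    assume c: "card Gm = 40"
    hence "\<forall>f\<in>dIrr. ddg f = 1" using tG by auto
    moreover have "even (card Lin)" using L by auto
    ultimately show False using hopf_int.central_40[OF dual_int n40 od] no unfolding dual_Gm by blast
  qed
  ultimately have LG: "card Lin = 4 \<or> card Lin = 8" "card Gm = 4 \<or> card Gm = 8" using L G by blast+
  have "card Gm \<noteq> 4" using card_Gm_not_4[OF n40 dd od LG(1) _ no] by blast
  hence g8: "card Gm = 8" using LG by blast
  show False
  proof (cases "card Lin = 8")
    case True thus False using orders_not_8_8[OF n40 dd od _ g8 no(1)] by blast
  next
    case False
    hence l4: "card Lin = 4" using LG by blast
    show False
      by (rule hopf_int.card_Gm_not_4[OF dual_int n40 od dd]) (use no l4 g8 in \<open>simp_all add: dual_Gm Gm_Lin\<close>)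
  qed
qed

end

section \<open>Normal Hopf subalgebras from central involutions\<close>

context hopf_int
begin

context
  fixes f assumes f: "hopf_int.central_inv D e M u f"
begin

lemma f_grp: "f \<cdot> u = 1" "f \<cdot> (x \<odot> y) = f \<cdot> x * f \<cdot> y"
  and f_ne: "f \<noteq> e" and f_inv: "f \<star> f = e" and f_central: "f \<star> y = y \<star> f"
proof -
  note f' = f[unfolded hopf_int.central_inv_def[OF dual_int] fin_hopf.grp_def[OF dual]]
  show "f \<cdot> u = 1" unfolding pr_comm[of f] using f' by blast
  show "f \<cdot> (x \<odot> y) = f \<cdot> x * f \<cdot> y" unfolding pr_comm[of f] using f' by blast
  show "f \<noteq> e" "f \<star> f = e" "f \<star> y = y \<star> f" using f' by blast+
qed

text \<open>The transpose of multiplication by \<open>f\<close> in the dual; in Sweedler notation, x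
  is sent to x_1 f(x_2).\<close>

definition tw where "tw x = (\<chi> j. (axis j 1 \<star> f) \<cdot> x)"

lemma pr_tw: "y \<cdot> tw x = (y \<star> f) \<cdot> x"
  by (rule lin_eqI[of "\<lambda>y. y \<cdot> tw x" "\<lambda>y. (y \<star> f) \<cdot> x", rotated 2]) (simp add: tw_def, (intro lin_intros)+)

lemma linv_tw: "linv tw"
  by (auto simp: linv_def tw_def vec_eq_iff pr_add pr_scale)

lemma tw_tw: "tw (tw x) = x"
  by (rule pr_eqI) (simp add: pr_tw cmul_assoc f_inv)

lemma tw_u: "tw u = u"
  by (rule pr_eqI) (simp add: pr_tw f_grp)

text \<open>In a product of two functionals the central factor \<open>f\<close> may be joined to
  either one. Dually, the twist may be put on either leg of the coproduct.\<close>

lemma sw_tw: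
  assumes F: "bil F"
  shows "sw F (tw x) = sw (\<lambda>p q. F p (tw q)) x" "sw F (tw x) = sw (\<lambda>p q. F (tw p) q) x"
proof -
  have 2: "F a b = (\<Sum>i\<in>UNIV. \<Sum>j\<in>UNIV. axis i 1 \<cdot> a * axis j 1 \<cdot> b * F (axis i 1) (axis j 1))" for a b
    using bil_basis[OF F, of a b] by simp
  have 3: "sw F (tw x) = (\<Sum>i\<in>UNIV. \<Sum>j\<in>UNIV. (axis i 1 \<star> axis j 1) \<cdot> tw x * F (axis i 1) (axis j 1))"
    by (subst cop_cong[OF 2]) (simp add: cop_sum cop_cmult pr_bm del: pr_axis)
  have "(axis i 1 \<star> axis j 1) \<cdot> tw x = sw (\<lambda>p q. axis i 1 \<cdot> p * axis j 1 \<cdot> tw q) x" for i j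
    by (simp only: pr_tw cmul_assoc pr_bm[symmetric])
  thus "sw F (tw x) = sw (\<lambda>p q. F p (tw q)) x"
    unfolding 3 by (subst 2[of _ "tw _"]) (simp add: cop_sum cop_cmult del: pr_axis)
  have "(axis i 1 \<star> axis j 1) \<cdot> tw x = sw (\<lambda>p q. axis i 1 \<cdot> tw p * axis j 1 \<cdot> q) x" for i j
  proof -
    have "axis i 1 \<star> axis j 1 \<star> f = axis i 1 \<star> f \<star> axis j 1" by (simp only: cmul_assoc f_central[of "axis j 1"])
    thus ?thesis by (simp only: pr_tw pr_bm[symmetric])
  qed
  thus "sw F (tw x) = sw (\<lambda>p q. F (tw p) q) x"
    unfolding 3 by (subst 2[of "tw _"]) (simp add: cop_sum cop_cmult del: pr_axis)
qed

lemma tw_mul: "tw (x \<odot> y) = tw x \<odot> tw y"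
proof (rule pr_eqI)
  fix g
  have fs: "sw (\<lambda>a b. g \<cdot> a * f \<cdot> b) y' = g \<cdot> tw y'" for g y' by (simp only: pr_tw pr_bm)
  have "g \<cdot> tw (x \<odot> y) = sw (\<lambda>a b. g \<cdot> a * f \<cdot> b) (x \<odot> y)" by (simp only: pr_tw pr_bm)
  also have "\<dots> = sw (\<lambda>a b. sw (\<lambda>c d. g \<cdot> (a \<odot> c) * (f \<cdot> b * f \<cdot> d)) y) x"
    by (subst sw_mul) (intro bilI lin_intros, simp add: f_grp)
  also have "\<dots> = sw (\<lambda>a b. g \<cdot> (a \<odot> tw y) * f \<cdot> b) x"
  proof (rule cop_cong)
    fix a b
    have h: "vof (\<lambda>c. g \<cdot> (a \<odot> c)) \<cdot> c = g \<cdot> (a \<odot> c)" for c by (rule vof_pr) (intro lin_intros)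
    have "sw (\<lambda>c d. g \<cdot> (a \<odot> c) * (f \<cdot> b * f \<cdot> d)) y = f \<cdot> b * sw (\<lambda>c d. g \<cdot> (a \<odot> c) * f \<cdot> d) y"
      by (subst cop_cmult(1)[symmetric]) (simp add: mult_ac)
    also have "sw (\<lambda>c d. g \<cdot> (a \<odot> c) * f \<cdot> d) y = g \<cdot> (a \<odot> tw y)" using fs[of "vof (\<lambda>c. g \<cdot> (a \<odot> c))" y] by (simp add: h)
    finally show "sw (\<lambda>c d. g \<cdot> (a \<odot> c) * (f \<cdot> b * f \<cdot> d)) y = g \<cdot> (a \<odot> tw y) * f \<cdot> b" by simp
  qed
  also have "\<dots> = g \<cdot> (tw x \<odot> tw y)"
  proof -
    have h: "vof (\<lambda>c. g \<cdot> (c \<odot> tw y)) \<cdot> c = g \<cdot> (c \<odot> tw y)" for c by (rule vof_pr) (intro lin_intros)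
    show ?thesis using fs[of "vof (\<lambda>c. g \<cdot> (c \<odot> tw y))" x] by (simp add: h)
  qed
  finally show "g \<cdot> tw (x \<odot> y) = g \<cdot> (tw x \<odot> tw y)" .
qed

lemma star_f: "star f = f"
proof -
  have "star f \<star> f = e" "f \<star> star f = e" using f hopf_int.central_inv_def[OF dual_int] fin_hopf.grp_inv[OF dual] by blast+
  hence "star f \<star> (f \<star> f) = f" by (simp add: cmul_assoc[symmetric])
  thus ?thesis by (simp add: f_inv)
qed

lemma tw_ant: "tw (ant S x) = ant S (tw x)"
proof (rule pr_eqI)
  fix y
  show "y \<cdot> tw (ant S x) = y \<cdot> ant S (tw x)"
    by (simp only: pr_tw pr_ant star_mul star_f f_central[of "star y"])
qed

definition prj where "prj x = (1/2) *s (x + tw x)"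

lemma linv_prj: "linv prj"
  unfolding prj_def by (intro lin_intros linv_tw)

lemma tw_prj: "tw (prj x) = prj x"
  unfolding prj_def by (simp add: linvD[OF linv_tw] tw_tw add.commute)

text \<open>For a fixed element, a twist on either leg changes nothing, so both legs may be
  averaged. This places the coproduct in the tensor square of the fixed points.\<close>

lemma sw_prj:
  assumes F: "bil F" and a: "tw a = a" shows "sw (\<lambda>p q. F (prj p) (prj q)) a = sw F a"
proof -
  have F': "bil (\<lambda>p q. F (prj p) q)" by (intro bilI bil1[OF F] bil2[OF F] linv_prj linv_id)
  have half: "sw (\<lambda>p q. F p (prj q)) a = sw F a" if F: "bil F" for F
  proof -
    have "F p (prj q) = (1/2) * (F p q + F p (tw q))" for p q
      using F linD(1)[of "F p" q "tw q"] linD(2)[of "F p" "1/2" "q + tw q"] by (simp add: bil_def prj_def)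
    hence "sw (\<lambda>p q. F p (prj q)) a = (1/2) * (sw F a + sw (\<lambda>p q. F p (tw q)) a)"
      by (simp only: cop_cmult cop_plus)
    also have "sw (\<lambda>p q. F p (tw q)) a = sw F a" using sw_tw(1)[OF F, of a] a by simp
    finally show ?thesis by simp
  qed
  have "F (prj p) q = (1/2) * (F p q + F (tw p) q)" for p q
    using F linD(1)[of "\<lambda>p. F p q" p "tw p"] linD(2)[of "\<lambda>p. F p q" "1/2" "p + tw p"] by (simp add: bil_def prj_def)
  hence "sw (\<lambda>p q. F (prj p) q) a = (1/2) * (sw F a + sw (\<lambda>p q. F (tw p) q) a)"
    by (simp only: cop_cmult cop_plus)
  also have "sw (\<lambda>p q. F (tw p) q) a = sw F a" using sw_tw(2)[OF F, of a] a by simp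
  finally show ?thesis using half[OF F'] by simp
qed

text \<open>The twist respects products and the antipode, so it acts on p and on q simultaneously.
  \<open>sw_tw\<close> gathers both twists on one leg, where they cancel.\<close>

lemma sw_adjoint:
  assumes a: "tw a = a"
  shows "sw (\<lambda>p q. y \<cdot> tw (p \<odot> a \<odot> ant S q)) h = sw (\<lambda>p q. y \<cdot> (p \<odot> a \<odot> ant S q)) h"
proof -
  let ?F = "\<lambda>p q. y \<cdot> (p \<odot> a \<odot> ant S (tw q))"
  have F: "bil ?F" by (intro bilI lin_intros linv_tw)
  have "sw (\<lambda>p q. y \<cdot> tw (p \<odot> a \<odot> ant S q)) h = sw (\<lambda>p q. ?F (tw p) q) h"
    by (simp add: tw_mul a tw_ant)
  also have "\<dots> = sw (\<lambda>p q. ?F p (tw q)) h" by (simp only: sw_tw[OF F, symmetric])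
  finally show ?thesis by (simp add: tw_tw)
qed

text \<open>The trace is the regular character of the dual at \<open>f\<close>, which vanishes
  because \<open>f\<close> is a grouplike element different from the unit \<open>e\<close>.\<close>

lemma trc_tw: "trc tw = 0"
proof -
  interpret d: hopf_int D e M u S' "(1 / of_nat CARD('i)) *s lv" by (rule dual_int)
  have "trc tw = d.lam f" unfolding d.lam_right trc_def by (simp add: tw_def)
  moreover have "d.lam f = 0"
  proof (rule ccontr)
    assume nz: "d.lam f \<noteq> 0"
    have "f = e"
    proof (rule pr_eqI')
      fix x
      have "(d.lv \<odot> x) \<cdot> f = ((x \<cdot> e) *s d.lv) \<cdot> f" by (simp only: d.lam_integral)
      hence "d.lam f * f \<cdot> x = x \<cdot> e * d.lam f"
        by (simp add: pr_comm[of _ f] f_grp pr_scale d.lv) (simp add: pr_comm[of f] d.lv)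
      thus "f \<cdot> x = e \<cdot> x" using nz by (simp add: pr_comm[of x])
    qed
    thus False using f_ne by simp
  qed
  ultimately show ?thesis by simp
qed

text \<open>The trace of \<open>prj\<close> is half the dimension, since \<open>tw\<close> has trace
  zero. If all fixed points were multiples of the unit, that trace would be 1.\<close>

lemma tw_proper: assumes "CARD('i) > 2" shows "\<exists>x. tw x \<noteq> x" "\<exists>a. tw a = a \<and> (\<forall>c. a \<noteq> c *s u)"
proof -
  show "\<exists>x. tw x \<noteq> x"
  proof (rule ccontr)
    assume "\<not> ?thesis"
    hence "trc tw = of_nat CARD('i)" by (simp add: trc_def)
    thus False using trc_tw by simp
  qed
  show "\<exists>a. tw a = a \<and> (\<forall>c. a \<noteq> c *s u)"
  proof (rule ccontr)
    assume no: "\<not> ?thesis"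
    hence "\<exists>c. prj x = c *s u" for x using tw_prj by blast
    then obtain c where c: "\<And>x. prj x = c x *s u" by metis
    have ec: "c x = e \<cdot> prj x" for x using c[of x] by (simp add: pr_scale counit_unit)
    have "trc prj = (1/2) * (of_nat CARD('i) + trc tw)"
      by (simp add: trc_def prj_def sum.distrib sum_distrib_left[symmetric] sum_divide_distrib[symmetric])
    moreover have "trc prj = (\<Sum>i\<in>UNIV. u $ i * c (axis i 1))" by (simp add: trc_def c mult.commute)
    moreover have "(\<Sum>i\<in>UNIV. u $ i * c (axis i 1)) = c u"
      by (rule lin_basis[symmetric]) (unfold ec, intro lin_intros linv_prj)
    moreover have "prj u = u"
    proof -
      have "u + u = (2::'k) *s u" by (metis one_add_one vec.scale_left_distrib vec.scale_one)
      thus ?thesis by (simp add: prj_def tw_u)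
    qed
    hence "c u = 1" by (simp add: ec counit_unit)
    ultimately have "(of_nat CARD('i) :: 'k) = of_nat 2" by (simp add: trc_tw)
    hence "CARD('i) = 2" by (simp only: of_nat_eq_iff)
    thus False using assms by simp
  qed
qed

end

end

section \<open>Tensors in coordinates\<close>

text \<open>A function on generators is extended to formal sums; when it is multilinear, the value
  depends only on the tensor that the sum represents.\<close>

definition eval_tensor :: "('x \<Rightarrow>\<^sub>0 'k::field) \<Rightarrow> ('x \<Rightarrow> 'k) \<Rightarrow> 'k" where
  "eval_tensor x F = (\<Sum>p\<in>Poly_Mapping.keys x. Poly_Mapping.lookup x p * F p)"

lemma eval_tensor_superset:
  assumes "finite K" "Poly_Mapping.keys x \<subseteq> K" shows "eval_tensor x F = (\<Sum>p\<in>K. Poly_Mapping.lookup x p * F p)"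
  unfolding eval_tensor_def by (rule sum.mono_neutral_left) (use assms in \<open>auto simp: in_keys_iff\<close>)

lemma eval_tensor_add: "eval_tensor (x + y) F = eval_tensor x F + eval_tensor y F"
proof -
  let ?K = "Poly_Mapping.keys x \<union> Poly_Mapping.keys y"
  have "Poly_Mapping.keys (x + y) \<subseteq> ?K" by (rule keys_add)
  thus ?thesis
    by (simp add: eval_tensor_superset[of ?K] lookup_add sum.distrib distrib_right)
qed

lemma eval_tensor_free_scale: "eval_tensor (free_scale c x) F = c * eval_tensor x F"
proof -
  have "Poly_Mapping.keys (free_scale c x) \<subseteq> Poly_Mapping.keys x" by (auto simp: in_keys_iff)
  thus ?thesis by (simp add: eval_tensor_superset[of "Poly_Mapping.keys x"] sum_distrib_left mult.assoc)
qed

lemma eval_tensor_gen [simp]: "eval_tensor (gen p) F = F p"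
  by (simp add: eval_tensor_def gen_def)

lemma eval_tensor_0 [simp]: "eval_tensor 0 F = 0" by (simp add: eval_tensor_def)

lemma eval_tensor_diff: "eval_tensor (x - y) F = eval_tensor x F - eval_tensor y F"
  using eval_tensor_add[of "x - y" y F] by simp

lemma eval_tensor_sum: "eval_tensor (\<Sum>a\<in>A. x a) F = (\<Sum>a\<in>A. eval_tensor (x a) F)"
  by (induction A rule: infinite_finite_induct) (simp_all add: eval_tensor_add)

lemma eval_tensor_fsum: "eval_tensor x (\<lambda>p. \<Sum>i\<in>I. G i p) = (\<Sum>i\<in>I. eval_tensor x (G i))"
  unfolding eval_tensor_def sum_distrib_left by (rule sum.swap)

lemma eval_tensor_fmult: "eval_tensor x (\<lambda>p. G p * c) = eval_tensor x G * c" "eval_tensor x (\<lambda>p. c * G p) = c * eval_tensor x G"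
  by (simp_all add: eval_tensor_def sum_distrib_left sum_distrib_right mult_ac)

lemma eval_tensor_lin_ext: "eval_tensor (lin_ext free_scale G x) F = eval_tensor x (\<lambda>p. eval_tensor (G p) F)"
  by (simp add: lin_ext_def eval_tensor_sum eval_tensor_free_scale eval_tensor_def[of x])

interpretation fs: vector_space "free_scale :: 'k::field \<Rightarrow> ('x \<Rightarrow>\<^sub>0 'k) \<Rightarrow> ('x \<Rightarrow>\<^sub>0 'k)"
  by (rule vector_space_free_scale)

lemma eval_tensor_span:
  assumes "x \<in> fs.span A" "\<And>a. a \<in> A \<Longrightarrow> eval_tensor a F = 0" shows "eval_tensor x F = 0"
proof -
  have "fs.subspace {x. eval_tensor x F = 0}" by (auto simp: fs.subspace_def eval_tensor_add eval_tensor_free_scale)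
  thus ?thesis using fs.span_induct[OF assms(1), of "\<lambda>x. eval_tensor x F = 0"] assms(2) by blast
qed

lemma tensor2_rel_subspace:
  "0 \<in> tensor2_rel s" "x \<in> tensor2_rel s \<Longrightarrow> y \<in> tensor2_rel s \<Longrightarrow> x + y \<in> tensor2_rel s"
  "x \<in> tensor2_rel s \<Longrightarrow> y \<in> tensor2_rel s \<Longrightarrow> x - y \<in> tensor2_rel s"
  "x \<in> tensor2_rel s \<Longrightarrow> free_scale c x \<in> tensor2_rel s"
  unfolding tensor2_rel_def by (rule fs.span_zero fs.span_add fs.span_diff fs.span_scale; assumption?)+

lemma free_expand: "x = (\<Sum>p\<in>Poly_Mapping.keys x. free_scale (Poly_Mapping.lookup x p) (gen p))"
proof (rule poly_mapping_eqI)
  fix q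
  have "(\<Sum>p\<in>Poly_Mapping.keys x. Poly_Mapping.lookup x p * (1 when p = q)) = (\<Sum>p\<in>Poly_Mapping.keys x. if p = q then Poly_Mapping.lookup x q else 0)"
    by (intro sum.cong refl) simp
  thus "Poly_Mapping.lookup x q = Poly_Mapping.lookup (\<Sum>p\<in>Poly_Mapping.keys x. free_scale (Poly_Mapping.lookup x p) (gen p)) q"
    by (simp add: lookup_sum gen_def lookup_single in_keys_iff)
qed

section \<open>Coordinates of a Hopf algebra\<close>

locale hopf_coord = hopf_algebra scale comul counit antipode
  for scale :: "'k::{alg_closed_field,field_char_0} \<Rightarrow> 'h::ring_1 \<Rightarrow> 'h" and comul counit antipode +
  fixes cf :: "'h \<Rightarrow> 'k ^ 'i::finite" and vf :: "'k ^ 'i \<Rightarrow> 'h"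
  assumes cf_add: "cf (x + y) = cf x + cf y" and cf_scale: "cf (scale c x) = c *s cf x"
    and vf_cf [simp]: "vf (cf x) = x" and cf_vf [simp]: "cf (vf z) = z"
begin

lemma cf_inj: "cf x = cf y \<Longrightarrow> x = y" by (metis vf_cf)

lemma cf_0 [simp]: "cf 0 = 0" using cf_add[of 0 0] by simp

lemma cf_sum: "cf (\<Sum>a\<in>A. x a) = (\<Sum>a\<in>A. cf (x a))"
  by (induction A rule: infinite_finite_induct) (simp_all add: cf_add)

lemma vf_add: "vf (x + y) = vf x + vf y" by (rule cf_inj) (simp add: cf_add)
lemma vf_scale: "vf (c *s x) = scale c (vf x)" by (rule cf_inj) (simp add: cf_scale)
lemma vf_sum: "vf (\<Sum>a\<in>A. x a) = (\<Sum>a\<in>A. vf (x a))" by (rule cf_inj) (simp add: cf_sum)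

definition b where "b i = vf (axis i 1)"

lemma cf_b [simp]: "cf (b i) = axis i 1" by (simp add: b_def)

lemma expand: "x = (\<Sum>i\<in>UNIV. scale (cf x $ i) (b i))"
proof -
  have "vf (\<Sum>i\<in>UNIV. cf x $ i *s axis i 1) = (\<Sum>i\<in>UNIV. scale (cf x $ i) (b i))" by (simp add: vf_sum vf_scale b_def)
  thus ?thesis by (simp add: basis_expansion)
qed

lemma eval_tensor_rel2:
  assumes "x \<in> tensor2_rel scale" "bil F" shows "eval_tensor x (\<lambda>(p, q). F (cf p) (cf q)) = 0"
  using assms(1) unfolding tensor2_rel_def
proof (rule eval_tensor_span)
  fix a assume "a \<in> {gen (a + a', b) - (gen (a, b) + gen (a', b)) | a a' b. True} \<union>
      {gen (a, b + b') - (gen (a, b) + gen (a, b')) | a b b'. True} \<union>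
      {gen (scale c a, b) - free_scale c (gen (a, b)) | c a b. True} \<union>
      {gen (a, scale c b) - free_scale c (gen (a, b)) | c a b. True}"
  thus "eval_tensor a (\<lambda>(p, q). F (cf p) (cf q)) = 0"
    using assms(2) by (elim UnE; auto simp: eval_tensor_diff eval_tensor_add eval_tensor_free_scale cf_add cf_scale bil_def lin_def)
qed

lemma comul_class: assumes "x \<in> comul h" "y \<in> comul h" shows "y - x \<in> tensor2_rel scale"
proof -
  obtain z where z: "comul h = {y. y - z \<in> tensor2_rel scale}"
    using comul_tensor2[of h] by (auto simp: tensor2_def tensor2_class_def)
  have "(y - z) - (x - z) \<in> tensor2_rel scale"
    by (rule tensor2_rel_subspace(3)) (use assms z in blast)+
  thus ?thesis by simp
qed

lemma comul_class2: assumes "x \<in> comul h" "y - x \<in> tensor2_rel scale" shows "y \<in> comul h"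
proof -
  obtain z where z: "comul h = {y. y - z \<in> tensor2_rel scale}"
    using comul_tensor2[of h] by (auto simp: tensor2_def tensor2_class_def)
  have "(y - x) + (x - z) \<in> tensor2_rel scale"
    by (rule tensor2_rel_subspace(2)) (use assms z in blast)+
  thus ?thesis by (simp add: z)
qed

definition rep where "rep h = (SOME x. x \<in> comul h)"

lemma rep: "rep h \<in> comul h"
proof -
  obtain z where z: "comul h = {y. y - z \<in> tensor2_rel scale}"
    using comul_tensor2[of h] by (auto simp: tensor2_def tensor2_class_def)
  hence "z \<in> comul h" by (simp add: tensor2_rel_subspace(1))
  thus ?thesis unfolding rep_def by (rule someI)
qed

definition M where "M i j l = cf (b i * b j) $ l"
definition D where "D i j l = eval_tensor (rep (b l)) (\<lambda>(p, q). cf p $ i * cf q $ j)"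
definition S where "S i j = cf (antipode (b i)) $ j"
definition e :: "'k ^ 'i" where "e = (\<chi> i. counit (b i))"
definition u where "u = cf 1"

lemma lin_component: "lin (\<lambda>x. x $ i)" by (simp add: lin_def)

text \<open>Evaluation on a representative of the coproduct is independent of the representative,
  hence linear in \<open>h\<close>, and it agrees with the coordinate Sweedler sum on the basis. The
  axioms on the coproduct are translated through this equation.\<close>

lemma eval_tensor_comul:
  assumes x: "x \<in> comul h" and F: "bil F" shows "eval_tensor x (\<lambda>(p, q). F (cf p) (cf q)) = cop D F (cf h)"
proof -
  let ?F = "\<lambda>(p, q). F (cf p) (cf q)"
  have wd: "eval_tensor y ?F = eval_tensor z ?F" if "y \<in> comul h" "z \<in> comul h" for y z h
    using eval_tensor_rel2[OF comul_class[OF that(2,1)] F] by (simp add: eval_tensor_diff)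
  define E where "E v = eval_tensor (rep (vf v)) ?F" for v
  have "lin E" unfolding lin_def
  proof (intro conjI allI)
    fix v w c
    show "E (v + w) = E v + E w" unfolding E_def eval_tensor_add[symmetric]
      by (rule wd[OF rep]) (simp add: vf_add comul_add rep)
    show "E (c *s v) = c * E v" unfolding E_def eval_tensor_free_scale[symmetric]
      by (rule wd[OF rep]) (simp add: vf_scale comul_scale rep)
  qed
  moreover have "E (axis l 1) = cop D F (axis l 1)" for l
  proof -
    have "eval_tensor x ?F = (\<Sum>i\<in>UNIV. \<Sum>j\<in>UNIV. eval_tensor x (\<lambda>(p, q). cf p $ i * cf q $ j) * F (axis i 1) (axis j 1))" for x
    proof -
      have "?F = (\<lambda>pq. \<Sum>i\<in>UNIV. \<Sum>j\<in>UNIV. (case pq of (p, q) \<Rightarrow> cf p $ i * cf q $ j) * F (axis i 1) (axis j 1))"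
        by (rule ext) (simp add: case_prod_unfold bil_basis[OF F, of "cf _"])
      thus ?thesis by (simp only: eval_tensor_fsum eval_tensor_fmult)
    qed
    thus ?thesis by (simp add: E_def cop_axis D_def b_def[symmetric])
  qed
  ultimately have "E (cf h) = cop D F (cf h)" by (rule lin_eqI[OF _ lin_cop])
  thus ?thesis using wd[OF x rep] by (simp add: E_def)
qed

lemma pr_lin_ext: "y \<cdot> cf (lin_ext scale G x) = eval_tensor x (\<lambda>p. y \<cdot> cf (G p))"
  by (simp add: lin_ext_def cf_sum cf_scale pr_sum pr_scale eval_tensor_def)

lemma component_lin_ext: "cf (lin_ext scale G x) $ i = eval_tensor x (\<lambda>p. cf (G p) $ i)"
  using pr_lin_ext[of "axis i 1"] by simp

lemma mul_expand: "bm M (cf x) (cf y) = cf (x * y)"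
proof -
  have "cf (x * y) $ l = bm M (cf x) (cf y) $ l" for l
  proof -
    have "bil (\<lambda>v w. cf (vf v * vf w) $ l)"
      by (auto simp: bil_def lin_def vf_add vf_scale cf_add cf_scale scale_mult_left scale_mult_right algebra_simps)
    from bil_basis[OF this, of "cf x" "cf y"] show ?thesis by (simp add: bm_def M_def b_def[symmetric])
  qed
  thus ?thesis by (simp add: vec_eq_iff)
qed

lemma linear_counit': "counit (x + y) = counit x + counit y" "counit (scale c x) = c * counit x"
  using linear_counit unfolding Vector_Spaces.linear_iff by auto

lemma linear_antipode': "antipode (x + y) = antipode x + antipode y" "antipode (scale c x) = scale c (antipode x)"
  using linear_antipode unfolding Vector_Spaces.linear_iff by auto

lemma counit_cf: "e \<cdot> cf x = counit x"
proof -
  have "lin (\<lambda>v. counit (vf v))" by (simp add: lin_def vf_add vf_scale linear_counit')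
  from lin_basis[OF this, of "cf x"] show ?thesis by (simp add: pr_def e_def b_def mult.commute)
qed

lemma ant_cf: "ant S (cf x) = cf (antipode x)"
proof -
  have 1: "linv (\<lambda>v. cf (antipode (vf v)))" by (simp add: linv_def vf_add vf_scale cf_add cf_scale linear_antipode')
  have 2: "ant S (axis i 1) = cf (antipode (vf (axis i 1)))" for i by (simp add: vec_eq_iff ant_axis S_def b_def)
  show ?thesis using linv_eqI[OF linv_ant 1 2, of "cf x"] by simp
qed

lemma fin_alg_M: "fin_alg M u"
proof (unfold_locales)
  fix i j k l
  have "(\<Sum>p\<in>UNIV. M i j p * M p k l) = bm M (cf (b i * b j)) (cf (b k)) $ l" by (simp add: bm_axis_right M_def)
  also have "\<dots> = bm M (cf (b i)) (cf (b j * b k)) $ l" by (simp only: mul_expand mult.assoc)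
  also have "\<dots> = (\<Sum>p\<in>UNIV. M j k p * M i p l)" by (simp add: bm_axis_left M_def)
  finally show "(\<Sum>p\<in>UNIV. M i j p * M p k l) = (\<Sum>p\<in>UNIV. M j k p * M i p l)" .
next
  fix j l
  have "(\<Sum>i\<in>UNIV. u $ i * M i j l) = bm M u (cf (b j)) $ l" by (simp add: bm_axis_right)
  also have "\<dots> = cf (b j) $ l" by (simp only: u_def mul_expand mult_1)
  finally show "(\<Sum>i\<in>UNIV. u $ i * M i j l) = (if j = l then 1 else 0)" by (simp add: axis_def eq_commute)
next
  fix i l
  have "(\<Sum>j\<in>UNIV. u $ j * M i j l) = bm M (cf (b i)) u $ l" by (simp add: bm_axis_left)
  also have "\<dots> = cf (b i) $ l" by (simp only: u_def mul_expand mult_1_right)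
  finally show "(\<Sum>j\<in>UNIV. u $ j * M i j l) = (if i = l then 1 else 0)" by (simp add: axis_def eq_commute)
qed

lemma eval_tensor_rel3:
  assumes "x \<in> tensor3_rel scale" shows "eval_tensor x (\<lambda>(p, q, r). cf p $ i * cf q $ j * cf r $ k) = 0"
  using assms(1) unfolding tensor3_rel_def
proof (rule eval_tensor_span)
  fix a assume "a \<in> {gen (a + a', b, d) - (gen (a, b, d) + gen (a', b, d)) | a a' b d. True} \<union>
      {gen (a, b + b', d) - (gen (a, b, d) + gen (a, b', d)) | a b b' d. True} \<union>
      {gen (a, b, d + d') - (gen (a, b, d) + gen (a, b, d')) | a b d d'. True} \<union>
      {gen (scale c a, b, d) - free_scale c (gen (a, b, d)) | c a b d. True} \<union>
      {gen (a, scale c b, d) - free_scale c (gen (a, b, d)) | c a b d. True} \<union>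
      {gen (a, b, scale c d) - free_scale c (gen (a, b, d)) | c a b d. True}"
  thus "eval_tensor a (\<lambda>(p, q, r). cf p $ i * cf q $ j * cf r $ k) = 0"
    by (elim UnE; auto simp: eval_tensor_diff eval_tensor_add eval_tensor_free_scale cf_add cf_scale distrib_left distrib_right mult.left_commute mult.assoc)
qed

lemma bil_component: "bil (\<lambda>x y. x $ i * y $ j)"
  by (auto simp: bil_def lin_def algebra_simps)

lemma fin_alg_D: "fin_alg D e"
proof (unfold_locales)
  fix i j k l
  let ?T = "\<lambda>(p, q, r). cf p $ i * cf q $ j * cf r $ k"
  have "eval_tensor (map_left rep (rep (b l))) ?T = eval_tensor (map_right rep (rep (b l))) ?T"
    using eval_tensor_rel3[OF coassoc[OF rep[of "b l"], of rep]] rep by (simp add: eval_tensor_diff)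
  moreover have "eval_tensor (map_left rep (rep (b l))) ?T = (\<Sum>p\<in>UNIV. D i j p * D p k l)"
  proof -
    have "eval_tensor (map_left rep (rep (b l))) ?T = eval_tensor (rep (b l)) (\<lambda>(a, c). eval_tensor (rep a) (\<lambda>(p, q). cf p $ i * cf q $ j * cf c $ k))"
      by (simp add: map_left_def eval_tensor_lin_ext case_prod_unfold)
    also have "\<dots> = eval_tensor (rep (b l)) (\<lambda>(a, c). cop D (\<lambda>x y. x $ i * y $ j) (cf a) * cf c $ k)"
    proof -
      have "eval_tensor (rep a) (\<lambda>(p, q). cf p $ i * cf q $ j * cf c $ k) = cop D (\<lambda>x y. x $ i * y $ j) (cf a) * cf c $ k" for a c
        using eval_tensor_comul[OF rep bil_component, of a i j] eval_tensor_fmult(1)[of "rep a" "\<lambda>(p, q). cf p $ i * cf q $ j" "cf c $ k"]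
        by (simp add: case_prod_unfold)
      thus ?thesis by simp
    qed
    also have "\<dots> = cop D (\<lambda>x y. cop D (\<lambda>x y. x $ i * y $ j) x * y $ k) (cf (b l))"
      by (rule eval_tensor_comul[OF rep]) (intro bil_prod lin_cop lin_component)
    also have "\<dots> = (\<Sum>p\<in>UNIV. D i j p * D p k l)"
      by (simp add: cop_axis) (simp add: axis_def delta_mult mult.commute cong: if_cong)
    finally show ?thesis .
  qed
  moreover have "eval_tensor (map_right rep (rep (b l))) ?T = (\<Sum>p\<in>UNIV. D j k p * D i p l)"
  proof -
    have "eval_tensor (map_right rep (rep (b l))) ?T = eval_tensor (rep (b l)) (\<lambda>(a, c). eval_tensor (rep c) (\<lambda>(p, q). cf a $ i * cf p $ j * cf q $ k))"
      by (simp add: map_right_def eval_tensor_lin_ext case_prod_unfold)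
    also have "\<dots> = eval_tensor (rep (b l)) (\<lambda>(a, c). cf a $ i * cop D (\<lambda>x y. x $ j * y $ k) (cf c))"
    proof -
      have "eval_tensor (rep c) (\<lambda>(p, q). cf a $ i * cf p $ j * cf q $ k) = cf a $ i * cop D (\<lambda>x y. x $ j * y $ k) (cf c)" for a c
        using eval_tensor_comul[OF rep bil_component, of c j k] eval_tensor_fmult(2)[of "rep c" "cf a $ i" "\<lambda>(p, q). cf p $ j * cf q $ k"]
        by (simp add: case_prod_unfold mult.assoc)
      thus ?thesis by simp
    qed
    also have "\<dots> = cop D (\<lambda>x y. x $ i * cop D (\<lambda>x y. x $ j * y $ k) y) (cf (b l))"
      by (rule eval_tensor_comul[OF rep]) (intro bil_prod lin_cop lin_component)
    also have "\<dots> = (\<Sum>p\<in>UNIV. D j k p * D i p l)"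
      by (simp add: cop_axis) (simp add: axis_def delta_mult mult.commute cong: if_cong, subst sum.swap, simp)
    finally show ?thesis .
  qed
  ultimately show "(\<Sum>p\<in>UNIV. D i j p * D p k l) = (\<Sum>p\<in>UNIV. D j k p * D i p l)" by simp
next
  fix j l
  have "cf (lin_ext scale (\<lambda>(p, q). scale (counit p) q) (rep (b l))) $ j = cop D (\<lambda>x y. e \<cdot> x * y $ j) (cf (b l))"
    unfolding component_lin_ext
    by (subst eval_tensor_comul[OF rep, symmetric]) (intro bil_prod lin_pr lin_component, simp add: case_prod_unfold cf_scale counit_cf)
  hence "axis l 1 $ j = (\<Sum>i\<in>UNIV. e $ i * D i j l)"
    by (simp add: counit_left[OF rep] cop_axis) (simp add: axis_def delta_mult mult.commute cong: if_cong)
  thus "(\<Sum>i\<in>UNIV. e $ i * D i j l) = (if j = l then 1 else 0)" by (simp add: axis_def eq_commute)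
next
  fix i l
  have "cf (lin_ext scale (\<lambda>(p, q). scale (counit q) p) (rep (b l))) $ i = cop D (\<lambda>x y. x $ i * e \<cdot> y) (cf (b l))"
    unfolding component_lin_ext
    by (subst eval_tensor_comul[OF rep, symmetric]) (intro bil_prod lin_pr lin_component, simp add: case_prod_unfold cf_scale counit_cf mult.commute)
  hence "axis l 1 $ i = (\<Sum>j\<in>UNIV. e $ j * D i j l)"
    by (simp add: counit_right[OF rep] cop_axis) (simp add: axis_def delta_mult mult.commute cong: if_cong, subst sum.swap, simp)
  thus "(\<Sum>j\<in>UNIV. e $ j * D i j l) = (if i = l then 1 else 0)" by (simp add: axis_def eq_commute)
qed

sublocale fin_hopf M u D e S
proof (intro fin_hopf.intro fin_alg_M fin_hopf_axioms.intro fin_alg_D)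
  fix i j p q
  have "(\<Sum>l\<in>UNIV. M i j l * D p q l) = cop D (\<lambda>x y. x $ p * y $ q) (cf (b i * b j))"
    unfolding cop_def by (simp add: M_def axis_def delta_mult cong: if_cong)
  also have "\<dots> = eval_tensor (tensor2_mult (rep (b i)) (rep (b j))) (\<lambda>(x, y). cf x $ p * cf y $ q)"
    by (rule eval_tensor_comul[OF comul_mult[OF rep rep] bil_component, symmetric])
  also have "\<dots> = eval_tensor (rep (b i)) (\<lambda>(a, c). eval_tensor (rep (b j)) (\<lambda>(a', c'). bm M (cf a) (cf a') $ p * bm M (cf c) (cf c') $ q))"
    by (simp add: tensor2_mult_def eval_tensor_lin_ext case_prod_unfold mul_expand)
  also have "\<dots> = eval_tensor (rep (b i)) (\<lambda>(a, c). cop D (\<lambda>a' c'. bm M (cf a) a' $ p * bm M (cf c) c' $ q) (cf (b j)))"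
  proof -
    have "eval_tensor (rep (b j)) (\<lambda>(a', c'). bm M (cf a) (cf a') $ p * bm M (cf c) (cf c') $ q) =
       cop D (\<lambda>a' c'. bm M (cf a) a' $ p * bm M (cf c) c' $ q) (cf (b j))" for a c
      by (rule eval_tensor_comul[OF rep]) (intro bil_prod lin_comp[OF lin_component] linv_bm)
    thus ?thesis by (simp only:)
  qed
  also have "\<dots> = cop D (\<lambda>a c. cop D (\<lambda>a' c'. bm M a a' $ p * bm M c c' $ q) (cf (b j))) (cf (b i))"
    by (rule eval_tensor_comul[OF rep]) (intro bilI lin_intros lin_comp[OF lin_component])
  also have "\<dots> = (\<Sum>a\<in>UNIV. \<Sum>b\<in>UNIV. \<Sum>c\<in>UNIV. \<Sum>d\<in>UNIV. D a b i * D c d j * (M a c p * M b d q))"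
    by (simp add: cop_axis bm_axis sum_distrib_left mult.assoc)
  finally show "(\<Sum>l\<in>UNIV. M i j l * D p q l) = (\<Sum>a\<in>UNIV. \<Sum>b\<in>UNIV. \<Sum>c\<in>UNIV. \<Sum>d\<in>UNIV. D a b i * D c d j * (M a c p * M b d q))" .
next
  fix i j
  have "(\<Sum>l\<in>UNIV. M i j l * e $ l) = e \<cdot> cf (b i * b j)" by (simp add: pr_def M_def mult.commute)
  thus "(\<Sum>l\<in>UNIV. M i j l * e $ l) = e $ i * e $ j" by (simp only: counit_cf counit_mult) (simp add: e_def)
next
  fix p q
  have "(\<Sum>l\<in>UNIV. D p q l * u $ l) = cop D (\<lambda>x y. x $ p * y $ q) (cf 1)"
    unfolding cop_def by (simp add: u_def axis_def delta_mult mult.commute cong: if_cong)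
  also have "\<dots> = u $ p * u $ q" unfolding u_def by (subst eval_tensor_comul[OF comul_one bil_component, symmetric]) simp
  finally show "(\<Sum>l\<in>UNIV. D p q l * u $ l) = u $ p * u $ q" .
next
  show "e \<cdot> u = 1" by (simp add: u_def counit_cf counit_one)
next
  fix i l
  have "(\<Sum>p\<in>UNIV. \<Sum>q\<in>UNIV. \<Sum>r\<in>UNIV. D p q i * S p r * M r q l) = cop D (\<lambda>x y. bm M (ant S x) y $ l) (cf (b i))"
    by (simp add: cop_axis bm_axis_right ant_axis sum_distrib_left mult.assoc)
  also have "\<dots> = eval_tensor (rep (b i)) (\<lambda>(x, y). bm M (ant S (cf x)) (cf y) $ l)"
    by (rule eval_tensor_comul[OF rep, symmetric]) (intro bilI lin_intros lin_comp[OF lin_component])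
  also have "\<dots> = cf (lin_ext scale (\<lambda>(x, y). antipode x * y) (rep (b i))) $ l"
    by (simp add: component_lin_ext case_prod_unfold ant_cf mul_expand)
  also have "\<dots> = e $ i * u $ l" by (simp add: antipode_left[OF rep] cf_scale e_def u_def)
  finally show "(\<Sum>p\<in>UNIV. \<Sum>q\<in>UNIV. \<Sum>r\<in>UNIV. D p q i * S p r * M r q l) = e $ i * u $ l" .
next
  fix i l
  have "(\<Sum>p\<in>UNIV. \<Sum>q\<in>UNIV. \<Sum>r\<in>UNIV. D p q i * S q r * M p r l) = cop D (\<lambda>x y. bm M x (ant S y) $ l) (cf (b i))"
    by (simp add: cop_axis bm_axis_left ant_axis sum_distrib_left mult.assoc)
  also have "\<dots> = eval_tensor (rep (b i)) (\<lambda>(x, y). bm M (cf x) (ant S (cf y)) $ l)"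
    by (rule eval_tensor_comul[OF rep, symmetric]) (intro bilI lin_intros lin_comp[OF lin_component])
  also have "\<dots> = cf (lin_ext scale (\<lambda>(x, y). x * antipode y) (rep (b i))) $ l"
    by (simp add: component_lin_ext case_prod_unfold ant_cf mul_expand)
  also have "\<dots> = e $ i * u $ l" by (simp add: antipode_right[OF rep] cf_scale e_def u_def)
  finally show "(\<Sum>p\<in>UNIV. \<Sum>q\<in>UNIV. \<Sum>r\<in>UNIV. D p q i * S q r * M p r l) = e $ i * u $ l" .
qed

abbreviation hmul (infixl "\<odot>" 75) where "x \<odot> y \<equiv> bm M x y"
abbreviation hcmul (infixl "\<star>" 75) where "x \<star> y \<equiv> bm D x y"

lemma rel2_base:
  "gen (p + p', q) - (gen (p, q) + gen (p', q)) \<in> tensor2_rel scale"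
  "gen (p, q + q') - (gen (p, q) + gen (p, q')) \<in> tensor2_rel scale"
  "gen (scale c p, q) - free_scale c (gen (p, q)) \<in> tensor2_rel scale"
  "gen (p, scale c q) - free_scale c (gen (p, q)) \<in> tensor2_rel scale"
  unfolding tensor2_rel_def by (rule fs.span_base, blast)+

lemma rel2_sum: "(\<And>i. i \<in> I \<Longrightarrow> x i \<in> tensor2_rel scale) \<Longrightarrow> (\<Sum>i\<in>I. x i) \<in> tensor2_rel scale"
  by (induction I rule: infinite_finite_induct) (auto intro: tensor2_rel_subspace)

lemma gen_sum:
  "gen (\<Sum>i\<in>I. scale (\<alpha> i) (x i), q) - (\<Sum>i\<in>I. free_scale (\<alpha> i) (gen (x i, q))) \<in> tensor2_rel scale"
  "gen (p, \<Sum>i\<in>I. scale (\<alpha> i) (x i)) - (\<Sum>i\<in>I. free_scale (\<alpha> i) (gen (p, x i))) \<in> tensor2_rel scale"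
proof -
  have z: "gen (0, q) \<in> tensor2_rel scale" "gen (p, 0) \<in> tensor2_rel scale"
    using rel2_base(3)[of 0 0 q] rel2_base(4)[of p 0 0] by simp_all
  show "gen (\<Sum>i\<in>I. scale (\<alpha> i) (x i), q) - (\<Sum>i\<in>I. free_scale (\<alpha> i) (gen (x i, q))) \<in> tensor2_rel scale"
  proof (induction I rule: infinite_finite_induct)
    case (insert j I)
    have "(gen (scale (\<alpha> j) (x j) + (\<Sum>i\<in>I. scale (\<alpha> i) (x i)), q) - (gen (scale (\<alpha> j) (x j), q) + gen (\<Sum>i\<in>I. scale (\<alpha> i) (x i), q)))
       + ((gen (scale (\<alpha> j) (x j), q) - free_scale (\<alpha> j) (gen (x j, q)))
       + (gen (\<Sum>i\<in>I. scale (\<alpha> i) (x i), q) - (\<Sum>i\<in>I. free_scale (\<alpha> i) (gen (x i, q))))) \<in> tensor2_rel scale"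
      by (intro tensor2_rel_subspace(2) rel2_base insert.IH)
    thus ?case using insert.hyps by (simp add: algebra_simps)
  qed (simp_all add: z)
  show "gen (p, \<Sum>i\<in>I. scale (\<alpha> i) (x i)) - (\<Sum>i\<in>I. free_scale (\<alpha> i) (gen (p, x i))) \<in> tensor2_rel scale"
  proof (induction I rule: infinite_finite_induct)
    case (insert j I)
    have "(gen (p, scale (\<alpha> j) (x j) + (\<Sum>i\<in>I. scale (\<alpha> i) (x i))) - (gen (p, scale (\<alpha> j) (x j)) + gen (p, \<Sum>i\<in>I. scale (\<alpha> i) (x i))))
       + ((gen (p, scale (\<alpha> j) (x j)) - free_scale (\<alpha> j) (gen (p, x j)))
       + (gen (p, \<Sum>i\<in>I. scale (\<alpha> i) (x i)) - (\<Sum>i\<in>I. free_scale (\<alpha> i) (gen (p, x i))))) \<in> tensor2_rel scale"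
      by (intro tensor2_rel_subspace(2) rel2_base insert.IH)
    thus ?case using insert.hyps by (simp add: algebra_simps)
  qed (simp_all add: z)
qed

text \<open>The normal form of a tensor with respect to the products of basis vectors.\<close>

definition nf where
  "nf x = (\<Sum>i\<in>UNIV. \<Sum>j\<in>UNIV. free_scale (eval_tensor x (\<lambda>(p, q). cf p $ i * cf q $ j)) (gen (b i, b j)))"

lemma nf_gen: "gen (p, q) - nf (gen (p, q)) \<in> tensor2_rel scale"
proof -
  let ?q = "\<lambda>i. \<Sum>j\<in>UNIV. free_scale (cf q $ j) (gen (b i, b j))"
  have 1: "gen (p, q) - (\<Sum>i\<in>UNIV. free_scale (cf p $ i) (gen (b i, q))) \<in> tensor2_rel scale"
    by (subst (1) expand[of p]) (rule gen_sum(1))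
  have "gen (b i, q) - ?q i \<in> tensor2_rel scale" for i
    by (subst (1) expand[of q]) (rule gen_sum(2))
  hence 2: "(\<Sum>i\<in>UNIV. free_scale (cf p $ i) (gen (b i, q) - ?q i)) \<in> tensor2_rel scale"
    by (intro rel2_sum tensor2_rel_subspace(4))
  have "gen (p, q) - nf (gen (p, q)) = (gen (p, q) - (\<Sum>i\<in>UNIV. free_scale (cf p $ i) (gen (b i, q))))
      + (\<Sum>i\<in>UNIV. free_scale (cf p $ i) (gen (b i, q) - ?q i))"
    by (simp add: nf_def fs.scale_right_diff_distrib sum_subtractf fs.scale_sum_right)
  thus ?thesis using tensor2_rel_subspace(2)[OF 1 2] by (simp only:)
qed

lemma nf_rel: "x - nf x \<in> tensor2_rel scale"
proof -
  let ?l = "Poly_Mapping.lookup x" and ?K = "Poly_Mapping.keys x"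
  have "nf x = (\<Sum>i\<in>UNIV. \<Sum>j\<in>UNIV. \<Sum>p\<in>?K. free_scale (?l p) (free_scale (eval_tensor (gen p) (\<lambda>(p, q). cf p $ i * cf q $ j)) (gen (b i, b j))))"
    unfolding nf_def eval_tensor_def[of x] by (simp add: fs.scale_sum_left)
  also have "\<dots> = (\<Sum>i\<in>UNIV. \<Sum>p\<in>?K. \<Sum>j\<in>UNIV. free_scale (?l p) (free_scale (eval_tensor (gen p) (\<lambda>(p, q). cf p $ i * cf q $ j)) (gen (b i, b j))))"
    by (rule sum.cong[OF refl], rule sum.swap)
  also have "\<dots> = (\<Sum>p\<in>?K. free_scale (?l p) (nf (gen p)))"
    unfolding nf_def fs.scale_sum_right by (rule sum.swap)
  finally have n: "nf x = (\<Sum>p\<in>?K. free_scale (?l p) (nf (gen p)))" .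
  have "x - nf x = (\<Sum>p\<in>?K. free_scale (?l p) (gen p)) - nf x" by (subst (1) free_expand[of x]) simp
  also have "\<dots> = (\<Sum>p\<in>?K. free_scale (?l p) (gen p - nf (gen p)))"
    unfolding n by (simp add: sum_subtractf fs.scale_right_diff_distrib)
  also have "\<dots> \<in> tensor2_rel scale"
    by (intro rel2_sum tensor2_rel_subspace(4)) (use nf_gen in \<open>auto simp: split_paired_all\<close>)
  finally show ?thesis .
qed

text \<open>A formal sum differs from its normal form by relations only, so a tensor is determined
  by its coordinates, and membership in a coproduct becomes a comparison of numbers.\<close>

lemma comulI:
  assumes "\<And>i j. eval_tensor y (\<lambda>(p, q). cf p $ i * cf q $ j) = cop D (\<lambda>p q. p $ i * q $ j) (cf h)" shows "y \<in> comul h"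
proof (rule comul_class2[OF rep])
  have "nf y = nf (rep h)" unfolding nf_def assms eval_tensor_comul[OF rep bil_component] ..
  hence "y - rep h = (y - nf y) - (rep h - nf (rep h))" by simp
  thus "y - rep h \<in> tensor2_rel scale" using tensor2_rel_subspace(3)[OF nf_rel nf_rel] by metis
qed

lemma cf_mul: "cf (x * y) = cf x \<odot> cf y" by (simp only: mul_expand)

lemma cf_1: "cf 1 = u" by (simp add: u_def)

lemma antipode_1: "antipode 1 = 1" by (rule cf_inj) (simp add: ant_cf[symmetric] cf_1)

lemma sw_component: "cop D (\<lambda>p q. p $ i * q $ j) x = (axis i 1 \<star> axis j 1) \<cdot> x"
  by (simp add: pr_bm)

text \<open>Centrality reduces normality to the antipode axiom: h_1 a S(h_2) is the counit of h
  times a.\<close>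

lemma normal_from_grouplike:
  assumes g: "grp g" "g \<noteq> u" "g \<odot> g = u" "\<And>x. g \<odot> x = x \<odot> g" and dim: "dim (UNIV :: 'h set) > 2"
  shows "\<exists>A. normal_hopf_subalgebra A \<and> proper A"
proof -
  define G where "G = vf g"
  have cG: "cf G = g" by (simp add: G_def)
  have GG: "G * G = 1" by (rule cf_inj) (simp add: cf_mul cG g(3) cf_1)
  have Gc: "G * x = x * G" for x by (rule cf_inj) (simp add: cf_mul cG g(4))
  have "ant S g = g"
  proof -
    have "ant S g \<odot> g \<odot> g = u \<odot> g" by (simp only: grp_inv(1)[OF g(1)])
    thus ?thesis by (simp add: mul_assoc g(3))
  qed
  hence aG: "antipode G = G" by (intro cf_inj) (simp add: ant_cf[symmetric] cG)
  have GD: "gen (G, G) \<in> comul G"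
    by (rule comulI) (use g(1) in \<open>simp add: sw_component cG grp_def\<close>)
  define A where "A = {scale \<alpha> 1 + scale \<beta> G | \<alpha> \<beta>. True}"
  have AI: "scale \<alpha> 1 + scale \<beta> G \<in> A" for \<alpha> \<beta> by (auto simp: A_def)
  have 1: "1 \<in> A" using AI[of 1 0] by simp
  have GA: "G \<in> A" using AI[of 0 1] by simp
  have sub: "subspace A" unfolding subspace_def
  proof (intro conjI ballI allI)
    show "0 \<in> A" using AI[of 0 0] by simp
    fix x assume "x \<in> A"
    then obtain \<alpha> \<beta> where x: "x = scale \<alpha> 1 + scale \<beta> G" by (auto simp: A_def)
    show "scale c x \<in> A" for c using AI[of "c * \<alpha>" "c * \<beta>"] by (simp add: x scale_right_distrib)
    fix y assume "y \<in> A"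
    then obtain \<alpha>' \<beta>' where y: "y = scale \<alpha>' 1 + scale \<beta>' G" by (auto simp: A_def)
    show "x + y \<in> A" using AI[of "\<alpha> + \<alpha>'" "\<beta> + \<beta>'"] by (simp add: x y scale_left_distrib algebra_simps)
  qed
  have mul: "x * y \<in> A" if "x \<in> A" "y \<in> A" for x y
  proof -
    obtain \<alpha> \<beta> \<alpha>' \<beta>' where xy: "x = scale \<alpha> 1 + scale \<beta> G" "y = scale \<alpha>' 1 + scale \<beta>' G" using \<open>x \<in> A\<close> \<open>y \<in> A\<close> by (auto simp: A_def)
    have "x * y = scale (\<alpha> * \<alpha>' + \<beta> * \<beta>') 1 + scale (\<alpha> * \<beta>' + \<beta> * \<alpha>') G"
      by (simp add: xy distrib_left distrib_right scale_mult_left scale_mult_right GG scale_left_distrib scale_right_distrib mult.commute)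
    thus ?thesis using AI by simp
  qed
  have com: "comul x \<inter> {y. Poly_Mapping.keys y \<subseteq> A \<times> A} \<noteq> {}" if "x \<in> A" for x
  proof -
    obtain \<alpha> \<beta> where x: "x = scale \<alpha> 1 + scale \<beta> G" using \<open>x \<in> A\<close> by (auto simp: A_def)
    let ?y = "free_scale \<alpha> (gen (1, 1)) + free_scale \<beta> (gen (G, G))"
    have "?y \<in> comul x" unfolding x by (intro comul_add comul_scale comul_one GD)
    moreover have "Poly_Mapping.keys ?y \<subseteq> A \<times> A"
    proof
      fix z assume "z \<in> Poly_Mapping.keys ?y"
      hence "z = (1, 1) \<or> z = (G, G)" by (auto simp: in_keys_iff lookup_add gen_def lookup_single when_def split: if_splits)
      thus "z \<in> A \<times> A" using 1 GA by auto
    qed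
    ultimately show ?thesis by blast
  qed
  have anti: "antipode x \<in> A" if "x \<in> A" for x
  proof -
    obtain \<alpha> \<beta> where "x = scale \<alpha> 1 + scale \<beta> G" using \<open>x \<in> A\<close> by (auto simp: A_def)
    hence "antipode x = x" by (simp add: linear_antipode' antipode_1 aG)
    thus ?thesis using \<open>x \<in> A\<close> by simp
  qed
  have norm: "lin_ext scale (\<lambda>(y, z). y * a * antipode z) x \<in> A" if x: "x \<in> comul h" and a: "a \<in> A" for h x a
  proof -
    have ac: "y * a = a * y" for y using a Gc by (auto simp: A_def distrib_left distrib_right scale_mult_left scale_mult_right)
    have "lin_ext scale (\<lambda>(y, z). y * a * antipode z) x = a * lin_ext scale (\<lambda>(y, z). y * antipode z) x"
      by (simp add: lin_ext_def sum_distrib_left scale_mult_right case_prod_unfold ac mult.assoc)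
    also have "\<dots> = scale (counit h) a" by (simp add: antipode_right[OF x] scale_mult_right)
    finally show ?thesis using sub a by (simp add: subspace_def)
  qed
  have "normal_hopf_subalgebra A"
    unfolding normal_hopf_subalgebra_def hopf_subalgebra_def using sub 1 mul com anti norm by blast
  moreover have "proper A" unfolding proper_def
  proof
    show "A \<noteq> {scale c 1 | c. True}"
    proof
      assume "A = {scale c 1 | c. True}"
      then obtain c where "G = scale c 1" using GA by blast
      hence gc: "g = c *s u" using cG by (metis cf_scale cf_1)
      hence "c = 1" using g(1) by (simp add: grp_def pr_scale counit_unit)
      thus False using gc g(2) by simp
    qed
    show "A \<noteq> UNIV"
    proof
      assume "A = UNIV"
      moreover have "A \<subseteq> span {1, G}" 
      proof
        fix x assume "x \<in> A"
        then obtain \<alpha> \<beta> where x: "x = scale \<alpha> 1 + scale \<beta> G" by (auto simp: A_def)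
        show "x \<in> span {1, G}" unfolding x by (intro span_add span_scale span_base) simp_all
      qed
      ultimately have "dim (UNIV :: 'h set) \<le> card {1, G}" by (intro dim_le_card) auto
      also have "\<dots> \<le> 2" by (simp add: card_insert_le_m1)
      finally show False using dim by simp
    qed
  qed
  ultimately show ?thesis by blast
qed

lemma normal_from_character:
  assumes L: "hopf_int M u D e S L" and f: "hopf_int.central_inv D e M u f" and c: "CARD('i) > 2"
  shows "\<exists>A. normal_hopf_subalgebra A \<and> proper A"
proof -
  interpret hi: hopf_int M u D e S L by (rule L)
  define T where "T = hi.tw f"
  define P where "P = hi.prj f"
  have T: "linv T" "T u = u" "\<And>x y. T (x \<odot> y) = T x \<odot> T y" "\<And>x. T (ant S x) = ant S (T x)" "\<And>x. T (P x) = P x" "linv P"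
    unfolding T_def P_def
    by (rule hi.linv_tw[OF f] hi.tw_u[OF f] hi.tw_mul[OF f] hi.tw_ant[OF f] hi.tw_prj[OF f] hi.linv_prj[OF f])+
  define A where "A = {h. T (cf h) = cf h}"
  have sub: "subspace A"
    using T(1) by (auto simp: subspace_def A_def cf_add cf_scale linvD linv_0)
  have 1: "1 \<in> A" by (simp add: A_def cf_1 T)
  have mul: "x * y \<in> A" if "x \<in> A" "y \<in> A" for x y using that by (simp add: A_def cf_mul T)
  have anti: "antipode x \<in> A" if "x \<in> A" for x using that by (simp add: A_def ant_cf[symmetric] T)
  have com: "comul a \<inter> {y. Poly_Mapping.keys y \<subseteq> A \<times> A} \<noteq> {}" if a: "a \<in> A" for a
  proof -
    define \<pi> where "\<pi> x = vf (P (cf x))" for x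
    have pA: "\<pi> x \<in> A" for x by (simp add: \<pi>_def A_def T)
    \<comment> \<open>Both legs of a representative are projected into \<open>A\<close>; by
      \<open>sw_prj\<close> the tensor does not change.\<close>
    define y where "y = lin_ext free_scale (\<lambda>(p, q). gen (\<pi> p, \<pi> q)) (rep a)"
    have "y \<in> comul a"
    proof (rule comulI)
      fix i j
      have "eval_tensor y (\<lambda>(p, q). cf p $ i * cf q $ j) = eval_tensor (rep a) (\<lambda>(p, q). P (cf p) $ i * P (cf q) $ j)"
        by (simp add: y_def eval_tensor_lin_ext case_prod_unfold \<pi>_def)
      also have "\<dots> = cop D (\<lambda>p q. P p $ i * P q $ j) (cf a)"
        by (rule eval_tensor_comul[OF rep]) (intro bil_prod lin_comp[OF lin_component] T)
      also have "\<dots> = cop D (\<lambda>p q. p $ i * q $ j) (cf a)"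
        unfolding P_def by (rule hi.sw_prj[OF f bil_component]) (use a in \<open>simp add: A_def T_def\<close>)
      finally show "eval_tensor y (\<lambda>(p, q). cf p $ i * cf q $ j) = cop D (\<lambda>p q. p $ i * q $ j) (cf a)" .
    qed
    moreover have "Poly_Mapping.keys y \<subseteq> A \<times> A"
    proof
      fix z assume z: "z \<in> Poly_Mapping.keys y"
      have "\<exists>p\<in>Poly_Mapping.keys (rep a). Poly_Mapping.lookup (gen (\<pi> (fst p), \<pi> (snd p)) :: ('h \<times> 'h) \<Rightarrow>\<^sub>0 'k) z \<noteq> 0"
      proof (rule ccontr)
        assume "\<not> ?thesis"
        hence "Poly_Mapping.lookup y z = 0" by (simp add: y_def lin_ext_def lookup_sum case_prod_unfold)
        thus False using z by (simp add: in_keys_iff)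
      qed
      then obtain p q where "z = (\<pi> p, \<pi> q)" by (auto simp: gen_def lookup_single when_def split: if_splits)
      thus "z \<in> A \<times> A" using pA by simp
    qed
    ultimately show ?thesis by blast
  qed
  have norm: "lin_ext scale (\<lambda>(y, z). y * a * antipode z) x \<in> A" if x: "x \<in> comul h" and a: "a \<in> A" for h x a
  proof -
    let ?r = "lin_ext scale (\<lambda>(y, z). y * a * antipode z) x"
    have "y \<cdot> T (cf ?r) = y \<cdot> cf ?r" for y
    proof -
      have ev: "w \<cdot> cf ?r = cop D (\<lambda>p q. w \<cdot> (p \<odot> cf a \<odot> ant S q)) (cf h)" for w
      proof -
        have "w \<cdot> cf ?r = eval_tensor x (\<lambda>(p, q). w \<cdot> (cf p \<odot> cf a \<odot> ant S (cf q)))"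
          by (simp add: pr_lin_ext case_prod_unfold cf_mul ant_cf)
        also have "\<dots> = cop D (\<lambda>p q. w \<cdot> (p \<odot> cf a \<odot> ant S q)) (cf h)"
          by (rule eval_tensor_comul[OF x]) (intro bilI lin_intros)
        finally show ?thesis .
      qed
      have "y \<cdot> T (cf ?r) = cop D (\<lambda>p q. y \<cdot> hi.tw f (p \<odot> cf a \<odot> ant S q)) (cf h)"
        unfolding T_def hi.pr_tw[OF f] by (rule ev)
      also have "\<dots> = y \<cdot> cf ?r"
        unfolding ev by (rule hi.sw_adjoint[OF f]) (use a in \<open>simp add: A_def T_def\<close>)
      finally show ?thesis .
    qed
    hence "T (cf ?r) = cf ?r" by (rule pr_eqI)
    thus ?thesis by (simp add: A_def)
  qed
  have "normal_hopf_subalgebra A"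
    unfolding normal_hopf_subalgebra_def hopf_subalgebra_def using sub 1 mul com anti norm by blast
  moreover have "proper A" unfolding proper_def
  proof
    show "A \<noteq> {scale c 1 | c. True}"
    proof
      assume A1: "A = {scale c 1 | c. True}"
      obtain z where z: "T z = z" "\<And>c. z \<noteq> c *s u" using hi.tw_proper(2)[OF f c] unfolding T_def by blast
      hence "vf z \<in> A" by (simp add: A_def)
      then obtain c where "vf z = scale c 1" using A1 by blast
      hence "cf (vf z) = c *s u" by (simp only: cf_scale cf_1)
      thus False using z(2) by simp
    qed
    show "A \<noteq> UNIV"
    proof
      assume "A = UNIV"
      hence "T (cf (vf z)) = cf (vf z)" for z unfolding A_def by blast
      thus False using hi.tw_proper(1)[OF f c] by (simp add: T_def)
    qed
  qed
  ultimately show ?thesis by blast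
qed

text \<open>A complement of the augmentation ideal \<open>I\<close> contains a left integral with
  counit one. That it is also a right integral follows from a second use of complete reducibility,
  for the right annihilator of \<open>I\<close> inside \<open>I\<close>.\<close>

lemma integral_exists:
  assumes ss: "semisimple_algebra"
  shows "\<exists>L. (\<forall>h. h * L = scale (counit h) L) \<and> (\<forall>h. L * h = scale (counit h) L) \<and> counit L = 1"
proof -
  have c0: "counit 0 = 0" using linear_counit'(2)[of 0 0] by simp
  have cdiff: "counit (x - y) = counit x - counit y" for x y using linear_counit'(1)[of "x - y" y] by simp
  note counit_mult' = counit_cf[symmetric]
  have cm: "counit (x * y) = counit x * counit y" for x y by (simp add: counit_mult' cf_mul)
  define I where "I = {h. counit h = 0}"
  have lI: "left_ideal I" unfolding left_ideal_def subspace_def by (auto simp: I_def c0 linear_counit' cm)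
  from ss[unfolded semisimple_algebra_def, rule_format, OF lI] obtain J
    where J: "left_ideal J" "I \<inter> J = {0}" "\<forall>h. \<exists>x\<in>I. \<exists>y\<in>J. h = x + y" by auto
  obtain x0 L where x0: "x0 \<in> I" "L \<in> J" "1 = x0 + L" using J(3)[rule_format, of 1] by blast
  have eL: "counit L = 1" using arg_cong[OF x0(3), of counit] x0(1) by (simp add: linear_counit' counit_one I_def)
  have hL: "h * L = scale (counit h) L" for h
  proof -
    have "h * L - scale (counit h) L \<in> J" using J(1) x0(2) unfolding left_ideal_def by (intro subspace_diff subspace_scale) auto
    moreover have "h * L - scale (counit h) L \<in> I" by (simp add: I_def cdiff cm eL linear_counit')
    ultimately have "h * L - scale (counit h) L \<in> {0}" unfolding J(2)[symmetric] by blast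
    thus ?thesis by simp
  qed
  \<comment> \<open>L h lies in \<open>N\<close> for h in \<open>I\<close>. Elements of
    \<open>N\<close> annihilate each other, so writing 1 = n + m with n in \<open>N\<close> and m in
    a complement gives z = z m for z in \<open>N\<close>; hence z lies in the complement as well and
    \<open>N\<close> is zero.\<close>
  define N where "N = {z\<in>I. \<forall>w\<in>I. w * z = 0}"
  have lN: "left_ideal N" unfolding left_ideal_def subspace_def
  proof (intro conjI ballI allI)
    show "0 \<in> N" by (simp add: N_def I_def c0)
    show "x + y \<in> N" if "x \<in> N" "y \<in> N" for x y using that by (simp add: N_def I_def linear_counit' distrib_left)
    show "scale c x \<in> N" if "x \<in> N" for c x using that by (simp add: N_def I_def linear_counit' scale_mult_right)
    show "h * x \<in> N" if x: "x \<in> N" for h x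
    proof -
      have "w * h \<in> I" if "w \<in> I" for w using that by (simp add: I_def cm)
      thus ?thesis using x by (auto simp: N_def I_def cm mult.assoc[symmetric])
    qed
  qed
  from ss[unfolded semisimple_algebra_def, rule_format, OF lN] obtain K
    where K: "left_ideal K" "N \<inter> K = {0}" "\<forall>h. \<exists>x\<in>N. \<exists>y\<in>K. h = x + y" by auto
  obtain n m where nm: "n \<in> N" "m \<in> K" "1 = n + m" using K(3)[rule_format, of 1] by blast
  have N0: "z = 0" if z: "z \<in> N" for z
  proof -
    have 1: "z = z * n + z * m" for z by (metis nm(3) distrib_left mult_1_right)
    have nn: "z * n = 0" if "z \<in> N" for z using that nm(1) by (simp add: N_def)
    have "z = z * m" using 1[of z] nn[OF z] by simp
    hence "z \<in> K" using K(1) nm(2) unfolding left_ideal_def by metis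
    thus ?thesis using z K(2) by blast
  qed
  have Lh: "L * h = 0" if h: "h \<in> I" for h
  proof -
    have "L * h \<in> N" unfolding N_def
    proof (intro CollectI conjI ballI)
      show "L * h \<in> I" using h by (simp add: I_def cm)
      show "w * (L * h) = 0" if "w \<in> I" for w
        using that by (simp add: mult.assoc[symmetric] hL I_def)
    qed
    thus ?thesis by (rule N0)
  qed
  have "L * h = scale (counit h) L" for h
  proof -
    have "L * (h - scale (counit h) 1) = 0" by (rule Lh) (simp add: I_def cdiff linear_counit' counit_one)
    thus ?thesis by (simp add: right_diff_distrib scale_mult_right)
  qed
  thus ?thesis using hL eL by blast
qed

theorem not_simple:
  assumes ss: "semisimple_algebra" and dim: "dim (UNIV :: 'h set) = 40" and n40: "CARD('i) = 40"
  shows "\<exists>A. normal_hopf_subalgebra A \<and> proper A"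
proof -
  obtain L where L: "\<And>h. h * L = scale (counit h) L" "\<And>h. L * h = scale (counit h) L" "counit L = 1"
    using integral_exists[OF ss] by blast
  have hi: "hopf_int M u D e S (cf L)"
  proof unfold_locales
    fix x
    show "x \<odot> cf L = (e \<cdot> x) *s cf L" using arg_cong[OF L(1)[of "vf x"], of cf] counit_cf[of "vf x"] by (simp add: cf_mul cf_scale)
    show "cf L \<odot> x = (e \<cdot> x) *s cf L" using arg_cong[OF L(2)[of "vf x"], of cf] counit_cf[of "vf x"] by (simp add: cf_mul cf_scale)
  qed (simp add: counit_cf L)
  from hopf_int.central_involution_40[OF hi n40] show ?thesis
  proof (elim disjE exE)
    fix g assume "hopf_int.central_inv M u D e g"
    thus ?thesis using dim unfolding hopf_int.central_inv_def[OF hi] by (intro normal_from_grouplike) auto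
  next
    fix f assume "hopf_int.central_inv D e M u f"
    thus ?thesis using n40 by (intro normal_from_character[OF hi]) auto
  qed
qed

end

lemma coordinates_exist:
  fixes scale :: "'k::field \<Rightarrow> 'h::ab_group_add \<Rightarrow> 'h"
  assumes vs: "vector_space scale" and dim: "vector_space.dim scale (UNIV :: 'h set) = CARD('i::finite)"
  shows "\<exists>(cf :: 'h \<Rightarrow> 'k ^ 'i) vf. (\<forall>x y. cf (x + y) = cf x + cf y) \<and> (\<forall>c x. cf (scale c x) = c *s cf x) \<and>
    (\<forall>x. vf (cf x) = x) \<and> (\<forall>z. cf (vf z) = z)"
proof -
  interpret vector_space scale by (rule vs)
  obtain B :: "'h set" where B: "independent B" "UNIV \<subseteq> span B" "card B = CARD('i)"
    using basis_exists[of UNIV] dim by metis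
  have fin: "finite B" using B(3) by (metis card.infinite zero_less_card_finite less_irrefl)
  obtain \<beta> :: "'i \<Rightarrow> 'h" where \<beta>: "bij_betw \<beta> UNIV B"
    using finite_same_card_bij[OF finite fin] B(3) by metis
  define cf :: "'h \<Rightarrow> 'k ^ 'i" where "cf x = (\<chi> i. representation B x (\<beta> i))" for x
  define vf where "vf z = (\<Sum>i\<in>UNIV. scale (z $ i) (\<beta> i))" for z :: "'k ^ 'i"
  have sp: "x \<in> span B" for x using B(2) by blast
  have \<beta>B: "\<beta> i \<in> B" for i using \<beta> by (auto simp: bij_betw_def)
  have "cf (x + y) = cf x + cf y" for x y by (simp add: cf_def vec_eq_iff representation_add[OF B(1) sp sp])
  moreover have "cf (scale c x) = c *s cf x" for c x by (simp add: cf_def vec_eq_iff representation_scale[OF B(1) sp])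
  moreover have "vf (cf x) = x" for x
  proof -
    have "vf (cf x) = (\<Sum>v\<in>B. scale (representation B x v) v)"
      using sum.reindex_bij_betw[OF \<beta>, of "\<lambda>v. scale (representation B x v) v"] by (simp add: vf_def cf_def)
    thus ?thesis using sum_representation_eq[OF B(1) sp fin order_refl] by simp
  qed
  moreover have "cf (vf z) = z" for z
  proof -
    have "representation B (vf z) (\<beta> j) = z $ j" for j
    proof -
      have "representation B (vf z) (\<beta> j) = (\<Sum>i\<in>UNIV. z $ i * representation B (\<beta> i) (\<beta> j))"
        unfolding vf_def by (simp add: representation_sum[OF B(1) sp] representation_scale[OF B(1) sp])
      also have "\<dots> = (\<Sum>i\<in>UNIV. if i = j then z $ j else 0)"
        using \<beta> by (intro sum.cong refl) (auto simp: representation_basis[OF B(1) \<beta>B] bij_betw_def inj_def)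
      finally show ?thesis by simp
    qed
    thus ?thesis by (simp add: cf_def vec_eq_iff)
  qed
  ultimately show ?thesis by blast
qed

theorem theorem9p2p3:
  fixes scale :: "'k::{alg_closed_field, field_char_0} \<Rightarrow> 'h::ring_1 \<Rightarrow> 'h"
    and comul :: "'h \<Rightarrow> (('h \<times> 'h) \<Rightarrow>\<^sub>0 'k) set"
    and counit :: "'h \<Rightarrow> 'k"
    and antipode :: "'h \<Rightarrow> 'h"
  assumes "hopf_algebra scale comul counit antipode"
    and "k_algebra.semisimple_algebra scale"
    and "vector_space.dim scale (UNIV :: 'h set) = 40"
  shows "\<exists>A. hopf_algebra.normal_hopf_subalgebra scale comul antipode A \<and>
             hopf_algebra.proper scale A"
proof -
  interpret hopf_algebra scale comul counit antipode by (rule assms(1))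
  have "vector_space scale" by unfold_locales
  \<comment> \<open>The numeral type of cardinality 40 serves as the index type of the
    coordinates.\<close>
  moreover have "vector_space.dim scale (UNIV :: 'h set) = CARD(40)" using assms(3) by simp
  ultimately obtain cf :: "'h \<Rightarrow> 'k ^ 40" and vf where c: "\<And>x y. cf (x + y) = cf x + cf y" "\<And>c x. cf (scale c x) = c *s cf x"
    "\<And>x. vf (cf x) = x" "\<And>z. cf (vf z) = z"
    using coordinates_exist[of scale, where 'i = 40] by blast
  have "hopf_coord scale comul counit antipode cf vf"
    by (intro hopf_coord.intro hopf_coord_axioms.intro assms(1) c)
  from hopf_coord.not_simple[OF this assms(2,3)] show ?thesis by simp
qed

end
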